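(* Let $\mathcal A$ be an irreducible Möbius net and let $Q^a=(\mathcal H_a,\mu^a,\iota^a)$, $Q^b=(\mathcal H_b,\mu^b,\iota^b)$, $Q^c=(\mathcal H_c,\mu^c,\iota^c)$ denote $C^*$-Frobenius algebras in $\mathrm{Rep}(\mathcal A)$. The following are true. (a) If $V:Q^a\to Q^b$ is a left isomorphism of $C^*$-Frobenius algebras, then there is a unique isomorphism $\varphi^V:\mathcal B_{Q^a}\to\mathcal B_{Q^b}$ (with respect to $\mathcal A$) satisfying $VX=\varphi^V_{\widetilde I}(X)V$ for all $\widetilde I\in\widetilde{\mathcal J}$, $X\in\mathcal B_{Q^a}(\widetilde I)$. Moreover, $V$ is unitary if and only if $\varphi^V$ is a unitary isomorphism. (b) If $V:Q^a\to Q^b$ and $W:Q^b\to Q^c$ are left isomorphisms, then $\varphi^{WV}=\varphi^W\circ\varphi^V$. (c) If $(\mathcal H_b,\mathcal B^b,\iota^b)$ is an extension of $\mathcal A$, and if $\varphi:\mathcal B_{Q^a}\to\mathcal B^b$ is an isomorphism (with respect to $\mathcal A$), then $\mathcal B^b=\mathcal B_{Q^b}$ for a unique $C^*$-Frobenius algebra $Q^b$ of the form $(\mathcal H_b,\mu^b,\iota^b)$, and $\varphi=\varphi^V$ for a unique left isomorphism $V:Q^a\to Q^b$.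
   Context: Conventions. Hilbert spaces are separable; $\mathrm{Hom}(\mathcal H,\mathcal K)$ is the set of bounded operators. A square of bounded operators $C:P\to R_1$, $A:P\to R_2$, $B:R_1\to S$, $D:R_2\to S$ commutes adjointly if $DA=BC$ and $CA^*=B^*D$. Nets. $\mathcal J$ is the set of non-empty non-dense open intervals of $\mathbb S^1$; for $I\in\mathcal J$, $I'$ is the interior of its complement. A Möbius net $\mathcal A$ assigns to each $I\in\mathcal J$ a von Neumann algebra $\mathcal A(I)$ on a fixed Hilbert space $\mathcal H_0$ such that: $I_1\subset I_2$ implies $\mathcal A(I_1)\subset\mathcal A(I_2)$; $\mathcal A(I_1),\mathcal A(I_2)$ commute if $I_1\cap I_2=\emptyset$; there is a strongly continuous unitary representation $U$ of $\mathrm{PSU}(1,1)$ on $\mathcal H_0$ with $U(g)\mathcal A(I)U(g)^*=\mathcal A(gI)$; the generator of the rotation subgroup is positive; there is a $\mathrm{PSU}(1,1)$-invariant unit vector $\Omega$ (the vacuum vector) cyclic for $\bigvee_I\mathcal A(I)$. It is irreducible if only scalars commute with all $\mathcal A(I)$. $\mathcal A$ is a fixed irreducible Möbius net. Modules. An $\mathcal A$-module is a Hilbert space $\mathcal H_i$ with normal unital representations $\pi_{i,I}$ of $\mathcal A(I)$ ($I\in\mathcal J$) such that $\pi_{i,J}|_{\mathcal A(I)}=\pi_{i,I}$ if $I\subset J$; we write $x\xi=\pi_{i,I}(x)\xi$. $\mathcal H_0$ is an $\mathcal A$-module. $\mathrm{Hom}_{\mathcal A}(\mathcal H_i,\mathcal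 H_j)$ is the set of bounded operators intertwining all actions of $\mathcal A(I)$, $I\in\mathcal J$. $\mathrm{Rep}(\mathcal A)$ is the $C^*$-category of $\mathcal A$-modules. $\mathcal H_i(I)=\mathrm{Hom}_{\mathcal A(I')}(\mathcal H_0,\mathcal H_i)\Omega$, where $\mathrm{Hom}_{\mathcal A(I')}$ denotes bounded operators intertwining $\mathcal A(I')$. Arg-valued intervals. $\widetilde{\mathcal J}$ is the set of pairs $\widetilde I=(I,\arg_I)$ with $I\in\mathcal J$ and $\arg_I:I\to\mathbb R$ a continuous argument function. $\widetilde I\subset\widetilde J$ means $I\subset J$ and $\arg_J|_I=\arg_I$. $\widetilde J$ is clockwise to $\widetilde I$ (and $\widetilde I$ anticlockwise to $\widetilde J$) if $\arg_I(z)-2\pi<\arg_J(\zeta)<\arg_I(z)$ for all $z\in I,\zeta\in J$. $\widetilde I'$ is the largest arg-valued interval clockwise to $\widetilde I$. Fusion. $\mathrm{Rep}(\mathcal A)$ is equipped with its (unique up to equivalence) braided $C^*$-tensor structure $(\boxtimes,\beta)$ given by Connes fusion, with associators and unitors suppressed, together with the operators of the categorical extension: for all modules $\mathcal H_i,\mathcal H_k$, $\widetilde I\in\widetilde{\mathcal J}$, $\xi\in\mathcal H_i(I)$, bounded operators $L(\xi,\widetilde I)\in\mathrm{Hom}_{\mathcal A(I')}(\mathcal H_k,\mathcal H_i\boxtimes\mathcal H_k)$ and $R(\xi,\widetilde I)\in\mathrm{Hom}_{\mathcal A(I')}(\mathcal H_k,\mathcal H_k\boxtimes\mathcal H_i)$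 satisfying: (isotony) they are unchanged when $\widetilde I$ is replaced by a larger arg-valued interval; (functoriality) $(\mathbf 1_i\boxtimes G)L(\xi,\widetilde I)\eta=L(\xi,\widetilde I)G\eta$, $(G\boxtimes\mathbf 1_i)R(\xi,\widetilde I)\eta=R(\xi,\widetilde I)G\eta$ for morphisms $G$; (state-field) $L(\xi,\widetilde I)\Omega=R(\xi,\widetilde I)\Omega=\xi$; (density) $L(\mathcal H_i(I),\widetilde I)\mathcal H_k$ and $R(\mathcal H_i(I),\widetilde I)\mathcal H_k$ span dense subspaces of $\mathcal H_i\boxtimes\mathcal H_k$, $\mathcal H_k\boxtimes\mathcal H_i$; (locality) if $\widetilde J$ is clockwise to $\widetilde I$, $\xi\in\mathcal H_i(I)$, $\eta\in\mathcal H_j(J)$, then the square formed by $L(\xi,\widetilde I)$ and $R(\eta,\widetilde J)$ from $\mathcal H_k$ to $\mathcal H_i\boxtimes\mathcal H_k\boxtimes\mathcal H_j$ commutes adjointly; (braiding) $\beta_{i,j}L(\xi,\widetilde I)\eta=R(\xi,\widetilde I)\eta$ for $\xi\in\mathcal H_i(I),\eta\in\mathcal H_j$, where $\beta_{i,j}:\mathcal H_i\boxtimes\mathcal H_j\to\mathcal H_j\boxtimes\mathcal H_i$ is the unitary braiding. $C^*$-Frobenius algebras. A $C^*$-Frobenius algebra in $\mathrm{Rep}(\mathcal A)$ is $Q=(\mathcal H_a,\mu,\iota)$ with $\mathcal H_a$ an $\mathcal A$-module, $\mu\in\mathrm{Hom}_{\mathcal A}(\mathcal H_a\boxtimes\mathcal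 H_a,\mathcal H_a)$, $\iota\in\mathrm{Hom}_{\mathcal A}(\mathcal H_0,\mathcal H_a)$, $\mu(\iota\boxtimes\mathbf 1_a)=\mathbf 1_a=\mu(\mathbf 1_a\boxtimes\iota)$, such that the square with sides $\mathbf 1_a\boxtimes\mu$, $\mu\boxtimes\mathbf 1_a$, $\mu$, $\mu$ (from $\mathcal H_a^{\boxtimes 3}$ to $\mathcal H_a$) commutes adjointly. Left isomorphisms. A left isomorphism $V:Q^a\to Q^b$ is $V\in\mathrm{Hom}_{\mathcal A}(\mathcal H_a,\mathcal H_b)$ with bounded inverse such that $V\iota^a=\iota^b$, $V\mu^a=\mu^b(V\boxtimes V)$, and $V^*\mu^b(V\boxtimes\mathbf 1_b)=\mu^a(\mathbf 1_a\boxtimes V^* )$. Extensions. A (non-local) extension of $\mathcal A$ is $(\mathcal H_a,\mathcal B,\iota)$ with $\mathcal H_a$ an $\mathcal A$-module, $\iota\in\mathrm{Hom}_{\mathcal A}(\mathcal H_0,\mathcal H_a)$, and $\mathcal B$ assigning to each $\widetilde I\in\widetilde{\mathcal J}$ a von Neumann algebra $\mathcal B(\widetilde I)$ on $\mathcal H_a$ such that: $\pi_{a,I}(\mathcal A(I))\subset\mathcal B(\widetilde I)$; $\widetilde I\subset\widetilde J$ implies $\mathcal B(\widetilde I)\subset\mathcal B(\widetilde J)$; $\iota\Omega$ is cyclic and separating for each $\mathcal B(\widetilde I)$; $[\mathcal B(\widetilde I),\pi_{a,I'}(\mathcal A(I'))]=0$. For a $C^*$-Frobenius algebra $Q$, it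 is known that $\mathcal B_Q(\widetilde I)=\{\mu L(\xi,\widetilde I)|_{\mathcal H_a}:\xi\in\mathcal H_a(I)\}$ defines an extension $(\mathcal H_a,\mathcal B_Q,\iota)$ of $\mathcal A$. Isomorphisms of extensions. An isomorphism $\varphi:\mathcal B^a\to\mathcal B^b$ (with respect to $\mathcal A$) between extensions $(\mathcal H_a,\mathcal B^a,\iota^a)$ and $(\mathcal H_b,\mathcal B^b,\iota^b)$ is a collection of normal isomorphisms of von Neumann algebras $\varphi_{\widetilde I}:\mathcal B^a(\widetilde I)\to\mathcal B^b(\widetilde I)$ for all $\widetilde I\in\widetilde{\mathcal J}$ with $\varphi_{\widetilde J}|_{\mathcal B^a(\widetilde I)}=\varphi_{\widetilde I}$ if $\widetilde I\subset\widetilde J$, and $\varphi_{\widetilde I}\circ\pi_{a,I}=\pi_{b,I}$ on $\mathcal A(I)$. It is a unitary isomorphism if there is a unitary $W:\mathcal H_a\to\mathcal H_b$ with $W\iota^a=\iota^b$ and $WX=\varphi_{\widetilde I}(X)W$ for all $\widetilde I\in\widetilde{\mathcal J}$, $X\in\mathcal B^a(\widetilde I)$. *)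

theory Defs
  imports "HOL-Analysis.Analysis" "HOL-Algebra.Module"
begin

section \<open>Hilbert spaces and bounded operators\<close>

text \<open>
  All Hilbert spaces have their vectors in one type \<open>'h\<close>, which plays the role of a universe:
  fusion is an operation on spaces, so the spaces have to be values and not types. The fields
  \<open>mult\<close> and \<open>one\<close> inherited from \<open>module\<close> carry no meaning, as usual for modules in HOL-Algebra.
  The inner product is linear in its first argument.
\<close>

definition complex_ring :: "complex ring" where
  "complex_ring = \<lparr>carrier = UNIV, mult = (*), one = 1, zero = 0, add = (+)\<rparr>"

record 'h hilbert = "(complex, 'h) module" +
  hinner :: "'h \<Rightarrow> 'h \<Rightarrow> complex"

definition hnorm :: "('h, 'm) hilbert_scheme \<Rightarrow> 'h \<Rightarrow> real" where
  "hnorm H x = sqrt (Re (hinner H x x))"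

text \<open>The value 0 off the carrier is needed because the locale \<open>Metric_space\<close> asks for
  nonnegativity and symmetry on the whole type.\<close>

definition hdist :: "('h, 'm) hilbert_scheme \<Rightarrow> 'h \<Rightarrow> 'h \<Rightarrow> real" where
  "hdist H x y = (if x \<in> carrier H \<and> y \<in> carrier H then hnorm H (x \<ominus>\<^bsub>H\<^esub> y) else 0)"

abbreviation htop :: "('h, 'm) hilbert_scheme \<Rightarrow> 'h topology" where
  "htop H \<equiv> Metric_space.mtopology (carrier H) (hdist H)"

locale hilbert_space = Module.module complex_ring H
  for H :: "('h, 'm) hilbert_scheme" (structure) +
  assumes inner_add: "\<lbrakk>x \<in> carrier H; y \<in> carrier H; z \<in> carrier H\<rbrakk>
      \<Longrightarrow> hinner H (x \<oplus>\<^bsub>H\<^esub> y) z = hinner H x z + hinner H y z"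
    and inner_smult: "\<lbrakk>x \<in> carrier H; y \<in> carrier H\<rbrakk>
      \<Longrightarrow> hinner H (c \<odot>\<^bsub>H\<^esub> x) y = c * hinner H x y"
    and inner_commute: "\<lbrakk>x \<in> carrier H; y \<in> carrier H\<rbrakk> \<Longrightarrow> hinner H y x = cnj (hinner H x y)"
    and inner_nonneg: "x \<in> carrier H \<Longrightarrow> 0 \<le> Re (hinner H x x)"
    and inner_definite: "\<lbrakk>x \<in> carrier H; hinner H x x = 0\<rbrakk> \<Longrightarrow> x = \<zero>\<^bsub>H\<^esub>"
    and complete: "Metric_space.mcomplete (carrier H) (hdist H)"
    and separable: "separable_space (htop H)"

definition dense_in :: "('h, 'm) hilbert_scheme \<Rightarrow> 'h set \<Rightarrow> bool" where
  "dense_in H S \<longleftrightarrow> S \<subseteq> carrier H \<and> htop H closure_of S = carrier H"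

definition lin_span :: "('h, 'm) hilbert_scheme \<Rightarrow> 'h set \<Rightarrow> 'h set" where
  "lin_span H S = \<Inter>{N. submodule N complex_ring H \<and> S \<subseteq> N}"

text \<open>Operators are functions that are \<open>undefined\<close> off the carrier of their domain, so that
  equality of functions is equality of operators; products are formed with \<open>compose\<close>.\<close>

definition bounded_ops ::
    "('h, 'm) hilbert_scheme \<Rightarrow> ('h, 'n) hilbert_scheme \<Rightarrow> ('h \<Rightarrow> 'h) set" where
  "bounded_ops H K = {T \<in> carrier H \<rightarrow>\<^sub>E carrier K.
     (\<forall>x\<in>carrier H. \<forall>y\<in>carrier H. T (x \<oplus>\<^bsub>H\<^esub> y) = T x \<oplus>\<^bsub>K\<^esub> T y) \<and>
     (\<forall>c. \<forall>x\<in>carrier H. T (c \<odot>\<^bsub>H\<^esub> x) = c \<odot>\<^bsub>K\<^esub> T x) \<and>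
     (\<exists>C. \<forall>x\<in>carrier H. hnorm K (T x) \<le> C * hnorm H x)}"

definition ident :: "('h, 'm) hilbert_scheme \<Rightarrow> 'h \<Rightarrow> 'h" where
  "ident H = (\<lambda>x\<in>carrier H. x)"

definition op_add :: "('h, 'm) hilbert_scheme \<Rightarrow> ('h, 'n) hilbert_scheme
    \<Rightarrow> ('h \<Rightarrow> 'h) \<Rightarrow> ('h \<Rightarrow> 'h) \<Rightarrow> 'h \<Rightarrow> 'h" where
  "op_add H K S T = (\<lambda>x\<in>carrier H. S x \<oplus>\<^bsub>K\<^esub> T x)"

definition op_smult :: "('h, 'm) hilbert_scheme \<Rightarrow> ('h, 'n) hilbert_scheme
    \<Rightarrow> complex \<Rightarrow> ('h \<Rightarrow> 'h) \<Rightarrow> 'h \<Rightarrow> 'h" where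
  "op_smult H K c T = (\<lambda>x\<in>carrier H. c \<odot>\<^bsub>K\<^esub> T x)"

definition adj :: "('h, 'm) hilbert_scheme \<Rightarrow> ('h, 'n) hilbert_scheme
    \<Rightarrow> ('h \<Rightarrow> 'h) \<Rightarrow> 'h \<Rightarrow> 'h" where
  "adj H K T = (\<lambda>y\<in>carrier K.
     THE x. x \<in> carrier H \<and> (\<forall>z\<in>carrier H. hinner K (T z) y = hinner H z x))"

definition unitary_ops ::
    "('h, 'm) hilbert_scheme \<Rightarrow> ('h, 'n) hilbert_scheme \<Rightarrow> ('h \<Rightarrow> 'h) set" where
  "unitary_ops H K = {T \<in> bounded_ops H K.
     compose (carrier H) (adj H K T) T = ident H \<and>
     compose (carrier K) T (adj H K T) = ident K}"

text \<open>For a square \<open>C : P \<rightarrow> R1\<close>, \<open>A : P \<rightarrow> R2\<close>, \<open>B : R1 \<rightarrow> S\<close>, \<open>D : R2 \<rightarrow> S\<close>: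
  \<open>D A = B C\<close> and \<open>C A\<^sup>* = B\<^sup>* D\<close>.\<close>

definition commutes_adjointly ::
    "('h, 'm) hilbert_scheme \<Rightarrow> ('h, 'm) hilbert_scheme \<Rightarrow>
     ('h, 'm) hilbert_scheme \<Rightarrow> ('h, 'm) hilbert_scheme \<Rightarrow>
     ('h \<Rightarrow> 'h) \<Rightarrow> ('h \<Rightarrow> 'h) \<Rightarrow> ('h \<Rightarrow> 'h) \<Rightarrow> ('h \<Rightarrow> 'h) \<Rightarrow> bool" where
  "commutes_adjointly P R1 R2 S C A B D \<longleftrightarrow>
     compose (carrier P) D A = compose (carrier P) B C \<and>
     compose (carrier R2) C (adj P R2 A) = compose (carrier R2) (adj R1 S B) D"


section \<open>Von Neumann algebras\<close>

definition commutant :: "('h, 'm) hilbert_scheme \<Rightarrow> ('h \<Rightarrow> 'h) set \<Rightarrow> ('h \<Rightarrow> 'h) set" where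
  "commutant H M = {T \<in> bounded_ops H H.
     \<forall>X\<in>M. compose (carrier H) T X = compose (carrier H) X T}"

definition von_neumann_algebra ::
    "('h, 'm) hilbert_scheme \<Rightarrow> ('h \<Rightarrow> 'h) set \<Rightarrow> bool" where
  "von_neumann_algebra H M \<longleftrightarrow> M \<subseteq> bounded_ops H H \<and> (\<forall>X\<in>M. adj H H X \<in> M) \<and>
     commutant H (commutant H M) = M"

definition sq_summable :: "('h, 'm) hilbert_scheme \<Rightarrow> (nat \<Rightarrow> 'h) \<Rightarrow> bool" where
  "sq_summable H \<xi> \<longleftrightarrow> range \<xi> \<subseteq> carrier H \<and> summable (\<lambda>n. (hnorm H (\<xi> n))\<^sup>2)"

text \<open>The coarsest topology making all functionals \<open>X \<mapsto> \<Sum>n. \<langle>X \<xi>\<^sub>n, \<eta>\<^sub>n\<rangle>\<close> continuous.\<close>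

definition sigma_weak :: "('h, 'm) hilbert_scheme \<Rightarrow> ('h \<Rightarrow> 'h) topology" where
  "sigma_weak H = topology_generated_by
     {{X \<in> bounded_ops H H. (\<Sum>n. hinner H (X (\<xi> n)) (\<eta> n)) \<in> S} | \<xi> \<eta> S.
        sq_summable H \<xi> \<and> sq_summable H \<eta> \<and> open S}"

definition normal_rep :: "('h, 'm) hilbert_scheme \<Rightarrow> ('h \<Rightarrow> 'h) set \<Rightarrow>
    ('h, 'n) hilbert_scheme \<Rightarrow> (('h \<Rightarrow> 'h) \<Rightarrow> ('h \<Rightarrow> 'h)) \<Rightarrow> bool" where
  "normal_rep H M K \<pi> \<longleftrightarrow>
     (\<forall>X\<in>M. \<pi> X \<in> bounded_ops K K) \<and>
     \<pi> (ident H) = ident K \<and>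
     (\<forall>X\<in>M. \<forall>Y\<in>M. \<pi> (op_add H H X Y) = op_add K K (\<pi> X) (\<pi> Y)) \<and>
     (\<forall>c. \<forall>X\<in>M. \<pi> (op_smult H H c X) = op_smult K K c (\<pi> X)) \<and>
     (\<forall>X\<in>M. \<forall>Y\<in>M. \<pi> (compose (carrier H) X Y) = compose (carrier K) (\<pi> X) (\<pi> Y)) \<and>
     (\<forall>X\<in>M. \<pi> (adj H H X) = adj K K (\<pi> X)) \<and>
     continuous_map (subtopology (sigma_weak H) M) (sigma_weak K) \<pi>"

definition normal_iso :: "('h, 'm) hilbert_scheme \<Rightarrow> ('h \<Rightarrow> 'h) set \<Rightarrow>
    ('h, 'n) hilbert_scheme \<Rightarrow> ('h \<Rightarrow> 'h) set \<Rightarrow> (('h \<Rightarrow> 'h) \<Rightarrow> ('h \<Rightarrow> 'h)) \<Rightarrow> bool" where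
  "normal_iso H M K N \<phi> \<longleftrightarrow> normal_rep H M K \<phi> \<and> bij_betw \<phi> M N"

definition cyclic_vec :: "('h, 'm) hilbert_scheme \<Rightarrow> ('h \<Rightarrow> 'h) set \<Rightarrow> 'h \<Rightarrow> bool" where
  "cyclic_vec H M v \<longleftrightarrow> dense_in H {X v | X. X \<in> M}"

definition separating_vec :: "('h, 'm) hilbert_scheme \<Rightarrow> ('h \<Rightarrow> 'h) set \<Rightarrow> 'h \<Rightarrow> bool" where
  "separating_vec H M v \<longleftrightarrow> (\<forall>X\<in>M. X v = \<zero>\<^bsub>H\<^esub> \<longrightarrow> X = (\<lambda>x\<in>carrier H. \<zero>\<^bsub>H\<^esub>))"


section \<open>Intervals of the circle\<close>

abbreviation circle :: "complex set" where
  "circle \<equiv> sphere 0 1"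

definition arcs :: "complex set set" where
  "arcs = {I. I \<noteq> {} \<and> openin (top_of_set circle) I \<and> connected I \<and> \<not> circle \<subseteq> closure I}"

definition arc_compl :: "complex set \<Rightarrow> complex set" where
  "arc_compl I = (top_of_set circle) interior_of (circle - I)"

type_synonym arg_arc = "complex set \<times> (complex \<Rightarrow> real)"

definition arg_arcs :: "arg_arc set" where
  "arg_arcs = {(I, \<theta>). I \<in> arcs \<and> \<theta> \<in> extensional I \<and> continuous_on I \<theta> \<and>
     (\<forall>z\<in>I. z = cis (\<theta> z))}"

definition arg_sub :: "arg_arc \<Rightarrow> arg_arc \<Rightarrow> bool" where
  "arg_sub I J \<longleftrightarrow> fst I \<subseteq> fst J \<and> (\<forall>z\<in>fst I. snd J z = snd I z)"

definition clockwise_to :: "arg_arc \<Rightarrow> arg_arc \<Rightarrow> bool" where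
  "clockwise_to J I \<longleftrightarrow> (\<forall>z\<in>fst I. \<forall>w\<in>fst J. snd I z - 2 * pi < snd J w \<and> snd J w < snd I z)"


section \<open>Moebius nets\<close>

text \<open>The pair \<open>(\<alpha>, \<beta>)\<close> stands for the matrix with rows \<open>(\<alpha>, \<beta>)\<close> and \<open>(cnj \<beta>, cnj \<alpha>)\<close>.
  A representation of PSU(1,1) = SU(1,1) / \<open>{1, -1}\<close> is a representation of SU(1,1) that is
  trivial on \<open>-1\<close>.\<close>

definition SU11 :: "(complex \<times> complex) set" where
  "SU11 = {(\<alpha>, \<beta>). (cmod \<alpha>)\<^sup>2 - (cmod \<beta>)\<^sup>2 = 1}"

fun su_mult :: "complex \<times> complex \<Rightarrow> complex \<times> complex \<Rightarrow> complex \<times> complex" where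
  "su_mult (\<alpha>, \<beta>) (\<gamma>, \<delta>) = (\<alpha> * \<gamma> + \<beta> * cnj \<delta>, \<alpha> * \<delta> + \<beta> * cnj \<gamma>)"

fun su_act :: "complex \<times> complex \<Rightarrow> complex \<Rightarrow> complex" where
  "su_act (\<alpha>, \<beta>) z = (\<alpha> * z + \<beta>) / (cnj \<beta> * z + cnj \<alpha>)"

definition PSU11_unitary_rep ::
    "('h, 'm) hilbert_scheme \<Rightarrow> (complex \<times> complex \<Rightarrow> 'h \<Rightarrow> 'h) \<Rightarrow> bool" where
  "PSU11_unitary_rep H U \<longleftrightarrow>
     (\<forall>g\<in>SU11. U g \<in> unitary_ops H H) \<and>
     (\<forall>g\<in>SU11. \<forall>h\<in>SU11. U (su_mult g h) = compose (carrier H) (U g) (U h)) \<and>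
     (\<forall>g\<in>SU11. U (- g) = U g) \<and>
     (\<forall>x\<in>carrier H. continuous_map (top_of_set SU11) (htop H) (\<lambda>g. U g x))"

definition su_rot :: "real \<Rightarrow> complex \<times> complex" where
  "su_rot t = (cis (t / 2), 0)"

text \<open>The rotation group is \<open>t \<mapsto> exp (i t L)\<close>; the graph of its generator \<open>L\<close> consists of the
  pairs \<open>(x, y)\<close> with \<open>y = lim\<^sub>t\<^sub>\<rightarrow>\<^sub>0 (U(rot t) x - x) / (i t)\<close>.\<close>

definition rot_generator ::
    "('h, 'm) hilbert_scheme \<Rightarrow> (complex \<times> complex \<Rightarrow> 'h \<Rightarrow> 'h) \<Rightarrow> ('h \<times> 'h) set" where
  "rot_generator H U = {(x, y). x \<in> carrier H \<and> y \<in> carrier H \<and>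
     limitin (htop H)
       (\<lambda>t::real. (1 / (\<i> * of_real t)) \<odot>\<^bsub>H\<^esub> (U (su_rot t) x \<ominus>\<^bsub>H\<^esub> x)) y (at 0)}"

record 'h net =
  vac_space :: "'h hilbert"
  local_alg :: "complex set \<Rightarrow> ('h \<Rightarrow> 'h) set"
  vacuum :: 'h

definition moebius_covariant :: "'h net \<Rightarrow> (complex \<times> complex \<Rightarrow> 'h \<Rightarrow> 'h) \<Rightarrow> bool" where
  "moebius_covariant N U \<longleftrightarrow>
     PSU11_unitary_rep (vac_space N) U \<and>
     (\<forall>g\<in>SU11. \<forall>I\<in>arcs. local_alg N (su_act g ` I) =
        {compose (carrier (vac_space N)) (U g)
           (compose (carrier (vac_space N)) X (adj (vac_space N) (vac_space N) (U g)))
         | X. X \<in> local_alg N I}) \<and>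
     (\<forall>(x, y)\<in>rot_generator (vac_space N) U.
        Im (hinner (vac_space N) y x) = 0 \<and> 0 \<le> Re (hinner (vac_space N) y x)) \<and>
     (\<forall>g\<in>SU11. U g (vacuum N) = vacuum N)"

locale moebius_net =
  fixes N :: "'h net"
  assumes vac_hilbert: "hilbert_space (vac_space N)"
    and local_vN: "I \<in> arcs \<Longrightarrow> von_neumann_algebra (vac_space N) (local_alg N I)"
    and isotony: "\<lbrakk>I \<in> arcs; J \<in> arcs; I \<subseteq> J\<rbrakk> \<Longrightarrow> local_alg N I \<subseteq> local_alg N J"
    and locality: "\<lbrakk>I \<in> arcs; J \<in> arcs; I \<inter> J = {}; X \<in> local_alg N I; Y \<in> local_alg N J\<rbrakk>
      \<Longrightarrow> compose (carrier (vac_space N)) X Y = compose (carrier (vac_space N)) Y X"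
    and covariance: "\<exists>U. moebius_covariant N U"
    and vacuum_unit: "vacuum N \<in> carrier (vac_space N)" "hnorm (vac_space N) (vacuum N) = 1"
    and vacuum_cyclic: "cyclic_vec (vac_space N)
      (commutant (vac_space N) (commutant (vac_space N) (\<Union>I\<in>arcs. local_alg N I))) (vacuum N)"

locale irreducible_moebius_net = moebius_net +
  assumes irreducible: "commutant (vac_space N) (\<Union>I\<in>arcs. local_alg N I)
      \<subseteq> {op_smult (vac_space N) (vac_space N) c (ident (vac_space N)) | c. True}"


section \<open>Modules of a net\<close>

record 'h rep_space = "'h hilbert" +
  act :: "complex set \<Rightarrow> ('h \<Rightarrow> 'h) \<Rightarrow> ('h \<Rightarrow> 'h)"

definition net_module :: "'h net \<Rightarrow> 'h rep_space \<Rightarrow> bool" where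
  "net_module N i \<longleftrightarrow> hilbert_space i \<and>
     (\<forall>I\<in>arcs. normal_rep (vac_space N) (local_alg N I) i (act i I)) \<and>
     (\<forall>I\<in>arcs. \<forall>J\<in>arcs. I \<subseteq> J \<longrightarrow> (\<forall>x\<in>local_alg N I. act i J x = act i I x))"

definition vac_module :: "'h net \<Rightarrow> 'h rep_space" where
  "vac_module N = hilbert.extend (vac_space N) (rep_space.fields (\<lambda>I x. x))"

definition local_hom ::
    "'h net \<Rightarrow> complex set \<Rightarrow> 'h rep_space \<Rightarrow> 'h rep_space \<Rightarrow> ('h \<Rightarrow> 'h) set" where
  "local_hom N I i j = {T \<in> bounded_ops i j. \<forall>x\<in>local_alg N I.
     compose (carrier i) T (act i I x) = compose (carrier i) (act j I x) T}"

definition net_hom :: "'h net \<Rightarrow> 'h rep_space \<Rightarrow> 'h rep_space \<Rightarrow> ('h \<Rightarrow> 'h) set" where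
  "net_hom N i j = {T \<in> bounded_ops i j. \<forall>I\<in>arcs. T \<in> local_hom N I i j}"

definition local_vecs :: "'h net \<Rightarrow> 'h rep_space \<Rightarrow> complex set \<Rightarrow> 'h set" where
  "local_vecs N i I = {T (vacuum N) | T. T \<in> local_hom N (arc_compl I) (vac_module N) i}"


section \<open>Fusion\<close>

text \<open>
  For \<open>S : i \<rightarrow> i'\<close> and \<open>T : j \<rightarrow> j'\<close> the morphism \<open>S \<boxtimes> T\<close> is \<open>tensm F i i' j j' S T\<close>. Associators
  \<open>(i \<boxtimes> j) \<boxtimes> k \<rightarrow> i \<boxtimes> (j \<boxtimes> k)\<close> and unitors \<open>0 \<boxtimes> i \<rightarrow> i\<close>, \<open>i \<boxtimes> 0 \<rightarrow> i\<close> are kept explicit.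
  \<open>Lop F i k I \<xi>\<close> is \<open>L(\<xi>, I) : k \<rightarrow> i \<boxtimes> k\<close> and \<open>Rop F i k I \<xi>\<close> is \<open>R(\<xi>, I) : k \<rightarrow> k \<boxtimes> i\<close>, for \<open>\<xi>\<close> in \<open>i\<close>.
  The axioms below determine the structure up to equivalence: locality and the state-field property
  give \<open>\<langle>L(\<xi>)\<eta>, L(\<xi>')\<eta>'\<rangle> = \<langle>L(\<xi>')\<^sup>* L(\<xi>) R(\<eta>')\<^sup>* R(\<eta>) \<Omega>, \<Omega>\<rangle>\<close>, the inner product of Connes fusion.
\<close>

record 'h fusion =
  tens :: "'h rep_space \<Rightarrow> 'h rep_space \<Rightarrow> 'h rep_space" (infixl "\<boxtimes>\<index>" 70)
  tensm :: "'h rep_space \<Rightarrow> 'h rep_space \<Rightarrow> 'h rep_space \<Rightarrow> 'h rep_space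
    \<Rightarrow> ('h \<Rightarrow> 'h) \<Rightarrow> ('h \<Rightarrow> 'h) \<Rightarrow> 'h \<Rightarrow> 'h"
  assoc :: "'h rep_space \<Rightarrow> 'h rep_space \<Rightarrow> 'h rep_space \<Rightarrow> 'h \<Rightarrow> 'h"
  lunit :: "'h rep_space \<Rightarrow> 'h \<Rightarrow> 'h"
  runit :: "'h rep_space \<Rightarrow> 'h \<Rightarrow> 'h"
  braid :: "'h rep_space \<Rightarrow> 'h rep_space \<Rightarrow> 'h \<Rightarrow> 'h"
  Lop :: "'h rep_space \<Rightarrow> 'h rep_space \<Rightarrow> arg_arc \<Rightarrow> 'h \<Rightarrow> 'h \<Rightarrow> 'h"
  Rop :: "'h rep_space \<Rightarrow> 'h rep_space \<Rightarrow> arg_arc \<Rightarrow> 'h \<Rightarrow> 'h \<Rightarrow> 'h"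

locale braided_cstar_tensor =
  fixes N :: "'h net" and F :: "'h fusion" (structure)
  assumes tens_module: "\<lbrakk>net_module N i; net_module N j\<rbrakk> \<Longrightarrow> net_module N (i \<boxtimes> j)"
    and tensm_hom: "\<lbrakk>net_module N i; net_module N i'; net_module N j; net_module N j';
        S \<in> net_hom N i i'; T \<in> net_hom N j j'\<rbrakk>
      \<Longrightarrow> tensm F i i' j j' S T \<in> net_hom N (i \<boxtimes> j) (i' \<boxtimes> j')"
    and tensm_ident: "\<lbrakk>net_module N i; net_module N j\<rbrakk>
      \<Longrightarrow> tensm F i i j j (ident i) (ident j) = ident (i \<boxtimes> j)"
    and tensm_compose: "\<lbrakk>net_module N i; net_module N i'; net_module N i'';
        net_module N j; net_module N j'; net_module N j'';
        S \<in> net_hom N i i'; S' \<in> net_hom N i' i''; T \<in> net_hom N j j'; T' \<in> net_hom N j' j''\<rbrakk>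
      \<Longrightarrow> tensm F i i'' j j'' (compose (carrier i) S' S) (compose (carrier j) T' T)
        = compose (carrier (i \<boxtimes> j)) (tensm F i' i'' j' j'' S' T') (tensm F i i' j j' S T)"
    and tensm_add_left: "\<lbrakk>net_module N i; net_module N i'; net_module N j; net_module N j';
        S \<in> net_hom N i i'; S' \<in> net_hom N i i'; T \<in> net_hom N j j'\<rbrakk>
      \<Longrightarrow> tensm F i i' j j' (op_add i i' S S') T
        = op_add (i \<boxtimes> j) (i' \<boxtimes> j') (tensm F i i' j j' S T) (tensm F i i' j j' S' T)"
    and tensm_add_right: "\<lbrakk>net_module N i; net_module N i'; net_module N j; net_module N j';
        S \<in> net_hom N i i'; T \<in> net_hom N j j'; T' \<in> net_hom N j j'\<rbrakk>
      \<Longrightarrow> tensm F i i' j j' S (op_add j j' T T')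
        = op_add (i \<boxtimes> j) (i' \<boxtimes> j') (tensm F i i' j j' S T) (tensm F i i' j j' S T')"
    and tensm_smult_left: "\<lbrakk>net_module N i; net_module N i'; net_module N j; net_module N j';
        S \<in> net_hom N i i'; T \<in> net_hom N j j'\<rbrakk>
      \<Longrightarrow> tensm F i i' j j' (op_smult i i' c S) T
        = op_smult (i \<boxtimes> j) (i' \<boxtimes> j') c (tensm F i i' j j' S T)"
    and tensm_smult_right: "\<lbrakk>net_module N i; net_module N i'; net_module N j; net_module N j';
        S \<in> net_hom N i i'; T \<in> net_hom N j j'\<rbrakk>
      \<Longrightarrow> tensm F i i' j j' S (op_smult j j' c T)
        = op_smult (i \<boxtimes> j) (i' \<boxtimes> j') c (tensm F i i' j j' S T)"
    and tensm_adj: "\<lbrakk>net_module N i; net_module N i'; net_module N j; net_module N j';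
        S \<in> net_hom N i i'; T \<in> net_hom N j j'\<rbrakk>
      \<Longrightarrow> tensm F i' i j' j (adj i i' S) (adj j j' T)
        = adj (i \<boxtimes> j) (i' \<boxtimes> j') (tensm F i i' j j' S T)"
    and assoc_iso: "\<lbrakk>net_module N i; net_module N j; net_module N k\<rbrakk>
      \<Longrightarrow> assoc F i j k \<in> net_hom N (i \<boxtimes> j \<boxtimes> k) (i \<boxtimes> (j \<boxtimes> k))
          \<inter> unitary_ops (i \<boxtimes> j \<boxtimes> k) (i \<boxtimes> (j \<boxtimes> k))"
    and lunit_iso: "net_module N i \<Longrightarrow> lunit F i \<in> net_hom N (vac_module N \<boxtimes> i) i
          \<inter> unitary_ops (vac_module N \<boxtimes> i) i"
    and runit_iso: "net_module N i \<Longrightarrow> runit F i \<in> net_hom N (i \<boxtimes> vac_module N) i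
          \<inter> unitary_ops (i \<boxtimes> vac_module N) i"
    and braid_iso: "\<lbrakk>net_module N i; net_module N j\<rbrakk>
      \<Longrightarrow> braid F i j \<in> net_hom N (i \<boxtimes> j) (j \<boxtimes> i) \<inter> unitary_ops (i \<boxtimes> j) (j \<boxtimes> i)"
    and assoc_natural: "\<lbrakk>net_module N i; net_module N i'; net_module N j; net_module N j';
        net_module N k; net_module N k';
        S \<in> net_hom N i i'; T \<in> net_hom N j j'; G \<in> net_hom N k k'; x \<in> carrier (i \<boxtimes> j \<boxtimes> k)\<rbrakk>
      \<Longrightarrow> assoc F i' j' k' (tensm F (i \<boxtimes> j) (i' \<boxtimes> j') k k' (tensm F i i' j j' S T) G x)
        = tensm F i i' (j \<boxtimes> k) (j' \<boxtimes> k') S (tensm F j j' k k' T G) (assoc F i j k x)"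
    and lunit_natural: "\<lbrakk>net_module N i; net_module N i'; S \<in> net_hom N i i';
        x \<in> carrier (vac_module N \<boxtimes> i)\<rbrakk>
      \<Longrightarrow> lunit F i' (tensm F (vac_module N) (vac_module N) i i' (ident (vac_module N)) S x)
        = S (lunit F i x)"
    and runit_natural: "\<lbrakk>net_module N i; net_module N i'; S \<in> net_hom N i i';
        x \<in> carrier (i \<boxtimes> vac_module N)\<rbrakk>
      \<Longrightarrow> runit F i' (tensm F i i' (vac_module N) (vac_module N) S (ident (vac_module N)) x)
        = S (runit F i x)"
    and braid_natural: "\<lbrakk>net_module N i; net_module N i'; net_module N j; net_module N j';
        S \<in> net_hom N i i'; T \<in> net_hom N j j'; x \<in> carrier (i \<boxtimes> j)\<rbrakk>
      \<Longrightarrow> braid F i' j' (tensm F i i' j j' S T x) = tensm F j j' i i' T S (braid F i j x)"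
    and pentagon: "\<lbrakk>net_module N i; net_module N j; net_module N k; net_module N l;
        x \<in> carrier (i \<boxtimes> j \<boxtimes> k \<boxtimes> l)\<rbrakk>
      \<Longrightarrow> tensm F i i (j \<boxtimes> k \<boxtimes> l) (j \<boxtimes> (k \<boxtimes> l)) (ident i) (assoc F j k l)
            (assoc F i (j \<boxtimes> k) l
              (tensm F (i \<boxtimes> j \<boxtimes> k) (i \<boxtimes> (j \<boxtimes> k)) l l (assoc F i j k) (ident l) x))
        = assoc F i j (k \<boxtimes> l) (assoc F (i \<boxtimes> j) k l x)"
    and triangle: "\<lbrakk>net_module N i; net_module N j; x \<in> carrier (i \<boxtimes> vac_module N \<boxtimes> j)\<rbrakk>
      \<Longrightarrow> tensm F i i (vac_module N \<boxtimes> j) j (ident i) (lunit F j) (assoc F i (vac_module N) j x)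
        = tensm F (i \<boxtimes> vac_module N) i j j (runit F i) (ident j) x"
    and hexagon: "\<lbrakk>net_module N i; net_module N j; net_module N k; x \<in> carrier (i \<boxtimes> j \<boxtimes> k)\<rbrakk>
      \<Longrightarrow> assoc F j k i (braid F i (j \<boxtimes> k) (assoc F i j k x))
        = tensm F j j (i \<boxtimes> k) (k \<boxtimes> i) (ident j) (braid F i k)
            (assoc F j i k (tensm F (i \<boxtimes> j) (j \<boxtimes> i) k k (braid F i j) (ident k) x))"
    and hexagon': "\<lbrakk>net_module N i; net_module N j; net_module N k; x \<in> carrier (i \<boxtimes> j \<boxtimes> k)\<rbrakk>
      \<Longrightarrow> assoc F k i j
            (tensm F (i \<boxtimes> k) (k \<boxtimes> i) j j (braid F i k) (ident j)
              (adj (i \<boxtimes> k \<boxtimes> j) (i \<boxtimes> (k \<boxtimes> j)) (assoc F i k j)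
                (tensm F i i (j \<boxtimes> k) (k \<boxtimes> j) (ident i) (braid F j k) (assoc F i j k x))))
        = braid F (i \<boxtimes> j) k x"

locale categorical_extension = braided_cstar_tensor +
  assumes L_hom: "\<lbrakk>net_module N i; net_module N k; I \<in> arg_arcs; \<xi> \<in> local_vecs N i (fst I)\<rbrakk>
      \<Longrightarrow> Lop F i k I \<xi> \<in> local_hom N (arc_compl (fst I)) k (i \<boxtimes> k)"
    and R_hom: "\<lbrakk>net_module N i; net_module N k; I \<in> arg_arcs; \<xi> \<in> local_vecs N i (fst I)\<rbrakk>
      \<Longrightarrow> Rop F i k I \<xi> \<in> local_hom N (arc_compl (fst I)) k (k \<boxtimes> i)"
    and L_isotony: "\<lbrakk>net_module N i; net_module N k; I \<in> arg_arcs; J \<in> arg_arcs; arg_sub I J;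
        \<xi> \<in> local_vecs N i (fst I)\<rbrakk>
      \<Longrightarrow> Lop F i k J \<xi> = Lop F i k I \<xi>"
    and R_isotony: "\<lbrakk>net_module N i; net_module N k; I \<in> arg_arcs; J \<in> arg_arcs; arg_sub I J;
        \<xi> \<in> local_vecs N i (fst I)\<rbrakk>
      \<Longrightarrow> Rop F i k J \<xi> = Rop F i k I \<xi>"
    and L_functorial: "\<lbrakk>net_module N i; net_module N k; net_module N k'; G \<in> net_hom N k k';
        I \<in> arg_arcs; \<xi> \<in> local_vecs N i (fst I); \<eta> \<in> carrier k\<rbrakk>
      \<Longrightarrow> tensm F i i k k' (ident i) G (Lop F i k I \<xi> \<eta>) = Lop F i k' I \<xi> (G \<eta>)"
    and R_functorial: "\<lbrakk>net_module N i; net_module N k; net_module N k'; G \<in> net_hom N k k';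
        I \<in> arg_arcs; \<xi> \<in> local_vecs N i (fst I); \<eta> \<in> carrier k\<rbrakk>
      \<Longrightarrow> tensm F k k' i i G (ident i) (Rop F i k I \<xi> \<eta>) = Rop F i k' I \<xi> (G \<eta>)"
    and L_state_field: "\<lbrakk>net_module N i; I \<in> arg_arcs; \<xi> \<in> local_vecs N i (fst I)\<rbrakk>
      \<Longrightarrow> runit F i (Lop F i (vac_module N) I \<xi> (vacuum N)) = \<xi>"
    and R_state_field: "\<lbrakk>net_module N i; I \<in> arg_arcs; \<xi> \<in> local_vecs N i (fst I)\<rbrakk>
      \<Longrightarrow> lunit F i (Rop F i (vac_module N) I \<xi> (vacuum N)) = \<xi>"
    and L_density: "\<lbrakk>net_module N i; net_module N k; I \<in> arg_arcs\<rbrakk>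
      \<Longrightarrow> dense_in (i \<boxtimes> k) (lin_span (i \<boxtimes> k)
            {Lop F i k I \<xi> \<eta> | \<xi> \<eta>. \<xi> \<in> local_vecs N i (fst I) \<and> \<eta> \<in> carrier k})"
    and R_density: "\<lbrakk>net_module N i; net_module N k; I \<in> arg_arcs\<rbrakk>
      \<Longrightarrow> dense_in (k \<boxtimes> i) (lin_span (k \<boxtimes> i)
            {Rop F i k I \<xi> \<eta> | \<xi> \<eta>. \<xi> \<in> local_vecs N i (fst I) \<and> \<eta> \<in> carrier k})"
    and LR_locality: "\<lbrakk>net_module N i; net_module N j; net_module N k;
        I \<in> arg_arcs; J \<in> arg_arcs; clockwise_to J I;
        \<xi> \<in> local_vecs N i (fst I); \<eta> \<in> local_vecs N j (fst J)\<rbrakk>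
      \<Longrightarrow> commutes_adjointly k (i \<boxtimes> k) (k \<boxtimes> j) (i \<boxtimes> (k \<boxtimes> j))
            (Lop F i k I \<xi>) (Rop F j k J \<eta>)
            (compose (carrier (i \<boxtimes> k)) (assoc F i k j) (Rop F j (i \<boxtimes> k) J \<eta>))
            (Lop F i (k \<boxtimes> j) I \<xi>)"
    and LR_braiding: "\<lbrakk>net_module N i; net_module N j; I \<in> arg_arcs;
        \<xi> \<in> local_vecs N i (fst I); \<eta> \<in> carrier j\<rbrakk>
      \<Longrightarrow> braid F i j (Lop F i j I \<xi> \<eta>) = Rop F i j I \<xi> \<eta>"


section \<open>C*-Frobenius algebras and extensions\<close>

record 'h frob =
  fobj :: "'h rep_space"
  fmult :: "'h \<Rightarrow> 'h"
  funit :: "'h \<Rightarrow> 'h"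

definition cstar_frobenius :: "'h net \<Rightarrow> 'h fusion \<Rightarrow> 'h frob \<Rightarrow> bool" where
  "cstar_frobenius N F Q \<longleftrightarrow> (let a = fobj Q; \<mu> = fmult Q; \<iota> = funit Q; v = vac_module N in
     net_module N a \<and>
     \<mu> \<in> net_hom N (a \<boxtimes>\<^bsub>F\<^esub> a) a \<and>
     \<iota> \<in> net_hom N v a \<and>
     (\<forall>x\<in>carrier (v \<boxtimes>\<^bsub>F\<^esub> a). \<mu> (tensm F v a a a \<iota> (ident a) x) = lunit F a x) \<and>
     (\<forall>x\<in>carrier (a \<boxtimes>\<^bsub>F\<^esub> v). \<mu> (tensm F a a v a (ident a) \<iota> x) = runit F a x) \<and>
     commutes_adjointly (a \<boxtimes>\<^bsub>F\<^esub> a \<boxtimes>\<^bsub>F\<^esub> a) (a \<boxtimes>\<^bsub>F\<^esub> a) (a \<boxtimes>\<^bsub>F\<^esub> a) a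
       (compose (carrier (a \<boxtimes>\<^bsub>F\<^esub> a \<boxtimes>\<^bsub>F\<^esub> a))
          (tensm F a a (a \<boxtimes>\<^bsub>F\<^esub> a) a (ident a) \<mu>) (assoc F a a a))
       (tensm F (a \<boxtimes>\<^bsub>F\<^esub> a) a a a \<mu> (ident a))
       \<mu> \<mu>)"

definition left_iso ::
    "'h net \<Rightarrow> 'h fusion \<Rightarrow> 'h frob \<Rightarrow> 'h frob \<Rightarrow> ('h \<Rightarrow> 'h) \<Rightarrow> bool" where
  "left_iso N F Qa Qb V \<longleftrightarrow> (let a = fobj Qa; b = fobj Qb in
     V \<in> net_hom N a b \<and>
     (\<exists>S\<in>bounded_ops b a. compose (carrier a) S V = ident a \<and> compose (carrier b) V S = ident b) \<and>
     compose (carrier (vac_module N)) V (funit Qa) = funit Qb \<and>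
     compose (carrier (a \<boxtimes>\<^bsub>F\<^esub> a)) V (fmult Qa)
       = compose (carrier (a \<boxtimes>\<^bsub>F\<^esub> a)) (fmult Qb) (tensm F a b a b V V) \<and>
     compose (carrier (a \<boxtimes>\<^bsub>F\<^esub> b)) (adj a b V)
         (compose (carrier (a \<boxtimes>\<^bsub>F\<^esub> b)) (fmult Qb) (tensm F a b b b V (ident b)))
       = compose (carrier (a \<boxtimes>\<^bsub>F\<^esub> b)) (fmult Qa) (tensm F a a b a (ident a) (adj a b V)))"

record 'h extn =
  emod :: "'h rep_space"
  ealg :: "arg_arc \<Rightarrow> ('h \<Rightarrow> 'h) set"
  eincl :: "'h \<Rightarrow> 'h"

definition net_extension :: "'h net \<Rightarrow> 'h extn \<Rightarrow> bool" where
  "net_extension N E \<longleftrightarrow>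
     net_module N (emod E) \<and>
     eincl E \<in> net_hom N (vac_module N) (emod E) \<and>
     (\<forall>I\<in>arg_arcs. von_neumann_algebra (emod E) (ealg E I) \<and>
        act (emod E) (fst I) ` local_alg N (fst I) \<subseteq> ealg E I \<and>
        cyclic_vec (emod E) (ealg E I) (eincl E (vacuum N)) \<and>
        separating_vec (emod E) (ealg E I) (eincl E (vacuum N)) \<and>
        (\<forall>X\<in>ealg E I. \<forall>y\<in>local_alg N (arc_compl (fst I)).
           compose (carrier (emod E)) X (act (emod E) (arc_compl (fst I)) y)
             = compose (carrier (emod E)) (act (emod E) (arc_compl (fst I)) y) X)) \<and>
     (\<forall>I\<in>arg_arcs. \<forall>J\<in>arg_arcs. arg_sub I J \<longrightarrow> ealg E I \<subseteq> ealg E J)"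

definition frob_extn :: "'h net \<Rightarrow> 'h fusion \<Rightarrow> 'h frob \<Rightarrow> 'h extn" where
  "frob_extn N F Q = \<lparr>emod = fobj Q,
     ealg = (\<lambda>I. {compose (carrier (fobj Q)) (fmult Q) (Lop F (fobj Q) (fobj Q) I \<xi>)
                  | \<xi>. \<xi> \<in> local_vecs N (fobj Q) (fst I)}),
     eincl = funit Q\<rparr>"

text \<open>Families of maps are taken to be \<open>undefined\<close> off their domain, so that equal families are
  equal functions.\<close>

definition extn_iso :: "'h net \<Rightarrow> 'h extn \<Rightarrow> 'h extn
    \<Rightarrow> (arg_arc \<Rightarrow> ('h \<Rightarrow> 'h) \<Rightarrow> ('h \<Rightarrow> 'h)) \<Rightarrow> bool" where
  "extn_iso N Ea Eb \<phi> \<longleftrightarrow>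
     \<phi> \<in> (\<Pi>\<^sub>E I\<in>arg_arcs. ealg Ea I \<rightarrow>\<^sub>E ealg Eb I) \<and>
     (\<forall>I\<in>arg_arcs. normal_iso (emod Ea) (ealg Ea I) (emod Eb) (ealg Eb I) (\<phi> I)) \<and>
     (\<forall>I\<in>arg_arcs. \<forall>J\<in>arg_arcs. arg_sub I J \<longrightarrow> (\<forall>X\<in>ealg Ea I. \<phi> J X = \<phi> I X)) \<and>
     (\<forall>I\<in>arg_arcs. \<forall>x\<in>local_alg N (fst I).
        \<phi> I (act (emod Ea) (fst I) x) = act (emod Eb) (fst I) x)"

definition implements :: "'h extn \<Rightarrow> 'h extn \<Rightarrow> ('h \<Rightarrow> 'h)
    \<Rightarrow> (arg_arc \<Rightarrow> ('h \<Rightarrow> 'h) \<Rightarrow> ('h \<Rightarrow> 'h)) \<Rightarrow> bool" where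
  "implements Ea Eb V \<phi> \<longleftrightarrow> (\<forall>I\<in>arg_arcs. \<forall>X\<in>ealg Ea I.
     compose (carrier (emod Ea)) V X = compose (carrier (emod Ea)) (\<phi> I X) V)"

definition unitary_extn_iso :: "'h net \<Rightarrow> 'h extn \<Rightarrow> 'h extn
    \<Rightarrow> (arg_arc \<Rightarrow> ('h \<Rightarrow> 'h) \<Rightarrow> ('h \<Rightarrow> 'h)) \<Rightarrow> bool" where
  "unitary_extn_iso N Ea Eb \<phi> \<longleftrightarrow> extn_iso N Ea Eb \<phi> \<and>
     (\<exists>W\<in>unitary_ops (emod Ea) (emod Eb).
        compose (carrier (vac_module N)) W (eincl Ea) = eincl Eb \<and> implements Ea Eb W \<phi>)"

definition iso_of :: "'h net \<Rightarrow> 'h fusion \<Rightarrow> 'h frob \<Rightarrow> 'h frob \<Rightarrow> ('h \<Rightarrow> 'h)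
    \<Rightarrow> arg_arc \<Rightarrow> ('h \<Rightarrow> 'h) \<Rightarrow> ('h \<Rightarrow> 'h)" where
  "iso_of N F Qa Qb V = (THE \<phi>. extn_iso N (frob_extn N F Qa) (frob_extn N F Qb) \<phi> \<and>
     implements (frob_extn N F Qa) (frob_extn N F Qb) V \<phi>)"

definition extn_iso_compose :: "'h extn \<Rightarrow> (arg_arc \<Rightarrow> ('h \<Rightarrow> 'h) \<Rightarrow> ('h \<Rightarrow> 'h))
    \<Rightarrow> (arg_arc \<Rightarrow> ('h \<Rightarrow> 'h) \<Rightarrow> ('h \<Rightarrow> 'h)) \<Rightarrow> arg_arc \<Rightarrow> ('h \<Rightarrow> 'h) \<Rightarrow> ('h \<Rightarrow> 'h)" where
  "extn_iso_compose Ea \<psi> \<phi> = (\<lambda>I\<in>arg_arcs. compose (ealg Ea I) (\<psi> I) (\<phi> I))"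

end

(* Locality of the categorical extension gives Haag duality, and B_Q(I) is then the commutant of the right
   multiplications by H_a(J), J clockwise to I, together with the action of A(I').
   A left isomorphism V conjugates B_Qa(I) onto B_Qb(I), and V*V commutes with B_Qa(I), so the conjugation
   respects adjoints. Conversely, an isomorphism phi of extensions satisfies |phi(X) omega_b| <= C |X omega_a| by
   X* X <= |mu|^2 L* L with L = L(X omega_a) and L* L in A(I), so X omega_a |-> phi(X) omega_b extends to a bounded V.
   Every module endomorphism D that commutes with B_Qa(I) satisfies |D| <= |mu| |D omega_a|; applied to
   the powers of 1 - c V*V this shows that V is bounded below, hence invertible, and mu_a is transported
   along V. Cyclicity of local vectors (Reeh-Schlieder) follows from positivity of the rotation generator. *)

theory Submission
  imports Defs
begin

section \<open>Hilbert spaces on a carrier\<close>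

text \<open>The two halves of a locality square match the two halves of the Frobenius square:
  associativity makes left and right multiplications commute, the adjoint relation does the same for
  left multiplications and adjoints of right ones. Identities between intertwiners are tested on
  local vectors, where \<open>L(\<xi>) \<eta> = R(\<eta>) \<xi>\<close>; this is why totality of
  local vectors comes so early.

  In the converse direction the difficulty is norm control: \<phi> says nothing about vectors except
  through \<open>A(I)\<close>, on which it is prescribed. Irreducibility closes this gap: the
  adjoint of \<iota> times \<iota> is a scalar, so the expectation of \<open>A(I)\<close> in
  \<open>\<omega>_b\<close> is a multiple of the vacuum expectation. For the lower bound on V no
  finiteness of the endomorphisms of \<open>H_a\<close> is assumed; an endomorphism commuting with
  \<open>B_Q(I)\<close> is right multiplication by its value at \<omega>, so decay of powers at the
  single vector \<omega> is decay in operator norm.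

  V is first obtained for each arg-valued interval separately. These intervals are linked by chains
  of inclusions, across all windings, hence the choices agree.\<close>

lemma complex_ring_simps [simp]:
  "carrier complex_ring = UNIV" "mult complex_ring = (*)" "one complex_ring = 1"
  "zero complex_ring = 0" "add complex_ring = (+)"
  by (simp_all add: complex_ring_def)

text \<open>Density is expressed by a trivial orthogonal complement, so that uniqueness arguments
  test against \<open>S\<close> by inner products and take no limits.\<close>

definition total_in :: "('h, 'm) hilbert_scheme \<Rightarrow> 'h set \<Rightarrow> bool" where
  "total_in H S \<longleftrightarrow> S \<subseteq> carrier H \<and>
     (\<forall>z\<in>carrier H. (\<forall>s\<in>S. hinner H s z = 0) \<longrightarrow> z = \<zero>\<^bsub>H\<^esub>)"

text \<open>Closedness is not asked for: domains met below, such as \<open>B_Q(I) \<omega>\<close>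
  or the range of an adjoint, are not known to be closed.\<close>

definition lin_subspace :: "('h, 'm) hilbert_scheme \<Rightarrow> 'h set \<Rightarrow> bool" where
  "lin_subspace H D \<longleftrightarrow> D \<subseteq> carrier H \<and> \<zero>\<^bsub>H\<^esub> \<in> D \<and>
     (\<forall>x\<in>D. \<forall>y\<in>D. x \<oplus>\<^bsub>H\<^esub> y \<in> D) \<and> (\<forall>c. \<forall>x\<in>D. c \<odot>\<^bsub>H\<^esub> x \<in> D)"

context hilbert_space
begin

lemma inner_add_right:
  "\<lbrakk>x \<in> carrier H; y \<in> carrier H; z \<in> carrier H\<rbrakk>
    \<Longrightarrow> hinner H z (x \<oplus> y) = hinner H z x + hinner H z y"
  using inner_commute[of "x \<oplus> y" z] inner_add[of x y z] inner_commute[of x z] inner_commute[of y z]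
  by simp

lemma inner_smult_right:
  "\<lbrakk>x \<in> carrier H; y \<in> carrier H\<rbrakk> \<Longrightarrow> hinner H y (c \<odot> x) = cnj c * hinner H y x"
  using inner_commute[of "c \<odot> x" y] inner_smult[of x y c] inner_commute[of x y] by simp

lemma zero_smult [simp]: "x \<in> carrier H \<Longrightarrow> 0 \<odot> x = \<zero>"
  using smult_l_null[of x] by simp

lemma one_smult [simp]: "x \<in> carrier H \<Longrightarrow> 1 \<odot> x = x"
  using smult_one[of x] by simp

lemma inner_zero_left [simp]: "y \<in> carrier H \<Longrightarrow> hinner H \<zero> y = 0"
  using inner_smult[of \<zero> y 0] by simp

lemma inner_zero_right [simp]: "y \<in> carrier H \<Longrightarrow> hinner H y \<zero> = 0"
  using inner_smult_right[of \<zero> y 0] by simp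

lemma inner_neg_left: "\<lbrakk>x \<in> carrier H; y \<in> carrier H\<rbrakk> \<Longrightarrow> hinner H (\<ominus> x) y = - hinner H x y"
  using inner_add[of "\<ominus> x" x y] by (simp add: M.l_neg eq_neg_iff_add_eq_0)

lemma inner_neg_right: "\<lbrakk>x \<in> carrier H; y \<in> carrier H\<rbrakk> \<Longrightarrow> hinner H y (\<ominus> x) = - hinner H y x"
  using inner_add_right[of "\<ominus> x" x y] by (simp add: M.l_neg eq_neg_iff_add_eq_0)

lemma inner_diff_left:
  "\<lbrakk>x \<in> carrier H; y \<in> carrier H; z \<in> carrier H\<rbrakk>
    \<Longrightarrow> hinner H (x \<ominus> y) z = hinner H x z - hinner H y z"
  by (simp add: a_minus_def inner_add inner_neg_left)

lemma inner_diff_right: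
  "\<lbrakk>x \<in> carrier H; y \<in> carrier H; z \<in> carrier H\<rbrakk>
    \<Longrightarrow> hinner H z (x \<ominus> y) = hinner H z x - hinner H z y"
  by (simp add: a_minus_def inner_add_right inner_neg_right)

lemmas inner_simps = inner_add inner_add_right inner_smult inner_smult_right
  inner_neg_left inner_neg_right inner_diff_left inner_diff_right

lemma hnorm_ge0 [simp]: "x \<in> carrier H \<Longrightarrow> 0 \<le> hnorm H x"
  by (simp add: hnorm_def inner_nonneg)

lemma hnorm_sq: "x \<in> carrier H \<Longrightarrow> (hnorm H x)\<^sup>2 = Re (hinner H x x)"
  by (simp add: hnorm_def inner_nonneg)

lemma inner_self: "x \<in> carrier H \<Longrightarrow> hinner H x x = of_real ((hnorm H x)\<^sup>2)"
  using inner_commute[of x x] by (simp add: hnorm_sq complex_eq_iff)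

lemma hnorm_zero [simp]: "hnorm H \<zero> = 0"
  by (simp add: hnorm_def)

lemma hnorm_eq_0: "x \<in> carrier H \<Longrightarrow> hnorm H x = 0 \<longleftrightarrow> x = \<zero>"
  using inner_self[of x] inner_definite[of x] by auto

lemma eq_if_diff_zero:
  assumes "x \<in> carrier H" "y \<in> carrier H" "x \<ominus> y = \<zero>" shows "x = y"
  using assms by (metis M.minus_equality M.minus_minus a_minus_def M.a_inv_closed)

lemma hilbert_eqI:
  assumes "x \<in> carrier H" "y \<in> carrier H" "\<And>z. z \<in> carrier H \<Longrightarrow> hinner H x z = hinner H y z"
  shows "x = y"
proof (rule eq_if_diff_zero[OF assms(1,2)])
  show "x \<ominus> y = \<zero>"
    by (rule inner_definite) (use assms in \<open>simp_all add: inner_diff_left\<close>)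
qed

lemma hilbert_eqI_total:
  assumes "x \<in> carrier H" "y \<in> carrier H" "total_in H S"
    "\<And>z. z \<in> S \<Longrightarrow> hinner H z x = hinner H z y"
  shows "x = y"
proof (rule eq_if_diff_zero[OF assms(1,2)])
  have "S \<subseteq> carrier H" using assms(3) by (simp add: total_in_def)
  then have "\<forall>s\<in>S. hinner H s (x \<ominus> y) = 0" using assms by (auto simp: inner_diff_right)
  then show "x \<ominus> y = \<zero>" using assms by (simp add: total_in_def)
qed

lemma cauchy_schwarz:
  assumes "x \<in> carrier H" "y \<in> carrier H"
  shows "cmod (hinner H x y) \<le> hnorm H x * hnorm H y"
proof (cases "hnorm H y = 0")
  case True
  then show ?thesis using assms by (simp add: hnorm_eq_0)
next
  case False
  define c where "c = hinner H x y / of_real ((hnorm H y)\<^sup>2)"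
  let ?n = "(hnorm H y)\<^sup>2"
  have n: "?n > 0" using False by simp
  have cy: "hinner H y x = cnj (hinner H x y)" using assms inner_commute by blast
  have "0 \<le> Re (hinner H (x \<ominus> c \<odot> y) (x \<ominus> c \<odot> y))" using assms by (simp add: inner_nonneg)
  also have "hinner H (x \<ominus> c \<odot> y) (x \<ominus> c \<odot> y)
      = hinner H x x - cnj c * hinner H x y - c * hinner H y x + c * cnj c * hinner H y y"
    using assms by (simp add: inner_simps algebra_simps)
  also have "\<dots> = of_real ((hnorm H x)\<^sup>2) - cnj c * hinner H x y"
    using n assms by (simp add: cy inner_self c_def field_simps power2_eq_square)
  also have "cnj c * hinner H x y = of_real ((cmod (hinner H x y))\<^sup>2 / ?n)"
    unfolding of_real_divide complex_norm_square by (simp add: c_def mult.commute)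
  finally have "(cmod (hinner H x y))\<^sup>2 \<le> (hnorm H x * hnorm H y)\<^sup>2"
    using n by (simp add: field_simps)
  then show ?thesis by (rule power2_le_imp_le) (simp add: assms)
qed

lemma hnorm_add_sq:
  assumes "x \<in> carrier H" "y \<in> carrier H"
  shows "(hnorm H (x \<oplus> y))\<^sup>2 = (hnorm H x)\<^sup>2 + 2 * Re (hinner H x y) + (hnorm H y)\<^sup>2"
  using assms inner_commute[of x y] by (simp add: hnorm_sq inner_simps)

lemma hnorm_diff_sq:
  assumes "x \<in> carrier H" "y \<in> carrier H"
  shows "(hnorm H (x \<ominus> y))\<^sup>2 = (hnorm H x)\<^sup>2 - 2 * Re (hinner H x y) + (hnorm H y)\<^sup>2"
  using assms inner_commute[of x y] by (simp add: hnorm_sq inner_simps)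

lemma hnorm_triangle:
  assumes "x \<in> carrier H" "y \<in> carrier H"
  shows "hnorm H (x \<oplus> y) \<le> hnorm H x + hnorm H y"
proof (rule power2_le_imp_le)
  have "Re (hinner H x y) \<le> hnorm H x * hnorm H y"
    using cauchy_schwarz[OF assms] complex_Re_le_cmod order_trans by blast
  then show "(hnorm H (x \<oplus> y))\<^sup>2 \<le> (hnorm H x + hnorm H y)\<^sup>2"
    using assms by (simp add: hnorm_add_sq power2_sum)
qed (use assms in simp)

lemma hnorm_smult: "x \<in> carrier H \<Longrightarrow> hnorm H (c \<odot> x) = cmod c * hnorm H x"
proof -
  assume x: "x \<in> carrier H"
  have "(hnorm H (c \<odot> x))\<^sup>2 = Re (c * cnj c * hinner H x x)"
    using x by (simp add: hnorm_sq inner_simps mult.left_commute mult.assoc del: times_complex.sel)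
  also have "c * cnj c * hinner H x x = of_real ((cmod c * hnorm H x)\<^sup>2)"
    unfolding complex_norm_square[symmetric] inner_self[OF x] by (simp add: power_mult_distrib)
  finally have "(hnorm H (c \<odot> x))\<^sup>2 = (cmod c * hnorm H x)\<^sup>2" by simp
  then show ?thesis using x by (simp add: power2_eq_iff_nonneg)
qed

lemma hnorm_minus_commute:
  assumes "x \<in> carrier H" "y \<in> carrier H" shows "hnorm H (x \<ominus> y) = hnorm H (y \<ominus> x)"
proof -
  have "(hnorm H (x \<ominus> y))\<^sup>2 = (hnorm H (y \<ominus> x))\<^sup>2"
    using assms inner_commute[of x y] by (simp add: hnorm_diff_sq)
  then show ?thesis using assms by (simp add: power2_eq_iff_nonneg)
qed

lemma diff_chain:
  assumes "x \<in> carrier H" "y \<in> carrier H" "z \<in> carrier H"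
  shows "(x \<ominus> y) \<oplus> (y \<ominus> z) = x \<ominus> z"
  by (rule hilbert_eqI) (use assms in \<open>simp_all add: inner_simps\<close>)

lemma diff_zero [simp]: "x \<in> carrier H \<Longrightarrow> x \<ominus> \<zero> = x"
  by (rule hilbert_eqI) (simp_all add: inner_simps)

lemma hnorm_diff_triangle:
  assumes "x \<in> carrier H" "y \<in> carrier H" "z \<in> carrier H"
  shows "hnorm H (x \<ominus> z) \<le> hnorm H (x \<ominus> y) + hnorm H (y \<ominus> z)"
  using hnorm_triangle[of "x \<ominus> y" "y \<ominus> z"] diff_chain[OF assms] assms by simp

lemma metric: "Metric_space (carrier H) (hdist H)"
proof
  fix x y z
  show "0 \<le> hdist H x y" by (simp add: hdist_def)
  show "hdist H x y = hdist H y x" by (simp add: hdist_def hnorm_minus_commute)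
  assume xy: "x \<in> carrier H" "y \<in> carrier H"
  show "(hdist H x y = 0) = (x = y)"
  proof -
    have "x \<ominus> x = \<zero>" using xy by (simp add: a_minus_def M.r_neg)
    then show ?thesis using xy eq_if_diff_zero by (auto simp: hdist_def hnorm_eq_0)
  qed
  assume "z \<in> carrier H"
  then show "hdist H x z \<le> hdist H x y + hdist H y z"
    using xy hnorm_diff_triangle by (simp add: hdist_def)
qed

sublocale MH: Metric_space "carrier H" "hdist H" by (rule metric)

lemma cauchy_limit:
  assumes "\<And>n. s n \<in> carrier H"
    and "\<And>e. e > 0 \<Longrightarrow> \<exists>M. \<forall>m\<ge>M. \<forall>n\<ge>M. hnorm H (s m \<ominus> s n) < e"
  obtains l where "l \<in> carrier H" "(\<lambda>n. hnorm H (s n \<ominus> l)) \<longlonglongrightarrow> 0"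
proof -
  have "MH.MCauchy s" unfolding MH.MCauchy_def using assms by (auto simp: hdist_def)
  then obtain l where l: "limitin (htop H) s l sequentially"
    using complete unfolding MH.mcomplete_def by blast
  then have lc: "l \<in> carrier H" by (simp add: MH.limitin_metric)
  have "(\<lambda>n. hnorm H (s n \<ominus> l)) \<longlonglongrightarrow> 0"
    unfolding tendsto_iff
  proof (intro allI impI)
    fix e :: real assume "e > 0"
    then have "\<forall>\<^sub>F n in sequentially. s n \<in> carrier H \<and> hdist H (s n) l < e"
      using l by (simp add: MH.limitin_metric)
    then show "\<forall>\<^sub>F n in sequentially. dist (hnorm H (s n \<ominus> l)) 0 < e"
      by eventually_elim (auto simp: hdist_def lc)
  qed
  with lc show ?thesis using that by blast
qed

lemma inner_tendsto:
  assumes "\<And>n. s n \<in> carrier H" "l \<in> carrier H" "y \<in> carrier H"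
    and "(\<lambda>n. hnorm H (s n \<ominus> l)) \<longlonglongrightarrow> 0"
  shows "(\<lambda>n. hinner H (s n) y) \<longlonglongrightarrow> hinner H l y"
proof (rule LIM_zero_cancel, rule Lim_null_comparison)
  show "\<forall>\<^sub>F n in sequentially. norm (hinner H (s n) y - hinner H l y) \<le> hnorm H (s n \<ominus> l) * hnorm H y"
  proof (rule eventuallyI)
    fix n
    show "norm (hinner H (s n) y - hinner H l y) \<le> hnorm H (s n \<ominus> l) * hnorm H y"
      using cauchy_schwarz[of "s n \<ominus> l" y] assms by (simp add: inner_diff_left)
  qed
  show "(\<lambda>n. hnorm H (s n \<ominus> l) * hnorm H y) \<longlonglongrightarrow> 0"
    using tendsto_mult_right[OF assms(4), of "hnorm H y"] by simp
qed

lemma dense_in_approx: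
  assumes "dense_in H S" "x \<in> carrier H" "e > 0"
  shows "\<exists>s\<in>S. hnorm H (x \<ominus> s) < e"
proof -
  have "x \<in> htop H closure_of S" "S \<subseteq> carrier H" using assms by (auto simp: dense_in_def)
  then show ?thesis using assms by (force simp: MH.metric_closure_of hdist_def MH.in_mball)
qed

lemma dense_in_total:
  assumes "dense_in H S" shows "total_in H S"
  unfolding total_in_def
proof (intro conjI ballI impI)
  show S: "S \<subseteq> carrier H" using assms by (simp add: dense_in_def)
  fix z assume z: "z \<in> carrier H" and o: "\<forall>s\<in>S. hinner H s z = 0"
  have "hnorm H z \<le> e" if "e > 0" for e
  proof -
    obtain s where s: "s \<in> S" "hnorm H (z \<ominus> s) < e"
      using dense_in_approx[OF assms z \<open>e > 0\<close>] by blast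
    then have sc: "s \<in> carrier H" using S by blast
    have "hinner H (z \<ominus> s) z = hinner H z z" using s sc z o by (simp add: inner_diff_left)
    then have "(hnorm H z)\<^sup>2 = cmod (hinner H (z \<ominus> s) z)"
      using z by (simp add: inner_self norm_power)
    also have "\<dots> \<le> hnorm H (z \<ominus> s) * hnorm H z" by (rule cauchy_schwarz) (use z sc in simp_all)
    also have "\<dots> \<le> e * hnorm H z" using s z by (intro mult_right_mono) auto
    finally have "hnorm H z * hnorm H z \<le> e * hnorm H z" by (simp add: power2_eq_square)
    then show ?thesis using z \<open>e > 0\<close>
      by (cases "hnorm H z = 0") (auto simp: mult_le_cancel_right)
  qed
  then have "hnorm H z \<le> 0" by (rule field_le_epsilon[of _ 0, simplified])
  then have "hnorm H z = 0" using hnorm_ge0[OF z] by linarith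
  then show "z = \<zero>" using z hnorm_eq_0 by blast
qed

lemma perp_submodule:
  assumes "z \<in> carrier H"
  shows "submodule {x \<in> carrier H. hinner H x z = 0} complex_ring H"
  by (rule module.submoduleI) (use assms in \<open>auto simp: inner_simps a_inv_def[symmetric]
    intro: module_axioms\<close>)

text \<open>The vectors orthogonal to a fixed \<open>z\<close> form a submodule, so orthogonality to
  \<open>S\<close> passes to the linear span. This converts the density axiom for \<open>L\<close>
  into totality.\<close>

lemma span_total:
  assumes "S \<subseteq> carrier H" "total_in H (lin_span H S)" shows "total_in H S"
  unfolding total_in_def
proof (intro conjI ballI impI)
  fix z assume z: "z \<in> carrier H" "\<forall>s\<in>S. hinner H s z = 0"
  have "lin_span H S \<subseteq> {x \<in> carrier H. hinner H x z = 0}"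
    unfolding lin_span_def using perp_submodule[OF z(1)] z assms(1) by blast
  then show "z = \<zero>" using assms(2) z unfolding total_in_def by blast
qed (rule assms)

lemma total_mono:
  assumes "total_in H S" "S \<subseteq> T" "T \<subseteq> carrier H" shows "total_in H T"
  using assms unfolding total_in_def by blast

text \<open>The vector is the limit of a sequence in \<open>D\<close> minimising
  \<open>J x = |x|^2 - 2 Re (f x)\<close>, which works on a domain that is not closed and
  presupposes no projections. The last clause places the vector in the closure of \<open>D\<close>;
  \<open>perp_projection\<close> uses it to get projections and \<open>analytic_orbit\<close> to
  pass from totality to density.\<close>

lemma riesz:
  assumes D: "lin_subspace H D"
    and add: "\<And>x y. \<lbrakk>x \<in> D; y \<in> D\<rbrakk> \<Longrightarrow> f (x \<oplus> y) = f x + f y"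
    and smult: "\<And>c x. x \<in> D \<Longrightarrow> f (c \<odot> x) = c * f x"
    and bound: "\<And>x. x \<in> D \<Longrightarrow> cmod (f x) \<le> C * hnorm H x"
  obtains z where "z \<in> carrier H" "\<And>x. x \<in> D \<Longrightarrow> f x = hinner H x z" "hnorm H z \<le> \<bar>C\<bar>"
    "\<And>e. e > 0 \<Longrightarrow> \<exists>d\<in>D. hnorm H (z \<ominus> d) < e"
proof -
  have Dc: "x \<in> carrier H" if "x \<in> D" for x using D that by (auto simp: lin_subspace_def)
  have D0: "\<zero> \<in> D" and Da: "\<And>x y. \<lbrakk>x \<in> D; y \<in> D\<rbrakk> \<Longrightarrow> x \<oplus> y \<in> D"
    and Ds: "\<And>c x. x \<in> D \<Longrightarrow> c \<odot> x \<in> D" using D by (auto simp: lin_subspace_def)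
  define J where "J x = (hnorm H x)\<^sup>2 - 2 * Re (f x)" for x
  have low: "- C\<^sup>2 \<le> J x" if "x \<in> D" for x
  proof -
    have "Re (f x) \<le> C * hnorm H x" using bound[OF that] complex_Re_le_cmod order_trans by blast
    moreover have "0 \<le> (hnorm H x - C)\<^sup>2" by simp
    ultimately show ?thesis unfolding J_def power2_diff by (simp add: mult.commute)
  qed
  define m where "m = Inf (J ` D)"
  have bdd: "bdd_below (J ` D)" by (rule bdd_belowI2[of _ "- C\<^sup>2"]) (rule low)
  have mle: "m \<le> J x" if "x \<in> D" for x
    unfolding m_def using bdd that by (intro cInf_lower) auto
  have "\<exists>x\<in>D. J x < m + e" if "e > 0" for e
    using cInf_lessD[of "J ` D" "m + e"] D0 that by (auto simp: m_def)
  then have "\<forall>n. \<exists>x\<in>D. J x < m + inverse (real (Suc n))" by simp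
  then obtain s where s: "\<And>n. s n \<in> D" "\<And>n. J (s n) < m + inverse (real (Suc n))" by metis
  \<comment> \<open>Parallelogram law: the midpoint of \<open>x\<close> and \<open>y\<close> lies in
    \<open>D\<close>, so its value of \<open>J\<close> is at least \<open>m\<close>. Hence
    minimising sequences are Cauchy.\<close>
  have par: "(hnorm H (x \<ominus> y))\<^sup>2 \<le> 2 * (J x - m) + 2 * (J y - m)" if "x \<in> D" "y \<in> D" for x y
  proof -
    have "m \<le> J ((1/2) \<odot> (x \<oplus> y))" using that by (intro mle Ds Da)
    also have "\<dots> = (hnorm H (x \<oplus> y))\<^sup>2 / 4 - Re (f x) - Re (f y)"
      using that by (simp add: J_def smult add Da hnorm_smult Dc power_divide add_divide_distrib)
    finally have "m \<le> ((hnorm H x)\<^sup>2 + 2 * Re (hinner H x y) + (hnorm H y)\<^sup>2) / 4 - Re (f x) - Re (f y)"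
      using that by (simp add: hnorm_add_sq Dc)
    then have "4 * m \<le> (hnorm H x)\<^sup>2 + 2 * Re (hinner H x y) + (hnorm H y)\<^sup>2 - 4 * Re (f x) - 4 * Re (f y)"
      by (simp add: field_simps)
    then show ?thesis unfolding J_def hnorm_diff_sq[OF Dc[OF that(1)] Dc[OF that(2)]]
      by (simp add: algebra_simps)
  qed
  have "\<exists>M. \<forall>p\<ge>M. \<forall>n\<ge>M. hnorm H (s p \<ominus> s n) < e" if e: "e > 0" for e
  proof -
    obtain M where M: "inverse (real (Suc M)) < e\<^sup>2 / 4" using reals_Archimedean[of "e\<^sup>2/4"] e by auto
    have "hnorm H (s p \<ominus> s n) < e" if "p \<ge> M" "n \<ge> M" for p n
    proof -
      have "inverse (real (Suc p)) \<le> inverse (real (Suc M))" "inverse (real (Suc n)) \<le> inverse (real (Suc M))"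
        using that by (auto simp: field_simps)
      then have a: "J (s p) - m < e\<^sup>2 / 4" "J (s n) - m < e\<^sup>2 / 4"
        using s(2)[of p] s(2)[of n] M by (simp_all only: less_diff_eq diff_less_eq)
      have "(hnorm H (s p \<ominus> s n))\<^sup>2 \<le> 2 * (J (s p) - m) + 2 * (J (s n) - m)"
        by (rule par[OF s(1) s(1)])
      also have "\<dots> < 2 * (e\<^sup>2 / 4) + 2 * (e\<^sup>2 / 4)" using a by (intro add_strict_mono) simp_all
      finally have "(hnorm H (s p \<ominus> s n))\<^sup>2 < e\<^sup>2" by simp
      then show ?thesis using e by (auto intro: power2_less_imp_less)
    qed
    then show ?thesis by blast
  qed
  then obtain z where z: "z \<in> carrier H" "(\<lambda>n. hnorm H (s n \<ominus> z)) \<longlonglongrightarrow> 0"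
    using cauchy_limit[of s] s(1) Dc by metis
  have appr: "\<exists>d\<in>D. hnorm H (z \<ominus> d) < e" if "e > 0" for e
  proof -
    have "\<forall>\<^sub>F n in sequentially. hnorm H (s n \<ominus> z) < e" using z(2) that order_tendstoD(2) by blast
    then obtain n where "hnorm H (s n \<ominus> z) < e" by (auto dest: eventually_happens)
    then show ?thesis using s(1)[of n] hnorm_minus_commute[of "s n" z] Dc z(1) by auto
  qed
  \<comment> \<open>First variation at the minimum: compare \<open>m\<close> with
    \<open>J (s n \<oplus> w)\<close>, where \<open>J (s n)\<close> exceeds \<open>m\<close> by less
    than \<open>1 / (n + 1)\<close>, and let \<open>n\<close> grow.\<close>
  have J: "0 \<le> (hnorm H w)\<^sup>2 + 2 * Re (hinner H z w) - 2 * Re (f w)" if w: "w \<in> D" for w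
  proof (rule tendsto_lowerbound)
    have "(\<lambda>n. hinner H (s n) w) \<longlonglongrightarrow> hinner H z w"
      by (rule inner_tendsto) (use s(1) Dc w z in auto)
    then have "(\<lambda>n. inverse (real (Suc n)) + (hnorm H w)\<^sup>2 + 2 * Re (hinner H (s n) w) - 2 * Re (f w))
      \<longlonglongrightarrow> 0 + (hnorm H w)\<^sup>2 + 2 * Re (hinner H z w) - 2 * Re (f w)"
      by (intro tendsto_intros LIMSEQ_inverse_real_of_nat)
    then show "(\<lambda>n. inverse (real (Suc n)) + (hnorm H w)\<^sup>2 + 2 * Re (hinner H (s n) w) - 2 * Re (f w))
      \<longlonglongrightarrow> (hnorm H w)\<^sup>2 + 2 * Re (hinner H z w) - 2 * Re (f w)"
      by (simp only: add_0_left)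
    show "\<forall>\<^sub>F n in sequentially. 0 \<le> inverse (real (Suc n)) + (hnorm H w)\<^sup>2
        + 2 * Re (hinner H (s n) w) - 2 * Re (f w)"
    proof (rule eventuallyI)
      fix n
      have "m \<le> J (s n \<oplus> w)" using w s(1) by (intro mle Da)
      also have "\<dots> = J (s n) + (hnorm H w)\<^sup>2 + 2 * Re (hinner H (s n) w) - 2 * Re (f w)"
        using w s(1) by (simp add: J_def hnorm_add_sq Dc add)
      finally show "0 \<le> inverse (real (Suc n)) + (hnorm H w)\<^sup>2
        + 2 * Re (hinner H (s n) w) - 2 * Re (f w)" using s(2)[of n] by linarith
    qed
  qed simp
  have re1: "Re (f w) \<le> Re (hinner H w z)" if w: "w \<in> D" for w
  proof -
    have "Re (f w) - Re (hinner H w z) \<le> 0 + e" if "e > 0" for e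
    proof -
      \<comment> \<open>Small enough that, after dividing the inequality for \<open>t w\<close> by
        \<open>t\<close>, the remaining quadratic term is at most \<open>e\<close>.\<close>
      define t where "t = e / ((hnorm H w)\<^sup>2 + 1)"
      have n: "(hnorm H w)\<^sup>2 + 1 > 0" by (simp add: add_nonneg_pos)
      have t: "t > 0" using that n by (simp add: t_def)
      have "0 \<le> t\<^sup>2 * (hnorm H w)\<^sup>2 + 2 * t * Re (hinner H w z) - 2 * t * Re (f w)"
        using J[OF Ds[OF w, of "of_real t"]] w z inner_commute[of w z]
        by (simp add: hnorm_smult Dc smult inner_simps power_mult_distrib)
      then have "0 \<le> t * (t * (hnorm H w)\<^sup>2 + 2 * Re (hinner H w z) - 2 * Re (f w))"
        by (simp add: power2_eq_square algebra_simps)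
      then have "0 \<le> t * (hnorm H w)\<^sup>2 + 2 * Re (hinner H w z) - 2 * Re (f w)"
        using t by (simp add: zero_le_mult_iff)
      moreover have "t * (hnorm H w)\<^sup>2 \<le> e" using that n by (simp add: t_def field_simps)
      ultimately show ?thesis using that by linarith
    qed
    then have "Re (f w) - Re (hinner H w z) \<le> 0" by (rule field_le_epsilon)
    then show ?thesis by simp
  qed
  \<comment> \<open>The inequality applied to \<open>- w\<close> gives equality of real parts;
    equality for \<open>\<i> w\<close> then gives the imaginary parts.\<close>
  have re: "Re (f w) = Re (hinner H w z)" if w: "w \<in> D" for w
    using re1[OF w] re1[OF Ds[OF w, of "-1"]] w z by (simp add: smult inner_simps Dc)
  have eq: "f w = hinner H w z" if w: "w \<in> D" for w
    using re[OF w] re[OF Ds[OF w, of "\<i>"]] w z by (simp add: smult inner_simps Dc complex_eq_iff)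
  \<comment> \<open>\<open>z\<close> is approximated by \<open>d\<close> in \<open>D\<close>, where
    the bound on \<open>f\<close> is available: \<open>|z|^2\<close> differs little from
    \<open>f d\<close>, which is at most \<open>|C| |d|\<close> in modulus.\<close>
  have "hnorm H z \<le> \<bar>C\<bar> + e" if "e > 0" for e
  proof (rule ccontr)
    assume "\<not> ?thesis"
    then have g: "hnorm H z > \<bar>C\<bar> + e" by simp
    define h where "h = e / 2"
    obtain d where d: "d \<in> D" "hnorm H (z \<ominus> d) < h" using appr[of h] \<open>e > 0\<close> by (auto simp: h_def)
    have dc: "d \<in> carrier H" using d Dc by blast
    have "hnorm H d \<le> hnorm H z + h"
      using hnorm_diff_triangle[of d z \<zero>] d dc z hnorm_minus_commute[of z d]
      by simp
    have "(hnorm H z)\<^sup>2 = cmod (hinner H d z + hinner H (z \<ominus> d) z)"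
      using dc z by (simp add: inner_diff_left inner_self norm_power)
    also have "\<dots> \<le> cmod (hinner H d z) + cmod (hinner H (z \<ominus> d) z)" by (rule norm_triangle_ineq)
    also have "cmod (hinner H d z) \<le> C * hnorm H d" using bound[OF d(1)] eq[OF d(1)] by simp
    also have "C * hnorm H d \<le> \<bar>C\<bar> * hnorm H d" using dc by (intro mult_right_mono) auto
    also have "\<dots> \<le> \<bar>C\<bar> * (hnorm H z + h)" using \<open>hnorm H d \<le> hnorm H z + h\<close> by (intro mult_left_mono) auto
    also have "cmod (hinner H (z \<ominus> d) z) \<le> hnorm H (z \<ominus> d) * hnorm H z"
      by (rule cauchy_schwarz) (use dc z in auto)
    also have "\<dots> \<le> h * hnorm H z" using d z by (intro mult_right_mono) auto
    finally have "(hnorm H z)\<^sup>2 \<le> \<bar>C\<bar> * (hnorm H z + h) + h * hnorm H z" by simp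
    moreover have "\<bar>C\<bar> * h \<le> hnorm H z * h" using g \<open>e > 0\<close> by (intro mult_right_mono) (auto simp: h_def)
    ultimately have "hnorm H z * hnorm H z \<le> (\<bar>C\<bar> + 2 * h) * hnorm H z"
      by (simp add: power2_eq_square algebra_simps)
    moreover have "hnorm H z > 0" using g \<open>e > 0\<close> by linarith
    ultimately show False using g by (simp add: h_def mult_le_cancel_right)
  qed
  then have "hnorm H z \<le> \<bar>C\<bar>" by (rule field_le_epsilon)
  with z eq appr show ?thesis using that by blast
qed

end

section \<open>Bounded operators, adjoints, extension by continuity and inversion of coercive
  operators\<close>

lemma bounded_below_cancel:
  fixes c a b :: real
  assumes "c * a\<^sup>2 \<le> b * a" "0 \<le> a" "0 \<le> b" "0 < c" shows "a \<le> b / c"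
proof (cases "a = 0")
  case False
  then have "c * a \<le> b" using assms by (auto simp: power2_eq_square mult.assoc[symmetric] mult_le_cancel_right)
  then show ?thesis using assms by (simp add: field_simps)
qed (use assms in auto)

lemma bopI:
  assumes "T \<in> extensional (carrier H)" "\<And>x. x \<in> carrier H \<Longrightarrow> T x \<in> carrier K"
    "\<And>x y. \<lbrakk>x \<in> carrier H; y \<in> carrier H\<rbrakk> \<Longrightarrow> T (x \<oplus>\<^bsub>H\<^esub> y) = T x \<oplus>\<^bsub>K\<^esub> T y"
    "\<And>c x. x \<in> carrier H \<Longrightarrow> T (c \<odot>\<^bsub>H\<^esub> x) = c \<odot>\<^bsub>K\<^esub> T x"
    "\<And>x. x \<in> carrier H \<Longrightarrow> hnorm K (T x) \<le> C * hnorm H x"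
  shows "T \<in> bounded_ops H K"
  using assms unfolding bounded_ops_def PiE_def by (auto intro!: exI[of _ C])

lemma bop_in: "\<lbrakk>T \<in> bounded_ops H K; x \<in> carrier H\<rbrakk> \<Longrightarrow> T x \<in> carrier K"
  by (auto simp: bounded_ops_def)

lemma bop_ext: "T \<in> bounded_ops H K \<Longrightarrow> T \<in> extensional (carrier H)"
  by (auto simp: bounded_ops_def PiE_def)

lemma bop_add: "\<lbrakk>T \<in> bounded_ops H K; x \<in> carrier H; y \<in> carrier H\<rbrakk>
    \<Longrightarrow> T (x \<oplus>\<^bsub>H\<^esub> y) = T x \<oplus>\<^bsub>K\<^esub> T y"
  by (auto simp: bounded_ops_def)

lemma bop_smult: "\<lbrakk>T \<in> bounded_ops H K; x \<in> carrier H\<rbrakk> \<Longrightarrow> T (c \<odot>\<^bsub>H\<^esub> x) = c \<odot>\<^bsub>K\<^esub> T x"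
  by (auto simp: bounded_ops_def)

lemma bop_eqI:
  assumes "S \<in> bounded_ops H K" "T \<in> bounded_ops H L" "\<And>x. x \<in> carrier H \<Longrightarrow> S x = T x"
  shows "S = T"
  by (rule extensionalityI[OF bop_ext[OF assms(1)] bop_ext[OF assms(2)]]) (rule assms(3))

lemma bop_bound:
  assumes "hilbert_space H" "T \<in> bounded_ops H K"
  obtains C where "C > 0" "\<And>x. x \<in> carrier H \<Longrightarrow> hnorm K (T x) \<le> C * hnorm H x"
proof -
  interpret H: hilbert_space H by fact
  obtain C where C: "\<forall>x\<in>carrier H. hnorm K (T x) \<le> C * hnorm H x"
    using assms(2) by (auto simp: bounded_ops_def)
  have "hnorm K (T x) \<le> (\<bar>C\<bar> + 1) * hnorm H x" if "x \<in> carrier H" for x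
  proof -
    have "C * hnorm H x \<le> (\<bar>C\<bar> + 1) * hnorm H x" by (rule mult_right_mono) (use that in auto)
    then show ?thesis using C that by force
  qed
  then show ?thesis by (intro that[of "\<bar>C\<bar> + 1"]) auto
qed

lemma bop_zero:
  assumes "hilbert_space H" "hilbert_space K" "T \<in> bounded_ops H K"
  shows "T \<zero>\<^bsub>H\<^esub> = \<zero>\<^bsub>K\<^esub>"
proof -
  interpret H: hilbert_space H by fact
  interpret K: hilbert_space K by fact
  show ?thesis using bop_smult[OF assms(3) H.zero_closed, of 0] bop_in[OF assms(3) H.zero_closed]
    by simp
qed

lemma bop_compose:
  assumes "hilbert_space H" "hilbert_space K" "T \<in> bounded_ops H K" "S \<in> bounded_ops K L"
  shows "compose (carrier H) S T \<in> bounded_ops H L"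
proof -
  interpret H: hilbert_space H by fact
  interpret K: hilbert_space K by fact
  obtain C where C: "C > 0" "\<And>x. x \<in> carrier H \<Longrightarrow> hnorm K (T x) \<le> C * hnorm H x"
    using bop_bound assms by blast
  obtain D where D: "D > 0" "\<And>x. x \<in> carrier K \<Longrightarrow> hnorm L (S x) \<le> D * hnorm K x"
    using bop_bound assms by blast
  show ?thesis
  proof (rule bopI)
    fix x assume x: "x \<in> carrier H"
    have "hnorm L (S (T x)) \<le> D * hnorm K (T x)" by (rule D) (rule bop_in[OF assms(3) x])
    also have "\<dots> \<le> D * (C * hnorm H x)" using C(2)[OF x] D(1) by (simp add: mult_left_mono)
    finally show "hnorm L (compose (carrier H) S T x) \<le> (D * C) * hnorm H x"
      using x by (simp add: compose_eq mult.assoc)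
  qed (use assms in \<open>auto simp: compose_eq bop_in bop_add bop_smult\<close>)
qed

lemma compose_apply [simp]: "x \<in> A \<Longrightarrow> compose A f g x = f (g x)"
  by (rule compose_eq)

lemma ident_apply [simp]: "x \<in> carrier H \<Longrightarrow> ident H x = x"
  by (simp add: ident_def)

lemma ident_bop [simp]: "ident H \<in> bounded_ops H H" if "hilbert_space H"
proof -
  interpret H: hilbert_space H by fact
  show ?thesis by (rule bopI[where C = 1]) (auto simp: ident_def)
qed

lemma op_add_apply [simp]: "x \<in> carrier H \<Longrightarrow> op_add H K S T x = S x \<oplus>\<^bsub>K\<^esub> T x"
  by (simp add: op_add_def)

lemma op_smult_apply [simp]: "x \<in> carrier H \<Longrightarrow> op_smult H K c T x = c \<odot>\<^bsub>K\<^esub> T x"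
  by (simp add: op_smult_def)

lemma op_add_bop:
  assumes "hilbert_space H" "hilbert_space K" "T \<in> bounded_ops H K" "S \<in> bounded_ops H K"
  shows "op_add H K S T \<in> bounded_ops H K"
proof -
  interpret H: hilbert_space H by fact
  interpret K: hilbert_space K by fact
  obtain C where C: "C > 0" "\<And>x. x \<in> carrier H \<Longrightarrow> hnorm K (T x) \<le> C * hnorm H x"
    using bop_bound assms by blast
  obtain D where D: "D > 0" "\<And>x. x \<in> carrier H \<Longrightarrow> hnorm K (S x) \<le> D * hnorm H x"
    using bop_bound assms by blast
  note [simp] = bop_in[OF assms(3)] bop_in[OF assms(4)]
  show ?thesis
  proof (rule bopI)
    fix x assume x: "x \<in> carrier H"
    show "hnorm K (op_add H K S T x) \<le> (D + C) * hnorm H x"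
      using K.hnorm_triangle[of "S x" "T x"] C(2)[OF x] D(2)[OF x] x by (simp add: algebra_simps)
  next
    fix x y assume xy: "x \<in> carrier H" "y \<in> carrier H"
    show "op_add H K S T (x \<oplus>\<^bsub>H\<^esub> y) = op_add H K S T x \<oplus>\<^bsub>K\<^esub> op_add H K S T y"
      by (rule K.hilbert_eqI) (use xy in \<open>simp_all add: bop_add[OF assms(3)] bop_add[OF assms(4)] K.inner_simps\<close>)
  next
    fix x c assume x: "x \<in> carrier H"
    show "op_add H K S T (c \<odot>\<^bsub>H\<^esub> x) = c \<odot>\<^bsub>K\<^esub> op_add H K S T x"
      by (rule K.hilbert_eqI) (use x in \<open>simp_all add: bop_smult[OF assms(3)] bop_smult[OF assms(4)] K.inner_simps algebra_simps\<close>)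
  qed (auto simp: op_add_def)
qed

lemma op_smult_bop:
  assumes "hilbert_space H" "hilbert_space K" "T \<in> bounded_ops H K"
  shows "op_smult H K c T \<in> bounded_ops H K"
proof -
  interpret H: hilbert_space H by fact
  interpret K: hilbert_space K by fact
  obtain C where C: "C > 0" "\<And>x. x \<in> carrier H \<Longrightarrow> hnorm K (T x) \<le> C * hnorm H x"
    using bop_bound assms by blast
  note [simp] = bop_in[OF assms(3)]
  show ?thesis
  proof (rule bopI)
    fix x assume x: "x \<in> carrier H"
    show "hnorm K (op_smult H K c T x) \<le> (cmod c * C) * hnorm H x"
      using C(2)[OF x] x by (simp add: K.hnorm_smult mult.assoc mult_left_mono)
  next
    fix x y assume xy: "x \<in> carrier H" "y \<in> carrier H"
    show "op_smult H K c T (x \<oplus>\<^bsub>H\<^esub> y) = op_smult H K c T x \<oplus>\<^bsub>K\<^esub> op_smult H K c T y"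
      by (rule K.hilbert_eqI) (use xy in \<open>simp_all add: bop_add[OF assms(3)] K.inner_simps algebra_simps\<close>)
  next
    fix x d assume x: "x \<in> carrier H"
    show "op_smult H K c T (d \<odot>\<^bsub>H\<^esub> x) = d \<odot>\<^bsub>K\<^esub> op_smult H K c T x"
      by (rule K.hilbert_eqI) (use x in \<open>simp_all add: bop_smult[OF assms(3)] K.inner_simps algebra_simps\<close>)
  qed (auto simp: op_smult_def)
qed

lemma carrier_subspace: "lin_subspace H (carrier H)" if "hilbert_space H"
proof -
  interpret H: hilbert_space H by fact
  show ?thesis by (auto simp: lin_subspace_def)
qed

text \<open>Existence is \<open>riesz\<close> for the functional \<open>z -> <T z, y>\<close> on the
  whole space; together with uniqueness it gives meaning to the description in
  \<open>adj\<close>.\<close>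

lemma adj_spec:
  assumes "hilbert_space H" "hilbert_space K" "T \<in> bounded_ops H K" "y \<in> carrier K"
  shows "adj H K T y \<in> carrier H \<and> (\<forall>z\<in>carrier H. hinner K (T z) y = hinner H z (adj H K T y))"
proof -
  interpret H: hilbert_space H by fact
  interpret K: hilbert_space K by fact
  obtain C where C: "C > 0" "\<And>x. x \<in> carrier H \<Longrightarrow> hnorm K (T x) \<le> C * hnorm H x"
    using bop_bound assms by blast
  note [simp] = bop_in[OF assms(3)]
  have b: "cmod (hinner K (T x) y) \<le> C * hnorm K y * hnorm H x" if x: "x \<in> carrier H" for x
  proof -
    have "cmod (hinner K (T x) y) \<le> hnorm K (T x) * hnorm K y"
      using x assms(4) by (intro K.cauchy_schwarz) auto
    also have "\<dots> \<le> C * hnorm H x * hnorm K y" using C(2)[OF x] assms(4) by (intro mult_right_mono) auto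
    finally show ?thesis by (simp add: algebra_simps)
  qed
  obtain x where x: "x \<in> carrier H" "\<And>z. z \<in> carrier H \<Longrightarrow> hinner K (T z) y = hinner H z x"
    by (rule H.riesz[OF carrier_subspace[OF assms(1)], of "\<lambda>z. hinner K (T z) y" "C * hnorm K y"])
      (use b assms in \<open>auto simp: bop_add[OF assms(3)] bop_smult[OF assms(3)] K.inner_simps\<close>)
  let ?P = "\<lambda>x. x \<in> carrier H \<and> (\<forall>z\<in>carrier H. hinner K (T z) y = hinner H z x)"
  have tot: "total_in H (carrier H)"
    unfolding total_in_def using H.inner_definite by blast
  have "?P (THE x. ?P x)"
    by (rule theI[of ?P x]) (use x in \<open>auto intro: H.hilbert_eqI_total[OF _ _ tot]\<close>)
  moreover have "adj H K T y = (THE x. ?P x)" using assms(4) by (simp add: adj_def)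
  ultimately show ?thesis by metis
qed

lemma adj_bop [simp]:
  assumes "hilbert_space H" "hilbert_space K" "T \<in> bounded_ops H K"
  shows "adj H K T \<in> bounded_ops K H"
proof -
  interpret H: hilbert_space H by fact
  interpret K: hilbert_space K by fact
  obtain C where C: "C > 0" "\<And>x. x \<in> carrier H \<Longrightarrow> hnorm K (T x) \<le> C * hnorm H x"
    using bop_bound assms by blast
  note s = adj_spec[OF assms]
  have tot: "total_in H (carrier H)"
    unfolding total_in_def using H.inner_definite by blast
  note [simp] = bop_in[OF assms(3)] s[THEN conjunct1]
  note s2 = s[THEN conjunct2, rule_format, symmetric]
  show ?thesis
  proof (rule bopI)
    fix y assume y: "y \<in> carrier K"
    let ?x = "adj H K T y"
    have "hnorm H ?x * hnorm H ?x = cmod (hinner H ?x ?x)"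
      using y by (simp add: H.inner_self norm_mult power2_eq_square)
    also have "\<dots> = cmod (hinner K (T ?x) y)" using y by (subst s2) auto
    also have "\<dots> \<le> hnorm K (T ?x) * hnorm K y" using y by (intro K.cauchy_schwarz) auto
    also have "\<dots> \<le> C * hnorm H ?x * hnorm K y" using C(2) y by (intro mult_right_mono) auto
    finally have "hnorm H ?x * hnorm H ?x \<le> (C * hnorm K y) * hnorm H ?x" by (simp add: algebra_simps)
    then show "hnorm H ?x \<le> C * hnorm K y"
      using bounded_below_cancel[of 1 "hnorm H ?x" "C * hnorm K y"] y C(1) by (simp add: power2_eq_square)
  next
    fix y z assume y: "y \<in> carrier K" "z \<in> carrier K"
    show "adj H K T (y \<oplus>\<^bsub>K\<^esub> z) = adj H K T y \<oplus>\<^bsub>H\<^esub> adj H K T z"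
      by (rule H.hilbert_eqI_total[OF _ _ tot])
         (use y in \<open>simp_all add: s2 H.inner_add_right K.inner_add_right\<close>)
  next
    fix y c assume y: "y \<in> carrier K"
    show "adj H K T (c \<odot>\<^bsub>K\<^esub> y) = c \<odot>\<^bsub>H\<^esub> adj H K T y"
      by (rule H.hilbert_eqI_total[OF _ _ tot])
         (use y in \<open>simp_all add: s2 H.inner_smult_right K.inner_smult_right\<close>)
  next
    show "adj H K T \<in> extensional (carrier K)" by (simp add: adj_def)
  qed simp
qed

lemma adj_ip:
  assumes "hilbert_space H" "hilbert_space K" "T \<in> bounded_ops H K" "x \<in> carrier H" "y \<in> carrier K"
  shows "hinner K (T x) y = hinner H x (adj H K T y)"
  using adj_spec[OF assms(1,2,3,5)] assms(4) by blast

lemma adj_ip2: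
  assumes "hilbert_space H" "hilbert_space K" "T \<in> bounded_ops H K" "x \<in> carrier H" "y \<in> carrier K"
  shows "hinner H (adj H K T y) x = hinner K y (T x)"
  using adj_ip[OF assms] hilbert_space.inner_commute[OF assms(1)] hilbert_space.inner_commute[OF assms(2)]
    bop_in[OF adj_bop[OF assms(1-3)] assms(5)] bop_in[OF assms(3,4)] assms(4,5) by metis

lemma adj_eqI:
  assumes "hilbert_space H" "hilbert_space K" "T \<in> bounded_ops H K" "S \<in> bounded_ops K H"
    and "\<And>x y. \<lbrakk>x \<in> carrier H; y \<in> carrier K\<rbrakk> \<Longrightarrow> hinner K (T x) y = hinner H x (S y)"
  shows "adj H K T = S"
proof (rule bop_eqI[OF adj_bop[OF assms(1-3)] assms(4)])
  interpret H: hilbert_space H by fact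
  have tot: "total_in H (carrier H)"
    unfolding total_in_def using H.inner_definite by blast
  fix y assume y: "y \<in> carrier K"
  show "adj H K T y = S y"
    by (rule H.hilbert_eqI_total[OF _ _ tot])
      (use y assms bop_in[OF assms(4)] in \<open>auto simp: bop_in[OF adj_bop[OF assms(1-3)]] adj_ip[symmetric]\<close>)
qed

lemma adj_adj:
  assumes "hilbert_space H" "hilbert_space K" "T \<in> bounded_ops H K"
  shows "adj K H (adj H K T) = T"
  by (rule adj_eqI) (use assms in \<open>auto simp: adj_ip2\<close>)

lemma adj_compose:
  assumes "hilbert_space H" "hilbert_space K" "hilbert_space L"
    "T \<in> bounded_ops H K" "S \<in> bounded_ops K L"
  shows "adj H L (compose (carrier H) S T) = compose (carrier L) (adj H K T) (adj K L S)"
proof (rule adj_eqI[OF assms(1,3)])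
  have A: "adj H K T \<in> bounded_ops K H" "adj K L S \<in> bounded_ops L K" using assms by auto
  show "compose (carrier H) S T \<in> bounded_ops H L" by (rule bop_compose[OF assms(1,2,4,5)])
  show "compose (carrier L) (adj H K T) (adj K L S) \<in> bounded_ops L H"
    by (rule bop_compose[OF assms(3,2) A(2,1)])
  fix x y assume xy: "x \<in> carrier H" "y \<in> carrier L"
  show "hinner L (compose (carrier H) S T x) y
      = hinner H x (compose (carrier L) (adj H K T) (adj K L S) y)"
    using xy adj_ip[OF assms(2,3,5) bop_in[OF assms(4) xy(1)] xy(2)]
      adj_ip[OF assms(1,2,4) xy(1) bop_in[OF A(2) xy(2)]] by simp
qed

lemma adj_ident [simp]: "hilbert_space H \<Longrightarrow> adj H H (ident H) = ident H"
  by (rule adj_eqI) auto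

text \<open>Passing to adjoints turns agreement on \<open>D\<close> into equality of inner products
  against \<open>D\<close>, so boundedness enters through the existence of adjoints. This is how
  nearly every operator identity below is proved.\<close>

lemma bop_eqI_total:
  assumes "hilbert_space H" "hilbert_space K" "S \<in> bounded_ops H K" "T \<in> bounded_ops H K"
    "total_in H D" "\<And>x. x \<in> D \<Longrightarrow> S x = T x"
  shows "S = T"
proof -
  interpret H: hilbert_space H by fact
  interpret K: hilbert_space K by fact
  have D: "x \<in> carrier H" if "x \<in> D" for x using assms(5) that by (auto simp: total_in_def)
  have "adj H K S = adj H K T"
  proof (rule bop_eqI)
    show "adj H K S \<in> bounded_ops K H" "adj H K T \<in> bounded_ops K H" using assms by auto
    fix y assume y: "y \<in> carrier K"
    show "adj H K S y = adj H K T y"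
      by (rule H.hilbert_eqI_total[OF _ _ assms(5)])
        (use y D assms in \<open>auto simp: bop_in[OF adj_bop] adj_ip[symmetric]\<close>)
  qed
  then show ?thesis using adj_adj assms by metis
qed

text \<open>The extension is the adjoint of \<open>W\<close>, where \<open>W y\<close> represents
  the bounded functional \<open>x -> <f x, y>\<close> on \<open>D\<close>; totality of
  \<open>D\<close> makes \<open>W\<close> linear.\<close>

lemma extend_bounded:
  assumes "hilbert_space H" "hilbert_space K" "lin_subspace H D" "total_in H D"
    and f: "\<And>x. x \<in> D \<Longrightarrow> f x \<in> carrier K"
    and add: "\<And>x y. \<lbrakk>x \<in> D; y \<in> D\<rbrakk> \<Longrightarrow> f (x \<oplus>\<^bsub>H\<^esub> y) = f x \<oplus>\<^bsub>K\<^esub> f y"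
    and smult: "\<And>c x. x \<in> D \<Longrightarrow> f (c \<odot>\<^bsub>H\<^esub> x) = c \<odot>\<^bsub>K\<^esub> f x"
    and bound: "\<And>x. x \<in> D \<Longrightarrow> hnorm K (f x) \<le> C * hnorm H x"
  obtains T where "T \<in> bounded_ops H K" "\<And>x. x \<in> D \<Longrightarrow> T x = f x"
proof -
  interpret H: hilbert_space H by fact
  interpret K: hilbert_space K by fact
  have D: "x \<in> carrier H" if "x \<in> D" for x using assms(4) that by (auto simp: total_in_def)
  have "\<exists>w\<in>carrier H. (\<forall>x\<in>D. hinner K (f x) y = hinner H x w) \<and> hnorm H w \<le> \<bar>C * hnorm K y\<bar>"
    if y: "y \<in> carrier K" for y
  proof -
    have "cmod (hinner K (f x) y) \<le> C * hnorm K y * hnorm H x" if x: "x \<in> D" for x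
    proof -
      have "cmod (hinner K (f x) y) \<le> hnorm K (f x) * hnorm K y"
        using x y f by (intro K.cauchy_schwarz) auto
      also have "\<dots> \<le> C * hnorm H x * hnorm K y" using bound[OF x] y by (intro mult_right_mono) auto
      finally show ?thesis by (simp add: algebra_simps)
    qed
    then show ?thesis
      by (rule_tac H.riesz[OF assms(3), of "\<lambda>x. hinner K (f x) y" "C * hnorm K y"])
        (use y f in \<open>auto simp: add smult K.inner_simps\<close>)
  qed
  then obtain w where w: "\<And>y. y \<in> carrier K \<Longrightarrow> w y \<in> carrier H"
    "\<And>x y. \<lbrakk>x \<in> D; y \<in> carrier K\<rbrakk> \<Longrightarrow> hinner H x (w y) = hinner K (f x) y"
    "\<And>y. y \<in> carrier K \<Longrightarrow> hnorm H (w y) \<le> \<bar>C * hnorm K y\<bar>" by metis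
  define W where "W = restrict w (carrier K)"
  have W: "W \<in> bounded_ops K H"
  proof (rule bopI)
    fix y assume y: "y \<in> carrier K"
    show "hnorm H (W y) \<le> \<bar>C\<bar> * hnorm K y" using w(3)[OF y] y by (simp add: W_def abs_mult)
  next
    fix y z assume y: "y \<in> carrier K" "z \<in> carrier K"
    show "W (y \<oplus>\<^bsub>K\<^esub> z) = W y \<oplus>\<^bsub>H\<^esub> W z"
      by (rule H.hilbert_eqI_total[OF _ _ assms(4)])
         (use y D f w in \<open>simp_all add: W_def H.inner_add_right K.inner_add_right\<close>)
  next
    fix y c assume y: "y \<in> carrier K"
    show "W (c \<odot>\<^bsub>K\<^esub> y) = c \<odot>\<^bsub>H\<^esub> W y"
      by (rule H.hilbert_eqI_total[OF _ _ assms(4)])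
         (use y D f w in \<open>simp_all add: W_def H.inner_smult_right K.inner_smult_right\<close>)
  qed (auto simp: W_def w)
  have "adj K H W x = f x" if x: "x \<in> D" for x
  proof (rule K.hilbert_eqI)
    fix y assume y: "y \<in> carrier K"
    show "hinner K (adj K H W x) y = hinner K (f x) y"
      using adj_ip2[OF assms(2,1) W y D[OF x]] w(2)[OF x y] y by (simp add: W_def)
  qed (use x D f bop_in[OF adj_bop[OF assms(2,1) W]] in auto)
  then show ?thesis using that adj_bop[OF assms(2,1) W] by blast
qed

text \<open>Coercivity bounds both \<open>T\<close> and its adjoint from below. Injectivity of
  \<open>T\<close> is immediate, and \<open>T s = y\<close> is solved by representing a functional
  on the range of the adjoint.\<close>

lemma lax_milgram:
  assumes "hilbert_space H" and T: "T \<in> bounded_ops H H" and "c > 0"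
    and pos: "\<And>x. x \<in> carrier H \<Longrightarrow> c * (hnorm H x)\<^sup>2 \<le> Re (hinner H (T x) x)"
  obtains S where "S \<in> bounded_ops H H" "\<And>x. x \<in> carrier H \<Longrightarrow> T (S x) = x"
    "\<And>x. x \<in> carrier H \<Longrightarrow> S (T x) = x"
proof -
  interpret H: hilbert_space H by fact
  let ?A = "adj H H T"
  have A: "?A \<in> bounded_ops H H" using assms by auto
  note [simp] = bop_in[OF T] bop_in[OF A]
  have low: "hnorm H x \<le> hnorm H (T x) / c" if x: "x \<in> carrier H" for x
  proof (rule bounded_below_cancel)
    have "c * (hnorm H x)\<^sup>2 \<le> cmod (hinner H (T x) x)" using pos[OF x] complex_Re_le_cmod order_trans by blast
    also have "\<dots> \<le> hnorm H (T x) * hnorm H x" using x by (intro H.cauchy_schwarz) auto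
    finally show "c * (hnorm H x)\<^sup>2 \<le> hnorm H (T x) * hnorm H x" .
  qed (use x assms in auto)
  have low': "hnorm H x \<le> hnorm H (?A x) / c" if x: "x \<in> carrier H" for x
  proof (rule bounded_below_cancel)
    have "c * (hnorm H x)\<^sup>2 \<le> cmod (hinner H (T x) x)" using pos[OF x] complex_Re_le_cmod order_trans by blast
    also have "hinner H (T x) x = hinner H x (?A x)" using adj_ip[OF assms(1,1) T x x] .
    also have "cmod \<dots> \<le> hnorm H x * hnorm H (?A x)" using x by (intro H.cauchy_schwarz) auto
    finally show "c * (hnorm H x)\<^sup>2 \<le> hnorm H (?A x) * hnorm H x" by (simp add: mult.commute)
  qed (use x assms in auto)
  define D where "D = ?A ` carrier H"
  have A_inj: "x = y" if "x \<in> carrier H" "y \<in> carrier H" "?A x = ?A y" for x y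
  proof -
    have "?A (x \<oplus>\<^bsub>H\<^esub> (-1) \<odot>\<^bsub>H\<^esub> y) = ?A x \<oplus>\<^bsub>H\<^esub> (-1) \<odot>\<^bsub>H\<^esub> ?A y"
      using that by (simp add: bop_add[OF A] bop_smult[OF A])
    also have "\<dots> = \<zero>\<^bsub>H\<^esub>" by (rule H.hilbert_eqI) (use that in \<open>simp_all add: H.inner_simps\<close>)
    finally have "hnorm H (x \<oplus>\<^bsub>H\<^esub> (-1) \<odot>\<^bsub>H\<^esub> y) \<le> 0"
      using low'[of "x \<oplus>\<^bsub>H\<^esub> (-1) \<odot>\<^bsub>H\<^esub> y"] that by simp
    then have "hnorm H (x \<oplus>\<^bsub>H\<^esub> (-1) \<odot>\<^bsub>H\<^esub> y) = 0" using that by (intro antisym) auto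
    then have z: "x \<oplus>\<^bsub>H\<^esub> (-1) \<odot>\<^bsub>H\<^esub> y = \<zero>\<^bsub>H\<^esub>" using that by (subst H.hnorm_eq_0[symmetric]) auto
    show ?thesis
    proof (rule H.hilbert_eqI[OF that(1,2)])
      fix z assume "z \<in> carrier H"
      then show "hinner H x z = hinner H y z"
        using arg_cong[OF z, of "\<lambda>u. hinner H u z"] that by (simp add: H.inner_simps)
    qed
  qed
  have Dsub: "lin_subspace H D"
    unfolding lin_subspace_def D_def
  proof (intro conjI ballI allI)
    show "\<zero>\<^bsub>H\<^esub> \<in> ?A ` carrier H" using bop_zero[OF assms(1,1) A] by (metis H.zero_closed image_eqI)
  qed (auto simp: bop_add[OF A, symmetric] bop_smult[OF A, symmetric])
  have ex: "\<exists>s\<in>carrier H. T s = y" if y: "y \<in> carrier H" for y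
  proof -
    \<comment> \<open>Well defined because the adjoint is injective, and bounded because it is
      bounded below. A vector \<open>s\<close> representing \<open>f\<close> satisfies
      \<open><x, y> = <adj T x, s> = <x, T s>\<close>.\<close>
    define f where "f d = hinner H (inv_into (carrier H) ?A d) y" for d
    have inv: "inv_into (carrier H) ?A (?A x) = x" if "x \<in> carrier H" for x
      using that A_inj by (intro inv_into_f_f) (auto simp: inj_on_def)
    have fA: "f (?A x) = hinner H x y" if "x \<in> carrier H" for x using that by (simp add: f_def inv)
    obtain s where s: "s \<in> carrier H" "\<And>d. d \<in> D \<Longrightarrow> f d = hinner H d s"
    proof (rule H.riesz[OF Dsub, of f "hnorm H y / c"])
      fix d e assume "d \<in> D" "e \<in> D"
      then obtain x x' where "x \<in> carrier H" "d = ?A x" "x' \<in> carrier H" "e = ?A x'" by (auto simp: D_def)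
      then show "f (d \<oplus>\<^bsub>H\<^esub> e) = f d + f e"
        using y by (simp add: bop_add[OF A, symmetric] fA H.inner_simps)
    next
      fix d k assume "d \<in> D"
      then obtain x where "x \<in> carrier H" "d = ?A x" by (auto simp: D_def)
      then show "f (k \<odot>\<^bsub>H\<^esub> d) = k * f d"
        using y by (simp add: bop_smult[OF A, symmetric] fA H.inner_simps)
    next
      fix d assume "d \<in> D"
      then obtain x where x: "x \<in> carrier H" "d = ?A x" by (auto simp: D_def)
      have "cmod (f d) \<le> hnorm H x * hnorm H y" using x y fA H.cauchy_schwarz by simp
      also have "\<dots> \<le> hnorm H d / c * hnorm H y" using x y low' by (intro mult_right_mono) auto
      finally show "cmod (f d) \<le> hnorm H y / c * hnorm H d" by (simp add: algebra_simps)
    qed auto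
    have "T s = y"
    proof (rule H.hilbert_eqI)
      fix x assume x: "x \<in> carrier H"
      have "hinner H x y = hinner H (?A x) s" using s(2)[of "?A x"] x by (simp add: fA D_def)
      also have "\<dots> = hinner H x (T s)" using adj_ip2[OF assms(1,1) T s(1) x] by simp
      finally show "hinner H (T s) x = hinner H y x"
        using H.inner_commute x y s(1) by (metis bop_in[OF T])
    qed (use s y in auto)
    then show ?thesis using s by blast
  qed
  then obtain s where s: "\<And>y. y \<in> carrier H \<Longrightarrow> s y \<in> carrier H" "\<And>y. y \<in> carrier H \<Longrightarrow> T (s y) = y" by metis
  have T_inj: "x = y" if "x \<in> carrier H" "y \<in> carrier H" "T x = T y" for x y
  proof -
    have "T (x \<oplus>\<^bsub>H\<^esub> (-1) \<odot>\<^bsub>H\<^esub> y) = T x \<oplus>\<^bsub>H\<^esub> (-1) \<odot>\<^bsub>H\<^esub> T y"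
      using that by (simp add: bop_add[OF T] bop_smult[OF T])
    also have "\<dots> = \<zero>\<^bsub>H\<^esub>" by (rule H.hilbert_eqI) (use that in \<open>simp_all add: H.inner_simps\<close>)
    finally have "hnorm H (x \<oplus>\<^bsub>H\<^esub> (-1) \<odot>\<^bsub>H\<^esub> y) \<le> 0"
      using low[of "x \<oplus>\<^bsub>H\<^esub> (-1) \<odot>\<^bsub>H\<^esub> y"] that by simp
    then have "hnorm H (x \<oplus>\<^bsub>H\<^esub> (-1) \<odot>\<^bsub>H\<^esub> y) = 0" using that by (intro antisym) auto
    then have z: "x \<oplus>\<^bsub>H\<^esub> (-1) \<odot>\<^bsub>H\<^esub> y = \<zero>\<^bsub>H\<^esub>" using that by (subst H.hnorm_eq_0[symmetric]) auto
    show ?thesis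
    proof (rule H.hilbert_eqI[OF that(1,2)])
      fix z assume "z \<in> carrier H"
      then show "hinner H x z = hinner H y z"
        using arg_cong[OF z, of "\<lambda>u. hinner H u z"] that by (simp add: H.inner_simps)
    qed
  qed
  define S where "S = restrict s (carrier H)"
  have "S \<in> bounded_ops H H"
  proof (rule bopI)
    fix x assume "x \<in> carrier H"
    then show "hnorm H (S x) \<le> (1/c) * hnorm H x" using low[OF s(1), of x] by (simp add: S_def s(2))
  next
    fix x y assume "x \<in> carrier H" "y \<in> carrier H"
    then show "S (x \<oplus>\<^bsub>H\<^esub> y) = S x \<oplus>\<^bsub>H\<^esub> S y" by (rule_tac T_inj) (auto simp: S_def s bop_add[OF T])
  next
    fix x k assume "x \<in> carrier H"
    then show "S (k \<odot>\<^bsub>H\<^esub> x) = k \<odot>\<^bsub>H\<^esub> S x" by (rule_tac T_inj) (auto simp: S_def s bop_smult[OF T])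
  qed (auto simp: S_def s)
  moreover have "S (T x) = x" if "x \<in> carrier H" for x using that by (rule_tac T_inj) (auto simp: S_def s)
  moreover have "T (S x) = x" if "x \<in> carrier H" for x using that by (simp add: S_def s)
  ultimately show ?thesis using that by blast
qed

lemma unitary_opsD:
  assumes "hilbert_space H" "hilbert_space K" "T \<in> unitary_ops H K"
  shows "T \<in> bounded_ops H K" "\<And>x. x \<in> carrier H \<Longrightarrow> adj H K T (T x) = x"
    "\<And>y. y \<in> carrier K \<Longrightarrow> T (adj H K T y) = y"
    "\<And>x y. \<lbrakk>x \<in> carrier H; y \<in> carrier H\<rbrakk> \<Longrightarrow> hinner K (T x) (T y) = hinner H x y"
    "\<And>x. x \<in> carrier H \<Longrightarrow> hnorm K (T x) = hnorm H x"
proof -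
  show T: "T \<in> bounded_ops H K" using assms by (simp add: unitary_ops_def)
  show 1: "adj H K T (T x) = x" if "x \<in> carrier H" for x
  proof -
    have "compose (carrier H) (adj H K T) T x = ident H x" using assms by (simp add: unitary_ops_def)
    then show ?thesis using that by simp
  qed
  show "T (adj H K T y) = y" if "y \<in> carrier K" for y
  proof -
    have "compose (carrier K) T (adj H K T) y = ident K y" using assms by (simp add: unitary_ops_def)
    then show ?thesis using that by simp
  qed
  show i: "hinner K (T x) (T y) = hinner H x y" if "x \<in> carrier H" "y \<in> carrier H" for x y
    using adj_ip[OF assms(1,2) T that(1) bop_in[OF T that(2)]] 1[OF that(2)] by simp
  show "hnorm K (T x) = hnorm H x" if "x \<in> carrier H" for x
    using i[OF that that] by (simp add: hnorm_def)
qed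

section \<open>Arcs of the circle\<close>

definition arc_of :: "real \<Rightarrow> real \<Rightarrow> complex set" where
  "arc_of a b = cis ` {a<..<b}"

text \<open>The branch of the argument that is cut opposite to the midpoint of the arc. It depends
  on \<open>a\<close> and \<open>b\<close> only through their midpoint, so one branch serves all
  concentric arcs.\<close>

definition ang :: "real \<Rightarrow> real \<Rightarrow> complex \<Rightarrow> real" where
  "ang a b z = (a + b) / 2 + Arg (z / cis ((a + b) / 2))"

lemma cis_eqD: "cis t = cis u \<Longrightarrow> \<exists>n::int. t = u + 2 * pi * real_of_int n"
  using sin_cos_eq_iff[of t u] by (simp add: complex_eq_iff)

lemma continuous_on_cis': "continuous_on A cis"
  by (intro continuous_intros)

lemma cis_inj:
  assumes "cis t = cis u" "\<bar>t - u\<bar> < 2 * pi" shows "t = u"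
proof -
  obtain n :: int where n: "t = u + 2 * pi * n"
    using cis_eqD[OF assms(1)] by blast
  then have "\<bar>real_of_int n\<bar> * (2 * pi) < 1 * (2 * pi)" using assms(2) by (simp add: abs_mult)
  then have "n = 0" by (simp add: mult_less_cancel_right)
  then show ?thesis using n by simp
qed

lemma cis_shift: "cis (t + 2 * pi * real_of_int n) = cis t"
  by (simp add: cis_mult[symmetric])

lemma cis_div': "cis t / cis u = cis (t - u)"
  by (simp add: cis_divide)

lemma ang_cis: "\<lbrakk>a < t; t < b; b \<le> a + 2 * pi\<rbrakk> \<Longrightarrow> ang a b (cis t) = t"
  by (simp add: ang_def cis_div' Arg_cis field_simps)

lemma cis_ang: "cmod z = 1 \<Longrightarrow> cis (ang a b z) = z"
proof -
  assume z: "cmod z = 1"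
  let ?c = "cis ((a + b) / 2)"
  have "z / ?c \<noteq> 0" using z by auto
  then have "cis (Arg (z / ?c)) = z / ?c" using z by (simp add: cis_Arg sgn_div_norm norm_divide)
  then show ?thesis by (simp add: ang_def cis_mult[symmetric])
qed

lemma circle_cut:
  assumes "z \<in> circle" shows "z = cis s \<or> z \<in> arc_of s (s + 2 * pi)"
proof -
  let ?t = "ang s (s + 2 * pi) z"
  have z: "cis ?t = z" using assms by (simp add: cis_ang)
  have "s < ?t \<and> ?t \<le> s + 2 * pi"
    using Arg_bounded[of "z / cis ((s + (s + 2 * pi)) / 2)"] by (simp add: ang_def field_simps)
  then show ?thesis
  proof (cases "?t = s + 2 * pi")
    case True
    then show ?thesis using z cis_shift[of s 1] by simp
  next
    case False
    then have "?t \<in> {s<..<s + 2 * pi}" using \<open>s < ?t \<and> _\<close> by auto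
    then show ?thesis unfolding arc_of_def using z by (metis image_eqI)
  qed
qed

lemma cut_notin: "cis s \<notin> arc_of s (s + 2 * pi)"
  using cis_inj[of s] by (force simp: arc_of_def)

lemma arc_of_circle: "arc_of a b \<subseteq> circle"
  by (auto simp: arc_of_def)

lemma cut_eq: "arc_of s (s + 2 * pi) = circle - {cis s}"
  using circle_cut cut_notin arc_of_circle by blast

lemma continuous_on_ang:
  assumes "b \<le> a + 2 * pi"
  shows "continuous_on (arc_of a b) (ang a b)"
  unfolding ang_def
proof (intro continuous_intros)
  show "\<And>z. z \<in> arc_of a b \<Longrightarrow> z / cis ((a + b) / 2) \<notin> \<real>\<^sub>\<le>\<^sub>0"
  proof
    fix z assume "z \<in> arc_of a b" and n: "z / cis ((a + b) / 2) \<in> \<real>\<^sub>\<le>\<^sub>0"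
    then obtain t where t: "a < t" "t < b" "z = cis t" by (auto simp: arc_of_def)
    let ?s = "t - (a + b) / 2"
    have s: "- pi < ?s" "?s < pi" using t assms by (simp_all add: field_simps)
    have "cis ?s \<in> \<real>\<^sub>\<le>\<^sub>0" using n t by (simp add: cis_div')
    then have "cis ?s = - 1"
    proof (elim nonpos_Reals_cases)
      fix x :: real assume x: "cis ?s = of_real x" "x \<le> 0"
      then have "cmod (of_real x) = 1" by (metis norm_cis)
      then show ?thesis using x by simp
    qed
    then have "Arg (cis ?s) = pi" using Arg_cis[of pi] by simp
    then show False using s by (simp add: Arg_cis)
  qed
qed auto

text \<open>The concentric full cut circle is open, being the circle without a point, and carries
  the same branch of the angle; the arc is the preimage of an open interval under it.\<close>

lemma arc_of_open:
  assumes "b \<le> a + 2 * pi"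
  shows "openin (top_of_set circle) (arc_of a b)"
proof -
  let ?c = "(a + b) / 2"
  let ?U = "arc_of (?c - pi) (?c + pi)"
  have U: "?U = circle - {cis (?c - pi)}" using cut_eq[of "?c - pi"] by (simp add: add.commute)
  have oU: "openin (top_of_set circle) ?U"
    unfolding U by (intro openin_delete) simp
  have e: "(?c - pi + (?c + pi)) / 2 = ?c" by simp
  have ang: "ang (?c - pi) (?c + pi) z = ang a b z" for z unfolding ang_def e ..
  have "continuous_on ?U (ang a b)"
    using continuous_on_ang[of "?c + pi" "?c - pi"] by (simp add: ang[abs_def])
  then have "openin (top_of_set ?U) (?U \<inter> ang a b -` {a<..<b})"
    by (rule continuous_openin_preimage[where T = UNIV]) auto
  moreover have "?U \<inter> ang a b -` {a<..<b} = arc_of a b"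
  proof
    show "?U \<inter> ang a b -` {a<..<b} \<subseteq> arc_of a b"
    proof
      fix z assume z: "z \<in> ?U \<inter> ang a b -` {a<..<b}"
      then have "z = cis (ang a b z)" using arc_of_circle by (force simp: cis_ang)
      then show "z \<in> arc_of a b" using z unfolding arc_of_def by blast
    qed
    show "arc_of a b \<subseteq> ?U \<inter> ang a b -` {a<..<b}"
    proof
      fix z assume "z \<in> arc_of a b"
      then obtain t where t: "a < t" "t < b" "z = cis t" by (auto simp: arc_of_def)
      then have "t \<in> {?c - pi<..<?c + pi}" using assms by (auto simp: field_simps)
      then show "z \<in> ?U \<inter> ang a b -` {a<..<b}" using t assms by (auto simp: arc_of_def ang_cis)
    qed
  qed
  ultimately show ?thesis using oU openin_trans by metis
qed

lemma arc_compl_of: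
  assumes "a < b" "b < a + 2 * pi"
  shows "arc_compl (arc_of a b) = arc_of b (a + 2 * pi)"
proof
  have co: "circle - arc_of a b \<subseteq> cis ` {b..a + 2 * pi}"
  proof
    fix z assume z: "z \<in> circle - arc_of a b"
    from circle_cut[of z a] z consider "z = cis a" | "z \<in> arc_of a (a + 2 * pi)" by auto
    then show "z \<in> cis ` {b..a + 2 * pi}"
    proof cases
      case 1
      then have "z = cis (a + 2 * pi)" using cis_shift[of a 1] by simp
      then show ?thesis using assms by auto
    next
      case 2
      then obtain t where "a < t" "t < a + 2 * pi" "z = cis t" by (auto simp: arc_of_def)
      moreover then have "\<not> t < b" using z by (auto simp: arc_of_def)
      ultimately show ?thesis by auto
    qed
  qed
  show "arc_of b (a + 2 * pi) \<subseteq> arc_compl (arc_of a b)"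
    unfolding arc_compl_def
  proof (rule interior_of_maximal)
    show "openin (top_of_set circle) (arc_of b (a + 2 * pi))" using assms by (intro arc_of_open) auto
    show "arc_of b (a + 2 * pi) \<subseteq> circle - arc_of a b"
    proof
      fix z assume "z \<in> arc_of b (a + 2 * pi)"
      then obtain t where t: "b < t" "t < a + 2 * pi" "z = cis t" by (auto simp: arc_of_def)
      moreover have "z \<notin> arc_of a b"
      proof
        assume "z \<in> arc_of a b"
        then obtain u where u: "a < u" "u < b" "z = cis u" by (auto simp: arc_of_def)
        then have "t = u" using t by (intro cis_inj) auto
        then show False using t u by simp
      qed
      ultimately show "z \<in> circle - arc_of a b" by simp
    qed
  qed
  show "arc_compl (arc_of a b) \<subseteq> arc_of b (a + 2 * pi)"
  proof
    fix z assume z: "z \<in> arc_compl (arc_of a b)"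
    then obtain T where T: "openin (top_of_set circle) T" "T \<subseteq> circle - arc_of a b" "z \<in> T"
      unfolding arc_compl_def interior_of_def by auto
    then obtain W where W: "open W" "T = circle \<inter> W" by (auto simp: openin_open)
    have op: "open (cis -` W)" by (rule open_vimage[OF W(1) continuous_on_cis'])
    have "z \<in> cis ` {b..a + 2 * pi}" using T co by blast
    then obtain t where t: "b \<le> t" "t \<le> a + 2 * pi" "z = cis t" by auto
    have near: "\<exists>e>0. \<forall>u. \<bar>u - t'\<bar> < e \<longrightarrow> cis u \<in> W" if "cis t' \<in> W" for t'
      using op that unfolding open_dist dist_real_def by auto
    have "t \<noteq> b"
    proof
      assume "t = b"
      then obtain e where e: "e > 0" "\<And>u. \<bar>u - b\<bar> < e \<Longrightarrow> cis u \<in> W" using near[of b] t T W by auto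
      \<comment> \<open>A point near the endpoint, close enough to stay in \<open>W\<close> and at
        most half the arc away from it, hence inside the arc. So an endpoint cannot be interior to
        the complement.\<close>
      let ?u = "b - min (e/2) ((b - a)/2)"
      have "cis ?u \<in> W" using e assms by (intro e(2)) auto
      moreover have "cis ?u \<in> arc_of a b" unfolding arc_of_def
        using e assms by (intro imageI) (auto simp: min_def field_simps)
      ultimately show False using T W by auto
    qed
    moreover have "t \<noteq> a + 2 * pi"
    proof
      assume "t = a + 2 * pi"
      then have "z = cis a" using cis_shift[of a 1] t by simp
      then obtain e where e: "e > 0" "\<And>u. \<bar>u - a\<bar> < e \<Longrightarrow> cis u \<in> W" using near[of a] T W by auto
      let ?u = "a + min (e/2) ((b - a)/2)"
      have "cis ?u \<in> W" using e assms by (intro e(2)) auto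
      moreover have "cis ?u \<in> arc_of a b" unfolding arc_of_def
        using e assms by (intro imageI) (auto simp: min_def field_simps)
      ultimately show False using T W by auto
    qed
    ultimately show "z \<in> arc_of b (a + 2 * pi)" using t by (auto simp: arc_of_def)
  qed
qed

lemma arc_of_in:
  assumes "a < b" "b < a + 2 * pi" shows "arc_of a b \<in> arcs"
proof -
  have "arc_of a b \<noteq> {}" using assms by (auto simp: arc_of_def)
  moreover have "connected (arc_of a b)"
    unfolding arc_of_def by (intro connected_continuous_image) (auto intro: continuous_intros)
  moreover have "\<not> circle \<subseteq> closure (arc_of a b)"
  proof
    assume c: "circle \<subseteq> closure (arc_of a b)"
    have "closed (cis ` {a..b})"
      by (intro compact_imp_closed compact_continuous_image continuous_intros) auto
    moreover have "arc_of a b \<subseteq> cis ` {a..b}" by (auto simp: arc_of_def)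
    ultimately have "closure (arc_of a b) \<subseteq> cis ` {a..b}" by (rule closure_minimal[rotated])
    \<comment> \<open>The midpoint of the complementary arc witnesses that the closed arc is not the
      whole circle.\<close>
    moreover have "cis ((b + a + 2 * pi) / 2) \<in> circle" by simp
    ultimately have "cis ((b + a + 2 * pi) / 2) \<in> cis ` {a..b}" using c by blast
    then obtain t where "a \<le> t" "t \<le> b" "cis ((b + a + 2 * pi) / 2) = cis t" by auto
    moreover then have "(b + a + 2 * pi) / 2 = t" using assms by (intro cis_inj) (auto simp: field_simps)
    ultimately show False using assms by (simp add: field_simps)
  qed
  ultimately show ?thesis using arc_of_open assms by (simp add: arcs_def)
qed

lemma arc_of_shift: "arc_of (a + 2 * pi * real_of_int n) (b + 2 * pi * real_of_int n) = arc_of a b"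
proof
  show "arc_of a b \<subseteq> arc_of (a + 2 * pi * real_of_int n) (b + 2 * pi * real_of_int n)"
  proof
    fix z assume "z \<in> arc_of a b"
    then obtain t where "t \<in> {a<..<b}" "z = cis (t + 2 * pi * real_of_int n)"
      by (auto simp: arc_of_def cis_shift)
    then show "z \<in> arc_of (a + 2 * pi * real_of_int n) (b + 2 * pi * real_of_int n)"
      unfolding arc_of_def by (intro image_eqI) auto
  qed
  show "arc_of (a + 2 * pi * real_of_int n) (b + 2 * pi * real_of_int n) \<subseteq> arc_of a b"
  proof
    fix z assume "z \<in> arc_of (a + 2 * pi * real_of_int n) (b + 2 * pi * real_of_int n)"
    then obtain t where "a + 2 * pi * real_of_int n < t" "t < b + 2 * pi * real_of_int n" "z = cis t"
      by (auto simp: arc_of_def)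
    then have "t - 2 * pi * real_of_int n \<in> {a<..<b}" "z = cis (t - 2 * pi * real_of_int n)"
      using cis_shift[of "t - 2 * pi * real_of_int n" n] by auto
    then show "z \<in> arc_of a b" unfolding arc_of_def by blast
  qed
qed

lemma open_interval_form:
  fixes A :: "real set"
  assumes "open A" "connected A" "A \<noteq> {}" "bdd_above A" "bdd_below A"
  shows "A = {Inf A<..<Sup A}"
proof
  show "A \<subseteq> {Inf A<..<Sup A}"
  proof
    fix x assume x: "x \<in> A"
    then obtain e where e: "e > 0" "\<And>y. \<bar>y - x\<bar> < e \<Longrightarrow> y \<in> A"
      using assms(1) unfolding open_dist dist_real_def by blast
    have "Inf A \<le> x - e/2" "x + e/2 \<le> Sup A"
      using e assms by (auto intro!: cInf_lower cSup_upper e)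
    then show "x \<in> {Inf A<..<Sup A}" using e by auto
  qed
  show "{Inf A<..<Sup A} \<subseteq> A"
  proof
    fix x assume "x \<in> {Inf A<..<Sup A}"
    then obtain u v where "u \<in> A" "u < x" "v \<in> A" "x < v"
      using assms by (auto simp: cInf_less_iff less_cSup_iff)
    then show "x \<in> A" using assms(2) unfolding connected_iff_interval by (meson less_imp_le)
  qed
qed

text \<open>Cut the circle at a point off the closure of \<open>I\<close>. The angle is then
  continuous on \<open>I\<close> and its image is open, connected and bounded, hence an open
  interval.\<close>

lemma arc_form:
  assumes "I \<in> arcs"
  obtains a b where "a < b" "b < a + 2 * pi" "I = arc_of a b"
proof -
  have I: "I \<noteq> {}" "openin (top_of_set circle) I" "connected I" "\<not> circle \<subseteq> closure I"
    using assms by (auto simp: arcs_def)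
  then obtain q where q: "q \<in> circle" "q \<notin> closure I" by blast
  obtain s where s: "q = cis s" using cis_ang[of q 0 0] q by (metis dist_0_norm mem_sphere)
  have Ic: "I \<subseteq> circle" using I(2) openin_imp_subset by fastforce
  have "cis s \<notin> I" using q s closure_subset by blast
  then have Is: "I \<subseteq> arc_of s (s + 2 * pi)" using Ic by (auto simp: cut_eq)
  let ?g = "ang s (s + 2 * pi)"
  define A where "A = ?g ` I"
  have A: "A = {t \<in> {s<..<s + 2 * pi}. cis t \<in> I}"
  proof
    show "A \<subseteq> {t \<in> {s<..<s + 2 * pi}. cis t \<in> I}"
      using Is by (force simp: A_def arc_of_def ang_cis)
    show "{t \<in> {s<..<s + 2 * pi}. cis t \<in> I} \<subseteq> A"
    proof
      fix t assume "t \<in> {t \<in> {s<..<s + 2 * pi}. cis t \<in> I}"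
      then show "t \<in> A" unfolding A_def by (intro image_eqI[of _ _ "cis t"]) (auto simp: ang_cis)
    qed
  qed
  have IA: "I = cis ` A"
    unfolding A_def using Ic by (force simp: image_image cis_ang image_def)
  have conn: "connected A"
    unfolding A_def by (intro connected_continuous_image I continuous_on_subset[OF continuous_on_ang Is]) auto
  obtain W where W: "open W" "I = circle \<inter> W" using I(2) by (auto simp: openin_open)
  have "open ({s<..<s + 2 * pi} \<inter> cis -` W)"
    by (intro open_Int open_vimage[OF W(1) continuous_on_cis']) auto
  moreover have "A = {s<..<s + 2 * pi} \<inter> cis -` W" unfolding A W by auto
  ultimately have op: "open A" by simp
  have ne: "A \<noteq> {}" using I by (simp add: A_def)
  have bd: "bdd_above A" "bdd_below A" unfolding A
    by (auto intro!: bdd_aboveI[of _ "s + 2 * pi"] bdd_belowI[of _ s])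
  note form = open_interval_form[OF op conn ne bd]
  have "open (cis -` (- closure I))"
    by (intro open_vimage continuous_on_cis') auto
  \<comment> \<open>The cut point has positive angular distance from \<open>I\<close>; this gives
    the strict bound \<open>b < a + 2 * pi\<close>, that is, a non-dense arc.\<close>
  then obtain d where d: "d > 0" "\<And>t. \<bar>t - s\<bar> < d \<Longrightarrow> cis t \<notin> closure I"
    using q s unfolding open_dist dist_real_def by auto
  have low: "s + d \<le> t" if "t \<in> A" for t
  proof (rule ccontr)
    assume "\<not> ?thesis"
    then have "cis t \<notin> closure I" using that A by (intro d(2)) auto
    then show False using that A closure_subset by blast
  qed
  have "s + d \<le> Inf A" by (rule cInf_greatest[OF ne low])
  moreover have "Sup A \<le> s + 2 * pi" by (rule cSup_least[OF ne]) (auto simp: A)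
  moreover have "Inf A < Sup A" using ne form by auto
  ultimately show ?thesis using that[of "Inf A" "Sup A"] IA form d(1) by (simp add: arc_of_def)
qed

lemma arc_compl_in: "I \<in> arcs \<Longrightarrow> arc_compl I \<in> arcs"
  by (erule arc_form) (simp add: arc_compl_of arc_of_in)

lemma arc_compl_compl: "I \<in> arcs \<Longrightarrow> arc_compl (arc_compl I) = I"
proof (erule arc_form)
  fix a b assume *: "a < b" "b < a + 2 * pi" "I = arc_of a b"
  then show "arc_compl (arc_compl I) = I"
    using arc_of_shift[of a 1 b] by (simp add: arc_compl_of)
qed

lemma arc_compl_mono: "I \<subseteq> J \<Longrightarrow> arc_compl J \<subseteq> arc_compl I"
  unfolding arc_compl_def by (intro interior_of_mono) auto

lemma arc_compl_disjoint: "I \<inter> arc_compl I = {}"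
  unfolding arc_compl_def using interior_of_subset by fastforce

text \<open>The arg-valued interval whose angles fill exactly \<open>{a<..<b}\<close>. Shifting both
  ends by a multiple of \<open>2 * pi\<close> keeps the arc and changes the winding.\<close>

definition AI :: "real \<Rightarrow> real \<Rightarrow> arg_arc" where
  "AI a b = (arc_of a b, restrict (ang a b) (arc_of a b))"

lemma fst_AI [simp]: "fst (AI a b) = arc_of a b"
  by (simp add: AI_def)

lemma snd_AI: "\<lbrakk>a < t; t < b; b \<le> a + 2 * pi\<rbrakk> \<Longrightarrow> snd (AI a b) (cis t) = t"
  by (auto simp: AI_def ang_cis arc_of_def)

lemma AI_in: "\<lbrakk>a < b; b < a + 2 * pi\<rbrakk> \<Longrightarrow> AI a b \<in> arg_arcs"
  using continuous_on_ang[of b a] arc_of_circle[of a b]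
  by (force simp: AI_def arg_arcs_def arc_of_in cis_ang cong: continuous_on_cong)

lemma AI_sub: "\<lbrakk>a \<le> c; c < d; d \<le> b; b < a + 2 * pi\<rbrakk> \<Longrightarrow> arg_sub (AI c d) (AI a b)"
  by (auto simp: arg_sub_def arc_of_def snd_AI)

text \<open>The given argument function differs from the standard angle by a continuous function
  with values in the discrete set of multiples of \<open>2 * pi\<close>, hence by a constant, which
  is absorbed into \<open>a\<close> and \<open>b\<close>.\<close>

lemma arg_arc_form:
  assumes "I \<in> arg_arcs"
  obtains a b where "a < b" "b < a + 2 * pi" "I = AI a b"
proof -
  obtain S \<theta> where I: "I = (S, \<theta>)" by fastforce
  then have S: "S \<in> arcs" "\<theta> \<in> extensional S" "continuous_on S \<theta>" "\<And>z. z \<in> S \<Longrightarrow> z = cis (\<theta> z)"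
    using assms by (auto simp: arg_arcs_def)
  obtain a b where ab: "a < b" "b < a + 2 * pi" "S = arc_of a b" using arc_form[OF S(1)] by blast
  define g where "g t = \<theta> (cis t) - t" for t
  have gz: "\<exists>n::int. g t = 2 * pi * n" if "a < t" "t < b" for t
  proof -
    have "cis t \<in> S" using that ab by (auto simp: arc_of_def)
    then have "cis (\<theta> (cis t)) = cis t" using S(4) by metis
    then obtain n :: int where "\<theta> (cis t) = t + 2 * pi * n"
      using cis_eqD by blast
    then show ?thesis by (auto simp: g_def)
  qed
  have "g constant_on {a<..<b}"
  proof (rule continuous_discrete_range_constant)
    have "continuous_on {a<..<b} (\<lambda>t. \<theta> (cis t))"
      by (rule continuous_on_compose2[OF S(3)]) (auto intro: continuous_intros simp: ab arc_of_def)
    then show "continuous_on {a<..<b} g" unfolding g_def by (intro continuous_intros)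
    fix t assume t: "t \<in> {a<..<b}"
    show "\<exists>e>0. \<forall>y. y \<in> {a<..<b} \<and> g y \<noteq> g t \<longrightarrow> e \<le> norm (g y - g t)"
    proof (intro exI[of _ "2 * pi"] conjI allI impI)
      fix y assume y: "y \<in> {a<..<b} \<and> g y \<noteq> g t"
      obtain m n :: int where mn: "g y = 2 * pi * m" "g t = 2 * pi * n" using gz y t by (metis greaterThanLessThan_iff)
      then have "m \<noteq> n" using y by auto
      then have "1 \<le> \<bar>real_of_int (m - n)\<bar>" by linarith
      then have "2 * pi * 1 \<le> 2 * pi * \<bar>real_of_int (m - n)\<bar>" by (intro mult_left_mono) auto
      also have "\<dots> = norm (g y - g t)" by (simp add: mn abs_mult right_diff_distrib[symmetric])
      finally show "2 * pi \<le> norm (g y - g t)" by simp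
    qed simp
  qed auto
  then obtain c where c: "\<And>t. \<lbrakk>a < t; t < b\<rbrakk> \<Longrightarrow> g t = c" by (auto simp: constant_on_def)
  obtain n :: int where n: "c = 2 * pi * n"
    using gz[of "(a+b)/2"] c[of "(a+b)/2"] ab by auto
  let ?p = "2 * pi * real_of_int n"
  have "I = AI (a + ?p) (b + ?p)"
  proof -
    have "\<theta> z = restrict (ang (a + ?p) (b + ?p)) S z" for z
    proof (cases "z \<in> S")
      case True
      then obtain t where t: "a < t" "t < b" "z = cis t" using ab by (auto simp: arc_of_def)
      have "\<theta> z = t + ?p" using c[OF t(1,2)] t(3) n by (simp add: g_def)
      moreover have "ang (a + ?p) (b + ?p) z = t + ?p"
        using ang_cis[of "a + ?p" "t + ?p" "b + ?p"] t ab cis_shift[of t n] by simp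
      ultimately show ?thesis using True by simp
    next
      case False
      then show ?thesis using S(2) by (simp add: extensional_def)
    qed
    then show ?thesis by (simp add: I AI_def arc_of_shift ab(3) fun_eq_iff)
  qed
  then show ?thesis using that[of "a + ?p" "b + ?p"] ab by simp
qed

text \<open>The angles \<open>(b - 2 * pi, a)\<close> lie directly below \<open>(a, b)\<close> and
  fill the rest of one turn: this is the clockwise complement of \<open>I\<close>.\<close>

lemma arg_compl_exists:
  assumes "I \<in> arg_arcs"
  obtains J where "J \<in> arg_arcs" "clockwise_to J I" "fst J = arc_compl (fst I)" "arc_compl (fst J) = fst I"
proof -
  obtain a b where ab: "a < b" "b < a + 2 * pi" "I = AI a b" using arg_arc_form[OF assms] by blast
  let ?J = "AI (b - 2 * pi) a"
  have "?J \<in> arg_arcs" by (rule AI_in) (use ab in auto)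
  moreover have "clockwise_to ?J I"
    unfolding clockwise_to_def ab(3) fst_AI
  proof (intro ballI)
    fix z w assume "z \<in> arc_of a b" "w \<in> arc_of (b - 2 * pi) a"
    then obtain t u where "a < t" "t < b" "z = cis t" "b - 2 * pi < u" "u < a" "w = cis u"
      by (auto simp: arc_of_def)
    then show "snd (AI a b) z - 2 * pi < snd (AI (b - 2 * pi) a) w \<and>
        snd (AI (b - 2 * pi) a) w < snd (AI a b) z" using ab by (simp add: snd_AI)
  qed
  moreover have "fst ?J = arc_compl (fst I)"
    using arc_of_shift[of "b - 2 * pi" 1 a] ab by (simp add: arc_compl_of)
  moreover have "arc_compl (arc_compl (fst I)) = fst I" using ab by (simp add: arc_compl_compl arc_of_in)
  ultimately show ?thesis using that by metis
qed

lemma arg_arc_fst: "I \<in> arg_arcs \<Longrightarrow> fst I \<in> arcs"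
  by (auto simp: arg_arcs_def)

lemma arg_arc_exists: "I \<in> arcs \<Longrightarrow> \<exists>J\<in>arg_arcs. fst J = I"
  by (erule arc_form) (metis AI_in fst_AI)

section \<open>Fourier coefficients and the Reeh-Schlieder argument\<close>

text \<open>Functions on the circle are written in the angle variable, so that rotations become
  translations.\<close>

definition periodic :: "(real \<Rightarrow> complex) \<Rightarrow> bool" where
  "periodic f \<longleftrightarrow> continuous_on UNIV f \<and> (\<forall>t. f (t + 2 * pi) = f t)"

definition circ_int :: "(real \<Rightarrow> complex) \<Rightarrow> complex" where
  "circ_int f = integral {0..2 * pi} f"

lemma periodic_integrable: "periodic f \<Longrightarrow> f integrable_on {0..2 * pi}"
  unfolding periodic_def by (intro integrable_continuous_real) (auto intro: continuous_on_subset)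

lemma periodic_const: "periodic (\<lambda>t. c)"
  by (simp add: periodic_def)

lemma periodic_add: "\<lbrakk>periodic f; periodic g\<rbrakk> \<Longrightarrow> periodic (\<lambda>t. f t + g t)"
  by (auto simp: periodic_def intro: continuous_intros)

lemma periodic_diff: "\<lbrakk>periodic f; periodic g\<rbrakk> \<Longrightarrow> periodic (\<lambda>t. f t - g t)"
  by (auto simp: periodic_def intro: continuous_intros)

lemma periodic_mult: "\<lbrakk>periodic f; periodic g\<rbrakk> \<Longrightarrow> periodic (\<lambda>t. f t * g t)"
  by (auto simp: periodic_def intro: continuous_intros)

lemma periodic_cnj: "periodic f \<Longrightarrow> periodic (\<lambda>t. cnj (f t))"
  by (auto simp: periodic_def intro: continuous_on_cnj)

lemma cis_int_shift: "cis (real_of_int n * (t + 2 * pi)) = cis (real_of_int n * t)"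
  using cis_shift[of "real_of_int n * t" n] by (simp add: algebra_simps)

lemma periodic_cis: "periodic (\<lambda>t. cis (real_of_int n * t))"
  unfolding periodic_def cis_int_shift by (auto intro!: continuous_intros)

lemma periodic_comp_cis:
  assumes "continuous_on circle g" shows "periodic (\<lambda>t. g (cis t))"
  unfolding periodic_def
proof
  show "continuous_on UNIV (\<lambda>t. g (cis t))"
    by (rule continuous_on_compose2[OF assms continuous_on_cis']) auto
  show "\<forall>t. g (cis (t + 2 * pi)) = g (cis t)" using cis_shift[of _ 1] by simp
qed

lemma periodic_shift_int:
  assumes "periodic f" shows "f (t + 2 * pi * real_of_int n) = f t"
proof -
  have 1: "f (s + 2 * pi * real k) = f s" for s k
  proof (induction k)
    case (Suc k)
    have "f (s + 2 * pi * real (Suc k)) = f ((s + 2 * pi * real k) + 2 * pi)" by (simp add: algebra_simps)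
    then show ?case using Suc assms by (simp add: periodic_def)
  qed simp
  show ?thesis
  proof (cases "n \<ge> 0")
    case True then show ?thesis using 1[of t "nat n"] by simp
  next
    case False then show ?thesis using 1[of "t + 2 * pi * real_of_int n" "nat (- n)"] by simp
  qed
qed

lemma reduce_angle:
  obtains s and n :: int where "0 \<le> s" "s < 2 * pi" "t = s + 2 * pi * real_of_int n"
proof -
  let ?n = "\<lfloor>t / (2 * pi)\<rfloor>"
  have "real_of_int ?n \<le> t / (2 * pi)" "t / (2 * pi) < real_of_int ?n + 1" by linarith+
  then have "real_of_int ?n * (2 * pi) \<le> t / (2 * pi) * (2 * pi)"
    "t / (2 * pi) * (2 * pi) < (real_of_int ?n + 1) * (2 * pi)"
    by (intro mult_right_mono mult_strict_right_mono; simp)+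
  then have "2 * pi * real_of_int ?n \<le> t" "t < 2 * pi * (real_of_int ?n + 1)"
    by (simp_all add: mult.commute mult.left_commute)
  then show ?thesis using that[of "t - 2 * pi * real_of_int ?n" ?n] by (simp add: algebra_simps)
qed

lemma circ_int_add: "\<lbrakk>periodic f; periodic g\<rbrakk> \<Longrightarrow> circ_int (\<lambda>t. f t + g t) = circ_int f + circ_int g"
  unfolding circ_int_def by (intro Henstock_Kurzweil_Integration.integral_add periodic_integrable)

lemma circ_int_diff: "\<lbrakk>periodic f; periodic g\<rbrakk> \<Longrightarrow> circ_int (\<lambda>t. f t - g t) = circ_int f - circ_int g"
  unfolding circ_int_def by (intro Henstock_Kurzweil_Integration.integral_diff periodic_integrable)

lemma circ_int_cmult: "circ_int (\<lambda>t. c * f t) = c * circ_int f"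
  unfolding circ_int_def by (rule Henstock_Kurzweil_Integration.integral_mult_right)

lemma circ_int_bound:
  assumes "periodic f" "\<And>t. cmod (f t) \<le> B" shows "cmod (circ_int f) \<le> 2 * pi * B"
proof -
  have "norm (integral {0..2 * pi} f) \<le> integral {0..2 * pi} (\<lambda>t. B)"
    by (rule Henstock_Kurzweil_Integration.integral_norm_bound_integral)
      (use assms periodic_integrable in auto)
  then show ?thesis by (simp add: circ_int_def)
qed

lemma circ_int_shift:
  assumes "periodic f" shows "circ_int (\<lambda>t. f (t + s)) = circ_int f"
proof -
  obtain r and n :: int where r: "0 \<le> r" "r < 2 * pi" "s = r + 2 * pi * real_of_int n"
    by (rule reduce_angle)
  have fi: "f integrable_on {a..b}" for a b
    using assms unfolding periodic_def by (intro integrable_continuous_real) (auto intro: continuous_on_subset)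
  have sh: "integral {a..b} (\<lambda>t. f (t + c)) = integral {a + c..b + c} f" for a b c
    using integral_shift_real_ivl[of "a + c" c "b + c" f] by simp
  have "f (t + s) = f (t + r)" for t
    using periodic_shift_int[OF assms, of "t + r" n] by (simp add: r add.assoc)
  then have "circ_int (\<lambda>t. f (t + s)) = integral {r..2 * pi + r} f"
    using sh[of 0 "2 * pi" r] by (simp add: circ_int_def)
  also have "\<dots> = integral {r..2 * pi} f + integral {2 * pi..2 * pi + r} f"
    by (rule Henstock_Kurzweil_Integration.integral_combine[symmetric]) (use r fi in auto)
  also have "integral {2 * pi..2 * pi + r} f = integral {0..r} f"
    using sh[of 0 r "2 * pi"] assms by (simp add: periodic_def add.commute)
  also have "integral {r..2 * pi} f + integral {0..r} f = circ_int f"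
    unfolding circ_int_def using Henstock_Kurzweil_Integration.integral_combine[of 0 r "2 * pi" f] r fi
    by (simp add: add.commute)
  finally show ?thesis .
qed

lemma circ_int_one: "circ_int (\<lambda>t. c) = 2 * pi * c"
  by (simp add: circ_int_def scaleR_conv_of_real)

text \<open>Translating by \<open>pi / n\<close> changes the sign of \<open>cis (n t)\<close>.\<close>

lemma circ_int_cis:
  assumes "n \<noteq> 0" shows "circ_int (\<lambda>t. cis (real_of_int n * t)) = 0"
proof -
  have e: "cis (real_of_int n * (t + pi / real_of_int n)) = - 1 * cis (real_of_int n * t)" for t
    using assms by (simp add: ring_distribs cis_mult[symmetric])
  have "circ_int (\<lambda>t. cis (real_of_int n * t)) = - 1 * circ_int (\<lambda>t. cis (real_of_int n * t))"
    using circ_int_shift[OF periodic_cis, of n "pi / real_of_int n"] unfolding e circ_int_cmult by (rule sym)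
  then show ?thesis by simp
qed

lemma circ_int_norm_zero:
  assumes "periodic f" "circ_int (\<lambda>t. f t * cnj (f t)) = 0" shows "f t = 0"
proof -
  have c: "continuous_on A f" for A
    using assms unfolding periodic_def by (auto intro: continuous_on_subset)
  have "circ_int (\<lambda>t. f t * cnj (f t)) = integral {0..2 * pi} (\<lambda>t. complex_of_real ((cmod (f t))\<^sup>2))"
    unfolding circ_int_def complex_norm_square ..
  also have "\<dots> = complex_of_real (integral {0..2 * pi} (\<lambda>t. (cmod (f t))\<^sup>2))"
    using integral_linear[OF _ bounded_linear_of_real, of "\<lambda>t. (cmod (f t))\<^sup>2" "{0..2 * pi}"]
    by (simp add: o_def integrable_continuous_real c continuous_intros)
  finally have "integral {0..2 * pi} (\<lambda>t. (cmod (f t))\<^sup>2) = 0" using assms by simp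
  then have z: "\<forall>t\<in>{0..2 * pi}. (cmod (f t))\<^sup>2 = 0"
    by (subst (asm) integral_eq_0_iff) (auto intro!: continuous_intros c)
  obtain s and n :: int where "0 \<le> s" "s < 2 * pi" "t = s + 2 * pi * real_of_int n"
    by (rule reduce_angle)
  then show ?thesis using z periodic_shift_int[OF assms(1)] by simp
qed

lemma periodic_bounded:
  assumes "periodic f" obtains K where "K > 0" "\<And>t. cmod (f t) \<le> K"
proof -
  have "bounded (f ` {0..2 * pi})"
    using assms unfolding periodic_def
    by (intro compact_imp_bounded compact_continuous_image) (auto intro: continuous_on_subset)
  then obtain K where K: "K > 0" "\<forall>x\<in>f ` {0..2 * pi}. norm x \<le> K" unfolding bounded_pos by blast
  have "cmod (f t) \<le> K" for t
  proof -
    obtain s and n :: int where "0 \<le> s" "s < 2 * pi" "t = s + 2 * pi * real_of_int n"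
      by (rule reduce_angle)
    then show ?thesis using K periodic_shift_int[OF assms] by auto
  qed
  then show ?thesis using that K by blast
qed

inductive trig_poly :: "(real \<Rightarrow> complex) \<Rightarrow> bool" where
  base: "trig_poly (\<lambda>t. c * cis (real_of_int n * t))"
| add: "\<lbrakk>trig_poly f; trig_poly g\<rbrakk> \<Longrightarrow> trig_poly (\<lambda>t. f t + g t)"

lemma trig_poly_mult: "\<lbrakk>trig_poly f; trig_poly g\<rbrakk> \<Longrightarrow> trig_poly (\<lambda>t. f t * g t)"
proof (induction rule: trig_poly.induct)
  case (base c n)
  then show ?case
  proof (induction rule: trig_poly.induct)
    case (base d m)
    have "(\<lambda>t. c * cis (real_of_int n * t) * (d * cis (real_of_int m * t)))
        = (\<lambda>t. (c * d) * cis (real_of_int (n + m) * t))"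
      by (auto simp: cis_mult[symmetric] algebra_simps)
    then show ?case using trig_poly.base[of "c * d" "n + m"] by simp
  next
    case (add f g)
    then show ?case using trig_poly.add by (simp add: ring_distribs)
  qed
next
  case (add f g)
  then show ?case using trig_poly.add[of "\<lambda>t. f t * _ t"] by (simp add: ring_distribs)
qed

lemma trig_poly_const: "trig_poly (\<lambda>t. c)"
  using trig_poly.base[of c 0] by simp

text \<open>The bridge from real Stone-Weierstrass on the plane to exponentials: a real linear
  functional of \<open>cis t\<close> is a combination of \<open>cos t\<close> and
  \<open>sin t\<close>.\<close>

lemma trig_poly_real_polynomial:
  assumes "real_polynomial_function g" shows "trig_poly (\<lambda>t. complex_of_real (g (cis t)))"
  using assms
proof (induction rule: real_polynomial_function.induct)
  case (linear g)
  then interpret g: bounded_linear g .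
  have "g (cis t) = cos t * g 1 + sin t * g \<i>" for t
  proof -
    have "cis t = cos t *\<^sub>R 1 + sin t *\<^sub>R \<i>" by (simp add: complex_eq_iff)
    then show ?thesis by (simp only: g.add g.scaleR) simp
  qed
  moreover have "complex_of_real (cos t) = 1/2 * cis (real_of_int 1 * t) + 1/2 * cis (real_of_int (-1) * t)" for t
    by (simp add: complex_eq_iff)
  moreover have "complex_of_real (sin t) = - \<i>/2 * cis (real_of_int 1 * t) + \<i>/2 * cis (real_of_int (-1) * t)" for t
    by (simp add: complex_eq_iff)
  ultimately have "(\<lambda>t. complex_of_real (g (cis t)))
    = (\<lambda>t. (1/2 * cis (real_of_int 1 * t) + 1/2 * cis (real_of_int (-1) * t)) * of_real (g 1)
        + (- \<i>/2 * cis (real_of_int 1 * t) + \<i>/2 * cis (real_of_int (-1) * t)) * of_real (g \<i>))"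
    by auto
  then show ?case by (simp only:) (intro trig_poly.add trig_poly_mult trig_poly_const trig_poly.base)
qed (auto intro: trig_poly.add trig_poly_mult trig_poly_const)

lemma trig_poly_approx:
  assumes "continuous_on circle f" "e > 0"
  obtains p where "trig_poly p" "\<And>t. cmod (f (cis t) - p t) < e"
proof -
  obtain u where u: "real_polynomial_function u" "\<And>z. z \<in> circle \<Longrightarrow> \<bar>Re (f z) - u z\<bar> < e / 2"
    by (rule Stone_Weierstrass_real_polynomial_function[of circle "\<lambda>z. Re (f z)" "e / 2"])
      (use assms in \<open>auto intro: continuous_intros\<close>)
  obtain v where v: "real_polynomial_function v" "\<And>z. z \<in> circle \<Longrightarrow> \<bar>Im (f z) - v z\<bar> < e / 2"
    by (rule Stone_Weierstrass_real_polynomial_function[of circle "\<lambda>z. Im (f z)" "e / 2"])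
      (use assms in \<open>auto intro: continuous_intros\<close>)
  let ?p = "\<lambda>t. complex_of_real (u (cis t)) + \<i> * complex_of_real (v (cis t))"
  have "trig_poly ?p"
    by (intro trig_poly.add trig_poly_mult trig_poly_const trig_poly_real_polynomial u v)
  moreover have "cmod (f (cis t) - ?p t) < e" for t
  proof -
    have "cmod (f (cis t) - ?p t) \<le> \<bar>Re (f (cis t) - ?p t)\<bar> + \<bar>Im (f (cis t) - ?p t)\<bar>"
      by (rule cmod_le)
    then show ?thesis using u(2)[of "cis t"] v(2)[of "cis t"] by simp
  qed
  ultimately show ?thesis using that by blast
qed

lemma periodic_trig_poly: "trig_poly p \<Longrightarrow> periodic p"
  by (induction rule: trig_poly.induct) (intro periodic_mult periodic_add periodic_const periodic_cis; assumption)+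

text \<open>Any branch of the angle jumps somewhere, but branches differ by multiples of
  \<open>2 * pi\<close>, which \<open>h\<close> does not see; so \<open>g\<close> is continuous on
  every cut circle.\<close>

lemma periodic_factor:
  assumes "periodic h" obtains g where "continuous_on circle g" "\<And>t. g (cis t) = h t"
proof -
  define g where "g z = h (ang 0 0 z)" for z
  have gh: "g (cis t) = h t" for t
  proof -
    have "cis (ang 0 0 (cis t)) = cis t" by (simp add: cis_ang)
    then obtain n :: int where "ang 0 0 (cis t) = t + 2 * pi * real_of_int n" using cis_eqD by blast
    then show ?thesis using periodic_shift_int[OF assms] by (simp add: g_def)
  qed
  have c: "continuous_on (arc_of s (s + 2 * pi)) g" for s
  proof -
    have "continuous_on (arc_of s (s + 2 * pi)) (\<lambda>z. h (ang s (s + 2 * pi) z))"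
      by (rule continuous_on_compose2[of UNIV h]) (use assms continuous_on_ang in \<open>auto simp: periodic_def\<close>)
    moreover have "h (ang s (s + 2 * pi) z) = g z" if "z \<in> arc_of s (s + 2 * pi)" for z
      using gh[of "ang s (s + 2 * pi) z"] cis_ang[of z s "s + 2 * pi"] arc_of_circle that by fastforce
    ultimately show ?thesis by (simp cong: continuous_on_cong)
  qed
  \<comment> \<open>Two circles cut at different points, \<open>cis 0\<close> and
    \<open>cis 1\<close>, cover the circle.\<close>
  have "continuous_on (arc_of 0 (0 + 2 * pi) \<union> arc_of 1 (1 + 2 * pi)) g"
  proof (rule continuous_on_Un_local_open[OF _ _ c c])
    have u: "arc_of 0 (0 + 2 * pi) \<union> arc_of 1 (1 + 2 * pi) \<subseteq> circle" using arc_of_circle by blast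
    show "openin (top_of_set (arc_of 0 (0 + 2 * pi) \<union> arc_of 1 (1 + 2 * pi))) (arc_of 0 (0 + 2 * pi))"
      by (rule openin_subset_trans[OF arc_of_open _ u]) auto
    show "openin (top_of_set (arc_of 0 (0 + 2 * pi) \<union> arc_of 1 (1 + 2 * pi))) (arc_of 1 (1 + 2 * pi))"
      by (rule openin_subset_trans[OF arc_of_open _ u]) auto
  qed
  moreover have "arc_of 0 (0 + 2 * pi) \<union> arc_of 1 (1 + 2 * pi) = circle"
  proof -
    have "cis 0 \<noteq> cis 1" using cis_inj[of 0 1] pi_gt3 by auto
    then show ?thesis unfolding cut_eq by auto
  qed
  ultimately show ?thesis using that gh by metis
qed

text \<open>The integral of \<open>h\<close> against every trigonometric polynomial vanishes.
  Approximating the conjugate of \<open>h\<close> uniformly by such polynomials gives that the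
  integral of \<open>|h|^2\<close> is zero.\<close>

lemma fourier_unique:
  assumes "periodic h" "\<And>n::int. circ_int (\<lambda>t. cis (real_of_int n * t) * h t) = 0"
  shows "h t = 0"
proof -
  have tp: "circ_int (\<lambda>t. p t * h t) = 0" if "trig_poly p" for p
    using that
  proof (induction rule: trig_poly.induct)
    case (base c n)
    then show ?case using circ_int_cmult[of c "\<lambda>t. cis (real_of_int n * t) * h t"] assms(2)
      by (simp add: mult.assoc)
  next
    case (add f g)
    then show ?case using circ_int_add[of "\<lambda>t. f t * h t" "\<lambda>t. g t * h t"]
      by (simp add: ring_distribs periodic_mult periodic_trig_poly assms(1))
  qed
  obtain g where g: "continuous_on circle g" "\<And>t. g (cis t) = h t" using periodic_factor[OF assms(1)] by blast
  obtain K where K: "K > 0" "\<And>t. cmod (h t) \<le> K" using periodic_bounded[OF assms(1)] by blast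
  have ph: "periodic (\<lambda>t. h t * cnj (h t))" by (intro periodic_mult periodic_cnj assms)
  have "cmod (circ_int (\<lambda>t. h t * cnj (h t))) \<le> 0 + e" if "e > 0" for e
  proof -
    define d where "d = e / (2 * pi * K)"
    have d: "d > 0" using that K by (simp add: d_def)
    obtain p where p: "trig_poly p" "\<And>t. cmod (cnj (g (cis t)) - p t) < d"
      using trig_poly_approx[of "\<lambda>z. cnj (g z)" d] d g continuous_on_cnj by metis
    have pp: "periodic (\<lambda>t. p t * h t)" by (intro periodic_mult periodic_trig_poly p assms)
    have "circ_int (\<lambda>t. h t * cnj (h t)) = circ_int (\<lambda>t. h t * cnj (h t) - p t * h t)"
      using circ_int_diff[OF ph pp] tp[OF p(1)] by simp
    also have "cmod \<dots> \<le> 2 * pi * (K * d)"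
    proof (rule circ_int_bound)
      fix t
      have "cmod (h t * cnj (h t) - p t * h t) = cmod (h t) * cmod (cnj (h t) - p t)"
        by (simp add: norm_mult[symmetric] algebra_simps)
      also have "\<dots> \<le> K * d" using K p(2)[of t] g(2)[of t] by (intro mult_mono) auto
      finally show "cmod (h t * cnj (h t) - p t * h t) \<le> K * d" .
    qed (intro periodic_diff ph pp)
    also have "\<dots> = e" using K by (simp add: d_def)
    finally show ?thesis by simp
  qed
  then have "cmod (circ_int (\<lambda>t. h t * cnj (h t))) \<le> 0" by (rule field_le_epsilon)
  then show ?thesis by (intro circ_int_norm_zero[OF assms(1)]) simp
qed

text \<open>For \<open>n = 0\<close> this is the mean value property at the centre of the disc. The
  induction keeps \<open>n\<close> arbitrary because splitting off the constant coefficient leaves a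
  factor \<open>cis t\<close> that raises \<open>n\<close> by one.\<close>

lemma circ_int_poly:
  assumes "n \<ge> 0"
  shows "circ_int (\<lambda>t. cis (real_of_int n * t) * poly p (cis t)) = (if n = 0 then 2 * pi * poly p 0 else 0)"
  using assms
proof (induction p arbitrary: n)
  case 0
  then show ?case using circ_int_one[of 0] by simp
next
  case (pCons a p)
  have "circ_int (\<lambda>t. cis (real_of_int n * t) * poly (pCons a p) (cis t))
     = circ_int (\<lambda>t. a * cis (real_of_int n * t) + cis (real_of_int (n + 1) * t) * poly p (cis t))"
    by (auto simp: cis_mult[symmetric] algebra_simps)
  also have "\<dots> = a * circ_int (\<lambda>t. cis (real_of_int n * t))
      + circ_int (\<lambda>t. cis (real_of_int (n + 1) * t) * poly p (cis t))"
    using circ_int_cmult by (subst circ_int_add)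
      (intro periodic_mult periodic_const periodic_cis periodic_comp_cis continuous_intros | simp)+
  also have "circ_int (\<lambda>t. cis (real_of_int (n + 1) * t) * poly p (cis t)) = 0"
    using pCons.IH[of "n + 1"] pCons.prems by simp
  finally show ?case using circ_int_cis[of n] circ_int_one[of 1] by auto
qed

lemma periodic_poly: "periodic (\<lambda>t. poly p (cis t))"
  by (intro periodic_comp_cis continuous_intros)

text \<open>Boundary values of the disc algebra: uniform limits of polynomials in
  \<open>cis t\<close>. Matrix coefficients of a rotation group with positive generator are of this
  kind.\<close>

definition analytic_approx :: "(real \<Rightarrow> complex) \<Rightarrow> bool" where
  "analytic_approx f \<longleftrightarrow> periodic f \<and> (\<forall>e>0. \<exists>p. \<forall>t. cmod (f t - poly p (cis t)) < e)"

text \<open>Translates of \<open>f\<close> through the \<open>m\<close>-th roots of unity have the zero arc sweep over the circle, so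
  the product of the translated polynomials is small on the whole circle and hence at \<open>0\<close>.\<close>

lemma analytic_approx_vanish_at_0:
  assumes f: "analytic_approx f" and d: "d > 0" "\<And>t. \<bar>t\<bar> < d \<Longrightarrow> f t = 0" and "e > 0"
  shows "\<exists>p. (\<forall>t. cmod (f t - poly p (cis t)) < e) \<and> poly p 0 = 0"
proof -
  have per: "periodic f" using f by (simp add: analytic_approx_def)
  obtain K0 where K0: "K0 > 0" "\<And>t. cmod (f t) \<le> K0" using periodic_bounded[OF per] by blast
  define K where "K = K0 + 1"
  \<comment> \<open>So many roots of unity that their spacing \<open>2 * pi / m\<close> is below
    \<open>d\<close>.\<close>
  obtain m :: nat where m: "2 * pi / d < real m" using reals_Archimedean2 by blast
  have mpos: "m > 0" using m d by (metis of_nat_0 gr0I divide_pos_pos not_less_iff_gr_or_eq pi_gt_zero zero_less_mult_iff zero_less_numeral)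
  \<comment> \<open>The product of one factor at most \<epsilon> and \<open>m - 1\<close> factors at
    most \<open>K\<close> has to stay below \<open>(e/2)^m\<close>; the other two bounds keep
    \<open>p\<close> within \<open>1\<close> and within \<open>e/2\<close> of
    \<open>f\<close>.\<close>
  define \<epsilon> where "\<epsilon> = min 1 (min (e/2) ((e/2)^m / (2 * K^(m - 1))))"
  have Kpos: "K > 1" using K0 by (simp add: K_def)
  have eps: "\<epsilon> > 0" using \<open>e > 0\<close> Kpos by (simp add: \<epsilon>_def)
  obtain p where p: "\<And>t. cmod (f t - poly p (cis t)) < \<epsilon>" using f eps by (auto simp: analytic_approx_def)
  define w where "w j = 2 * pi * real j / real m" for j :: nat
  define P where "P = (\<Prod>j<m. pcompose p [:0, cis (w j):])"
  have P: "poly P z = (\<Prod>j<m. poly p (cis (w j) * z))" for z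
    by (simp add: P_def poly_prod poly_pcompose mult.commute)
  have pb: "cmod (poly p (cis t)) \<le> K" for t
    using norm_triangle_ineq4[of "f t" "f t - poly p (cis t)"] p[of t] K0(2)[of t]
    by (simp add: K_def \<epsilon>_def)
  \<comment> \<open>Some translate by a root of unity lands where \<open>f\<close> vanishes, so one
    factor is at most \<epsilon>; the remaining ones are bounded by \<open>K\<close>.\<close>
  have Pb: "cmod (poly P (cis t)) \<le> \<epsilon> * K^(m - 1)" for t
  proof -
    have "\<exists>j<m. f (w j + t) = 0"
    proof -
      obtain s and n :: int where s: "0 \<le> s" "s < 2 * pi" "- t = s + 2 * pi * real_of_int n"
        by (rule reduce_angle)
      define j where "j = nat \<lfloor>s * real m / (2 * pi)\<rfloor>"
      have fl: "real j \<le> s * real m / (2 * pi)" "s * real m / (2 * pi) < real j + 1"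
        using s mpos by (auto simp: j_def of_nat_nat)
      have "s * real m / (2 * pi) < real m" using s mpos by (simp add: divide_less_eq)
      then have jm: "j < m" using fl(1) by linarith
      have "w j \<le> s" using fl(1) mpos by (simp add: w_def field_simps)
      moreover have "s < w j + 2 * pi / real m" using fl(2) mpos by (simp add: w_def field_simps)
      moreover have "2 * pi / real m < d" using m d mpos by (simp add: field_simps)
      ultimately have "f (w j - s) = 0" by (intro d(2)) auto
      moreover have "w j + t = w j - s + 2 * pi * real_of_int (- n)" using s by simp
      ultimately have "f (w j + t) = 0" using periodic_shift_int[OF per] by metis
      then show ?thesis using jm by blast
    qed
    then obtain j where j: "j < m" "f (w j + t) = 0" by blast
    have "cmod (poly P (cis t)) = cmod (poly p (cis (w j + t))) * (\<Prod>i\<in>{..<m} - {j}. cmod (poly p (cis (w i + t))))"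
      using j(1) by (simp add: P prod_norm norm_mult cis_mult prod.remove[of "{..<m}" j])
    also have "\<dots> \<le> \<epsilon> * (\<Prod>i\<in>{..<m} - {j}. K)"
      using p[of "w j + t"] j pb by (intro mult_mono prod_mono prod_nonneg) (auto simp: less_imp_le eps)
    also have "(\<Prod>i\<in>{..<m} - {j}. K) = K^(m - 1)" using j by simp
    finally show ?thesis .
  qed
  \<comment> \<open>The mean value property carries the bound on the circle to the centre, where all
    factors of \<open>P\<close> equal \<open>poly p 0\<close>.\<close>
  have "2 * pi * cmod (poly P 0) = cmod (circ_int (\<lambda>t. poly P (cis t)))"
    using circ_int_poly[of 0 P] by (simp add: norm_mult)
  also have "\<dots> \<le> 2 * pi * (\<epsilon> * K^(m - 1))" by (rule circ_int_bound[OF periodic_poly Pb])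
  finally have "cmod (poly P 0) \<le> \<epsilon> * K^(m - 1)" by simp
  moreover have "cmod (poly P 0) = cmod (poly p 0)^m" by (simp add: P norm_power)
  moreover have "\<epsilon> * K^(m - 1) \<le> (e/2)^m / (2 * K^(m - 1)) * K^(m - 1)"
    using Kpos by (intro mult_right_mono) (auto simp: \<epsilon>_def)
  moreover have "(e/2)^m / (2 * K^(m - 1)) * K^(m - 1) < (e/2)^m"
    using Kpos \<open>e > 0\<close> by simp
  ultimately have "cmod (poly p 0)^m < (e/2)^m" by linarith
  then have p0: "cmod (poly p 0) < e/2" by (rule power_less_imp_less_base) (use \<open>e > 0\<close> in simp)
  let ?q = "p - [:poly p 0:]"
  have "cmod (f t - poly ?q (cis t)) < e" for t
  proof -
    have "cmod (f t - poly ?q (cis t)) \<le> cmod (f t - poly p (cis t)) + cmod (poly p 0)"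
      using norm_triangle_ineq[of "f t - poly p (cis t)" "poly p 0"] by (simp add: algebra_simps)
    then show ?thesis using p[of t] p0 by (simp add: \<epsilon>_def)
  qed
  then show ?thesis by (intro exI[of _ ?q]) simp
qed

text \<open>All Fourier coefficients vanish. Negative frequencies are absent from limits of
  polynomials. For the others, an approximating polynomial may be chosen without constant term, so
  \<open>f\<close> can be divided by \<open>cis t\<close> again and again within the same
  class.\<close>

lemma analytic_approx_zero:
  assumes f: "analytic_approx f" and d: "d > 0" "\<And>t. \<bar>t\<bar> < d \<Longrightarrow> f t = 0"
  shows "f t = 0"
proof -
  have per: "periodic f" using f by (simp add: analytic_approx_def)
  have fk: "analytic_approx (\<lambda>t. f t * cis (real_of_int (- int k) * t))" for k
  proof (induction k)
    case 0
    then show ?case using f by simp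
  next
    case (Suc k)
    let ?g = "\<lambda>t. f t * cis (real_of_int (- int k) * t)"
    let ?g' = "\<lambda>t. f t * cis (real_of_int (- int (Suc k)) * t)"
    have "\<exists>p. \<forall>t. cmod (?g' t - poly p (cis t)) < e" if "e > 0" for e
    proof -
      obtain p where p: "\<And>t. cmod (?g t - poly p (cis t)) < e" "poly p 0 = 0"
        using analytic_approx_vanish_at_0[OF Suc.IH d(1) _ \<open>e > 0\<close>] d(2) by auto
      \<comment> \<open>\<open>p\<close> vanishes at the centre, so \<open>p = z q\<close>, and
        \<open>q\<close> approximates the quotient by \<open>cis t\<close> with the same error since
        \<open>|cis t| = 1\<close>.\<close>
      obtain q where q: "p = pCons 0 q" using p(2) by (cases p) simp
      have "cmod (?g' t - poly q (cis t)) < e" for t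
      proof -
        have "?g t - poly p (cis t) = cis t * (?g' t - poly q (cis t))"
          by (simp add: q ring_distribs cis_mult mult.left_commute algebra_simps)
        then show ?thesis using p(1)[of t] by (simp add: norm_mult)
      qed
      then show ?thesis by blast
    qed
    moreover have "periodic ?g'" by (intro periodic_mult per periodic_cis)
    ultimately show ?case by (simp add: analytic_approx_def)
  qed
  \<comment> \<open>The integral against \<open>cis (- k t)\<close> extracts the coefficient of
    frequency \<open>k\<close>, which is the constant coefficient after \<open>k\<close>
    divisions.\<close>
  have zero: "circ_int (\<lambda>t. cis (real_of_int (- int k) * t) * f t) = 0" for k
  proof -
    let ?g = "\<lambda>t. f t * cis (real_of_int (- int k) * t)"
    have "cmod (circ_int ?g) \<le> 0 + e" if "e > 0" for e
    proof -
      have "e / (2 * pi) > 0" using that by simp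
      then obtain p where p: "\<And>t. cmod (?g t - poly p (cis t)) < e / (2 * pi)" "poly p 0 = 0"
        using analytic_approx_vanish_at_0[OF fk d(1), of k "e / (2 * pi)"] d(2) by auto
      have pg: "periodic ?g" by (intro periodic_mult per periodic_cis)
      have "circ_int ?g = circ_int (\<lambda>t. ?g t - poly p (cis t))"
        using circ_int_diff[OF pg periodic_poly, of p] circ_int_poly[of 0 p] p(2) by simp
      also have "cmod \<dots> \<le> 2 * pi * (e / (2 * pi))"
        by (rule circ_int_bound) (use p(1) pg in \<open>auto intro: periodic_diff periodic_poly less_imp_le\<close>)
      finally show ?thesis by simp
    qed
    then have "cmod (circ_int ?g) \<le> 0" by (rule field_le_epsilon)
    then show ?thesis by (simp add: mult.commute)
  qed
  \<comment> \<open>For positive \<open>n\<close> the integral extracts the coefficient of frequency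
    \<open>- n\<close>, which is zero for each approximating polynomial.\<close>
  have zero': "circ_int (\<lambda>t. cis (real_of_int n * t) * f t) = 0" if "n > 0" for n :: int
  proof -
    let ?g = "\<lambda>t. cis (real_of_int n * t) * f t"
    have pg: "periodic ?g" by (intro periodic_mult per periodic_cis)
    have "cmod (circ_int ?g) \<le> 0 + e" if "e > 0" for e
    proof -
      have "e / (2 * pi) > 0" using that by simp
      then obtain p where p: "\<And>t. cmod (f t - poly p (cis t)) < e / (2 * pi)"
        using f by (auto simp: analytic_approx_def)
      have pp: "periodic (\<lambda>t. cis (real_of_int n * t) * poly p (cis t))"
        by (intro periodic_mult periodic_cis periodic_poly)
      have "circ_int ?g = circ_int (\<lambda>t. ?g t - cis (real_of_int n * t) * poly p (cis t))"
        using circ_int_diff[OF pg pp] circ_int_poly[of n p] \<open>n > 0\<close> by simp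
      also have "cmod \<dots> \<le> 2 * pi * (e / (2 * pi))"
      proof (rule circ_int_bound)
        fix t
        have "cmod (?g t - cis (real_of_int n * t) * poly p (cis t)) = cmod (f t - poly p (cis t))"
          by (simp add: right_diff_distrib[symmetric] norm_mult)
        then show "cmod (?g t - cis (real_of_int n * t) * poly p (cis t)) \<le> e / (2 * pi)"
          using p[of t] by simp
      qed (intro periodic_diff pg pp)
      finally show ?thesis by simp
    qed
    then have "cmod (circ_int ?g) \<le> 0" by (rule field_le_epsilon)
    then show ?thesis by simp
  qed
  have "circ_int (\<lambda>t. cis (real_of_int n * t) * f t) = 0" for n
    using zero[of "nat (- n)"] zero'[of n] by (cases "n > 0") auto
  then show ?thesis by (rule fourier_unique[OF per])
qed

section \<open>Unitary rotation groups with positive generator\<close>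

text \<open>Positivity is recorded in the bounded form \<open>W_pos\<close>: no eigenvector has
  negative frequency. Fourier analysis on the circle turns this into analyticity of all
  orbits.\<close>

locale positive_rotations = hilbert_space H for H :: "('h, 'm) hilbert_scheme" (structure) +
  fixes W :: "real \<Rightarrow> 'h \<Rightarrow> 'h"
  assumes W_bop: "W t \<in> bounded_ops H H"
    and W_inner: "\<lbrakk>x \<in> carrier H; y \<in> carrier H\<rbrakk> \<Longrightarrow> hinner H (W t x) (W t y) = hinner H x y"
    and W_add: "x \<in> carrier H \<Longrightarrow> W (s + t) x = W s (W t x)"
    and W_zero: "x \<in> carrier H \<Longrightarrow> W 0 x = x"
    and W_period: "x \<in> carrier H \<Longrightarrow> W (t + 2 * pi) x = W t x"
    and W_cont: "\<lbrakk>x \<in> carrier H; y \<in> carrier H\<rbrakk> \<Longrightarrow> continuous_on UNIV (\<lambda>t. hinner H (W t x) y)"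
    and W_pos: "\<lbrakk>e \<in> carrier H; \<And>t. W t e = cis (real_of_int n * t) \<odot> e; n < 0\<rbrakk> \<Longrightarrow> e = \<zero>"
begin

lemma W_in [simp]: "x \<in> carrier H \<Longrightarrow> W t x \<in> carrier H"
  by (rule bop_in[OF W_bop])

lemma W_norm [simp]: "x \<in> carrier H \<Longrightarrow> hnorm H (W t x) = hnorm H x"
  by (simp add: hnorm_def W_inner)

lemma W_inner_shift:
  assumes "x \<in> carrier H" "y \<in> carrier H" shows "hinner H x (W s y) = hinner H (W (- s) x) y"
  using W_inner[of "W (- s) x" y s] W_add[of x s "- s"] W_zero assms by simp

lemma W_periodic:
  assumes "x \<in> carrier H" "y \<in> carrier H"
  shows "periodic (\<lambda>t. hinner H (W t x) y)" "periodic (\<lambda>t. hinner H y (W t x))"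
proof -
  show 1: "periodic (\<lambda>t. hinner H (W t x) y)" using assms W_cont W_period by (simp add: periodic_def)
  have "hinner H y (W t x) = cnj (hinner H (W t x) y)" for t using assms by (intro inner_commute) auto
  then show "periodic (\<lambda>t. hinner H y (W t x))" using periodic_cnj[OF 1] by simp
qed

text \<open>\<open>p\<close> is the weak integral of \<open>cis (- n t) W t z\<close> over one
  period, that is, \<open>2 * pi\<close> times the component of \<open>z\<close> of frequency
  \<open>n\<close>. The sign changes in the integrand because the inner product is conjugate-linear
  in its second argument.\<close>

lemma eigen_projection:
  assumes z: "z \<in> carrier H"
  obtains p where "p \<in> carrier H" "\<And>t. W t p = cis (real_of_int n * t) \<odot> p"
    "\<And>w. w \<in> carrier H \<Longrightarrow> circ_int (\<lambda>t. cis (real_of_int n * t) * hinner H w (W t z)) = hinner H w p"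
proof -
  let ?f = "\<lambda>w. circ_int (\<lambda>t. cis (real_of_int n * t) * hinner H w (W t z))"
  have per: "periodic (\<lambda>t. cis (real_of_int n * t) * hinner H w (W t z))" if "w \<in> carrier H" for w
    using that z by (intro periodic_mult periodic_cis W_periodic)
  obtain p where p: "p \<in> carrier H" "\<And>w. w \<in> carrier H \<Longrightarrow> ?f w = hinner H w p"
  proof (rule riesz[OF carrier_subspace[OF hilbert_space_axioms], of ?f "2 * pi * hnorm H z"])
    fix x y assume xy: "x \<in> carrier H" "y \<in> carrier H"
    then show "?f (x \<oplus> y) = ?f x + ?f y"
      using circ_int_add[OF per[OF xy(1)] per[OF xy(2)]] z by (simp add: inner_add ring_distribs)
  next
    fix c x assume "x \<in> carrier H"
    then show "?f (c \<odot> x) = c * ?f x"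
      using z by (simp add: inner_smult circ_int_cmult[symmetric] mult.left_commute)
  next
    fix x assume x: "x \<in> carrier H"
    have "cmod (?f x) \<le> 2 * pi * (hnorm H x * hnorm H z)"
    proof (rule circ_int_bound[OF per[OF x]])
      fix t
      show "cmod (cis (real_of_int n * t) * hinner H x (W t z)) \<le> hnorm H x * hnorm H z"
        using cauchy_schwarz[of x "W t z"] x z by (simp add: norm_mult)
    qed
    then show "cmod (?f x) \<le> 2 * pi * hnorm H z * hnorm H x" by (simp add: mult.commute mult.left_commute)
  qed auto
  have "W s p = cis (real_of_int n * s) \<odot> p" for s
  proof (rule hilbert_eqI)
    fix w assume w: "w \<in> carrier H"
    have "hinner H w (W s p) = ?f (W (- s) w)" using p w by (simp add: W_inner_shift)
    also have "\<dots> = circ_int (\<lambda>t. cis (- (real_of_int n * s)) *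
        (cis (real_of_int n * (t + s)) * hinner H w (W (t + s) z)))"
    proof (rule arg_cong[of _ _ circ_int], rule ext)
      fix t
      have "hinner H w (W (t + s) z) = hinner H (W (- s) w) (W t z)"
        using W_inner_shift[of w "W t z" s] W_add[of z s t] w z by (simp add: add.commute)
      then show "cis (real_of_int n * t) * hinner H (W (- s) w) (W t z) =
        cis (- (real_of_int n * s)) * (cis (real_of_int n * (t + s)) * hinner H w (W (t + s) z))"
        by (simp add: mult.assoc[symmetric] cis_mult algebra_simps)
    qed
    also have "\<dots> = cis (- (real_of_int n * s)) * ?f w"
      unfolding circ_int_cmult using circ_int_shift[OF per[OF w], of s] by simp
    also have "\<dots> = hinner H w (cis (real_of_int n * s) \<odot> p)"
      using p w by (simp add: inner_smult_right cis_cnj)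
    finally have e: "hinner H w (W s p) = hinner H w (cis (real_of_int n * s) \<odot> p)" .
    show "hinner H (W s p) w = hinner H (cis (real_of_int n * s) \<odot> p) w"
      using inner_commute[of w "W s p"] inner_commute[of w "cis (real_of_int n * s) \<odot> p"] e p w by simp
  qed (use p in auto)
  then show ?thesis using that p by blast
qed

text \<open>On the span of eigenvectors the matrix coefficients are polynomials in
  \<open>cis t\<close>, frequencies being nonnegative. That span is dense, and the error of an
  approximation of \<open>x\<close> is uniform in \<open>t\<close> by unitarity.\<close>

lemma analytic_orbit:
  assumes x: "x \<in> carrier H" and y: "y \<in> carrier H"
  shows "analytic_approx (\<lambda>t. hinner H (W t x) y)"
proof -
  define D where "D = {d \<in> carrier H. \<forall>y\<in>carrier H. \<exists>p. \<forall>t. hinner H (W t d) y = poly p (cis t)}"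
  have Dc: "d \<in> carrier H" if "d \<in> D" for d using that by (simp add: D_def)
  have Dp: "\<exists>p. \<forall>t. hinner H (W t d) y = poly p (cis t)" if "d \<in> D" "y \<in> carrier H" for d y
    using that by (simp add: D_def)
  have sub: "lin_subspace H D"
    unfolding lin_subspace_def
  proof (intro conjI ballI allI)
    show "D \<subseteq> carrier H" by (auto simp: D_def)
    show "\<zero> \<in> D" using bop_zero[OF hilbert_space_axioms hilbert_space_axioms W_bop]
      by (auto simp: D_def intro!: exI[of _ 0])
    fix u v assume uv: "u \<in> D" "v \<in> D"
    have "\<exists>p. \<forall>t. hinner H (W t (u \<oplus> v)) y = poly p (cis t)" if yc: "y \<in> carrier H" for y
    proof -
      obtain p q where "\<And>t. hinner H (W t u) y = poly p (cis t)" "\<And>t. hinner H (W t v) y = poly q (cis t)"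
        using Dp[OF uv(1) yc] Dp[OF uv(2) yc] by blast
      then show ?thesis
        using uv yc Dc by (intro exI[of _ "p + q"]) (simp add: bop_add[OF W_bop] inner_add)
    qed
    then show "u \<oplus> v \<in> D" using Dc[OF uv(1)] Dc[OF uv(2)] by (simp add: D_def)
  next
    fix c u assume u: "u \<in> D"
    have "\<exists>p. \<forall>t. hinner H (W t (c \<odot> u)) y = poly p (cis t)" if yc: "y \<in> carrier H" for y
    proof -
      obtain p where "\<And>t. hinner H (W t u) y = poly p (cis t)"
        using Dp[OF u yc] by blast
      then show ?thesis
        using u yc Dc by (intro exI[of _ "Polynomial.smult c p"]) (simp add: bop_smult[OF W_bop] inner_smult)
    qed
    then show "c \<odot> u \<in> D" using Dc[OF u] by (simp add: D_def)
  qed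
  have eig: "e \<in> D" if e: "e \<in> carrier H" "\<And>t. W t e = cis (real_of_int n * t) \<odot> e" for e n
  proof (cases "n < 0")
    case True
    then have "e = \<zero>" using W_pos e by blast
    then show ?thesis using sub by (simp add: lin_subspace_def)
  next
    case False
    have "\<exists>p. \<forall>t. hinner H (W t e) y = poly p (cis t)" if yc: "y \<in> carrier H" for y
      using e yc False
      by (intro exI[of _ "monom (hinner H e y) (nat n)"])
        (simp add: inner_smult poly_monom Complex.DeMoivre mult.commute)
    then show ?thesis using e by (simp add: D_def)
  qed
  \<comment> \<open>If \<open>z\<close> is orthogonal to all eigenvectors then every Fourier
    coefficient of \<open>t -> <z, W t z>\<close> vanishes; its value at \<open>t = 0\<close> is
    \<open>|z|^2\<close>.\<close>
  have tot: "total_in H D"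
    unfolding total_in_def
  proof (intro conjI ballI impI)
    fix z assume z: "z \<in> carrier H" "\<forall>d\<in>D. hinner H d z = 0"
    have "circ_int (\<lambda>t. cis (real_of_int n * t) * hinner H z (W t z)) = 0" for n
    proof -
      obtain p where p: "p \<in> carrier H" "\<And>t. W t p = cis (real_of_int n * t) \<odot> p"
        "\<And>w. w \<in> carrier H \<Longrightarrow> circ_int (\<lambda>t. cis (real_of_int n * t) * hinner H w (W t z)) = hinner H w p"
        by (rule eigen_projection[OF z(1), of n]) (rule that)
      have "hinner H p z = 0" using eig[OF p(1,2)] z by blast
      then show ?thesis using p(1) p(3)[OF z(1)] inner_commute[of p z] z(1) by simp
    qed
    then have "hinner H z (W 0 z) = 0" by (rule fourier_unique[OF W_periodic(2)[OF z(1) z(1)]])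
    then show "z = \<zero>" using W_zero z inner_definite by simp
  qed (use sub in \<open>simp add: lin_subspace_def\<close>)
  \<comment> \<open>A total subspace is dense: the vector representing \<open><_, x>\<close> on
    \<open>D\<close> is approximable from \<open>D\<close>, and totality identifies it with
    \<open>x\<close>.\<close>
  have appr: "\<exists>d\<in>D. hnorm H (x \<ominus> d) < e" if "e > 0" for e
  proof -
    obtain z where z: "z \<in> carrier H" "\<And>d. d \<in> D \<Longrightarrow> hinner H d x = hinner H d z"
      "\<And>e. e > 0 \<Longrightarrow> \<exists>d\<in>D. hnorm H (z \<ominus> d) < e"
      by (rule riesz[OF sub, of "\<lambda>d. hinner H d x" "hnorm H x"])
        (use cauchy_schwarz[OF Dc x] in \<open>auto simp: inner_add[OF Dc Dc x] inner_smult[OF Dc x] mult.commute\<close>)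
    have "x = z" by (rule hilbert_eqI_total[OF x z(1) tot z(2)])
    then show ?thesis using z(3) that by blast
  qed
  show ?thesis unfolding analytic_approx_def
  proof (intro conjI allI impI)
    fix e :: real assume e: "e > 0"
    have ny: "hnorm H y + 1 > 0" using y by (simp add: add_nonneg_pos)
    obtain d where d: "d \<in> D" "hnorm H (x \<ominus> d) < e / (hnorm H y + 1)"
      using appr[of "e / (hnorm H y + 1)"] e ny by auto
    obtain p where p: "\<And>t. hinner H (W t d) y = poly p (cis t)" using Dp[OF d(1) y] by blast
    have "cmod (hinner H (W t x) y - poly p (cis t)) < e" for t
    proof -
      have "W t (x \<ominus> d) = W t x \<oplus> (-1) \<odot> W t d"
      proof -
        have "x \<ominus> d = x \<oplus> (-1) \<odot> d"
          by (rule hilbert_eqI) (use x Dc[OF d(1)] in \<open>simp_all add: inner_simps\<close>)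
        then show ?thesis using x Dc[OF d(1)] by (simp add: bop_add[OF W_bop] bop_smult[OF W_bop])
      qed
      then have "hinner H (W t x) y - poly p (cis t) = hinner H (W t (x \<ominus> d)) y"
        using x y Dc[OF d(1)] by (simp add: inner_simps p[symmetric])
      also have "cmod \<dots> \<le> hnorm H (x \<ominus> d) * hnorm H y"
        using cauchy_schwarz[of "W t (x \<ominus> d)" y] x y Dc[OF d(1)] by simp
      also have "\<dots> \<le> hnorm H (x \<ominus> d) * (hnorm H y + 1)"
        using x Dc[OF d(1)] by (intro mult_left_mono) auto
      also have "\<dots> < e" using d(2) ny by (simp add: pos_less_divide_eq)
      finally show ?thesis .
    qed
    then show "\<exists>p. \<forall>t. cmod (hinner H (W t x) y - poly p (cis t)) < e" by blast
  qed (rule W_periodic[OF x y])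
qed

lemma orbit_orthogonal:
  assumes "x \<in> carrier H" "y \<in> carrier H" "d > 0" "\<And>t. \<bar>t\<bar> < d \<Longrightarrow> hinner H (W t x) y = 0"
  shows "hinner H (W t x) y = 0"
  by (rule analytic_approx_zero[OF analytic_orbit[OF assms(1,2)] assms(3,4)])

end

section \<open>Transfer between the vacuum space and the vacuum module, which extends it by the
  action\<close>

lemma vac_module_simps [simp]:
  "carrier (vac_module N) = carrier (vac_space N)" "add (vac_module N) = add (vac_space N)"
  "zero (vac_module N) = zero (vac_space N)" "smult (vac_module N) = smult (vac_space N)"
  "hinner (vac_module N) = hinner (vac_space N)" "act (vac_module N) I x = x"
  by (simp_all add: vac_module_def hilbert.defs rep_space.defs)

lemma vac_hnorm [simp]: "hnorm (vac_module N) = hnorm (vac_space N)"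
  by (rule ext) (simp add: hnorm_def)

lemma vac_minus [simp]: "a_minus (vac_module N) = a_minus (vac_space N)"
  by (intro ext) (simp add: a_minus_def a_inv_def m_inv_def)

lemma vac_hdist [simp]: "hdist (vac_module N) = hdist (vac_space N)"
  by (intro ext) (simp add: hdist_def)

lemma vac_bounded_ops [simp]:
  "bounded_ops (vac_module N) K = bounded_ops (vac_space N) K"
  "bounded_ops K (vac_module N) = bounded_ops K (vac_space N)"
  by (simp_all add: bounded_ops_def)

lemma vac_adj [simp]:
  "adj (vac_module N) K = adj (vac_space N) K" "adj K (vac_module N) = adj K (vac_space N)"
  by (simp_all add: fun_eq_iff adj_def)

lemma vac_ident [simp]: "ident (vac_module N) = ident (vac_space N)"
  by (simp add: ident_def)

lemma vac_ops [simp]: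
  "op_add (vac_module N) K = op_add (vac_space N) K" "op_add K (vac_module N) = op_add K (vac_space N)"
  "op_smult (vac_module N) K = op_smult (vac_space N) K" "op_smult K (vac_module N) = op_smult K (vac_space N)"
  by (simp_all add: fun_eq_iff op_add_def op_smult_def)

lemma vac_sigma_weak [simp]: "sigma_weak (vac_module N) = sigma_weak (vac_space N)"
  by (simp add: sigma_weak_def sq_summable_def)

lemma vac_hilbert_space:
  assumes "hilbert_space (vac_space N)" shows "hilbert_space (vac_module N)"
proof -
  interpret H: hilbert_space "vac_space N" by fact
  show ?thesis
    by (unfold_locales)
     (auto simp: H.inner_simps H.smult_assoc1[simplified] H.smult_l_distr[simplified] H.smult_r_distr H.M.a_ac
      H.inner_nonneg H.inner_definite Units_def H.complete H.separable intro: H.inner_commute)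
qed

section \<open>Orthogonal complements and their projections\<close>

definition perp :: "('h, 'm) hilbert_scheme \<Rightarrow> 'h set \<Rightarrow> 'h set" where
  "perp H S = {z \<in> carrier H. \<forall>s\<in>S. hinner H s z = 0}"

context hilbert_space
begin

lemma perp_subspace:
  assumes "S \<subseteq> carrier H" shows "lin_subspace H (perp H S)"
  using assms by (auto simp: lin_subspace_def perp_def inner_add_right inner_smult_right subset_iff)

lemma perp_projection:
  assumes S: "S \<subseteq> carrier H"
  obtains P where "P \<in> bounded_ops H H" "\<And>x. x \<in> carrier H \<Longrightarrow> P x \<in> perp H S"
    "\<And>x. x \<in> perp H S \<Longrightarrow> P x = x"
    "\<And>x y. \<lbrakk>x \<in> carrier H; y \<in> carrier H\<rbrakk> \<Longrightarrow> hinner H (P x) y = hinner H x (P y)"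
proof -
  let ?N = "perp H S"
  have N: "z \<in> carrier H" if "z \<in> ?N" for z using that by (simp add: perp_def)
  have ex: "\<exists>p. p \<in> ?N \<and> (\<forall>z\<in>?N. hinner H z x = hinner H z p) \<and> hnorm H p \<le> hnorm H x"
    if x: "x \<in> carrier H" for x
  proof -
    obtain p where p: "p \<in> carrier H" "\<And>z. z \<in> ?N \<Longrightarrow> hinner H z x = hinner H z p"
      "hnorm H p \<le> \<bar>hnorm H x\<bar>" "\<And>e. e > 0 \<Longrightarrow> \<exists>d\<in>?N. hnorm H (p \<ominus> d) < e"
      by (rule riesz[OF perp_subspace[OF S], of "\<lambda>z. hinner H z x" "hnorm H x"])
        (use cauchy_schwarz[OF N x] in \<open>auto simp: inner_add[OF N N x] inner_smult[OF N x] mult.commute\<close>)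
    \<comment> \<open>\<open>riesz\<close> places \<open>p\<close> only in the closure of the
      complement; continuity of the inner product shows that the complement is closed.\<close>
    have "hinner H s p = 0" if s: "s \<in> S" for s
    proof -
      have sc: "s \<in> carrier H" using s S by blast
      have "cmod (hinner H s p) \<le> 0 + e" if "e > 0" for e
      proof -
        have pos: "hnorm H s + 1 > 0" using sc by (simp add: add_nonneg_pos)
        obtain d where d: "d \<in> ?N" "hnorm H (p \<ominus> d) < e / (hnorm H s + 1)"
          using p(4)[of "e / (hnorm H s + 1)"] \<open>e > 0\<close> pos by auto
        have "hinner H s d = 0" using d(1) s by (simp add: perp_def)
        then have "cmod (hinner H s p) = cmod (hinner H s (p \<ominus> d))"
          using sc p(1) N[OF d(1)] by (simp add: inner_diff_right)
        also have "\<dots> \<le> hnorm H s * hnorm H (p \<ominus> d)" using sc p(1) N[OF d(1)] by (intro cauchy_schwarz) auto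
        also have "\<dots> \<le> (hnorm H s + 1) * (e / (hnorm H s + 1))"
          using d(2) sc p(1) N[OF d(1)] by (intro mult_mono) auto
        also have "\<dots> = e" using pos by simp
        finally show ?thesis by simp
      qed
      then have "cmod (hinner H s p) \<le> 0" by (rule field_le_epsilon)
      then show ?thesis by simp
    qed
    then have "p \<in> ?N" using p(1) by (simp add: perp_def)
    then show ?thesis using p x by auto
  qed
  obtain p where p: "\<And>x. x \<in> carrier H \<Longrightarrow> p x \<in> ?N"
    "\<And>x z. \<lbrakk>x \<in> carrier H; z \<in> ?N\<rbrakk> \<Longrightarrow> hinner H z (p x) = hinner H z x"
    "\<And>x. x \<in> carrier H \<Longrightarrow> hnorm H (p x) \<le> hnorm H x"
  proof -
    have "\<exists>p. \<forall>x\<in>carrier H. p x \<in> ?N \<and> (\<forall>z\<in>?N. hinner H z x = hinner H z (p x)) \<and> hnorm H (p x) \<le> hnorm H x"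
      by (rule bchoice) (use ex in blast)
    then obtain p where "\<forall>x\<in>carrier H. p x \<in> ?N \<and> (\<forall>z\<in>?N. hinner H z x = hinner H z (p x)) \<and> hnorm H (p x) \<le> hnorm H x"
      by blast
    note q = bspec[OF this]
    show ?thesis
    proof (rule that[of p])
      fix x assume x: "x \<in> carrier H"
      show "p x \<in> ?N" "hnorm H (p x) \<le> hnorm H x" using q[OF x] by auto
      fix z assume z: "z \<in> ?N"
      have "\<forall>z\<in>?N. hinner H z x = hinner H z (p x)" using q[OF x] by (elim conjE)
      from bspec[OF this z] show "hinner H z (p x) = hinner H z x" by (rule sym)
    qed
  qed
  note pc = N[OF p(1)]
  have uniq: "u = w" if "u \<in> ?N" "w \<in> ?N" "\<And>z. z \<in> ?N \<Longrightarrow> hinner H z u = hinner H z w" for u w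
  proof (rule eq_if_diff_zero)
    have uw: "u \<in> carrier H" "w \<in> carrier H" using N that(1,2) by blast+
    have "hinner H s (u \<ominus> w) = 0" if s: "s \<in> S" for s
      using \<open>u \<in> ?N\<close> \<open>w \<in> ?N\<close> s S uw by (simp add: perp_def inner_diff_right subset_iff)
    then have "u \<ominus> w \<in> ?N" using uw by (simp add: perp_def)
    then have "hinner H (u \<ominus> w) u = hinner H (u \<ominus> w) w" by (rule that(3))
    then show "u \<ominus> w = \<zero>" using N[OF that(1)] N[OF that(2)]
      by (intro inner_definite) (auto simp: inner_diff_right)
  qed (use N that(1,2) in auto)
  have sub: "lin_subspace H ?N" by (rule perp_subspace[OF S])
  define P where "P = restrict p (carrier H)"
  have "P \<in> bounded_ops H H"
  proof (rule bopI)
    fix x y assume xy: "x \<in> carrier H" "y \<in> carrier H"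
    have "p (x \<oplus> y) = p x \<oplus> p y"
    proof (rule uniq)
      show "p x \<oplus> p y \<in> ?N" using sub p(1) xy by (simp add: lin_subspace_def)
      fix z assume z: "z \<in> ?N"
      show "hinner H z (p (x \<oplus> y)) = hinner H z (p x \<oplus> p y)"
        using xy z by (simp add: p(2) inner_add_right N pc)
    qed (use p xy in auto)
    then show "P (x \<oplus> y) = P x \<oplus> P y" using xy by (simp add: P_def)
  next
    fix c x assume x: "x \<in> carrier H"
    have "p (c \<odot> x) = c \<odot> p x"
    proof (rule uniq)
      show "c \<odot> p x \<in> ?N" using sub p(1) x by (simp add: lin_subspace_def)
      fix z assume z: "z \<in> ?N"
      show "hinner H z (p (c \<odot> x)) = hinner H z (c \<odot> p x)"
        using x z by (simp add: p(2) inner_smult_right N pc)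
    qed (use p x in auto)
    then show "P (c \<odot> x) = c \<odot> P x" using x by (simp add: P_def)
  next
    fix x assume "x \<in> carrier H"
    then show "hnorm H (P x) \<le> 1 * hnorm H x" using p(3) by (simp add: P_def)
  qed (auto simp: P_def pc)
  moreover have "P x \<in> ?N" if "x \<in> carrier H" for x using p(1) that by (simp add: P_def)
  moreover have "P x = x" if "x \<in> ?N" for x
    using uniq[OF p(1)[OF N[OF that]] that p(2)[OF N[OF that]]] N[OF that] by (simp add: P_def)
  moreover have "hinner H (P x) y = hinner H x (P y)" if "x \<in> carrier H" "y \<in> carrier H" for x y
  proof -
    have "hinner H (p x) y = hinner H (p x) (p y)" using p that by simp
    also have "\<dots> = cnj (hinner H (p y) (p x))" by (rule inner_commute) (use pc that in auto)
    also have "\<dots> = cnj (hinner H (p y) x)" using p that by simp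
    also have "\<dots> = hinner H x (p y)" by (rule inner_commute[symmetric]) (use pc that in auto)
    finally show ?thesis using that by (simp add: P_def)
  qed
  ultimately show ?thesis using that by blast
qed

text \<open>Invariance of the range under \<open>X\<close> gives \<open>X P = P X P\<close>;
  invariance under the adjoint gives \<open>P X = P X P\<close>.\<close>

lemma projection_commute:
  assumes P: "P \<in> bounded_ops H H" "\<And>x. x \<in> carrier H \<Longrightarrow> P x \<in> perp H S"
    "\<And>x. x \<in> perp H S \<Longrightarrow> P x = x"
    "\<And>x y. \<lbrakk>x \<in> carrier H; y \<in> carrier H\<rbrakk> \<Longrightarrow> hinner H (P x) y = hinner H x (P y)"
    and X: "X \<in> bounded_ops H H" "\<And>z. z \<in> perp H S \<Longrightarrow> X z \<in> perp H S"
    "\<And>z. z \<in> perp H S \<Longrightarrow> adj H H X z \<in> perp H S" and x: "x \<in> carrier H"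
  shows "P (X x) = X (P x)"
proof (rule hilbert_eqI)
  note A = adj_bop[OF hilbert_space_axioms hilbert_space_axioms X(1)]
  note [simp] = bop_in[OF P(1)] bop_in[OF X(1)] bop_in[OF A]
  note ip = adj_ip[OF hilbert_space_axioms hilbert_space_axioms X(1)]
  show "P (X x) \<in> carrier H" "X (P x) \<in> carrier H" using x by auto
  fix y assume y: "y \<in> carrier H"
  have "hinner H (P (X x)) y = hinner H (X x) (P y)" using P(4) x y by simp
  also have "\<dots> = hinner H x (adj H H X (P y))" using x y by (simp add: ip)
  also have "\<dots> = hinner H x (P (adj H H X (P y)))" using P(3)[OF X(3)[OF P(2)[OF y]]] by simp
  also have "\<dots> = hinner H (X (P x)) (P y)" using P(4)[of x "adj H H X (P y)"] x y by (simp add: ip)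
  also have "\<dots> = hinner H (P (X (P x))) y" using P(4)[of "X (P x)" y] x y by simp
  also have "P (X (P x)) = X (P x)" using P(3)[OF X(2)[OF P(2)[OF x]]] .
  finally show "hinner H (P (X x)) y = hinner H (X (P x)) y" .
qed

end

section \<open>Commutants and von Neumann algebras\<close>

lemma commutantD:
  assumes "T \<in> commutant H M" "X \<in> M" "x \<in> carrier H" shows "T (X x) = X (T x)"
proof -
  have "compose (carrier H) T X = compose (carrier H) X T" using assms by (simp add: commutant_def)
  then have "compose (carrier H) T X x = compose (carrier H) X T x" by simp
  then show ?thesis using assms(3) by simp
qed

lemma commutantI:
  assumes "T \<in> bounded_ops H H" "\<And>X x. \<lbrakk>X \<in> M; x \<in> carrier H\<rbrakk> \<Longrightarrow> T (X x) = X (T x)"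
  shows "T \<in> commutant H M"
  using assms by (auto simp: commutant_def compose_def intro!: restrict_ext)

lemma commutant_bop: "T \<in> commutant H M \<Longrightarrow> T \<in> bounded_ops H H"
  by (simp add: commutant_def)

lemma commutant_ident:
  assumes "hilbert_space H" "M \<subseteq> bounded_ops H H" shows "ident H \<in> commutant H M"
  by (rule commutantI) (use assms bop_in in \<open>auto simp: bop_in subset_iff\<close>)

lemma commutant_compose:
  assumes "hilbert_space H" "S \<in> commutant H M" "T \<in> commutant H M" "M \<subseteq> bounded_ops H H"
  shows "compose (carrier H) S T \<in> commutant H M"
proof (rule commutantI)
  show "compose (carrier H) S T \<in> bounded_ops H H" using bop_compose[OF assms(1,1) commutant_bop[OF assms(3)] commutant_bop[OF assms(2)]] .
  fix X x assume X: "X \<in> M" "x \<in> carrier H"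
  have [simp]: "X x \<in> carrier H" "T x \<in> carrier H"
    using X assms bop_in[OF commutant_bop[OF assms(3)]] by (auto simp: bop_in subset_iff)
  show "compose (carrier H) S T (X x) = X (compose (carrier H) S T x)"
    using X commutantD[OF assms(2)] commutantD[OF assms(3)] by simp
qed

lemma vN_bop: "\<lbrakk>von_neumann_algebra H M; X \<in> M\<rbrakk> \<Longrightarrow> X \<in> bounded_ops H H"
  by (auto simp: von_neumann_algebra_def)

lemma vN_adj: "\<lbrakk>von_neumann_algebra H M; X \<in> M\<rbrakk> \<Longrightarrow> adj H H X \<in> M"
  by (simp add: von_neumann_algebra_def)

lemma vN_compose:
  assumes "hilbert_space H" "von_neumann_algebra H M" "X \<in> M" "Y \<in> M"
  shows "compose (carrier H) X Y \<in> M"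
proof -
  have "commutant H (commutant H M) = M" using assms by (simp add: von_neumann_algebra_def)
  moreover have "commutant H M \<subseteq> bounded_ops H H" using commutant_bop by blast
  ultimately show ?thesis using commutant_compose[OF assms(1), of X "commutant H M" Y] assms(3,4) by simp
qed

lemma vN_ident:
  assumes "hilbert_space H" "von_neumann_algebra H M" shows "ident H \<in> M"
proof -
  have "commutant H (commutant H M) = M" using assms by (simp add: von_neumann_algebra_def)
  moreover have "commutant H M \<subseteq> bounded_ops H H" using commutant_bop by blast
  ultimately show ?thesis using commutant_ident[OF assms(1), of "commutant H M"] by simp
qed

section \<open>The action of SU(1,1) on the circle\<close>

definition su_inv :: "complex \<times> complex \<Rightarrow> complex \<times> complex" where
  "su_inv g = (cnj (fst g), - snd g)"

lemma su_det: "(a, b) \<in> SU11 \<Longrightarrow> a * cnj a - b * cnj b = 1"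
  unfolding SU11_def complex_norm_square[symmetric] by (simp flip: of_real_diff of_real_power)

lemma su_inv_in: "g \<in> SU11 \<Longrightarrow> su_inv g \<in> SU11"
  by (auto simp: SU11_def su_inv_def)

lemma su_denom_nz:
  assumes "(a, b) \<in> SU11" "z \<in> circle" shows "cnj b * z + cnj a \<noteq> 0"
proof
  assume "cnj b * z + cnj a = 0"
  then have "cmod (cnj b * z) = cmod (cnj a)" by (metis add_eq_0_iff norm_minus_cancel)
  then have "(cmod b)\<^sup>2 = (cmod a)\<^sup>2" using assms(2) by (simp add: norm_mult)
  then show False using assms(1) by (simp add: SU11_def)
qed

lemma su_act_circle:
  assumes "g \<in> SU11" "z \<in> circle" shows "su_act g z \<in> circle"
proof -
  obtain a b where g: "g = (a, b)" by fastforce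
  have z: "cmod z = 1" using assms by simp
  then have zz: "z * cnj z = 1" by (simp add: complex_norm_square[symmetric])
  have "a * z + b = z * cnj (cnj b * z + cnj a)" using zz by (simp add: algebra_simps)
  then have "cmod (a * z + b) = cmod (cnj b * z + cnj a)" using z by (simp add: norm_mult del: complex_cnj_add complex_cnj_mult)
  then show ?thesis using su_denom_nz[of a b z] assms g by (simp add: norm_divide)
qed

lemma su_act_inv:
  assumes "g \<in> SU11" "z \<in> circle" shows "su_act (su_inv g) (su_act g z) = z"
proof -
  obtain a b where g: "g = (a, b)" by fastforce
  have n: "cnj b * z + cnj a \<noteq> 0" using su_denom_nz assms g by simp
  have d: "a * cnj a - b * cnj b = 1" using su_det assms g by simp
  have "su_act (su_inv g) (su_act g z)
      = (cnj a * ((a * z + b) / (cnj b * z + cnj a)) - b) / (- cnj b * ((a * z + b) / (cnj b * z + cnj a)) + a)"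
    by (simp add: g su_inv_def)
  also have "cnj a * ((a * z + b) / (cnj b * z + cnj a)) - b = (a * cnj a - b * cnj b) * z / (cnj b * z + cnj a)"
    using n by (simp add: field_simps)
  also have "- cnj b * ((a * z + b) / (cnj b * z + cnj a)) + a = (a * cnj a - b * cnj b) / (cnj b * z + cnj a)"
    using n by (simp add: field_simps)
  finally show ?thesis using n d by simp
qed

lemma su_inv_inv: "su_inv (su_inv g) = g"
  by (simp add: su_inv_def)

lemma su_act_cont:
  assumes "g \<in> SU11" shows "continuous_on circle (su_act g)"
proof -
  obtain a b where g: "g = (a, b)" by fastforce
  have "continuous_on circle (\<lambda>z. (a * z + b) / (cnj b * z + cnj a))"
    using su_denom_nz assms g by (intro continuous_intros) auto
  then show ?thesis unfolding g su_act.simps .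
qed

lemma su_homeo:
  assumes "g \<in> SU11" shows "homeomorphism circle circle (su_act g) (su_act (su_inv g))"
proof (rule homeomorphismI)
  show "continuous_on circle (su_act g)" "continuous_on circle (su_act (su_inv g))"
    using su_act_cont su_inv_in assms by auto
  show "su_act g ` circle \<subseteq> circle" "su_act (su_inv g) ` circle \<subseteq> circle"
    using su_act_circle su_inv_in assms by blast+
  show "\<And>x. x \<in> circle \<Longrightarrow> su_act (su_inv g) (su_act g x) = x" using su_act_inv assms by blast
  show "\<And>y. y \<in> circle \<Longrightarrow> su_act g (su_act (su_inv g) y) = y"
    using su_act_inv[OF su_inv_in[OF assms]] by (simp add: su_inv_inv)
qed

lemma arcs_subset_circle: "I \<in> arcs \<Longrightarrow> I \<subseteq> circle"
  unfolding arcs_def using openin_imp_subset by fastforce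

text \<open>The action is by homeomorphisms of the circle. The image of \<open>I\<close> is not
  dense because it misses the image of the complementary arc, which is open and nonempty.\<close>

lemma su_act_arcs:
  assumes g: "g \<in> SU11" and I: "I \<in> arcs" shows "su_act g ` I \<in> arcs"
proof -
  have o: "openin (top_of_set circle) (su_act g ` T)" if "openin (top_of_set circle) T" for T
    using homeomorphism_imp_open_map[OF su_homeo[OF g] that] .
  have Ic: "I \<subseteq> circle" using arcs_subset_circle[OF I] .
  let ?T = "su_act g ` arc_compl I"
  have C: "arc_compl I \<in> arcs" by (rule arc_compl_in[OF I])
  have "openin (top_of_set circle) ?T" using C o by (simp add: arcs_def)
  then obtain W where W: "open W" "?T = circle \<inter> W" by (auto simp: openin_open)
  have disj: "?T \<inter> su_act g ` I = {}"
  proof -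
    have "inj_on (su_act g) circle" using su_homeo[OF g] homeomorphism_def inj_on_inverseI by metis
    then show ?thesis using arc_compl_disjoint[of I] arcs_subset_circle[OF C] Ic
      by (metis inj_on_image_Int Int_commute image_empty)
  qed
  have "\<not> circle \<subseteq> closure (su_act g ` I)"
  proof
    assume "circle \<subseteq> closure (su_act g ` I)"
    moreover have "?T \<noteq> {}" using C by (simp add: arcs_def)
    ultimately have "W \<inter> closure (su_act g ` I) \<noteq> {}" using W(2) by blast
    then have "W \<inter> su_act g ` I \<noteq> {}" using open_Int_closure_eq_empty[OF W(1)] by blast
    moreover have "su_act g ` I \<subseteq> circle" using su_act_circle[OF g] Ic by blast
    ultimately show False using disj W(2) by blast
  qed
  moreover have "connected (su_act g ` I)"
    using I Ic by (intro connected_continuous_image continuous_on_subset[OF su_act_cont[OF g]]) (auto simp: arcs_def)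
  ultimately show ?thesis using I o by (auto simp: arcs_def)
qed

lemma su_rot_in: "su_rot t \<in> SU11"
  by (simp add: su_rot_def SU11_def)

lemma su_rot_mult: "su_mult (su_rot s) (su_rot t) = su_rot (s + t)"
  by (simp add: su_rot_def cis_mult add_divide_distrib)

lemma su_rot_period: "su_rot (t + 2 * pi) = - su_rot t"
proof -
  have "(t + 2 * pi) / 2 = t / 2 + pi" by simp
  then show ?thesis unfolding su_rot_def by (simp only: cis_mult[symmetric]) simp
qed

lemma su_rot_act: "su_act (su_rot t) z = cis t * z"
  by (simp add: su_rot_def cis_cnj field_simps cis_mult)

lemma closure_arc_of: "closure (arc_of a b) \<subseteq> cis ` {a..b}"
proof (rule closure_minimal)
  show "closed (cis ` {a..b})"
    by (intro compact_imp_closed compact_continuous_image continuous_intros) auto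
qed (auto simp: arc_of_def)

text \<open>The hyperbolic element with repelling fixed point \<open>p\<close> and attracting fixed point \<open>- p\<close>.\<close>

lemma dilation:
  assumes p: "p \<in> circle" and d: "d > 0"
  obtains g where "g \<in> SU11" "\<And>z. \<lbrakk>z \<in> circle; d \<le> dist p z\<rbrakk> \<Longrightarrow> dist (- p) (su_act g z) < 1/2"
proof -
  \<comment> \<open>\<open>s\<close> and \<open>c\<close> are the hyperbolic sine and cosine of the
    rapidity. The product \<open>s * d = 6\<close> makes the denominator at least
    \<open>6 - 1 = 5\<close>, so the image is within \<open>2/5\<close> of
    \<open>- p\<close>.\<close>
  define s where "s = 6 / d"
  define c where "c = sqrt (1 + s\<^sup>2)"
  have s: "s > 0" using d by (simp add: s_def)
  have c2: "c\<^sup>2 = 1 + s\<^sup>2" by (simp add: c_def add_nonneg_nonneg)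
  have c1: "c > 0" by (simp add: c_def add_pos_nonneg)
  have cs: "s < c" using s c1 c2 by (intro power2_less_imp_less[of s c]) auto
  \<comment> \<open>The factor by which the numerator contracts the distance to the attracting
    point: \<open>su_act g z + p\<close> equals \<open>e * (z + p)\<close> divided by the
    denominator.\<close>
  define e where "e = c - s"
  have e0: "e > 0" using cs by (simp add: e_def)
  have e1: "e \<le> 1"
  proof -
    have "c\<^sup>2 \<le> (1 + s)\<^sup>2" using s c2 by (simp add: power2_sum)
    then have "c \<le> 1 + s" by (rule power2_le_imp_le) (use s in auto)
    then show ?thesis by (simp add: e_def)
  qed
  have pp: "p * cnj p = 1" using p by (simp add: complex_norm_square[symmetric])
  let ?g = "(complex_of_real c, - complex_of_real s * p)"
  have g: "?g \<in> SU11" using p c2 s c1 by (simp add: SU11_def norm_mult power_mult_distrib)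
  have "dist (- p) (su_act ?g z) < 1/2" if z: "z \<in> circle" "d \<le> dist p z" for z
  proof -
    let ?D = "of_real c - of_real s * cnj p * z"
    have Dnz: "?D \<noteq> 0" using su_denom_nz[OF g z(1)] by (simp add: algebra_simps)
    have "su_act ?g z = (of_real c * z - of_real s * p) / ?D" by (simp add: algebra_simps)
    then have "su_act ?g z + p = (of_real c * z - of_real s * p + p * ?D) / ?D"
      using Dnz by (simp add: field_simps)
    also have "of_real c * z - of_real s * p + p * ?D = of_real e * (z + p)"
      using pp by (simp add: e_def algebra_simps)
    finally have eq: "su_act ?g z + p = of_real e * (z + p) / ?D" .
    have "?D = of_real e + of_real s * cnj p * (p - z)"
      using pp by (simp add: e_def algebra_simps)
    then have "cmod ?D \<ge> cmod (of_real s * cnj p * (p - z)) - cmod (of_real e)"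
      by (metis add.commute norm_diff_ineq)
    moreover have "cmod (of_real s * cnj p * (p - z)) \<ge> s * d"
      using p s z(2) by (simp add: norm_mult dist_norm)
    moreover have "s * d = 6" using d by (simp add: s_def)
    ultimately have D5: "cmod ?D \<ge> 5" using e0 e1 by simp
    have "cmod (z + p) \<le> 2" using norm_triangle_ineq[of z p] z p by simp
    then have "e * cmod (z + p) \<le> 1 * 2" using e0 e1 by (intro mult_mono) auto
    then have "cmod (su_act ?g z + p) \<le> 2 / cmod ?D"
      using e0 unfolding eq by (simp add: norm_divide norm_mult divide_right_mono)
    also have "\<dots> \<le> 2 / 5" using D5 by (intro divide_left_mono) auto
    finally have "cmod (su_act ?g z + p) < 1/2" by simp
    moreover have "- p - su_act ?g z = - (su_act ?g z + p)" by simp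
    ultimately show ?thesis by (simp only: dist_norm norm_minus_cancel)
  qed
  then show ?thesis using that g by blast
qed

section \<open>The Reeh-Schlieder theorem for a Moebius net\<close>

context moebius_net
begin

sublocale V: hilbert_space "vac_space N" by (rule vac_hilbert)

definition vac_vecs :: "complex set \<Rightarrow> 'h set" where
  "vac_vecs I = {x (vacuum N) | x. x \<in> local_alg N I}"

lemma local_bop: "\<lbrakk>I \<in> arcs; x \<in> local_alg N I\<rbrakk> \<Longrightarrow> x \<in> bounded_ops (vac_space N) (vac_space N)"
  using vN_bop local_vN by blast

lemma vac_vecs_carrier: "I \<in> arcs \<Longrightarrow> vac_vecs I \<subseteq> carrier (vac_space N)"
  using bop_in[OF local_bop vacuum_unit(1)] by (auto simp: vac_vecs_def)

text \<open>Puts eigenvectors of the rotations into the domain of the generator, with the frequency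
  as eigenvalue.\<close>

lemma rot_quotient_limit:
  "((\<lambda>t::real. (cis (r * t) - 1) / (\<i> * of_real t)) \<longlongrightarrow> of_real r) (at 0)"
proof -
  have "((\<lambda>z. exp (\<i> * of_real r * z)) has_field_derivative (\<i> * of_real r) * exp (\<i> * of_real r * 0)) (at 0)"
    by (auto intro!: derivative_eq_intros)
  then have "((\<lambda>h. (exp (\<i> * of_real r * h) - 1) / h) \<longlongrightarrow> \<i> * of_real r) (at 0)"
    by (simp add: DERIV_def)
  then have "((\<lambda>t::real. (exp (\<i> * of_real r * of_real t) - 1) / of_real t) \<longlongrightarrow> \<i> * of_real r) (at 0)"
    by (rule filterlim_compose) (auto simp: filterlim_at eventually_at_filter intro!: tendsto_eq_intros)
  then have "((\<lambda>t::real. (exp (\<i> * of_real r * of_real t) - 1) / of_real t / \<i>) \<longlongrightarrow> \<i> * of_real r / \<i>) (at 0)"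
    by (intro tendsto_intros) auto
  moreover have "(cis (r * t) - 1) / (\<i> * of_real t) = (exp (\<i> * of_real r * of_real t) - 1) / of_real t / \<i>" for t
    by (simp only: cis_conv_exp of_real_mult mult.assoc divide_divide_eq_left mult.commute[of "complex_of_real t" "\<i>"])
  ultimately show ?thesis by simp
qed

context
  fixes U assumes U: "moebius_covariant N U"
begin

lemma U_rep: "PSU11_unitary_rep (vac_space N) U"
  using U by (simp add: moebius_covariant_def)

lemma U_unitary: "g \<in> SU11 \<Longrightarrow> U g \<in> unitary_ops (vac_space N) (vac_space N)"
  using U_rep by (simp add: PSU11_unitary_rep_def)

lemmas U_D = unitary_opsD[OF vac_hilbert vac_hilbert U_unitary]

lemma U_in: "\<lbrakk>g \<in> SU11; x \<in> carrier (vac_space N)\<rbrakk> \<Longrightarrow> U g x \<in> carrier (vac_space N)"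
  by (rule bop_in[OF U_D(1)])

lemma U_vac: "g \<in> SU11 \<Longrightarrow> U g (vacuum N) = vacuum N"
  using U by (simp add: moebius_covariant_def)

lemma U_adj_vac: "g \<in> SU11 \<Longrightarrow> adj (vac_space N) (vac_space N) (U g) (vacuum N) = vacuum N"
  using U_D(2)[of g "vacuum N"] U_vac vacuum_unit by simp

lemma U_mult:
  assumes "g \<in> SU11" "h \<in> SU11" "x \<in> carrier (vac_space N)"
  shows "U (su_mult g h) x = U g (U h x)"
proof -
  have "U (su_mult g h) = compose (carrier (vac_space N)) (U g) (U h)"
    using U_rep assms by (simp add: PSU11_unitary_rep_def)
  then show ?thesis using assms(3) by simp
qed

lemma covariant_vec:
  assumes g: "g \<in> SU11" and I: "I \<in> arcs"
  shows "vac_vecs (su_act g ` I) = U g ` vac_vecs I"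
proof -
  have "local_alg N (su_act g ` I) = {compose (carrier (vac_space N)) (U g)
           (compose (carrier (vac_space N)) X (adj (vac_space N) (vac_space N) (U g))) | X. X \<in> local_alg N I}"
    using U g I by (simp add: moebius_covariant_def)
  moreover have "compose (carrier (vac_space N)) (U g)
      (compose (carrier (vac_space N)) X (adj (vac_space N) (vac_space N) (U g))) (vacuum N) = U g (X (vacuum N))" for X
    using g by (simp add: vacuum_unit(1) U_adj_vac)
  ultimately show ?thesis unfolding vac_vecs_def by (auto simp: image_iff) metis+
qed

lemma rotations: "positive_rotations (vac_space N) (\<lambda>t. U (su_rot t))"
proof
  note [simp] = su_rot_in U_in
  show "U (su_rot t) \<in> bounded_ops (vac_space N) (vac_space N)" for t by (rule U_D(1)) simp
  show i: "hinner (vac_space N) (U (su_rot t) x) (U (su_rot t) y) = hinner (vac_space N) x y"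
    if "x \<in> carrier (vac_space N)" "y \<in> carrier (vac_space N)" for x y t
    using that by (intro U_D(4)) auto
  show a: "U (su_rot (s + t)) x = U (su_rot s) (U (su_rot t) x)" if "x \<in> carrier (vac_space N)" for x s t
    using that U_mult[of "su_rot s" "su_rot t" x] by (simp add: su_rot_mult)
  show "U (su_rot 0) x = x" if x: "x \<in> carrier (vac_space N)" for x
  proof -
    \<comment> \<open>\<open>U\<close> of the unit element is idempotent by multiplicativity and
      invertible by unitarity, hence the identity.\<close>
    have "U (su_rot 0) (U (su_rot 0) x) = U (su_rot 0) x" using a[OF x, of 0 0] by simp
    then show ?thesis using U_D(2)[of "su_rot 0" "U (su_rot 0) x"] U_D(2)[of "su_rot 0" x] x by simp
  qed
  show "U (su_rot (t + 2 * pi)) x = U (su_rot t) x" for t x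
    using U_rep by (simp add: su_rot_period PSU11_unitary_rep_def)
  show "continuous_on UNIV (\<lambda>t. hinner (vac_space N) (U (su_rot t) x) y)"
    if x: "x \<in> carrier (vac_space N)" and y: "y \<in> carrier (vac_space N)" for x y
  proof -
    have "continuous_map euclideanreal (top_of_set SU11) su_rot"
      by (auto simp: continuous_map_in_subtopology su_rot_def intro!: continuous_intros su_rot_in[unfolded su_rot_def])
    moreover have "continuous_map (top_of_set SU11) (htop (vac_space N)) (\<lambda>g. U g x)"
      using U_rep x by (simp add: PSU11_unitary_rep_def)
    ultimately have c: "continuous_map euclideanreal (htop (vac_space N)) (\<lambda>t. U (su_rot t) x)"
      using continuous_map_compose by (fastforce simp: o_def)
    show ?thesis
      unfolding continuous_on_iff
    proof (intro ballI allI impI)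
      fix t and e :: real assume e: "e > 0"
      let ?r = "e / (hnorm (vac_space N) y + 1)"
      have ny: "hnorm (vac_space N) y + 1 > 0" using y by (simp add: add_nonneg_pos)
      then have r: "?r > 0" using e by simp
      obtain T where T: "open T" "t \<in> T"
        "\<And>u. u \<in> T \<Longrightarrow> U (su_rot u) x \<in> V.MH.mball (U (su_rot t) x) ?r"
      proof -
        have "\<exists>T. openin euclideanreal T \<and> t \<in> T \<and>
            (\<forall>u\<in>T. U (su_rot u) x \<in> V.MH.mball (U (su_rot t) x) ?r)"
          using c[unfolded V.MH.continuous_map_to_metric, THEN bspec, of t] r by simp
        then show thesis using that by (auto simp del: V.MH.in_mball)
      qed
      obtain d where d: "d > 0" "\<And>u. dist u t < d \<Longrightarrow> u \<in> T" using T(1,2) unfolding open_dist by blast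
      show "\<exists>d>0. \<forall>u\<in>UNIV. dist u t < d \<longrightarrow>
          dist (hinner (vac_space N) (U (su_rot u) x) y) (hinner (vac_space N) (U (su_rot t) x) y) < e"
      proof (intro exI[of _ d] conjI ballI impI)
        fix u assume u: "dist u t < d"
        have b: "hnorm (vac_space N) (U (su_rot t) x \<ominus>\<^bsub>vac_space N\<^esub> U (su_rot u) x) < ?r"
          using T(3)[OF d(2)[OF u]] x by (simp add: V.MH.in_mball hdist_def)
        have "dist (hinner (vac_space N) (U (su_rot u) x) y) (hinner (vac_space N) (U (su_rot t) x) y)
            = cmod (hinner (vac_space N) (U (su_rot t) x \<ominus>\<^bsub>vac_space N\<^esub> U (su_rot u) x) y)"
          using x y by (simp add: dist_norm V.inner_diff_left norm_minus_commute)
        also have "\<dots> \<le> hnorm (vac_space N) (U (su_rot t) x \<ominus>\<^bsub>vac_space N\<^esub> U (su_rot u) x) * hnorm (vac_space N) y"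
          using x y by (intro V.cauchy_schwarz) auto
        also have "\<dots> \<le> hnorm (vac_space N) (U (su_rot t) x \<ominus>\<^bsub>vac_space N\<^esub> U (su_rot u) x) * (hnorm (vac_space N) y + 1)"
          using x y by (intro mult_left_mono) auto
        also have "\<dots> < e" using b ny by (simp add: pos_less_divide_eq)
        finally show "dist (hinner (vac_space N) (U (su_rot u) x) y) (hinner (vac_space N) (U (su_rot t) x) y) < e" .
      qed (rule d)
    qed
  qed
  show "e = \<zero>\<^bsub>vac_space N\<^esub>" if e: "e \<in> carrier (vac_space N)"
    "\<And>t. U (su_rot t) e = cis (real_of_int n * t) \<odot>\<^bsub>vac_space N\<^esub> e" and n: "n < 0" for e n
  proof -
    let ?q = "\<lambda>t. (cis (real_of_int n * t) - 1) / (\<i> * complex_of_real t)"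
    let ?f = "\<lambda>t::real. (1 / (\<i> * of_real t)) \<odot>\<^bsub>vac_space N\<^esub> (U (su_rot t) e \<ominus>\<^bsub>vac_space N\<^esub> e)"
    have f: "?f t = ?q t \<odot>\<^bsub>vac_space N\<^esub> e" for t
      by (rule V.hilbert_eqI) (use e in \<open>simp_all add: V.inner_simps algebra_simps diff_divide_distrib\<close>)
    let ?l = "of_int n \<odot>\<^bsub>vac_space N\<^esub> e"
    have hd: "hdist (vac_space N) (?f t) ?l = cmod (?q t - of_int n) * hnorm (vac_space N) e" for t
    proof -
      have "?q t \<odot>\<^bsub>vac_space N\<^esub> e \<ominus>\<^bsub>vac_space N\<^esub> ?l = (?q t - of_int n) \<odot>\<^bsub>vac_space N\<^esub> e"
        by (rule V.hilbert_eqI) (use e in \<open>simp_all add: V.inner_simps algebra_simps\<close>)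
      then show ?thesis using e unfolding f by (simp add: hdist_def V.hnorm_smult)
    qed
    \<comment> \<open>On an eigenvector of frequency \<open>n\<close> the difference quotient is a
      scalar multiple of \<open>e\<close>, and its limit is \<open>n e\<close>. Positivity then
      reads \<open>0 \<le> n |e|^2\<close>.\<close>
    have "limitin (htop (vac_space N)) ?f ?l (at 0)"
      unfolding V.MH.limitin_metric
    proof (intro conjI allI impI)
      fix \<epsilon> :: real assume eps: "\<epsilon> > 0"
      have "((\<lambda>t. cmod (?q t - of_int n) * hnorm (vac_space N) e) \<longlongrightarrow> cmod (of_int n - of_int n) * hnorm (vac_space N) e) (at 0)"
        using rot_quotient_limit[of "real_of_int n"] by (intro tendsto_intros) simp
      then have "\<forall>\<^sub>F t in at 0. cmod (?q t - of_int n) * hnorm (vac_space N) e < \<epsilon>"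
        using eps by (simp add: order_tendstoD(2))
      then show "\<forall>\<^sub>F t in at 0. ?f t \<in> carrier (vac_space N) \<and> hdist (vac_space N) (?f t) ?l < \<epsilon>"
        by eventually_elim (use e hd in simp)
    qed (use e in simp)
    then have "(e, ?l) \<in> rot_generator (vac_space N) U" using e by (simp add: rot_generator_def)
    then have "0 \<le> Re (hinner (vac_space N) ?l e)" using U unfolding moebius_covariant_def by fastforce
    then have "0 \<le> real_of_int n * (hnorm (vac_space N) e)\<^sup>2" using e by (simp add: V.inner_simps V.hnorm_sq)
    then have "(hnorm (vac_space N) e)\<^sup>2 \<le> 0" using n by (simp add: zero_le_mult_iff)
    then show ?thesis using V.hnorm_eq_0[OF e(1)] by simp
  qed
qed

text \<open>A vector orthogonal to \<open>A(I) Om\<close> is orthogonal to \<open>U(t) s\<close> for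
  all angles \<open>t\<close> near \<open>t0\<close>; by analyticity it is so for every
  \<open>t\<close>, in particular for \<open>t = 0\<close>. The angle \<open>t0\<close> may be
  large, only a small interval around it has to move \<open>J\<close> into \<open>I\<close>.\<close>

lemma perp_rotation:
  assumes I: "I \<in> arcs" and J: "J \<in> arcs" and d: "d > 0"
    and sub: "\<And>t. \<bar>t - t0\<bar> < d \<Longrightarrow> (\<lambda>z. cis t * z) ` J \<subseteq> I"
  shows "perp (vac_space N) (vac_vecs I) \<subseteq> perp (vac_space N) (vac_vecs J)"
proof
  interpret R: positive_rotations "vac_space N" "\<lambda>t. U (su_rot t)" by (rule rotations)
  fix z assume z: "z \<in> perp (vac_space N) (vac_vecs I)"
  then have zc: "z \<in> carrier (vac_space N)" by (simp add: perp_def)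
  have "hinner (vac_space N) s z = 0" if s: "s \<in> vac_vecs J" for s
  proof -
    have sc: "s \<in> carrier (vac_space N)" using s vac_vecs_carrier[OF J] by blast
    have "hinner (vac_space N) (U (su_rot t) (U (su_rot t0) s)) z = 0" if t: "\<bar>t\<bar> < d" for t
    proof -
      let ?J = "su_act (su_rot (t + t0)) ` J"
      have "?J \<subseteq> I" using sub[of "t + t0"] t by (simp add: su_rot_act)
      then have "vac_vecs ?J \<subseteq> vac_vecs I"
        using isotony[OF su_act_arcs[OF su_rot_in J] I, of "t + t0"] by (auto simp: vac_vecs_def)
      moreover have "U (su_rot (t + t0)) s \<in> vac_vecs ?J"
        using covariant_vec[OF su_rot_in J] s by blast
      ultimately show ?thesis using z R.W_add[OF sc, of t t0] by (auto simp: perp_def)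
    qed
    then have "hinner (vac_space N) (U (su_rot (- t0)) (U (su_rot t0) s)) z = 0"
      using R.orbit_orthogonal[of "U (su_rot t0) s" z d] sc zc d by simp
    then show ?thesis using R.W_add[OF sc, of "- t0" t0] R.W_zero[OF sc] by simp
  qed
  then show "z \<in> perp (vac_space N) (vac_vecs J)" using zc by (simp add: perp_def)
qed

text \<open>\<open>U g\<close> is unitary and fixes the vacuum, so the inclusion may be checked
  after a Moebius map. Rotations alone cannot fit a long arc \<open>J\<close> into a short arc
  \<open>I\<close>.\<close>

lemma perp_covariant:
  assumes g: "g \<in> SU11" and I: "I \<in> arcs" and J: "J \<in> arcs"
    and sub: "perp (vac_space N) (vac_vecs (su_act g ` I)) \<subseteq> perp (vac_space N) (vac_vecs (su_act g ` J))"
  shows "perp (vac_space N) (vac_vecs I) \<subseteq> perp (vac_space N) (vac_vecs J)"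
proof
  fix z assume z: "z \<in> perp (vac_space N) (vac_vecs I)"
  then have zc: "z \<in> carrier (vac_space N)" by (simp add: perp_def)
  have eq: "hinner (vac_space N) (U g s) (U g z) = hinner (vac_space N) s z"
    if "s \<in> vac_vecs K" "K \<in> arcs" for s K
    using U_D(4)[OF g _ zc] that vac_vecs_carrier by blast
  have "U g z \<in> perp (vac_space N) (vac_vecs (su_act g ` I))"
    using z zc eq[OF _ I] U_in[OF g zc] by (auto simp: perp_def covariant_vec[OF g I])
  then have "U g z \<in> perp (vac_space N) (vac_vecs (su_act g ` J))" using sub by blast
  then show "z \<in> perp (vac_space N) (vac_vecs J)"
    using zc eq[OF _ J] by (auto simp: perp_def covariant_vec[OF g J])
qed

text \<open>The dilation that repels from \<open>p\<close> shrinks \<open>J\<close> into a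
  neighbourhood of \<open>- p\<close> and enlarges \<open>I\<close> to nearly the whole circle.
  After it, rotations by angles near \<open>pi\<close> carry the image of \<open>J\<close> into the
  image of \<open>I\<close>.\<close>

lemma perp_step:
  assumes I: "I \<in> arcs" and J: "J \<in> arcs" and p: "p \<in> I" "p \<notin> closure J"
  shows "perp (vac_space N) (vac_vecs I) \<subseteq> perp (vac_space N) (vac_vecs J)"
proof -
  have pc: "p \<in> circle" using arcs_subset_circle[OF I] p by blast
  obtain W where W: "open W" "I = circle \<inter> W" using I by (auto simp: arcs_def openin_open)
  have "open (W \<inter> - closure J)" using W by auto
  then obtain d where d: "d > 0" "\<And>z. dist z p < d \<Longrightarrow> z \<in> W \<inter> - closure J"
    using p W unfolding open_dist by blast
  obtain g where g: "g \<in> SU11" "\<And>z. \<lbrakk>z \<in> circle; d \<le> dist p z\<rbrakk> \<Longrightarrow> dist (- p) (su_act g z) < 1/2"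
    using dilation[OF pc d(1)] by blast
  have "(\<lambda>z. cis t * z) ` su_act g ` J \<subseteq> su_act g ` I" if t: "\<bar>t - pi\<bar> < 1/2" for t
  proof
    fix w assume "w \<in> (\<lambda>z. cis t * z) ` su_act g ` J"
    then obtain z where z: "z \<in> J" "w = cis t * su_act g z" by blast
    have zc: "z \<in> circle" using arcs_subset_circle[OF J] z by blast
    let ?u = "su_act g z"
    have uc: "?u \<in> circle" by (rule su_act_circle[OF g(1) zc])
    then have wc: "w \<in> circle" using z by (simp add: norm_mult)
    have "d \<le> dist p z" using d(2)[of z] z closure_subset[of J] by (force simp: dist_commute)
    then have u: "cmod (?u + p) < 1/2" using g(2)[OF zc] by (simp add: dist_norm)
      (metis add.commute add_uminus_conv_diff minus_add_distrib norm_minus_cancel)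
    have "cmod (cis t + 1) \<le> \<bar>t - pi\<bar>"
    proof -
      have "cis t + 1 = cis t - cis pi" by simp
      then have "cmod (cis t + 1) = cmod (exp (\<i> * of_real t) - exp (\<i> * of_real pi))"
        by (simp add: cis_conv_exp)
      also have "\<dots> \<le> \<bar>t - pi\<bar>"
      proof -
        have "cmod (exp (\<i> * of_real t) - exp (\<i> * of_real pi)) = 2 * \<bar>sin ((t - pi) / 2)\<bar>"
          using dist_exp_i_1[of "t - pi"] norm_minus_cancel[of "exp (\<i> * of_real t) + 1"]
            by (simp add: norm_divide exp_diff right_diff_distrib del: norm_minus_cancel)
        also have "\<dots> \<le> 2 * \<bar>(t - pi) / 2\<bar>" using abs_sin_x_le_abs_x[of "(t - pi) / 2"] by simp
        finally show ?thesis by simp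
      qed
      finally show ?thesis .
    qed
    then have c: "cmod (cis t + 1) < 1/2" using t by linarith
    have "w - p = (cis t + 1) * ?u - (?u + p)" by (simp add: z(2) algebra_simps)
    then have "cmod (w - p) \<le> cmod (cis t + 1) * cmod ?u + cmod (?u + p)"
      by (metis norm_mult norm_triangle_ineq4)
    then have wp: "cmod (w - p) < 1" using u c uc by simp
    obtain y where y: "y \<in> circle" "su_act g y = w"
      using su_homeo[OF g(1)] wc unfolding homeomorphism_def by blast
    \<comment> \<open>Otherwise \<open>w\<close> would be within \<open>1/2\<close> of
      \<open>- p\<close>, while it is within \<open>1\<close> of \<open>p\<close>; but
      \<open>p\<close> and \<open>- p\<close> have distance \<open>2\<close>.\<close>
    have "dist p y < d"
    proof (rule ccontr)
      assume "\<not> dist p y < d"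
      then have "cmod (- p - w) < 1/2" using g(2)[OF y(1)] y(2) by (simp add: dist_norm)
      moreover have "cmod ((w - p) + (- p - w)) \<le> cmod (w - p) + cmod (- p - w)" by (rule norm_triangle_ineq)
      moreover have "cmod ((w - p) + (- p - w)) = 2"
      proof -
        have "(w - p) + (- p - w) = - 2 * p" by simp
        then have "cmod ((w - p) + (- p - w)) = 2 * cmod p" by (simp only: norm_mult) simp
        then show ?thesis using pc by simp
      qed
      ultimately show False using wp by simp
    qed
    then have "y \<in> I" using d(2)[of y] W y(1) by (simp add: dist_commute)
    then show "w \<in> su_act g ` I" using y by blast
  qed
  then have "perp (vac_space N) (vac_vecs (su_act g ` I)) \<subseteq> perp (vac_space N) (vac_vecs (su_act g ` J))"
    by (intro perp_rotation[where d = "1/2" and ?t0.0 = pi] su_act_arcs g I J) auto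
  then show ?thesis by (rule perp_covariant[OF g(1) I J])
qed

text \<open>\<open>perp_step\<close> needs a point of \<open>I\<close> off the closure of
  \<open>J\<close>. If there is none, a short arc \<open>M\<close> outside the closure of
  \<open>J\<close> is interposed, and the step applies from \<open>I\<close> to \<open>M\<close> and
  from \<open>M\<close> to \<open>J\<close>.\<close>

lemma perp_all:
  assumes I: "I \<in> arcs" and J: "J \<in> arcs"
  shows "perp (vac_space N) (vac_vecs I) \<subseteq> perp (vac_space N) (vac_vecs J)"
proof (cases "I \<subseteq> closure J")
  case False
  then show ?thesis using perp_step[OF I J] by blast
next
  case True
  obtain a b where ab: "a < b" "b < a + 2 * pi" "J = arc_of a b" using arc_form[OF J] by blast
  \<comment> \<open>The midpoint of the complement of \<open>J\<close>; with \<open>h\<close> a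
    quarter of its length, \<open>M\<close> occupies its middle half and keeps away from
    \<open>J\<close>.\<close>
  define c where "c = (b + a + 2 * pi) / 2"
  define h where "h = (a + 2 * pi - b) / 4"
  have h: "h > 0" using ab by (simp add: h_def)
  let ?M = "arc_of (c - h) (c + h)"
  have M: "?M \<in> arcs" 
  proof (rule arc_of_in)
    have "h < pi" using ab by (simp add: h_def)
    then show "c + h < c - h + 2 * pi" by simp
  qed (use h in simp)
  have disj: "closure J \<inter> cis ` {c - h..c + h} = {}"
  proof -
    have "cis t \<noteq> cis u" if "t \<in> {a..b}" "u \<in> {c - h..c + h}" for t u
    proof
      assume "cis t = cis u"
      have "t < u" "u < t + 2 * pi" using that ab by (auto simp: c_def h_def field_simps)
      then have "t = u" using \<open>cis t = cis u\<close> by (intro cis_inj) auto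
      then show False using \<open>t < u\<close> by simp
    qed
    then have "cis ` {a..b} \<inter> cis ` {c - h..c + h} = {}" by blast
    then show ?thesis using closure_arc_of[of a b] unfolding ab(3) by auto
  qed
  obtain p where p: "p \<in> I" using I by (auto simp: arcs_def)
  then have "p \<notin> closure ?M" using True disj closure_arc_of[of "c - h" "c + h"] by blast
  then have 1: "perp (vac_space N) (vac_vecs I) \<subseteq> perp (vac_space N) (vac_vecs ?M)"
    by (rule perp_step[OF I M p])
  have "cis c \<in> ?M" "cis c \<in> cis ` {c - h..c + h}" using h by (auto simp: arc_of_def)
  then have "perp (vac_space N) (vac_vecs ?M) \<subseteq> perp (vac_space N) (vac_vecs J)"
    using disj by (intro perp_step[OF M J, of "cis c"]) auto
  with 1 show ?thesis by blast
qed

end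

text \<open>The complement of \<open>A(J) Om\<close> is the same for all \<open>J\<close>, hence
  invariant under every \<open>A(J)\<close>, so its projection \<open>P\<close> lies in the
  commutant of the net. As \<open>Om\<close> itself belongs to \<open>A(I) Om\<close>,
  \<open>P\<close> kills \<open>Om\<close>, and then the complement is orthogonal to the vectors
  generated from the cyclic vacuum.\<close>

theorem Reeh_Schlieder:
  assumes I: "I \<in> arcs" shows "total_in (vac_space N) (vac_vecs I)"
proof -
  obtain U where U: "moebius_covariant N U" using covariance by blast
  let ?N = "perp (vac_space N) (vac_vecs I)"
  have eq: "perp (vac_space N) (vac_vecs J) = ?N" if "J \<in> arcs" for J
    using perp_all[OF U] that I by blast
  have inv: "x z \<in> ?N" if J: "J \<in> arcs" and x: "x \<in> local_alg N J" and z: "z \<in> ?N" for J x z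
  proof -
    note xb = local_bop[OF J x]
    have zJ: "z \<in> perp (vac_space N) (vac_vecs J)" using eq[OF J] z by simp
    then have zc: "z \<in> carrier (vac_space N)" by (simp add: perp_def)
    have "hinner (vac_space N) s (x z) = 0" if s: "s \<in> vac_vecs J" for s
    proof -
      obtain y where y: "y \<in> local_alg N J" "s = y (vacuum N)" using s by (auto simp: vac_vecs_def)
      have sc: "s \<in> carrier (vac_space N)" using s vac_vecs_carrier[OF J] by blast
      have "compose (carrier (vac_space N)) (adj (vac_space N) (vac_space N) x) y \<in> local_alg N J"
        by (intro vN_compose[OF vac_hilbert local_vN[OF J]] vN_adj[OF local_vN[OF J]] x y)
      then have "adj (vac_space N) (vac_space N) x s \<in> vac_vecs J"
        unfolding vac_vecs_def y(2) using compose_apply[OF vacuum_unit(1)] by (metis (mono_tags, lifting) mem_Collect_eq)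
      then have "hinner (vac_space N) (adj (vac_space N) (vac_space N) x s) z = 0" using zJ by (simp add: perp_def)
      then show ?thesis using adj_ip2[OF vac_hilbert vac_hilbert xb zc sc] by simp
    qed
    then have "x z \<in> perp (vac_space N) (vac_vecs J)" using bop_in[OF xb zc] by (simp add: perp_def)
    then show ?thesis using eq[OF J] by simp
  qed
  obtain P where P: "P \<in> bounded_ops (vac_space N) (vac_space N)"
    "\<And>x. x \<in> carrier (vac_space N) \<Longrightarrow> P x \<in> ?N" "\<And>x. x \<in> ?N \<Longrightarrow> P x = x"
    "\<And>x y. \<lbrakk>x \<in> carrier (vac_space N); y \<in> carrier (vac_space N)\<rbrakk>
      \<Longrightarrow> hinner (vac_space N) (P x) y = hinner (vac_space N) x (P y)"
    by (rule V.perp_projection[OF vac_vecs_carrier[OF I]]) (rule that)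
  let ?A = "\<Union>I\<in>arcs. local_alg N I"
  have Pc: "P \<in> commutant (vac_space N) ?A"
  proof (rule commutantI[OF P(1)])
    fix X x assume X: "X \<in> ?A" and x: "x \<in> carrier (vac_space N)"
    then obtain J where J: "J \<in> arcs" "X \<in> local_alg N J" by blast
    show "P (X x) = X (P x)"
      by (rule V.projection_commute[OF P local_bop[OF J] inv[OF J] inv[OF J(1) vN_adj[OF local_vN[OF J(1)] J(2)]] x])
  qed
  have PO: "P (vacuum N) = \<zero>\<^bsub>vac_space N\<^esub>"
  proof -
    let ?w = "P (vacuum N)"
    have w: "?w \<in> ?N" "?w \<in> carrier (vac_space N)" using P(2)[OF vacuum_unit(1)] by (auto simp: perp_def)
    have "vacuum N \<in> vac_vecs I"
      unfolding vac_vecs_def using vN_ident[OF vac_hilbert local_vN[OF I]] ident_apply[OF vacuum_unit(1)]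
      by (metis (mono_tags, lifting) mem_Collect_eq)
    then have "hinner (vac_space N) (vacuum N) ?w = 0" using w by (simp add: perp_def)
    then have "hinner (vac_space N) ?w ?w = 0"
      using P(4)[OF vacuum_unit(1) w(2)] P(3)[OF w(1)] by simp
    then show ?thesis using w(2) V.inner_definite by blast
  qed
  have "z = \<zero>\<^bsub>vac_space N\<^esub>" if z: "z \<in> ?N" for z
  proof -
    have zc: "z \<in> carrier (vac_space N)" using z by (simp add: perp_def)
    let ?M = "commutant (vac_space N) (commutant (vac_space N) ?A)"
    have "total_in (vac_space N) {X (vacuum N) | X. X \<in> ?M}"
      using vacuum_cyclic V.dense_in_total by (simp add: cyclic_vec_def)
    moreover have "hinner (vac_space N) (X (vacuum N)) z = 0" if X: "X \<in> ?M" for X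
    proof -
      note Xb = commutant_bop[OF X]
      have "hinner (vac_space N) (X (vacuum N)) z = hinner (vac_space N) (P (X (vacuum N))) z"
        using P(3)[OF z] P(4)[OF bop_in[OF Xb vacuum_unit(1)] zc] by simp
      also have "P (X (vacuum N)) = X (P (vacuum N))" using commutantD[OF X Pc vacuum_unit(1)] by simp
      also have "\<dots> = \<zero>\<^bsub>vac_space N\<^esub>" using PO bop_zero[OF vac_hilbert vac_hilbert Xb] by simp
      finally show ?thesis using zc by simp
    qed
    ultimately show ?thesis using zc unfolding total_in_def by blast
  qed
  then show ?thesis using vac_vecs_carrier[OF I] by (simp add: total_in_def perp_def)
qed

end

section \<open>Fusion\<close>

lemma module_hilbert: "net_module N i \<Longrightarrow> hilbert_space i"
  by (simp add: net_module_def)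

lemma lhom_bop: "T \<in> local_hom N I i j \<Longrightarrow> T \<in> bounded_ops i j"
  by (simp add: local_hom_def)

lemma nhom_bop: "T \<in> net_hom N i j \<Longrightarrow> T \<in> bounded_ops i j"
  by (simp add: net_hom_def)

lemma nhom_lhom: "\<lbrakk>T \<in> net_hom N i j; I \<in> arcs\<rbrakk> \<Longrightarrow> T \<in> local_hom N I i j"
  by (simp add: net_hom_def)

lemmas lhom_in = bop_in[OF lhom_bop]
lemmas nhom_in = bop_in[OF nhom_bop]

lemma lhom_act:
  assumes "T \<in> local_hom N I i j" "x \<in> local_alg N I" "\<xi> \<in> carrier i"
  shows "T (act i I x \<xi>) = act j I x (T \<xi>)"
proof -
  have "compose (carrier i) T (act i I x) = compose (carrier i) (act j I x) T"
    using assms by (simp add: local_hom_def)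
  then have "compose (carrier i) T (act i I x) \<xi> = compose (carrier i) (act j I x) T \<xi>" by simp
  then show ?thesis using assms(3) by simp
qed

lemma lhomI:
  assumes "T \<in> bounded_ops i j"
    "\<And>x \<xi>. \<lbrakk>x \<in> local_alg N I; \<xi> \<in> carrier i\<rbrakk> \<Longrightarrow> T (act i I x \<xi>) = act j I x (T \<xi>)"
  shows "T \<in> local_hom N I i j"
  using assms by (auto simp: local_hom_def compose_def intro!: restrict_ext)

lemma nhomI:
  assumes "\<And>I. I \<in> arcs \<Longrightarrow> T \<in> local_hom N I i j"
  shows "T \<in> net_hom N i j"
proof -
  \<comment> \<open>Boundedness has to be read off from one arc, so an arc must be
    exhibited.\<close>
  have "arc_of 0 1 \<in> arcs" using pi_gt3 by (intro arc_of_in) auto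
  then have "T \<in> bounded_ops i j" by (rule lhom_bop[OF assms])
  then show ?thesis using assms by (simp add: net_hom_def)
qed

lemma local_vecsI: "T \<in> local_hom N (arc_compl I) (vac_module N) i \<Longrightarrow> T (vacuum N) \<in> local_vecs N i I"
  by (auto simp: local_vecs_def)

lemma module_normal: "\<lbrakk>net_module N i; I \<in> arcs\<rbrakk> \<Longrightarrow> normal_rep (vac_space N) (local_alg N I) i (act i I)"
  by (simp add: net_module_def)

lemma act_bop: "\<lbrakk>net_module N i; I \<in> arcs; x \<in> local_alg N I\<rbrakk> \<Longrightarrow> act i I x \<in> bounded_ops i i"
  using module_normal unfolding normal_rep_def by blast

lemmas act_in = bop_in[OF act_bop]

lemma act_adj: "\<lbrakk>net_module N i; I \<in> arcs; x \<in> local_alg N I\<rbrakk>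
    \<Longrightarrow> act i I (adj (vac_space N) (vac_space N) x) = adj i i (act i I x)"
  using module_normal unfolding normal_rep_def by blast

lemma act_mono: "\<lbrakk>net_module N i; I \<in> arcs; J \<in> arcs; I \<subseteq> J; x \<in> local_alg N I\<rbrakk>
    \<Longrightarrow> act i J x = act i I x"
  unfolding net_module_def by blast

lemma lhom_compose:
  assumes "net_module N i" "net_module N j" "T \<in> local_hom N I i j" "S \<in> local_hom N I j k" "I \<in> arcs"
  shows "compose (carrier i) S T \<in> local_hom N I i k"
proof (rule lhomI)
  show "compose (carrier i) S T \<in> bounded_ops i k"
    by (rule bop_compose[OF module_hilbert[OF assms(1)] module_hilbert[OF assms(2)] lhom_bop[OF assms(3)] lhom_bop[OF assms(4)]])
  fix x \<xi> assume x: "x \<in> local_alg N I" and \<xi>: "\<xi> \<in> carrier i"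
  show "compose (carrier i) S T (act i I x \<xi>) = act k I x (compose (carrier i) S T \<xi>)"
    using \<xi> act_in[OF assms(1,5) x \<xi>] lhom_act[OF assms(3) x \<xi>] lhom_act[OF assms(4) x lhom_in[OF assms(3) \<xi>]]
    by simp
qed

lemma nhom_compose:
  assumes "net_module N i" "net_module N j" "T \<in> net_hom N i j" "S \<in> net_hom N j k"
  shows "compose (carrier i) S T \<in> net_hom N i k"
  by (rule nhomI) (intro lhom_compose[OF assms(1,2)] nhom_lhom assms)

lemma nhom_ident: "net_module N i \<Longrightarrow> ident i \<in> net_hom N i i"
  by (rule nhomI, rule lhomI) (auto simp: act_in module_hilbert)

lemma adj_commute:
  assumes "hilbert_space H" "hilbert_space K" "T \<in> bounded_ops H K" "X \<in> bounded_ops H H" "Y \<in> bounded_ops K K"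
    "\<And>x. x \<in> carrier H \<Longrightarrow> T (adj H H X x) = adj K K Y (T x)" "y \<in> carrier K"
  shows "adj H K T (Y y) = X (adj H K T y)"
proof -
  interpret H: hilbert_space H by fact
  interpret K: hilbert_space K by fact
  note A = adj_bop[OF assms(1,2,3)] adj_bop[OF assms(1,1,4)] adj_bop[OF assms(2,2,5)]
  note [simp] = bop_in[OF assms(3)] bop_in[OF assms(4)] bop_in[OF assms(5)] bop_in[OF A(1)] bop_in[OF A(2)] bop_in[OF A(3)]
  have tot: "total_in H (carrier H)" unfolding total_in_def using H.inner_definite by blast
  show ?thesis
  proof (rule H.hilbert_eqI_total[OF _ _ tot])
    fix x assume x: "x \<in> carrier H"
    have "hinner H x (adj H K T (Y y)) = hinner K (T x) (Y y)" using adj_ip[OF assms(1-3)] x assms(7) by simp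
    also have "\<dots> = hinner K (adj K K Y (T x)) y" using adj_ip2[OF assms(2,2,5)] x assms(7) by simp
    also have "\<dots> = hinner K (T (adj H H X x)) y" using assms(6)[OF x] by simp
    also have "\<dots> = hinner H (adj H H X x) (adj H K T y)" using adj_ip[OF assms(1-3)] x assms(7) by simp
    also have "\<dots> = hinner H x (X (adj H K T y))" using adj_ip2[OF assms(1,1,4)] x assms(7) by simp
    finally show "hinner H x (adj H K T (Y y)) = hinner H x (X (adj H K T y))" .
  qed (use assms(7) in auto)
qed

context moebius_net
begin

lemma hs [simp]: "net_module N i \<Longrightarrow> hilbert_space i"
  by (rule module_hilbert)

lemma lhom_adj:
  assumes "net_module N i" "net_module N j" "T \<in> local_hom N I i j" "I \<in> arcs"
  shows "adj i j T \<in> local_hom N I j i"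
proof (rule lhomI)
  show "adj i j T \<in> bounded_ops j i"
    by (rule adj_bop[OF module_hilbert[OF assms(1)] module_hilbert[OF assms(2)] lhom_bop[OF assms(3)]])
  fix x \<xi> assume x: "x \<in> local_alg N I" and \<xi>: "\<xi> \<in> carrier j"
  have ax: "adj (vac_space N) (vac_space N) x \<in> local_alg N I" using vN_adj[OF local_vN] assms x by blast
  show "adj i j T (act j I x \<xi>) = act i I x (adj i j T \<xi>)"
  proof (rule adj_commute[OF module_hilbert[OF assms(1)] module_hilbert[OF assms(2)] lhom_bop[OF assms(3)]
        act_bop[OF assms(1,4) x] act_bop[OF assms(2,4) x] _ \<xi>])
    fix z assume z: "z \<in> carrier i"
    show "T (adj i i (act i I x) z) = adj j j (act j I x) (T z)"
      using lhom_act[OF assms(3) ax z] by (simp only: act_adj[OF assms(1,4) x] act_adj[OF assms(2,4) x])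
  qed
qed

lemma nhom_adj:
  assumes "net_module N i" "net_module N j" "T \<in> net_hom N i j"
  shows "adj i j T \<in> net_hom N j i"
  by (rule nhomI) (intro lhom_adj[OF assms(1,2)] nhom_lhom assms)

lemma lhom_mono:
  assumes "net_module N i" "net_module N j" "I \<in> arcs" "J \<in> arcs" "I \<subseteq> J" "T \<in> local_hom N J i j"
  shows "T \<in> local_hom N I i j"
proof (rule lhomI[OF lhom_bop[OF assms(6)]])
  fix x \<xi> assume x: "x \<in> local_alg N I" and \<xi>: "\<xi> \<in> carrier i"
  have "x \<in> local_alg N J" using isotony assms x by blast
  then show "T (act i I x \<xi>) = act j I x (T \<xi>)"
    using lhom_act[OF assms(6) _ \<xi>] act_mono assms x by metis
qed

lemma vac_module: "net_module N (vac_module N)"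
  unfolding net_module_def
proof (intro conjI ballI impI)
  show "hilbert_space (vac_module N)" by (rule vac_hilbert_space[OF vac_hilbert])
  fix I assume I: "I \<in> arcs"
  \<comment> \<open>Zero sequences together with the whole plane give the subbasic set of all
    bounded operators.\<close>
  have "local_alg N I \<subseteq> topspace (sigma_weak (vac_space N))"
  proof
    fix X assume X: "X \<in> local_alg N I"
    have "X \<in> {X \<in> bounded_ops (vac_space N) (vac_space N).
        (\<Sum>n. hinner (vac_space N) (X ((\<lambda>n. \<zero>\<^bsub>vac_space N\<^esub>) n)) ((\<lambda>n. \<zero>\<^bsub>vac_space N\<^esub>) n)) \<in> UNIV}"
      using local_bop[OF I X] by simp
    moreover have "sq_summable (vac_space N) (\<lambda>n. \<zero>\<^bsub>vac_space N\<^esub>)" by (auto simp: sq_summable_def)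
    ultimately show "X \<in> topspace (sigma_weak (vac_space N))"
      unfolding sigma_weak_def topology_generated_by_topspace
      by (intro UnionI CollectI exI conjI) (rule refl | assumption | rule open_UNIV)+
  qed
  then have "continuous_map (subtopology (sigma_weak (vac_space N)) (local_alg N I)) (sigma_weak (vac_space N)) (\<lambda>x. x)"
    by (intro continuous_map_from_subtopology) simp
  moreover have "act (vac_module N) I = (\<lambda>x. x)" for I by (rule ext) simp
  ultimately show "normal_rep (vac_space N) (local_alg N I) (vac_module N) (act (vac_module N) I)"
    using local_bop[OF I] by (simp add: normal_rep_def)
qed simp

lemma vac_hilb [simp]: "hilbert_space (vac_module N)"
  by (rule module_hilbert[OF vac_module])

lemma local_lhom:
  assumes "I \<in> arcs" "J \<in> arcs" "I \<inter> J = {}" "x \<in> local_alg N I"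
  shows "x \<in> local_hom N J (vac_module N) (vac_module N)"
proof (rule lhomI)
  show "x \<in> bounded_ops (vac_module N) (vac_module N)" using local_bop assms by simp
  fix y \<xi> assume y: "y \<in> local_alg N J" and "\<xi> \<in> carrier (vac_module N)"
  then show "x (act (vac_module N) J y \<xi>) = act (vac_module N) J y (x \<xi>)"
    using fun_cong[OF locality[OF assms(1,2,3,4) y], of \<xi>] by simp
qed

lemma local_lhom_compl: "\<lbrakk>I \<in> arcs; x \<in> local_alg N I\<rbrakk> \<Longrightarrow> x \<in> local_hom N (arc_compl I) (vac_module N) (vac_module N)"
  by (rule local_lhom[OF _ arc_compl_in arc_compl_disjoint])

lemma local_vecs_carrier:
  assumes "net_module N i" shows "local_vecs N i I \<subseteq> carrier i"
  using lhom_in vacuum_unit(1) by (fastforce simp: local_vecs_def)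

lemma local_vecs_in: "\<lbrakk>net_module N i; \<xi> \<in> local_vecs N i I\<rbrakk> \<Longrightarrow> \<xi> \<in> carrier i"
  using local_vecs_carrier by blast

lemma local_vecs_mono:
  assumes "net_module N i" "I \<in> arcs" "J \<in> arcs" "I \<subseteq> J"
  shows "local_vecs N i I \<subseteq> local_vecs N i J"
  using lhom_mono[OF vac_module assms(1) arc_compl_in arc_compl_in arc_compl_mono] assms
  by (force simp: local_vecs_def)

lemma hom_local_vecs:
  assumes "net_module N i" "net_module N j" "I \<in> arcs" "G \<in> local_hom N (arc_compl I) i j" "\<xi> \<in> local_vecs N i I"
  shows "G \<xi> \<in> local_vecs N j I"
proof -
  obtain T where T: "T \<in> local_hom N (arc_compl I) (vac_module N) i" "\<xi> = T (vacuum N)"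
    using assms(5) by (auto simp: local_vecs_def)
  have "compose (carrier (vac_module N)) G T (vacuum N) \<in> local_vecs N j I"
    by (intro local_vecsI lhom_compose[OF vac_module assms(1) T(1) assms(4)] arc_compl_in assms)
  then show ?thesis using T vacuum_unit(1) by simp
qed

lemma vac_total: "I \<in> arcs \<Longrightarrow> total_in (vac_module N) {x (vacuum N) | x. x \<in> local_alg N I}"
  using Reeh_Schlieder[of I] by (simp add: total_in_def vac_vecs_def)

text \<open>Reeh-Schlieder makes the vacuum separating for intertwiners of a single
  \<open>A(I)\<close>: agreement at \<open>Om\<close> spreads to the total set
  \<open>A(I) Om\<close>.\<close>

lemma lhom_vac_eqI:
  assumes "net_module N i" "I \<in> arcs" "S \<in> local_hom N I (vac_module N) i" "T \<in> local_hom N I (vac_module N) i"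
    "S (vacuum N) = T (vacuum N)"
  shows "S = T"
proof (rule bop_eqI_total[OF _ _ lhom_bop[OF assms(3)] lhom_bop[OF assms(4)] vac_total[OF assms(2)]])
  fix y assume "y \<in> {x (vacuum N) |x. x \<in> local_alg N I}"
  then obtain x where x: "x \<in> local_alg N I" "y = x (vacuum N)" by blast
  then show "S y = T y"
    using lhom_act[OF assms(3) x(1), of "vacuum N"] lhom_act[OF assms(4) x(1), of "vacuum N"]
      vacuum_unit(1) assms(5) by simp
qed (use assms in simp_all)

end

section \<open>Local vectors, the exchange of \<open>L\<close> and \<open>R\<close>, and Haag
  duality\<close>

locale fusion_net = irreducible_moebius_net N + categorical_extension N F
  for N :: "'h net" and F :: "'h fusion" (structure)
begin

abbreviation vac :: "'h rep_space" where "vac \<equiv> vac_module N"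
abbreviation Om :: 'h where "Om \<equiv> vacuum N"

lemma Om_in [simp]: "Om \<in> carrier (vac_space N)"
  by (rule vacuum_unit)

lemma scalar_hom:
  assumes "T \<in> net_hom N vac vac"
  obtains c where "\<And>x. x \<in> carrier (vac_space N) \<Longrightarrow> T x = c \<odot>\<^bsub>vac_space N\<^esub> x"
proof -
  have "T \<in> commutant (vac_space N) (\<Union>I\<in>arcs. local_alg N I)"
  proof (rule commutantI)
    show "T \<in> bounded_ops (vac_space N) (vac_space N)" using nhom_bop[OF assms] by simp
    fix X x assume "X \<in> (\<Union>I\<in>arcs. local_alg N I)" "x \<in> carrier (vac_space N)"
    then show "T (X x) = X (T x)" using lhom_act[OF nhom_lhom[OF assms]] by auto
  qed
  then obtain c where "T = op_smult (vac_space N) (vac_space N) c (ident (vac_space N))"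
    using irreducible by blast
  then show ?thesis using that[of c] by simp
qed

lemma unitors:
  assumes "net_module N i"
  shows "lunit F i \<in> net_hom N (vac \<boxtimes> i) i" "lunit F i \<in> unitary_ops (vac \<boxtimes> i) i"
    "runit F i \<in> net_hom N (i \<boxtimes> vac) i" "runit F i \<in> unitary_ops (i \<boxtimes> vac) i"
  using lunit_iso[OF assms] runit_iso[OF assms] by auto

lemma L_in: "\<lbrakk>net_module N i; net_module N k; I \<in> arg_arcs; \<xi> \<in> local_vecs N i (fst I); \<eta> \<in> carrier k\<rbrakk>
    \<Longrightarrow> Lop F i k I \<xi> \<eta> \<in> carrier (i \<boxtimes> k)"
  by (rule lhom_in[OF L_hom])

lemma R_in: "\<lbrakk>net_module N i; net_module N k; I \<in> arg_arcs; \<xi> \<in> local_vecs N i (fst I); \<eta> \<in> carrier k\<rbrakk>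
    \<Longrightarrow> Rop F i k I \<xi> \<eta> \<in> carrier (k \<boxtimes> i)"
  by (rule lhom_in[OF R_hom])

lemma L_total:
  assumes "net_module N i" "net_module N k" "I \<in> arg_arcs"
  shows "total_in (i \<boxtimes> k) {Lop F i k I \<xi> \<eta> | \<xi> \<eta>. \<xi> \<in> local_vecs N i (fst I) \<and> \<eta> \<in> carrier k}"
proof -
  interpret H: hilbert_space "i \<boxtimes> k" by (rule module_hilbert[OF tens_module]) (use assms in auto)
  show ?thesis
    by (rule H.span_total[OF _ H.dense_in_total[OF L_density[OF assms]]]) (use L_in[OF assms] in blast)
qed

text \<open>For \<open>x\<close> in \<open>A(I)\<close> the vector \<open>L(\<xi>) x Om\<close>,
  read in \<open>k\<close> through the right unitor, is again local. So if \<open>z\<close> is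
  orthogonal to all local vectors, the adjoint of \<open>L(\<xi>)\<close> sends it into the
  complement of \<open>A(I) Om\<close>, which is zero, and density of the range of \<open>L\<close>
  forces \<open>z = 0\<close>.\<close>

lemma local_total:
  assumes "net_module N k" "I \<in> arcs" shows "total_in k (local_vecs N k I)"
proof -
  obtain A where A: "A \<in> arg_arcs" "fst A = I" using arg_arc_exists[OF assms(2)] by blast
  have kv: "net_module N (k \<boxtimes> vac)" by (rule tens_module[OF assms(1) vac_module])
  interpret K: hilbert_space k using assms by simp
  interpret KV: hilbert_space "k \<boxtimes> vac" using kv by simp
  note r = unitary_opsD[OF KV.hilbert_space_axioms K.hilbert_space_axioms unitors(4)[OF assms(1)]]
  show ?thesis
    unfolding total_in_def
  proof (intro conjI ballI impI)
    show "local_vecs N k I \<subseteq> carrier k" by (rule local_vecs_carrier[OF assms(1)])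
    fix z assume z: "z \<in> carrier k" "\<forall>s\<in>local_vecs N k I. hinner k s z = 0"
    let ?w = "adj (k \<boxtimes> vac) k (runit F k) z"
    have wc: "?w \<in> carrier (k \<boxtimes> vac)" 
      by (rule bop_in[OF adj_bop[OF KV.hilbert_space_axioms K.hilbert_space_axioms r(1)] z(1)])
    have "hinner (k \<boxtimes> vac) (Lop F k vac A \<xi> \<eta>) ?w = 0"
      if \<xi>: "\<xi> \<in> local_vecs N k (fst A)" and \<eta>: "\<eta> \<in> carrier vac" for \<xi> \<eta>
    proof -
      let ?T = "compose (carrier vac) (runit F k) (Lop F k vac A \<xi>)"
      have T: "?T \<in> local_hom N (arc_compl I) vac k"
        by (rule lhom_compose[OF vac_module kv])
          (use L_hom[OF assms(1) vac_module A(1) \<xi>] A(2) nhom_lhom[OF unitors(3)[OF assms(1)]] assms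
             arc_compl_in in auto)
      \<comment> \<open>\<open>?T\<close> intertwines \<open>A(I')\<close>, and so does
        \<open>?T x\<close> for \<open>x\<close> in \<open>A(I)\<close> by locality of the net;
        hence \<open>?T x Om\<close> is a local vector.\<close>
      have tz: "adj vac k ?T z = \<zero>\<^bsub>vac_space N\<^esub>"
      proof -
        have c: "adj vac k ?T z \<in> carrier vac" 
          by (rule bop_in[OF adj_bop[OF vac_hilb K.hilbert_space_axioms lhom_bop[OF T]] z(1)])
        have "hinner vac s (adj vac k ?T z) = 0" if s: "s \<in> {x Om | x. x \<in> local_alg N I}" for s
        proof -
          obtain x where x: "x \<in> local_alg N I" "s = x Om" using s by blast
          have sc: "s \<in> carrier vac" using bop_in[OF local_bop[OF assms(2) x(1)]] x by simp
          have "compose (carrier vac) ?T x \<in> local_hom N (arc_compl I) vac k"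
            by (rule lhom_compose[OF vac_module vac_module local_lhom_compl[OF assms(2) x(1)] T])
              (rule arc_compl_in[OF assms(2)])
          then have "compose (carrier vac) ?T x Om \<in> local_vecs N k I" by (rule local_vecsI)
          then have "?T s \<in> local_vecs N k I" using x sc by simp
          then have "hinner k (?T s) z = 0" using z by blast
          then show ?thesis using adj_ip[OF vac_hilb K.hilbert_space_axioms lhom_bop[OF T] sc z(1)] by simp
        qed
        then show ?thesis using vac_total[OF assms(2)] c unfolding total_in_def by simp
      qed
      have "hinner (k \<boxtimes> vac) (Lop F k vac A \<xi> \<eta>) ?w = hinner k (?T \<eta>) z"
        using adj_ip[OF KV.hilbert_space_axioms K.hilbert_space_axioms r(1) L_in[OF assms(1) vac_module A(1) \<xi> \<eta>] z(1)] \<eta>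
        by simp
      also have "\<dots> = hinner vac \<eta> (adj vac k ?T z)"
        by (rule adj_ip[OF vac_hilb K.hilbert_space_axioms lhom_bop[OF T] \<eta> z(1)])
      also have "\<dots> = 0" unfolding tz using \<eta> by simp
      finally show ?thesis .
    qed
    then have "?w = \<zero>\<^bsub>k \<boxtimes> vac\<^esub>"
      using L_total[OF assms(1) vac_module A(1)] wc unfolding total_in_def by blast
    then have "z = runit F k \<zero>\<^bsub>k \<boxtimes> vac\<^esub>" using r(3)[OF z(1)] by simp
    also have "\<dots> = \<zero>\<^bsub>k\<^esub>" by (rule bop_zero[OF KV.hilbert_space_axioms K.hilbert_space_axioms r(1)])
    finally show "z = \<zero>\<^bsub>k\<^esub>" .
  qed
qed

lemma LR1:
  assumes "net_module N i" "net_module N j" "net_module N k" "I \<in> arg_arcs" "J \<in> arg_arcs"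
    "clockwise_to J I" "\<xi> \<in> local_vecs N i (fst I)" "\<eta> \<in> local_vecs N j (fst J)" "x \<in> carrier k"
  shows "Lop F i (k \<boxtimes> j) I \<xi> (Rop F j k J \<eta> x) = assoc F i k j (Rop F j (i \<boxtimes> k) J \<eta> (Lop F i k I \<xi> x))"
proof -
  have "compose (carrier k) (Lop F i (k \<boxtimes> j) I \<xi>) (Rop F j k J \<eta>) =
     compose (carrier k) (compose (carrier (i \<boxtimes> k)) (assoc F i k j) (Rop F j (i \<boxtimes> k) J \<eta>)) (Lop F i k I \<xi>)"
    using LR_locality[OF assms(1-8)] by (simp add: commutes_adjointly_def)
  from fun_cong[OF this, of x] show ?thesis
    using assms(9) L_in[OF assms(1,3,4,7,9)] by simp
qed

lemma LR2:
  assumes "net_module N i" "net_module N j" "net_module N k" "I \<in> arg_arcs" "J \<in> arg_arcs"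
    "clockwise_to J I" "\<xi> \<in> local_vecs N i (fst I)" "\<eta> \<in> local_vecs N j (fst J)" "y \<in> carrier (k \<boxtimes> j)"
  shows "Lop F i k I \<xi> (adj k (k \<boxtimes> j) (Rop F j k J \<eta>) y)
    = adj (i \<boxtimes> k) ((i \<boxtimes> k) \<boxtimes> j) (Rop F j (i \<boxtimes> k) J \<eta>)
        (adj ((i \<boxtimes> k) \<boxtimes> j) (i \<boxtimes> (k \<boxtimes> j)) (assoc F i k j) (Lop F i (k \<boxtimes> j) I \<xi> y))"
proof -
  have m: "net_module N (i \<boxtimes> k)" "net_module N (k \<boxtimes> j)" "net_module N ((i \<boxtimes> k) \<boxtimes> j)"
    "net_module N (i \<boxtimes> (k \<boxtimes> j))" using assms tens_module by auto
  have "compose (carrier (k \<boxtimes> j)) (Lop F i k I \<xi>) (adj k (k \<boxtimes> j) (Rop F j k J \<eta>)) =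
     compose (carrier (k \<boxtimes> j)) (adj (i \<boxtimes> k) (i \<boxtimes> (k \<boxtimes> j))
       (compose (carrier (i \<boxtimes> k)) (assoc F i k j) (Rop F j (i \<boxtimes> k) J \<eta>))) (Lop F i (k \<boxtimes> j) I \<xi>)"
    using LR_locality[OF assms(1-8)] by (simp add: commutes_adjointly_def)
  also have "adj (i \<boxtimes> k) (i \<boxtimes> (k \<boxtimes> j)) (compose (carrier (i \<boxtimes> k)) (assoc F i k j) (Rop F j (i \<boxtimes> k) J \<eta>))
    = compose (carrier (i \<boxtimes> (k \<boxtimes> j))) (adj (i \<boxtimes> k) ((i \<boxtimes> k) \<boxtimes> j) (Rop F j (i \<boxtimes> k) J \<eta>))
        (adj ((i \<boxtimes> k) \<boxtimes> j) (i \<boxtimes> (k \<boxtimes> j)) (assoc F i k j))"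
    by (rule adj_compose)
      (use m assoc_iso[OF assms(1,3,2)] R_hom[OF assms(2) m(1) assms(5,8)] in \<open>auto simp: lhom_bop nhom_bop\<close>)
  finally have e: "compose (carrier (k \<boxtimes> j)) (Lop F i k I \<xi>) (adj k (k \<boxtimes> j) (Rop F j k J \<eta>)) =
     compose (carrier (k \<boxtimes> j)) (compose (carrier (i \<boxtimes> (k \<boxtimes> j)))
       (adj (i \<boxtimes> k) ((i \<boxtimes> k) \<boxtimes> j) (Rop F j (i \<boxtimes> k) J \<eta>))
       (adj ((i \<boxtimes> k) \<boxtimes> j) (i \<boxtimes> (k \<boxtimes> j)) (assoc F i k j))) (Lop F i (k \<boxtimes> j) I \<xi>)" .
  from fun_cong[OF e, of y] show ?thesis
    using assms(9) L_in[OF assms(1) m(2) assms(4,7,9)] by simp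
qed

text \<open>The locality square with the vacuum module in the middle, evaluated at the vacuum: both
  paths produce the fusion of \<xi> and \<eta>, and the triangle identity removes the associator. On
  local vectors it trades \<open>L\<close> for \<open>R\<close>.\<close>

lemma L_R_swap:
  assumes i: "net_module N i" and j: "net_module N j" and I: "I \<in> arg_arcs" and J: "J \<in> arg_arcs"
    and c: "clockwise_to J I" and \<xi>: "\<xi> \<in> local_vecs N i (fst I)" and \<eta>: "\<eta> \<in> local_vecs N j (fst J)"
  shows "Lop F i j I \<xi> \<eta> = Rop F j i J \<eta> \<xi>"
proof -
  have m: "net_module N (i \<boxtimes> vac)" "net_module N (vac \<boxtimes> j)" using tens_module i j vac_module by auto
  have Om: "Om \<in> carrier vac" by simp
  note Lin = L_in[OF i vac_module I \<xi> Om] and Rin = R_in[OF j vac_module J \<eta> Om]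
  have "Lop F i j I \<xi> \<eta> = Lop F i j I \<xi> (lunit F j (Rop F j vac J \<eta> Om))"
    using R_state_field[OF j J \<eta>] by simp
  also have "\<dots> = tensm F i i (vac \<boxtimes> j) j (ident i) (lunit F j) (Lop F i (vac \<boxtimes> j) I \<xi> (Rop F j vac J \<eta> Om))"
    by (rule L_functorial[OF i m(2) j unitors(1)[OF j] I \<xi> Rin, symmetric])
  also have "\<dots> = tensm F i i (vac \<boxtimes> j) j (ident i) (lunit F j)
      (assoc F i vac j (Rop F j (i \<boxtimes> vac) J \<eta> (Lop F i vac I \<xi> Om)))"
    using LR1[OF i j vac_module I J c \<xi> \<eta> Om] by simp
  also have "\<dots> = tensm F (i \<boxtimes> vac) i j j (runit F i) (ident j) (Rop F j (i \<boxtimes> vac) J \<eta> (Lop F i vac I \<xi> Om))"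
    by (rule triangle[OF i j R_in[OF j m(1) J \<eta> Lin]])
  also have "\<dots> = Rop F j i J \<eta> (runit F i (Lop F i vac I \<xi> Om))"
    by (rule R_functorial[OF j m(1) i unitors(3)[OF i] J \<eta> Lin])
  also have "\<dots> = Rop F j i J \<eta> \<xi>" using L_state_field[OF i I \<xi>] by simp
  finally show ?thesis .
qed

text \<open>Functoriality in the label \<xi> instead of the argument. After exchanging
  \<open>L\<close> for \<open>R\<close> on the total set of vectors local in \<open>J\<close>, \<xi>
  becomes the argument of \<open>R\<close>, where functoriality is given.\<close>

lemma L_left_functorial:
  assumes i: "net_module N i" and i': "net_module N i'" and k: "net_module N k" and G: "G \<in> net_hom N i i'"
    and I: "I \<in> arg_arcs" and \<xi>: "\<xi> \<in> local_vecs N i (fst I)" and \<eta>: "\<eta> \<in> carrier k"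
  shows "tensm F i i' k k G (ident k) (Lop F i k I \<xi> \<eta>) = Lop F i' k I (G \<xi>) \<eta>"
proof -
  obtain J where J: "J \<in> arg_arcs" "clockwise_to J I" by (rule arg_compl_exists[OF I]) (rule that)
  have m: "net_module N (i \<boxtimes> k)" "net_module N (i' \<boxtimes> k)" using tens_module i i' k by auto
  have G\<xi>: "G \<xi> \<in> local_vecs N i' (fst I)"
    by (rule hom_local_vecs[OF i i' arg_arc_fst[OF I] nhom_lhom[OF G] \<xi>])
      (rule arc_compl_in[OF arg_arc_fst[OF I]])
  have t: "tensm F i i' k k G (ident k) \<in> bounded_ops (i \<boxtimes> k) (i' \<boxtimes> k)"
    by (intro nhom_bop[OF tensm_hom[OF i i' k k G nhom_ident[OF k]]])
  let ?S = "compose (carrier k) (tensm F i i' k k G (ident k)) (Lop F i k I \<xi>)"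
  have "?S = Lop F i' k I (G \<xi>)"
  proof (rule bop_eqI_total[OF _ _ _ _ local_total[OF k arg_arc_fst[OF J(1)]]])
    show "hilbert_space k" "hilbert_space (i' \<boxtimes> k)" using k m by auto
    show "?S \<in> bounded_ops k (i' \<boxtimes> k)"
      using k m t L_hom[OF i k I \<xi>] by (intro bop_compose[of _ "i \<boxtimes> k"]) (auto simp: lhom_bop)
    show "Lop F i' k I (G \<xi>) \<in> bounded_ops k (i' \<boxtimes> k)" using L_hom[OF i' k I G\<xi>] lhom_bop by blast
    fix z assume z: "z \<in> local_vecs N k (fst J)"
    have "?S z = tensm F i i' k k G (ident k) (Rop F k i J z \<xi>)"
      using L_R_swap[OF i k I J \<xi> z] local_vecs_in[OF k z] by simp
    also have "\<dots> = Rop F k i' J z (G \<xi>)"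
      by (rule R_functorial[OF k i i' G J(1) z local_vecs_in[OF i \<xi>]])
    also have "\<dots> = Lop F i' k I (G \<xi>) z" using L_R_swap[OF i' k I J G\<xi> z] by simp
    finally show "?S z = Lop F i' k I (G \<xi>) z" .
  qed
  from fun_cong[OF this, of \<eta>] show ?thesis using \<eta> by simp
qed

text \<open>The two unitors differ by an endomorphism of the vacuum, a scalar by irreducibility.
  Evaluating both on \<open>L(Om) Om = R(Om) Om\<close> with the state-field property shows that the
  scalar is \<open>1\<close>.\<close>

lemma unitors_vac:
  assumes "x \<in> carrier (vac \<boxtimes> vac)" shows "runit F vac x = lunit F vac x"
proof -
  have vv: "net_module N (vac \<boxtimes> vac)" by (rule tens_module[OF vac_module vac_module])
  note l = unitary_opsD[OF module_hilbert[OF vv] vac_hilb unitors(2)[OF vac_module]]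
  let ?l = "adj (vac \<boxtimes> vac) vac (lunit F vac)"
  have lb: "?l \<in> net_hom N vac (vac \<boxtimes> vac)" by (rule nhom_adj[OF vv vac_module unitors(1)[OF vac_module]])
  obtain c where c: "\<And>x. x \<in> carrier (vac_space N) \<Longrightarrow> compose (carrier vac) (runit F vac) ?l x = c \<odot>\<^bsub>vac_space N\<^esub> x"
    using scalar_hom[OF nhom_compose[OF vac_module vv lb unitors(3)[OF vac_module]]] by blast
  have rc: "runit F vac x = c \<odot>\<^bsub>vac_space N\<^esub> lunit F vac x" if "x \<in> carrier (vac \<boxtimes> vac)" for x
    using c[of "lunit F vac x"] l(2)[OF that] bop_in[OF l(1) that] by simp
  have "arc_of 0 1 \<in> arcs" using pi_gt3 by (intro arc_of_in) auto
  then obtain I where I: "I \<in> arg_arcs" using arg_arc_exists by blast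
  obtain J where J: "J \<in> arg_arcs" "clockwise_to J I" by (rule arg_compl_exists[OF I]) (rule that)
  have Oml: "Om \<in> local_vecs N vac K" if "K \<in> arcs" for K
  proof -
    have "ident vac Om \<in> local_vecs N vac K"
      by (rule local_vecsI[OF nhom_lhom[OF nhom_ident[OF vac_module] arc_compl_in[OF that]]])
    then show ?thesis by simp
  qed
  note o = Oml[OF arg_arc_fst[OF I]] Oml[OF arg_arc_fst[OF J(1)]]
  have "runit F vac (Lop F vac vac I Om Om) = Om" by (rule L_state_field[OF vac_module I o(1)])
  moreover have "lunit F vac (Rop F vac vac J Om Om) = Om" by (rule R_state_field[OF vac_module J(1) o(2)])
  moreover have "Lop F vac vac I Om Om = Rop F vac vac J Om Om"
    by (rule L_R_swap[OF vac_module vac_module I J o])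
  ultimately have "Om = c \<odot>\<^bsub>vac_space N\<^esub> Om"
    using rc[OF L_in[OF vac_module vac_module I o(1)], of Om] by simp
  then have "hinner (vac_space N) Om Om = c * hinner (vac_space N) Om Om"
    using V.inner_smult[of Om Om c] by simp
  moreover have "hinner (vac_space N) Om Om = 1" using V.inner_self[of Om] vacuum_unit by simp
  ultimately have "c = 1" by simp
  then show ?thesis using rc[OF assms] bop_in[OF l(1) assms] by simp
qed

text \<open>Locality is available for all vectors of \<open>A(I')'\<Omega>\<close> and \<open>A(I)'\<Omega>\<close>, not only for those of
  \<open>A(I)\<Omega>\<close> and \<open>A(I')\<Omega>\<close>; this already forces Haag duality.\<close>

lemma dual_commute:
  assumes I: "I \<in> arg_arcs" and y: "y \<in> local_hom N (arc_compl (fst I)) vac vac"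
    and z: "z \<in> local_hom N (fst I) vac vac"
  shows "y (z Om) = z (y Om)"
proof -
  obtain J where J: "J \<in> arg_arcs" "clockwise_to J I" "fst J = arc_compl (fst I)" "arc_compl (fst J) = fst I"
    by (rule arg_compl_exists[OF I]) (rule that)
  have vv: "net_module N (vac \<boxtimes> vac)" by (rule tens_module[OF vac_module vac_module])
  have yv: "y Om \<in> local_vecs N vac (fst I)" by (rule local_vecsI[OF y])
  have zv: "z Om \<in> local_vecs N vac (fst J)" using local_vecsI[of z N "fst J" vac] z J by simp
  note arcs = arg_arc_fst[OF I] arc_compl_in[OF arg_arc_fst[OF I]]
  \<comment> \<open>Up to the unitor \<open>y\<close> is \<open>L(y Om)\<close>: both intertwine
    \<open>A(I')\<close> and they agree at the vacuum. The same holds below for \<open>z\<close> and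
    \<open>R\<close>.\<close>
  have e1: "compose (carrier vac) (runit F vac) (Lop F vac vac I (y Om)) = y"
    by (rule lhom_vac_eqI[OF vac_module arcs(2) lhom_compose[OF vac_module vv L_hom[OF vac_module vac_module I yv]
        nhom_lhom[OF unitors(3)[OF vac_module] arcs(2)] arcs(2)] y])
      (simp add: L_state_field[OF vac_module I yv])
  have 1: "y x = runit F vac (Lop F vac vac I (y Om) x)" if "x \<in> carrier (vac_space N)" for x
    using that fun_cong[OF e1, of x] by simp
  have R: "Rop F vac vac J (z Om) \<in> local_hom N (fst I) vac (vac \<boxtimes> vac)"
    using R_hom[OF vac_module vac_module J(1) zv] J(4) by simp
  have e2: "compose (carrier vac) (lunit F vac) (Rop F vac vac J (z Om)) = z"
    by (rule lhom_vac_eqI[OF vac_module arcs(1) lhom_compose[OF vac_module vv R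
        nhom_lhom[OF unitors(1)[OF vac_module] arcs(1)] arcs(1)] z])
      (simp add: R_state_field[OF vac_module J(1) zv])
  have 2: "z x = lunit F vac (Rop F vac vac J (z Om) x)" if "x \<in> carrier (vac_space N)" for x
    using that fun_cong[OF e2, of x] by simp
  have c: "y Om \<in> carrier (vac_space N)" "z Om \<in> carrier (vac_space N)"
    using lhom_in[OF y, of Om] lhom_in[OF z, of Om] by auto
  have "y (z Om) = runit F vac (Lop F vac vac I (y Om) (z Om))" by (rule 1[OF c(2)])
  also have "\<dots> = lunit F vac (Lop F vac vac I (y Om) (z Om))"
    by (rule unitors_vac[OF L_in[OF vac_module vac_module I yv]]) (use c in simp)
  also have "Lop F vac vac I (y Om) (z Om) = Rop F vac vac J (z Om) (y Om)"
    by (rule L_R_swap[OF vac_module vac_module I J(1,2) yv zv])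
  also have "lunit F vac \<dots> = z (y Om)" using 2[OF c(1)] by simp
  finally show ?thesis .
qed

text \<open>Let \<open>z\<close> commute with \<open>A(I)\<close> and test on \<open>w Om\<close>
  with \<open>w\<close> in \<open>A(I')\<close>. The product \<open>z w\<close> again commutes with
  \<open>A(I)\<close>, so \<open>dual_commute\<close> gives
  \<open>y z w Om = z w y Om = z y w Om\<close>. Hence \<open>y\<close> lies in the double commutant
  of \<open>A(I)\<close>.\<close>

theorem Haag_duality:
  assumes I: "I \<in> arcs" and y: "y \<in> local_hom N (arc_compl I) vac vac"
  shows "y \<in> local_alg N I"
proof -
  obtain A where A: "A \<in> arg_arcs" "fst A = I" using arg_arc_exists[OF I] by blast
  have CI: "arc_compl I \<in> arcs" by (rule arc_compl_in[OF I])
  have "y \<in> commutant (vac_space N) (commutant (vac_space N) (local_alg N I))"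
  proof (rule commutantI)
    show yb: "y \<in> bounded_ops (vac_space N) (vac_space N)" using lhom_bop[OF y] by simp
    fix z x assume z: "z \<in> commutant (vac_space N) (local_alg N I)" and x: "x \<in> carrier (vac_space N)"
    have zb: "z \<in> bounded_ops vac vac" using commutant_bop[OF z] by simp
    have zl: "z \<in> local_hom N I vac vac"
      by (rule lhomI[OF zb]) (use commutantD[OF z] in simp)
    note s = vac_hilb vac_hilb
    have yb': "y \<in> bounded_ops vac vac" using yb by simp
    have "compose (carrier vac) y z = compose (carrier vac) z y"
    proof (rule bop_eqI_total[OF s bop_compose[OF s zb yb'] bop_compose[OF s yb' zb] vac_total[OF CI]])
      fix u assume "u \<in> {x Om |x. x \<in> local_alg N (arc_compl I)}"
      then obtain w where w: "w \<in> local_alg N (arc_compl I)" "u = w Om" by blast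
      have wl: "w \<in> local_hom N I vac vac"
        using local_lhom[OF CI I _ w(1)] arc_compl_disjoint[of I] by (simp add: Int_commute)
      have wO: "w Om \<in> carrier (vac_space N)" using lhom_in[OF wl, of Om] by simp
      have "compose (carrier vac) z w \<in> local_hom N I vac vac"
        by (rule lhom_compose[OF vac_module vac_module wl zl I])
      then have "y (compose (carrier vac) z w Om) = compose (carrier vac) z w (y Om)"
        using dual_commute[OF A(1), of y "compose (carrier vac) z w"] y A(2) by simp
      moreover have yO: "y Om \<in> carrier (vac_space N)" using lhom_in[OF y, of Om] by simp
      moreover have "y (w Om) = w (y Om)" using lhom_act[OF y w(1), of Om] by simp
      ultimately show "compose (carrier vac) y z u = compose (carrier vac) z y u"
        using w wO by simp
    qed
    from fun_cong[OF this, of x] show "y (z x) = z (y x)" using x by simp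
  qed
  then show ?thesis using local_vN[OF I] by (simp add: von_neumann_algebra_def)
qed

end

section \<open>Frobenius algebras\<close>

text \<open>In the vacuum the product commutes with \<open>A(I')\<close>, so Haag duality puts it
  into \<open>A(I)\<close>. For general \<open>k\<close>, locality moves it past \<open>R(z)\<close>
  with \<open>z\<close> local in the complement; \<open>R(z)\<close> intertwines \<open>A(I)\<close>
  and \<open>R(z) Om\<close> is \<open>z\<close> up to the unitor, so the product acts on
  \<open>z\<close> as the element \<open>x\<close>.\<close>

lemma (in fusion_net) LstarL_act:
  assumes i: "net_module N i" and k: "net_module N k" and I: "I \<in> arg_arcs" and \<xi>: "\<xi> \<in> local_vecs N i (fst I)"
  defines "x \<equiv> compose (carrier vac) (adj vac (i \<boxtimes> vac) (Lop F i vac I \<xi>)) (Lop F i vac I \<xi>)"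
  shows "x \<in> local_alg N (fst I)"
    and "\<eta> \<in> carrier k \<Longrightarrow> adj k (i \<boxtimes> k) (Lop F i k I \<xi>) (Lop F i k I \<xi> \<eta>) = act k (fst I) x \<eta>"
proof -
  note arcs = arg_arc_fst[OF I] arc_compl_in[OF arg_arc_fst[OF I]]
  have m: "net_module N (i \<boxtimes> vac)" "net_module N (vac \<boxtimes> k)" "net_module N (i \<boxtimes> k)"
    "net_module N (i \<boxtimes> (vac \<boxtimes> k))" "net_module N (i \<boxtimes> vac \<boxtimes> k)" using tens_module i k vac_module by auto
  note Lv = L_hom[OF i vac_module I \<xi>] and Lk = L_hom[OF i k I \<xi>] and Lvk = L_hom[OF i m(2) I \<xi>]
  show x: "x \<in> local_alg N (fst I)"
    unfolding x_def by (rule Haag_duality[OF arcs(1) lhom_compose[OF vac_module m(1) Lv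
      lhom_adj[OF vac_module m(1) Lv arcs(2)] arcs(2)]])
  obtain J where J: "J \<in> arg_arcs" "clockwise_to J I" "arc_compl (fst J) = fst I"
    by (rule arg_compl_exists[OF I]) (rule that)
  note ip = adj_ip[OF hs hs lhom_bop] and ip2 = adj_ip2[OF hs hs lhom_bop]
  note Lka = lhom_bop[OF lhom_adj[OF k m(3) Lk arcs(2)]] and Lvka = lhom_bop[OF lhom_adj[OF m(2) m(4) Lvk arcs(2)]]
    and Lva = lhom_bop[OF lhom_adj[OF vac_module m(1) Lv arcs(2)]]
  note l = unitors(1)[OF k] and lu = unitary_opsD[OF hs[OF m(2)] hs[OF k] unitors(2)[OF k]]
  \<comment> \<open>Identifies \<open>i \<boxtimes> (vac \<boxtimes> k)\<close> with
    \<open>i \<boxtimes> k\<close> isometrically, so that inner products of \<open>L\<close> vectors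
    over \<open>k\<close> can be computed over \<open>vac \<boxtimes> k\<close>, where
    \<open>R\<close> takes its values.\<close>
  let ?\<Lambda> = "tensm F i i (vac \<boxtimes> k) k (ident i) (lunit F k)"
  have \<Lambda>: "?\<Lambda> \<in> net_hom N (i \<boxtimes> (vac \<boxtimes> k)) (i \<boxtimes> k)"
    by (rule tensm_hom[OF i i m(2) k nhom_ident[OF i] l])
  have \<Lambda>inner: "hinner (i \<boxtimes> k) (?\<Lambda> u) (?\<Lambda> w) = hinner (i \<boxtimes> (vac \<boxtimes> k)) u w"
    if "u \<in> carrier (i \<boxtimes> (vac \<boxtimes> k))" "w \<in> carrier (i \<boxtimes> (vac \<boxtimes> k))" for u w
  proof -
    have "adj (i \<boxtimes> (vac \<boxtimes> k)) (i \<boxtimes> k) ?\<Lambda>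
        = tensm F i i k (vac \<boxtimes> k) (ident i) (adj (vac \<boxtimes> k) k (lunit F k))"
      using tensm_adj[OF i i m(2) k nhom_ident[OF i] l] i by simp
    moreover have "compose (carrier (i \<boxtimes> (vac \<boxtimes> k)))
        (tensm F i i k (vac \<boxtimes> k) (ident i) (adj (vac \<boxtimes> k) k (lunit F k))) ?\<Lambda>
      = ident (i \<boxtimes> (vac \<boxtimes> k))"
    proof -
      have "compose (carrier i) (ident i) (ident i) = ident i"
        by (rule ext) (simp add: compose_def ident_def)
      moreover have "compose (carrier (vac \<boxtimes> k)) (adj (vac \<boxtimes> k) k (lunit F k)) (lunit F k) = ident (vac \<boxtimes> k)"
        using unitors(2)[OF k] by (simp add: unitary_ops_def)
      ultimately show ?thesis
        using tensm_compose[OF i i i m(2) k m(2) nhom_ident[OF i] nhom_ident[OF i] l nhom_adj[OF m(2) k l]]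
          tensm_ident[OF i m(2)] by simp
    qed
    ultimately have e: "compose (carrier (i \<boxtimes> (vac \<boxtimes> k))) (adj (i \<boxtimes> (vac \<boxtimes> k)) (i \<boxtimes> k) ?\<Lambda>) ?\<Lambda>
      = ident (i \<boxtimes> (vac \<boxtimes> k))" by (simp only:)
    have "adj (i \<boxtimes> (vac \<boxtimes> k)) (i \<boxtimes> k) ?\<Lambda> (?\<Lambda> w) = w"
      using fun_cong[OF e, of w] that(2) by simp
    then show ?thesis using adj_ip[OF hs[OF m(4)] hs[OF m(3)] nhom_bop[OF \<Lambda>] that(1) nhom_in[OF \<Lambda> that(2)]] by simp
  qed
  let ?S = "compose (carrier k) (adj k (i \<boxtimes> k) (Lop F i k I \<xi>)) (Lop F i k I \<xi>)"
  have "?S = act k (fst I) x"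
  proof (rule bop_eqI_total[OF hs[OF k] hs[OF k] _ act_bop[OF k arcs(1) x] local_total[OF k arg_arc_fst[OF J(1)]]])
    show "?S \<in> bounded_ops k k" by (rule bop_compose[OF hs[OF k] hs[OF m(3)] lhom_bop[OF Lk] Lka])
    fix z assume z: "z \<in> local_vecs N k (fst J)"
    have zc: "z \<in> carrier k" by (rule local_vecs_in[OF k z])
    let ?R = "Rop F k vac J z" and ?R' = "Rop F k (i \<boxtimes> vac) J z"
    let ?\<alpha> = "assoc F i vac k"
    note R = R_hom[OF k vac_module J(1) z]
    note R' = R_hom[OF k m(1) J(1) z]
    have \<alpha>: "?\<alpha> \<in> net_hom N (i \<boxtimes> vac \<boxtimes> k) (i \<boxtimes> (vac \<boxtimes> k))" using assoc_iso[OF i vac_module k] by simp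
    note Ra = adj_bop[OF vac_hilb hs[OF m(2)] lhom_bop[OF R]]
    have ROm: "?R Om \<in> carrier (vac \<boxtimes> k)" using lhom_in[OF R, of Om] by simp
    have lR: "lunit F k (?R Om) = z" by (rule R_state_field[OF k J(1) z])
    have xO: "x Om \<in> carrier vac" using bop_in[OF local_bop[OF arcs(1) x], of Om] by simp
    \<comment> \<open>\<open>LR1\<close> moves \<open>L\<close> past \<open>R\<close> on one side of
      the inner product and \<open>LR2\<close> moves it past the adjoint of \<open>R\<close> on the
      other, which leaves the product over the vacuum.\<close>
    have main: "adj (vac \<boxtimes> k) (i \<boxtimes> (vac \<boxtimes> k)) (Lop F i (vac \<boxtimes> k) I \<xi>) (Lop F i (vac \<boxtimes> k) I \<xi> (?R Om)) = ?R (x Om)"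
    proof -
      interpret VK: hilbert_space "vac \<boxtimes> k" by (rule hs[OF m(2)])
      have tot: "total_in (vac \<boxtimes> k) (carrier (vac \<boxtimes> k))" unfolding total_in_def using VK.inner_definite by blast
      show ?thesis
      proof (rule VK.hilbert_eqI_total[OF _ _ tot])
        have c1: "Lop F i (vac \<boxtimes> k) I \<xi> (?R Om) \<in> carrier (i \<boxtimes> (vac \<boxtimes> k))" by (rule lhom_in[OF Lvk ROm])
        show "adj (vac \<boxtimes> k) (i \<boxtimes> (vac \<boxtimes> k)) (Lop F i (vac \<boxtimes> k) I \<xi>) (Lop F i (vac \<boxtimes> k) I \<xi> (?R Om)) \<in> carrier (vac \<boxtimes> k)"
          by (rule bop_in[OF Lvka c1])
        show "?R (x Om) \<in> carrier (vac \<boxtimes> k)" by (rule lhom_in[OF R xO])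
        fix y assume y: "y \<in> carrier (vac \<boxtimes> k)"
        have LROm: "Lop F i (vac \<boxtimes> k) I \<xi> (?R Om) = ?\<alpha> (?R' (Lop F i vac I \<xi> Om))"
          by (rule LR1[OF i k vac_module I J(1,2) \<xi> z]) simp
        have LO: "Lop F i vac I \<xi> Om \<in> carrier (i \<boxtimes> vac)" using lhom_in[OF Lv, of Om] by simp
        have Ly: "Lop F i (vac \<boxtimes> k) I \<xi> y \<in> carrier (i \<boxtimes> (vac \<boxtimes> k))" by (rule lhom_in[OF Lvk y])
        have aLy: "adj (i \<boxtimes> vac \<boxtimes> k) (i \<boxtimes> (vac \<boxtimes> k)) ?\<alpha> (Lop F i (vac \<boxtimes> k) I \<xi> y) \<in> carrier (i \<boxtimes> vac \<boxtimes> k)"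
          by (rule bop_in[OF adj_bop[OF hs[OF m(5)] hs[OF m(4)] nhom_bop[OF \<alpha>]] Ly])
        have Ray: "adj vac (vac \<boxtimes> k) ?R y \<in> carrier vac" by (rule bop_in[OF Ra y])
        have "hinner (vac \<boxtimes> k) y (adj (vac \<boxtimes> k) (i \<boxtimes> (vac \<boxtimes> k)) (Lop F i (vac \<boxtimes> k) I \<xi>) (Lop F i (vac \<boxtimes> k) I \<xi> (?R Om)))
            = hinner (i \<boxtimes> (vac \<boxtimes> k)) (Lop F i (vac \<boxtimes> k) I \<xi> y) (Lop F i (vac \<boxtimes> k) I \<xi> (?R Om))"
          by (rule adj_ip[OF hs[OF m(2)] hs[OF m(4)] lhom_bop[OF Lvk] y c1, symmetric])
        also have "\<dots>
          = hinner (i \<boxtimes> vac \<boxtimes> k) (adj (i \<boxtimes> vac \<boxtimes> k) (i \<boxtimes> (vac \<boxtimes> k)) ?\<alpha> (Lop F i (vac \<boxtimes> k) I \<xi> y)) (?R' (Lop F i vac I \<xi> Om))"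
          unfolding LROm by (rule adj_ip2[OF hs[OF m(5)] hs[OF m(4)] nhom_bop[OF \<alpha>] lhom_in[OF R' LO] Ly, symmetric])
        also have "\<dots> = hinner (i \<boxtimes> vac) (adj (i \<boxtimes> vac) (i \<boxtimes> vac \<boxtimes> k) ?R'
            (adj (i \<boxtimes> vac \<boxtimes> k) (i \<boxtimes> (vac \<boxtimes> k)) ?\<alpha> (Lop F i (vac \<boxtimes> k) I \<xi> y))) (Lop F i vac I \<xi> Om)"
          by (rule adj_ip2[OF hs[OF m(1)] hs[OF m(5)] lhom_bop[OF R'] LO aLy, symmetric])
        also have "adj (i \<boxtimes> vac) (i \<boxtimes> vac \<boxtimes> k) ?R'
            (adj (i \<boxtimes> vac \<boxtimes> k) (i \<boxtimes> (vac \<boxtimes> k)) ?\<alpha> (Lop F i (vac \<boxtimes> k) I \<xi> y))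
            = Lop F i vac I \<xi> (adj vac (vac \<boxtimes> k) ?R y)"
          by (rule LR2[OF i k vac_module I J(1,2) \<xi> z y, symmetric])
        also have "hinner (i \<boxtimes> vac) \<dots> (Lop F i vac I \<xi> Om) = hinner vac (adj vac (vac \<boxtimes> k) ?R y) (x Om)"
          using adj_ip[OF vac_hilb hs[OF m(1)] lhom_bop[OF Lv] Ray LO] by (simp add: x_def)
        also have "\<dots> = hinner (vac \<boxtimes> k) y (?R (x Om))"
          by (rule adj_ip2[OF vac_hilb hs[OF m(2)] lhom_bop[OF R] xO y])
        finally show "hinner (vac \<boxtimes> k) y (adj (vac \<boxtimes> k) (i \<boxtimes> (vac \<boxtimes> k)) (Lop F i (vac \<boxtimes> k) I \<xi>) (Lop F i (vac \<boxtimes> k) I \<xi> (?R Om)))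
          = hinner (vac \<boxtimes> k) y (?R (x Om))" .
      qed
    qed
    interpret K: hilbert_space k by (rule hs[OF k])
    have tot: "total_in k (carrier k)" unfolding total_in_def using K.inner_definite by blast
    have LROm: "Lop F i (vac \<boxtimes> k) I \<xi> (?R Om) \<in> carrier (i \<boxtimes> (vac \<boxtimes> k))" by (rule lhom_in[OF Lvk ROm])
    have "adj k (i \<boxtimes> k) (Lop F i k I \<xi>) (Lop F i k I \<xi> z)
        = lunit F k (adj (vac \<boxtimes> k) (i \<boxtimes> (vac \<boxtimes> k)) (Lop F i (vac \<boxtimes> k) I \<xi>) (Lop F i (vac \<boxtimes> k) I \<xi> (?R Om)))"
    proof (rule K.hilbert_eqI_total[OF _ _ tot])
      show "adj k (i \<boxtimes> k) (Lop F i k I \<xi>) (Lop F i k I \<xi> z) \<in> carrier k"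
        by (rule bop_in[OF Lka lhom_in[OF Lk zc]])
      show "lunit F k (adj (vac \<boxtimes> k) (i \<boxtimes> (vac \<boxtimes> k)) (Lop F i (vac \<boxtimes> k) I \<xi>) (Lop F i (vac \<boxtimes> k) I \<xi> (?R Om))) \<in> carrier k"
        by (rule nhom_in[OF l bop_in[OF Lvka LROm]])
      fix y assume y: "y \<in> carrier k"
      let ?y = "adj (vac \<boxtimes> k) k (lunit F k) y"
      have yc: "?y \<in> carrier (vac \<boxtimes> k)" by (rule bop_in[OF adj_bop[OF hs[OF m(2)] hs[OF k] lu(1)] y])
      have fy: "Lop F i k I \<xi> y = ?\<Lambda> (Lop F i (vac \<boxtimes> k) I \<xi> ?y)"
        using L_functorial[OF i m(2) k l I \<xi> yc] lu(3)[OF y] by simp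
      have fz: "Lop F i k I \<xi> z = ?\<Lambda> (Lop F i (vac \<boxtimes> k) I \<xi> (?R Om))"
        using L_functorial[OF i m(2) k l I \<xi> ROm] lR by simp
      have "hinner k y (adj k (i \<boxtimes> k) (Lop F i k I \<xi>) (Lop F i k I \<xi> z)) = hinner (i \<boxtimes> k) (Lop F i k I \<xi> y) (Lop F i k I \<xi> z)"
        by (rule adj_ip[OF hs[OF k] hs[OF m(3)] lhom_bop[OF Lk] y lhom_in[OF Lk zc], symmetric])
      also have "\<dots> = hinner (i \<boxtimes> (vac \<boxtimes> k)) (Lop F i (vac \<boxtimes> k) I \<xi> ?y) (Lop F i (vac \<boxtimes> k) I \<xi> (?R Om))"
        unfolding fy fz by (rule \<Lambda>inner[OF lhom_in[OF Lvk yc] LROm])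
      also have "\<dots> = hinner (vac \<boxtimes> k) ?y (adj (vac \<boxtimes> k) (i \<boxtimes> (vac \<boxtimes> k)) (Lop F i (vac \<boxtimes> k) I \<xi>) (Lop F i (vac \<boxtimes> k) I \<xi> (?R Om)))"
        by (rule adj_ip[OF hs[OF m(2)] hs[OF m(4)] lhom_bop[OF Lvk] yc LROm])
      also have "\<dots> = hinner k y (lunit F k (adj (vac \<boxtimes> k) (i \<boxtimes> (vac \<boxtimes> k)) (Lop F i (vac \<boxtimes> k) I \<xi>) (Lop F i (vac \<boxtimes> k) I \<xi> (?R Om))))"
        by (rule adj_ip2[OF hs[OF m(2)] hs[OF k] lu(1) bop_in[OF Lvka LROm] y])
      finally show "hinner k y (adj k (i \<boxtimes> k) (Lop F i k I \<xi>) (Lop F i k I \<xi> z))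
        = hinner k y (lunit F k (adj (vac \<boxtimes> k) (i \<boxtimes> (vac \<boxtimes> k)) (Lop F i (vac \<boxtimes> k) I \<xi>) (Lop F i (vac \<boxtimes> k) I \<xi> (?R Om))))" .
    qed
    also have "\<dots> = lunit F k (?R (x Om))" by (simp only: main)
    also have "\<dots> = lunit F k (act (vac \<boxtimes> k) (fst I) x (?R Om))"
      using lhom_act[OF R, of x Om] J(3) x by simp
    also have "\<dots> = act k (fst I) x z"
      using lhom_act[OF nhom_lhom[OF l arcs(1)] x ROm] lR by simp
    finally show "?S z = act k (fst I) x z" using zc by simp
  qed
  from fun_cong[OF this, of \<eta>]
  show "\<eta> \<in> carrier k \<Longrightarrow> adj k (i \<boxtimes> k) (Lop F i k I \<xi>) (Lop F i k I \<xi> \<eta>) = act k (fst I) x \<eta>"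
    by simp
qed

locale frobenius_alg = fusion_net N F for N :: "'h net" and F :: "'h fusion" (structure) +
  fixes Q :: "'h frob"
  assumes frob: "cstar_frobenius N F Q"
begin

abbreviation "a \<equiv> fobj Q"
abbreviation "\<mu> \<equiv> fmult Q"
abbreviation "\<iota> \<equiv> funit Q"
abbreviation "\<omega> \<equiv> \<iota> Om"

lemma a_mod [simp]: "net_module N a" and \<mu>_hom: "\<mu> \<in> net_hom N (a \<boxtimes> a) a" and \<iota>_hom: "\<iota> \<in> net_hom N vac a"
  and unit_left: "x \<in> carrier (vac \<boxtimes> a) \<Longrightarrow> \<mu> (tensm F vac a a a \<iota> (ident a) x) = lunit F a x"
  and unit_right: "x \<in> carrier (a \<boxtimes> vac) \<Longrightarrow> \<mu> (tensm F a a vac a (ident a) \<iota> x) = runit F a x"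
  using frob by (simp_all add: cstar_frobenius_def Let_def)

lemma aa_mod [simp]: "net_module N (a \<boxtimes> a)" "net_module N (a \<boxtimes> a \<boxtimes> a)" "net_module N (a \<boxtimes> (a \<boxtimes> a))"
  by (simp_all add: tens_module)

abbreviation "\<mu>l \<equiv> tensm F (a \<boxtimes> a) a a a \<mu> (ident a)"
abbreviation "\<mu>r \<equiv> tensm F a a (a \<boxtimes> a) a (ident a) \<mu>"
abbreviation "\<alpha> \<equiv> assoc F a a a"

lemma \<mu>l_hom: "\<mu>l \<in> net_hom N (a \<boxtimes> a \<boxtimes> a) (a \<boxtimes> a)" and \<mu>r_hom: "\<mu>r \<in> net_hom N (a \<boxtimes> (a \<boxtimes> a)) (a \<boxtimes> a)"
  and \<alpha>_hom: "\<alpha> \<in> net_hom N (a \<boxtimes> a \<boxtimes> a) (a \<boxtimes> (a \<boxtimes> a))"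
  using tensm_hom[OF aa_mod(1) a_mod a_mod a_mod \<mu>_hom nhom_ident[OF a_mod]]
    tensm_hom[OF a_mod a_mod aa_mod(1) a_mod nhom_ident[OF a_mod] \<mu>_hom] assoc_iso[of a a a] by auto

lemma frob_square: "commutes_adjointly (a \<boxtimes> a \<boxtimes> a) (a \<boxtimes> a) (a \<boxtimes> a) a
       (compose (carrier (a \<boxtimes> a \<boxtimes> a)) \<mu>r \<alpha>) \<mu>l \<mu> \<mu>"
  using frob by (simp add: cstar_frobenius_def Let_def)

lemma \<mu>_assoc: "x \<in> carrier (a \<boxtimes> a \<boxtimes> a) \<Longrightarrow> \<mu> (\<mu>l x) = \<mu> (\<mu>r (\<alpha> x))"
  using fun_cong[OF conjunct1[OF frob_square[unfolded commutes_adjointly_def]], of x] by simp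

lemma \<mu>_frob: "x \<in> carrier (a \<boxtimes> a) \<Longrightarrow>
    \<mu>r (\<alpha> (adj (a \<boxtimes> a \<boxtimes> a) (a \<boxtimes> a) \<mu>l x)) = adj (a \<boxtimes> a) a \<mu> (\<mu> x)"
  using fun_cong[OF conjunct2[OF frob_square[unfolded commutes_adjointly_def]], of x]
    nhom_in[OF nhom_adj[OF _ _ \<mu>l_hom], of x] by simp

text \<open>The adjoint of \<open>\<mu>_frob\<close>, whose right side is self-adjoint. This
  mirrored form is the one that meets left multiplications followed by adjoints of right
  multiplications.\<close>

lemma \<mu>_frob': "x \<in> carrier (a \<boxtimes> a) \<Longrightarrow>
    \<mu>l (adj (a \<boxtimes> a \<boxtimes> a) (a \<boxtimes> (a \<boxtimes> a)) \<alpha> (adj (a \<boxtimes> (a \<boxtimes> a)) (a \<boxtimes> a) \<mu>r x)) = adj (a \<boxtimes> a) a \<mu> (\<mu> x)"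
proof -
  assume x: "x \<in> carrier (a \<boxtimes> a)"
  note h = hs[OF a_mod] hs[OF aa_mod(1)] hs[OF aa_mod(2)] hs[OF aa_mod(3)]
  note aj = nhom_adj[OF aa_mod(2) aa_mod(1) \<mu>l_hom] nhom_adj[OF aa_mod(3,1) \<mu>r_hom]
    nhom_adj[OF aa_mod(2,3) \<alpha>_hom] nhom_adj[OF aa_mod(1) a_mod \<mu>_hom]
  note c = nhom_in[OF \<mu>l_hom] nhom_in[OF \<mu>r_hom] nhom_in[OF \<alpha>_hom] nhom_in[OF \<mu>_hom]
    aj[THEN nhom_in]
  note ip = adj_ip[OF _ _ nhom_bop]
  interpret AA: hilbert_space "a \<boxtimes> a" by (rule h)
  show ?thesis
  proof (rule AA.hilbert_eqI)
    fix y assume y: "y \<in> carrier (a \<boxtimes> a)"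
    let ?u = "adj (a \<boxtimes> a \<boxtimes> a) (a \<boxtimes> (a \<boxtimes> a)) \<alpha> (adj (a \<boxtimes> (a \<boxtimes> a)) (a \<boxtimes> a) \<mu>r x)"
    have "hinner (a \<boxtimes> a) (\<mu>l ?u) y = hinner (a \<boxtimes> a \<boxtimes> a) ?u (adj (a \<boxtimes> a \<boxtimes> a) (a \<boxtimes> a) \<mu>l y)"
      by (rule adj_ip[OF h(3,2) nhom_bop[OF \<mu>l_hom] _ y]) (intro c x)
    also have "\<dots> = hinner (a \<boxtimes> (a \<boxtimes> a)) (adj (a \<boxtimes> (a \<boxtimes> a)) (a \<boxtimes> a) \<mu>r x) (\<alpha> (adj (a \<boxtimes> a \<boxtimes> a) (a \<boxtimes> a) \<mu>l y))"
      by (rule adj_ip2[OF h(3,4) nhom_bop[OF \<alpha>_hom]]) (intro c x y)+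
    also have "\<dots> = hinner (a \<boxtimes> a) x (\<mu>r (\<alpha> (adj (a \<boxtimes> a \<boxtimes> a) (a \<boxtimes> a) \<mu>l y)))"
      by (rule adj_ip2[OF h(4,2) nhom_bop[OF \<mu>r_hom]]) (intro c x y)+
    also have "\<dots> = hinner (a \<boxtimes> a) x (adj (a \<boxtimes> a) a \<mu> (\<mu> y))" by (simp only: \<mu>_frob[OF y])
    also have "\<dots> = hinner a (\<mu> x) (\<mu> y)"
      by (rule adj_ip[OF h(2,1) nhom_bop[OF \<mu>_hom], symmetric]) (intro c x y)+
    also have "\<dots> = hinner (a \<boxtimes> a) (adj (a \<boxtimes> a) a \<mu> (\<mu> x)) y"
      by (rule adj_ip2[OF h(2,1) nhom_bop[OF \<mu>_hom], symmetric]) (intro c x y)+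
    finally show "hinner (a \<boxtimes> a) (\<mu>l ?u) y = hinner (a \<boxtimes> a) (adj (a \<boxtimes> a) a \<mu> (\<mu> x)) y" .
  qed (intro c x)+
qed

text \<open>Left multiplication by a local vector; \<open>Y_op\<close> is right
  multiplication.\<close>

definition X_op :: "arg_arc \<Rightarrow> 'h \<Rightarrow> 'h \<Rightarrow> 'h" where
  "X_op I \<xi> = compose (carrier a) \<mu> (Lop F a a I \<xi>)"

definition Y_op :: "arg_arc \<Rightarrow> 'h \<Rightarrow> 'h \<Rightarrow> 'h" where
  "Y_op I \<xi> = compose (carrier a) \<mu> (Rop F a a I \<xi>)"

abbreviation BQ :: "arg_arc \<Rightarrow> ('h \<Rightarrow> 'h) set" where
  "BQ \<equiv> ealg (frob_extn N F Q)"

lemma BQ_eq: "BQ I = {X_op I \<xi> | \<xi>. \<xi> \<in> local_vecs N a (fst I)}"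
  by (simp add: frob_extn_def X_op_def)

lemma \<omega>_in [simp]: "\<omega> \<in> carrier a"
  using nhom_in[OF \<iota>_hom, of Om] by simp

lemma X_op_apply: "\<zeta> \<in> carrier a \<Longrightarrow> X_op I \<xi> \<zeta> = \<mu> (Lop F a a I \<xi> \<zeta>)"
  by (simp add: X_op_def)

lemma Y_op_apply: "\<zeta> \<in> carrier a \<Longrightarrow> Y_op I \<xi> \<zeta> = \<mu> (Rop F a a I \<xi> \<zeta>)"
  by (simp add: Y_op_def)

context
  fixes I assumes I: "I \<in> arg_arcs"
begin

lemma X_op_hom: "\<xi> \<in> local_vecs N a (fst I) \<Longrightarrow> X_op I \<xi> \<in> local_hom N (arc_compl (fst I)) a a"
  unfolding X_op_def
  by (rule lhom_compose[OF a_mod aa_mod(1) L_hom[OF a_mod a_mod I] nhom_lhom[OF \<mu>_hom]])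
    (use arc_compl_in[OF arg_arc_fst[OF I]] in auto)

lemma Y_op_hom: "\<xi> \<in> local_vecs N a (fst I) \<Longrightarrow> Y_op I \<xi> \<in> local_hom N (arc_compl (fst I)) a a"
  unfolding Y_op_def
  by (rule lhom_compose[OF a_mod aa_mod(1) R_hom[OF a_mod a_mod I] nhom_lhom[OF \<mu>_hom]])
    (use arc_compl_in[OF arg_arc_fst[OF I]] in auto)

lemma X_op_vac:
  assumes \<xi>: "\<xi> \<in> local_vecs N a (fst I)" shows "X_op I \<xi> \<omega> = \<xi>"
proof -
  have O: "Om \<in> carrier vac" by simp
  have "Lop F a a I \<xi> \<omega> = tensm F a a vac a (ident a) \<iota> (Lop F a vac I \<xi> Om)"
    by (rule L_functorial[OF a_mod vac_module a_mod \<iota>_hom I \<xi> O, symmetric])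
  then show ?thesis
    using unit_right[OF L_in[OF a_mod vac_module I \<xi> O]] L_state_field[OF a_mod I \<xi>] by (simp add: X_op_apply)
qed

lemma Y_op_vac:
  assumes \<xi>: "\<xi> \<in> local_vecs N a (fst I)" shows "Y_op I \<xi> \<omega> = \<xi>"
proof -
  have O: "Om \<in> carrier vac" by simp
  have "Rop F a a I \<xi> \<omega> = tensm F vac a a a \<iota> (ident a) (Rop F a vac I \<xi> Om)"
    by (rule R_functorial[OF a_mod vac_module a_mod \<iota>_hom I \<xi> O, symmetric])
  then show ?thesis
    using unit_left[OF R_in[OF a_mod vac_module I \<xi> O]] R_state_field[OF a_mod I \<xi>] by (simp add: Y_op_apply)
qed

context
  fixes J assumes J: "J \<in> arg_arcs" "clockwise_to J I"
begin

text \<open>Functoriality moves \<mu> past \<open>L\<close>, locality exchanges \<open>L\<close> and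
  \<open>R\<close> at the price of an associator, and associativity of \<mu> absorbs it.\<close>

lemma XY_commute:
  assumes \<xi>: "\<xi> \<in> local_vecs N a (fst I)" and \<eta>: "\<eta> \<in> local_vecs N a (fst J)" and z: "z \<in> carrier a"
  shows "X_op I \<xi> (Y_op J \<eta> z) = Y_op J \<eta> (X_op I \<xi> z)"
proof -
  have Rz: "Rop F a a J \<eta> z \<in> carrier (a \<boxtimes> a)" by (rule R_in[OF a_mod a_mod J(1) \<eta> z])
  have Lz: "Lop F a a I \<xi> z \<in> carrier (a \<boxtimes> a)" by (rule L_in[OF a_mod a_mod I \<xi> z])
  have RLz: "Rop F a (a \<boxtimes> a) J \<eta> (Lop F a a I \<xi> z) \<in> carrier (a \<boxtimes> a \<boxtimes> a)"
    by (rule R_in[OF a_mod aa_mod(1) J(1) \<eta> Lz])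
  have "X_op I \<xi> (Y_op J \<eta> z) = \<mu> (Lop F a a I \<xi> (\<mu> (Rop F a a J \<eta> z)))"
    using nhom_in[OF \<mu>_hom Rz] z by (simp add: X_op_apply Y_op_apply)
  also have "Lop F a a I \<xi> (\<mu> (Rop F a a J \<eta> z)) = \<mu>r (Lop F a (a \<boxtimes> a) I \<xi> (Rop F a a J \<eta> z))"
    by (rule L_functorial[OF a_mod aa_mod(1) a_mod \<mu>_hom I \<xi> Rz, symmetric])
  also have "Lop F a (a \<boxtimes> a) I \<xi> (Rop F a a J \<eta> z) = \<alpha> (Rop F a (a \<boxtimes> a) J \<eta> (Lop F a a I \<xi> z))"
    by (rule LR1[OF a_mod a_mod a_mod I J \<xi> \<eta> z])
  also have "\<mu> (\<mu>r \<dots>) = \<mu> (\<mu>l (Rop F a (a \<boxtimes> a) J \<eta> (Lop F a a I \<xi> z)))"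
    by (rule \<mu>_assoc[OF RLz, symmetric])
  also have "\<mu>l (Rop F a (a \<boxtimes> a) J \<eta> (Lop F a a I \<xi> z)) = Rop F a a J \<eta> (\<mu> (Lop F a a I \<xi> z))"
    by (rule R_functorial[OF a_mod aa_mod(1) a_mod \<mu>_hom J(1) \<eta> Lz])
  also have "\<mu> \<dots> = Y_op J \<eta> (X_op I \<xi> z)"
    using nhom_in[OF \<mu>_hom Lz] z by (simp add: X_op_apply Y_op_apply)
  finally show ?thesis .
qed

text \<open>The same route with the adjoint half of the locality square, where the Frobenius
  relation takes the place of associativity.\<close>

lemma XY_adj_commute:
  assumes \<xi>: "\<xi> \<in> local_vecs N a (fst I)" and \<eta>: "\<eta> \<in> local_vecs N a (fst J)" and z: "z \<in> carrier a"
  shows "X_op I \<xi> (adj a a (Y_op J \<eta>) z) = adj a a (Y_op J \<eta>) (X_op I \<xi> z)"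
proof -
  note h = hs[OF a_mod] hs[OF aa_mod(1)] hs[OF aa_mod(2)] hs[OF aa_mod(3)]
  note R = lhom_bop[OF R_hom[OF a_mod a_mod J(1) \<eta>]]
  note R' = lhom_bop[OF R_hom[OF a_mod aa_mod(1) J(1) \<eta>]]
  have Ya: "adj a a (Y_op J \<eta>) = compose (carrier a) (adj a (a \<boxtimes> a) (Rop F a a J \<eta>)) (adj (a \<boxtimes> a) a \<mu>)"
    unfolding Y_op_def by (rule adj_compose[OF h(1,2,1) R nhom_bop[OF \<mu>_hom]])
  have \<mu>s: "adj (a \<boxtimes> a) a \<mu> \<in> net_hom N a (a \<boxtimes> a)" by (rule nhom_adj[OF aa_mod(1) a_mod \<mu>_hom])
  let ?z = "adj (a \<boxtimes> a) a \<mu> z"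
  have zc: "?z \<in> carrier (a \<boxtimes> a)" by (rule nhom_in[OF \<mu>s z])
  have Rzc: "adj a (a \<boxtimes> a) (Rop F a a J \<eta>) ?z \<in> carrier a" by (rule bop_in[OF adj_bop[OF h(1,2) R] zc])
  have Lz: "Lop F a a I \<xi> z \<in> carrier (a \<boxtimes> a)" by (rule L_in[OF a_mod a_mod I \<xi> z])
  \<comment> \<open>The adjoint of functoriality of \<open>R\<close> for the adjoint of \<mu>: it
    carries \<mu> past the adjoint of \<open>R\<close>.\<close>
  have key: "\<mu> (adj (a \<boxtimes> a) (a \<boxtimes> a \<boxtimes> a) (Rop F a (a \<boxtimes> a) J \<eta>) u)
      = adj a (a \<boxtimes> a) (Rop F a a J \<eta>) (\<mu>l u)" if u: "u \<in> carrier (a \<boxtimes> a \<boxtimes> a)" for u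
  proof -
    interpret A: hilbert_space a by (rule h)
    have tot: "total_in a (carrier a)" unfolding total_in_def using A.inner_definite by blast
    have \<mu>la: "adj (a \<boxtimes> a \<boxtimes> a) (a \<boxtimes> a) \<mu>l = tensm F a (a \<boxtimes> a) a a (adj (a \<boxtimes> a) a \<mu>) (ident a)"
      using tensm_adj[OF aa_mod(1) a_mod a_mod a_mod \<mu>_hom nhom_ident[OF a_mod]] by simp
    have Ru: "adj (a \<boxtimes> a) (a \<boxtimes> a \<boxtimes> a) (Rop F a (a \<boxtimes> a) J \<eta>) u \<in> carrier (a \<boxtimes> a)"
      by (rule bop_in[OF adj_bop[OF h(2,3) R'] u])
    show ?thesis
    proof (rule A.hilbert_eqI_total[OF nhom_in[OF \<mu>_hom Ru] bop_in[OF adj_bop[OF h(1,2) R] nhom_in[OF \<mu>l_hom u]] tot])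
      fix y assume y: "y \<in> carrier a"
      have \<mu>y: "adj (a \<boxtimes> a) a \<mu> y \<in> carrier (a \<boxtimes> a)" by (rule nhom_in[OF \<mu>s y])
      have "hinner a y (\<mu> (adj (a \<boxtimes> a) (a \<boxtimes> a \<boxtimes> a) (Rop F a (a \<boxtimes> a) J \<eta>) u))
        = hinner (a \<boxtimes> a) (adj (a \<boxtimes> a) a \<mu> y) (adj (a \<boxtimes> a) (a \<boxtimes> a \<boxtimes> a) (Rop F a (a \<boxtimes> a) J \<eta>) u)"
        by (rule adj_ip2[OF h(2,1) nhom_bop[OF \<mu>_hom] Ru y, symmetric])
      also have "\<dots> = hinner (a \<boxtimes> a \<boxtimes> a) (Rop F a (a \<boxtimes> a) J \<eta> (adj (a \<boxtimes> a) a \<mu> y)) u"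
        by (rule adj_ip[OF h(2,3) R' \<mu>y u, symmetric])
      also have "Rop F a (a \<boxtimes> a) J \<eta> (adj (a \<boxtimes> a) a \<mu> y) = adj (a \<boxtimes> a \<boxtimes> a) (a \<boxtimes> a) \<mu>l (Rop F a a J \<eta> y)"
        unfolding \<mu>la by (rule R_functorial[OF a_mod a_mod aa_mod(1) \<mu>s J(1) \<eta> y, symmetric])
      also have "hinner (a \<boxtimes> a \<boxtimes> a) \<dots> u = hinner (a \<boxtimes> a) (Rop F a a J \<eta> y) (\<mu>l u)"
        by (rule adj_ip2[OF h(3,2) nhom_bop[OF \<mu>l_hom] u R_in[OF a_mod a_mod J(1) \<eta> y]])
      also have "\<dots> = hinner a y (adj a (a \<boxtimes> a) (Rop F a a J \<eta>) (\<mu>l u))"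
        by (rule adj_ip[OF h(1,2) R y nhom_in[OF \<mu>l_hom u]])
      finally show "hinner a y (\<mu> (adj (a \<boxtimes> a) (a \<boxtimes> a \<boxtimes> a) (Rop F a (a \<boxtimes> a) J \<eta>) u))
        = hinner a y (adj a (a \<boxtimes> a) (Rop F a a J \<eta>) (\<mu>l u))" .
    qed
  qed
  have "X_op I \<xi> (adj a a (Y_op J \<eta>) z) = \<mu> (Lop F a a I \<xi> (adj a (a \<boxtimes> a) (Rop F a a J \<eta>) ?z))"
    using z Rzc by (simp add: X_op_apply Ya)
  also have "Lop F a a I \<xi> (adj a (a \<boxtimes> a) (Rop F a a J \<eta>) ?z)
    = adj (a \<boxtimes> a) (a \<boxtimes> a \<boxtimes> a) (Rop F a (a \<boxtimes> a) J \<eta>)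
        (adj (a \<boxtimes> a \<boxtimes> a) (a \<boxtimes> (a \<boxtimes> a)) \<alpha> (Lop F a (a \<boxtimes> a) I \<xi> ?z))"
    by (rule LR2[OF a_mod a_mod a_mod I J \<xi> \<eta> zc])
  also have "Lop F a (a \<boxtimes> a) I \<xi> ?z = adj (a \<boxtimes> (a \<boxtimes> a)) (a \<boxtimes> a) \<mu>r (Lop F a a I \<xi> z)"
  proof -
    have "adj (a \<boxtimes> (a \<boxtimes> a)) (a \<boxtimes> a) \<mu>r = tensm F a a a (a \<boxtimes> a) (ident a) (adj (a \<boxtimes> a) a \<mu>)"
      using tensm_adj[OF a_mod a_mod aa_mod(1) a_mod nhom_ident[OF a_mod] \<mu>_hom] by simp
    then show ?thesis using L_functorial[OF a_mod a_mod aa_mod(1) \<mu>s I \<xi> z] by simp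
  qed
  also have "\<mu> (adj (a \<boxtimes> a) (a \<boxtimes> a \<boxtimes> a) (Rop F a (a \<boxtimes> a) J \<eta>)
        (adj (a \<boxtimes> a \<boxtimes> a) (a \<boxtimes> (a \<boxtimes> a)) \<alpha> (adj (a \<boxtimes> (a \<boxtimes> a)) (a \<boxtimes> a) \<mu>r (Lop F a a I \<xi> z))))
    = adj a (a \<boxtimes> a) (Rop F a a J \<eta>) (\<mu>l (adj (a \<boxtimes> a \<boxtimes> a) (a \<boxtimes> (a \<boxtimes> a)) \<alpha>
        (adj (a \<boxtimes> (a \<boxtimes> a)) (a \<boxtimes> a) \<mu>r (Lop F a a I \<xi> z))))"
    by (rule key[OF nhom_in[OF nhom_adj[OF aa_mod(2,3) \<alpha>_hom] nhom_in[OF nhom_adj[OF aa_mod(3,1) \<mu>r_hom] Lz]]])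
  also have "\<dots> = adj a (a \<boxtimes> a) (Rop F a a J \<eta>) (adj (a \<boxtimes> a) a \<mu> (\<mu> (Lop F a a I \<xi> z)))"
    by (simp only: \<mu>_frob'[OF Lz])
  also have "\<dots> = adj a a (Y_op J \<eta>) (X_op I \<xi> z)"
    using nhom_in[OF \<mu>_hom Lz] z by (simp add: X_op_apply Ya)
  finally show ?thesis .
qed

end

end

end

section \<open>Conjugation by invertible operators, and the algebra structure of
  \<open>B_Q(I)\<close>\<close>

lemma commute_adj_left:
  assumes H: "hilbert_space H" and X: "X \<in> bounded_ops H H" and Y: "Y \<in> bounded_ops H H"
    and c: "\<And>x. x \<in> carrier H \<Longrightarrow> X (Y x) = Y (X x)" and x: "x \<in> carrier H"
  shows "adj H H X (adj H H Y x) = adj H H Y (adj H H X x)"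
proof -
  have Ya: "adj H H Y \<in> bounded_ops H H" using H Y by simp
  show ?thesis
    by (rule adj_commute[OF H H X Ya Ya _ x]) (simp add: adj_adj[OF H H Y] c)
qed

lemma commute_adj_mixed:
  assumes H: "hilbert_space H" and X: "X \<in> bounded_ops H H" and Y: "Y \<in> bounded_ops H H"
    and c: "\<And>x. x \<in> carrier H \<Longrightarrow> X (adj H H Y x) = adj H H Y (X x)" and x: "x \<in> carrier H"
  shows "adj H H X (Y x) = Y (adj H H X x)"
  by (rule adj_commute[OF H H X Y Y c x])

text \<open>\<open>V X V\<inverse>\<close> respects adjoints because \<open>V\<^sup>* V\<close> commutes with \<open>M\<close>.\<close>

lemma conj_normal_rep:
  assumes H: "hilbert_space H" and K: "hilbert_space K" and V: "V \<in> bounded_ops H K" and S: "S \<in> bounded_ops K H"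
    and SV: "\<And>x. x \<in> carrier H \<Longrightarrow> S (V x) = x" and VS: "\<And>y. y \<in> carrier K \<Longrightarrow> V (S y) = y"
    and M: "M \<subseteq> bounded_ops H H" "ident H \<in> M" "\<And>X. X \<in> M \<Longrightarrow> adj H H X \<in> M"
    "\<And>X Y. \<lbrakk>X \<in> M; Y \<in> M\<rbrakk> \<Longrightarrow> op_add H H X Y \<in> M" "\<And>c X. X \<in> M \<Longrightarrow> op_smult H H c X \<in> M"
    "\<And>X Y. \<lbrakk>X \<in> M; Y \<in> M\<rbrakk> \<Longrightarrow> compose (carrier H) X Y \<in> M"
    and c: "\<And>X x. \<lbrakk>X \<in> M; x \<in> carrier H\<rbrakk> \<Longrightarrow> adj H K V (V (X x)) = X (adj H K V (V x))"
  shows "normal_rep H M K (\<lambda>X\<in>M. compose (carrier K) V (compose (carrier K) X S))"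
proof -
  interpret H: hilbert_space H by fact
  interpret K: hilbert_space K by fact
  have Mb: "X \<in> bounded_ops H H" if "X \<in> M" for X using M(1) that by blast
  note [simp] = bop_in[OF V] bop_in[OF S] bop_in[OF Mb] SV VS
  let ?p = "\<lambda>X. compose (carrier K) V (compose (carrier K) X S)"
  have pb: "?p X \<in> bounded_ops K K" if "X \<in> M" for X
    by (rule bop_compose[OF K H bop_compose[OF K H S Mb[OF that]] V])
  have p: "?p X y = V (X (S y))" if "y \<in> carrier K" for X y using that by simp
  have ident: "?p (ident H) = ident K"
    by (rule bop_eqI[OF pb[OF M(2)] ident_bop[OF K]]) simp
  have add: "?p (op_add H H X Y) = op_add K K (?p X) (?p Y)" if "X \<in> M" "Y \<in> M" for X Y
    by (rule bop_eqI[OF pb[OF M(4)[OF that]] op_add_bop[OF K K pb[OF that(2)] pb[OF that(1)]]])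
      (use that in \<open>simp add: bop_add[OF V]\<close>)
  have smult: "?p (op_smult H H k X) = op_smult K K k (?p X)" if "X \<in> M" for X k
    by (rule bop_eqI[OF pb[OF M(5)[OF that]] op_smult_bop[OF K K pb[OF that]]])
      (use that in \<open>simp add: bop_smult[OF V]\<close>)
  have comp: "?p (compose (carrier H) X Y) = compose (carrier K) (?p X) (?p Y)" if "X \<in> M" "Y \<in> M" for X Y
    by (rule bop_eqI[OF pb[OF M(6)[OF that]] bop_compose[OF K K pb[OF that(2)] pb[OF that(1)]]])
      (use that in simp)
  have adj: "?p (adj H H X) = adj K K (?p X)" if X: "X \<in> M" for X
  proof (rule adj_eqI[OF K K pb[OF X] pb[OF M(3)[OF X]], symmetric])
    fix y z assume y: "y \<in> carrier K" and z: "z \<in> carrier K"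
    note [simp] = bop_in[OF adj_bop[OF H K V]] bop_in[OF adj_bop[OF H H Mb[OF X]]]
    have "hinner K (?p X y) z = hinner H (X (S y)) (adj H K V z)"
      using y z X by (simp add: adj_ip[OF H K V])
    also have "\<dots> = hinner H (S y) (adj H H X (adj H K V (V (S z))))"
      using y z X by (simp add: adj_ip[OF H H Mb[OF X]])
    also have "\<dots> = hinner H (S y) (adj H K V (V (adj H H X (S z))))"
      using c[OF M(3)[OF X], of "S z"] z by simp
    also have "\<dots> = hinner K (V (S y)) (V (adj H H X (S z)))"
      by (rule adj_ip[OF H K V, symmetric]) (use y z X in simp_all)
    also have "\<dots> = hinner K y (?p (adj H H X) z)" using y z by simp
    finally show "hinner K (?p X y) z = hinner K y (?p (adj H H X) z)" .
  qed
  \<comment> \<open>Vectors representing a sigma-weak functional may be moved by bounded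
    operators.\<close>
  have ssq: "sq_summable H (\<lambda>n. T (\<xi> n))" if T: "T \<in> bounded_ops K H" and s: "sq_summable K \<xi>" for T \<xi>
  proof -
    obtain C where C: "C > 0" "\<And>x. x \<in> carrier K \<Longrightarrow> hnorm H (T x) \<le> C * hnorm K x"
      using bop_bound[OF K T] by blast
    have \<xi>: "\<xi> n \<in> carrier K" for n using s by (auto simp: sq_summable_def)
    have "summable (\<lambda>n. C\<^sup>2 * (hnorm K (\<xi> n))\<^sup>2)" using s by (intro summable_mult) (simp add: sq_summable_def)
    then have "summable (\<lambda>n. (hnorm H (T (\<xi> n)))\<^sup>2)"
    proof (rule summable_comparison_test')
      fix n :: nat
      have "hnorm H (T (\<xi> n)) ^ 2 \<le> (C * hnorm K (\<xi> n))\<^sup>2"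
        using C(2)[OF \<xi>] bop_in[OF T \<xi>] by (intro power_mono) auto
      then show "norm ((hnorm H (T (\<xi> n)))\<^sup>2) \<le> C\<^sup>2 * (hnorm K (\<xi> n))\<^sup>2" by (simp add: power_mult_distrib)
    qed
    then show ?thesis using bop_in[OF T \<xi>] by (auto simp: sq_summable_def)
  qed
  have top: "M \<subseteq> topspace (sigma_weak H)"
  proof
    fix X assume X: "X \<in> M"
    have "X \<in> {X \<in> bounded_ops H H. (\<Sum>n. hinner H (X ((\<lambda>n. \<zero>\<^bsub>H\<^esub>) n)) ((\<lambda>n. \<zero>\<^bsub>H\<^esub>) n)) \<in> UNIV}"
      using Mb[OF X] by simp
    moreover have "sq_summable H (\<lambda>n. \<zero>\<^bsub>H\<^esub>)" by (auto simp: sq_summable_def)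
    ultimately show "X \<in> topspace (sigma_weak H)"
      unfolding sigma_weak_def topology_generated_by_topspace
      by (intro UnionI CollectI exI conjI) (rule refl | assumption | rule open_UNIV)+
  qed
  have cont: "continuous_map (subtopology (sigma_weak H) M) (sigma_weak K) (\<lambda>X\<in>M. ?p X)"
    unfolding sigma_weak_def[of K]
  proof (rule continuous_on_generated_topo)
    fix U assume "U \<in> {{X \<in> bounded_ops K K. (\<Sum>n. hinner K (X (\<xi> n)) (\<eta> n)) \<in> T} | \<xi> \<eta> T.
        sq_summable K \<xi> \<and> sq_summable K \<eta> \<and> open T}"
    then obtain \<xi> \<eta> T where U: "U = {X \<in> bounded_ops K K. (\<Sum>n. hinner K (X (\<xi> n)) (\<eta> n)) \<in> T}"
      and s: "sq_summable K \<xi>" "sq_summable K \<eta>" "open T" by blast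
    have \<xi>: "\<xi> n \<in> carrier K" "\<eta> n \<in> carrier K" for n using s by (auto simp: sq_summable_def)
    \<comment> \<open>\<open><V X S \<xi>, \<eta>> = <X S \<xi>, adj V \<eta>>\<close>, so the
      preimage of a subbasic set is again subbasic: conjugation is sigma-weakly continuous.\<close>
    let ?W = "{X \<in> bounded_ops H H. (\<Sum>n. hinner H (X (S (\<xi> n))) (adj H K V (\<eta> n))) \<in> T}"
    have "openin (sigma_weak H) ?W"
      unfolding sigma_weak_def
      by (rule topology_generated_by_Basis, rule CollectI, rule exI[of _ "\<lambda>n. S (\<xi> n)"],
          rule exI[of _ "\<lambda>n. adj H K V (\<eta> n)"], rule exI[of _ T])
        (use ssq[OF S s(1)] ssq[OF adj_bop[OF H K V] s(2)] s(3) in simp)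
    then have "openin (subtopology (sigma_weak H) M) (?W \<inter> M)"
      by (auto simp: openin_subtopology)
    moreover have "(\<lambda>X\<in>M. ?p X) -` U \<inter> topspace (subtopology (sigma_weak H) M) = ?W \<inter> M"
    proof -
      have "(\<lambda>X\<in>M. ?p X) X \<in> U \<longleftrightarrow> X \<in> ?W" if X: "X \<in> M" for X
      proof -
        have "hinner K (?p X (\<xi> n)) (\<eta> n) = hinner H (X (S (\<xi> n))) (adj H K V (\<eta> n))" for n
          using \<xi>[of n] X by (simp add: adj_ip[OF H K V])
        then show ?thesis using X pb[OF X] Mb[OF X] by (simp add: U)
      qed
      then show ?thesis using top by auto
    qed
    ultimately show "openin (subtopology (sigma_weak H) M) ((\<lambda>X\<in>M. ?p X) -` U \<inter> topspace (subtopology (sigma_weak H) M))"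
      by simp
  next
    have "topspace (sigma_weak K) = bounded_ops K K"
    proof
      show "topspace (sigma_weak K) \<subseteq> bounded_ops K K"
        unfolding sigma_weak_def topology_generated_by_topspace by blast
      show "bounded_ops K K \<subseteq> topspace (sigma_weak K)"
      proof
        fix X assume X: "X \<in> bounded_ops K K"
        have "X \<in> {X \<in> bounded_ops K K. (\<Sum>n. hinner K (X ((\<lambda>n. \<zero>\<^bsub>K\<^esub>) n)) ((\<lambda>n. \<zero>\<^bsub>K\<^esub>) n)) \<in> UNIV}"
          using X by simp
        moreover have "sq_summable K (\<lambda>n. \<zero>\<^bsub>K\<^esub>)" by (auto simp: sq_summable_def)
        ultimately show "X \<in> topspace (sigma_weak K)"
          unfolding sigma_weak_def topology_generated_by_topspace
          by (intro UnionI CollectI exI conjI) (rule refl | assumption | rule open_UNIV)+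
      qed
    qed
    then show "(\<lambda>X\<in>M. ?p X) ` topspace (subtopology (sigma_weak H) M)
        \<subseteq> \<Union> {{X \<in> bounded_ops K K. (\<Sum>n. hinner K (X (\<xi> n)) (\<eta> n)) \<in> S} | \<xi> \<eta> S.
        sq_summable K \<xi> \<and> sq_summable K \<eta> \<and> open S}"
      using pb unfolding sigma_weak_def topology_generated_by_topspace by auto
  qed
  show ?thesis
    unfolding normal_rep_def
    using cont pb ident add smult comp adj M(2-6) by simp
qed

context moebius_net
begin

lemma lhom_op_add:
  assumes i: "net_module N i" and j: "net_module N j" and I: "I \<in> arcs"
    and S: "S \<in> local_hom N I i j" and T: "T \<in> local_hom N I i j"
  shows "op_add i j S T \<in> local_hom N I i j"
proof (rule lhomI)
  show "op_add i j S T \<in> bounded_ops i j"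
    by (rule op_add_bop[OF hs[OF i] hs[OF j] lhom_bop[OF T] lhom_bop[OF S]])
  fix x \<xi> assume x: "x \<in> local_alg N I" and \<xi>: "\<xi> \<in> carrier i"
  show "op_add i j S T (act i I x \<xi>) = act j I x (op_add i j S T \<xi>)"
    using \<xi> act_in[OF i I x \<xi>] lhom_act[OF S x \<xi>] lhom_act[OF T x \<xi>]
      bop_add[OF act_bop[OF j I x] lhom_in[OF S \<xi>] lhom_in[OF T \<xi>]] by simp
qed

lemma lhom_op_smult:
  assumes i: "net_module N i" and j: "net_module N j" and I: "I \<in> arcs" and T: "T \<in> local_hom N I i j"
  shows "op_smult i j c T \<in> local_hom N I i j"
proof (rule lhomI)
  show "op_smult i j c T \<in> bounded_ops i j" by (rule op_smult_bop[OF hs[OF i] hs[OF j] lhom_bop[OF T]])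
  fix x \<xi> assume x: "x \<in> local_alg N I" and \<xi>: "\<xi> \<in> carrier i"
  show "op_smult i j c T (act i I x \<xi>) = act j I x (op_smult i j c T \<xi>)"
    using \<xi> act_in[OF i I x \<xi>] lhom_act[OF T x \<xi>] bop_smult[OF act_bop[OF j I x] lhom_in[OF T \<xi>]] by simp
qed

lemma lhom_inverse:
  assumes i: "net_module N i" and j: "net_module N j" and I: "I \<in> arcs" and T: "T \<in> local_hom N I i j"
    and S: "S \<in> bounded_ops j i" "\<And>x. x \<in> carrier i \<Longrightarrow> S (T x) = x" "\<And>y. y \<in> carrier j \<Longrightarrow> T (S y) = y"
  shows "S \<in> local_hom N I j i"
proof (rule lhomI[OF S(1)])
  fix x y assume x: "x \<in> local_alg N I" and y: "y \<in> carrier j"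
  have Sy: "S y \<in> carrier i" by (rule bop_in[OF S(1) y])
  have "act j I x y = T (act i I x (S y))" using lhom_act[OF T x Sy] S(3)[OF y] by simp
  then show "S (act j I x y) = act i I x (S y)" using S(2)[OF act_in[OF i I x Sy]] by simp
qed

end

text \<open>\<open>I\<close> and \<open>I'\<close> lie in no common arc, so the modules are local only because \<open>A(I)\<close> acts through \<open>L\<close>.\<close>

lemma (in fusion_net) act_lhom_compl:
  assumes k: "net_module N k" and I: "I \<in> arg_arcs" and x: "x \<in> local_alg N (fst I)"
  shows "act k (fst I) x \<in> local_hom N (arc_compl (fst I)) k k"
proof -
  obtain J where J: "J \<in> arg_arcs" "clockwise_to J I" "arc_compl (fst J) = fst I"
    by (rule arg_compl_exists[OF I]) (rule that)
  note arcs = arg_arc_fst[OF I] arc_compl_in[OF arg_arc_fst[OF I]]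
  have m: "net_module N (vac \<boxtimes> k)" by (rule tens_module[OF vac_module k])
  have xv: "x Om \<in> local_vecs N vac (fst I)" by (rule local_vecsI[OF local_lhom_compl[OF arcs(1) x]])
  have h: "compose (carrier k) (lunit F k) (Lop F vac k I (x Om)) \<in> local_hom N (arc_compl (fst I)) k k"
    by (rule lhom_compose[OF k m L_hom[OF vac_module k I xv] nhom_lhom[OF unitors(1)[OF k] arcs(2)] arcs(2)])
  \<comment> \<open>The action of \<open>x\<close> is \<open>L(x Om)\<close> up to the unitor. On a
    vector \<open>z\<close> local in the complement this follows by exchanging \<open>L\<close> for
    \<open>R(z)\<close>, which intertwines \<open>A(I)\<close>.\<close>
  have "compose (carrier k) (lunit F k) (Lop F vac k I (x Om)) = act k (fst I) x"
  proof (rule bop_eqI_total[OF hs[OF k] hs[OF k] lhom_bop[OF h] act_bop[OF k arcs(1) x] local_total[OF k arg_arc_fst[OF J(1)]]])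
    fix z assume z: "z \<in> local_vecs N k (fst J)"
    have zc: "z \<in> carrier k" by (rule local_vecs_in[OF k z])
    have R: "Rop F k vac J z \<in> local_hom N (fst I) vac (vac \<boxtimes> k)"
      using R_hom[OF k vac_module J(1) z] J(3) by simp
    have ROm: "Rop F k vac J z Om \<in> carrier (vac \<boxtimes> k)" using lhom_in[OF R, of Om] by simp
    have "lunit F k (Lop F vac k I (x Om) z) = lunit F k (Rop F k vac J z (x Om))"
      using L_R_swap[OF vac_module k I J(1,2) xv z] by simp
    also have "Rop F k vac J z (x Om) = act (vac \<boxtimes> k) (fst I) x (Rop F k vac J z Om)"
      using lhom_act[OF R x, of Om] by simp
    also have "lunit F k \<dots> = act k (fst I) x z"
      using lhom_act[OF nhom_lhom[OF unitors(1)[OF k] arcs(1)] x ROm] R_state_field[OF k J(1) z] by simp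
    finally show "compose (carrier k) (lunit F k) (Lop F vac k I (x Om)) z = act k (fst I) x z" using zc by simp
  qed
  then show ?thesis using h by simp
qed

context frobenius_alg
begin

text \<open>Right multiplications create every local vector from \<omega>, by
  \<open>Y_op_vac\<close>. So an operator commuting with them is determined by its value at \<omega>
  and agrees with left multiplication by that value; the value is local because the operator
  intertwines \<open>A(I')\<close>.\<close>

lemma BQ_iff:
  assumes I: "I \<in> arg_arcs" and J: "J \<in> arg_arcs" "clockwise_to J I"
  shows "X \<in> BQ I \<longleftrightarrow> X \<in> local_hom N (arc_compl (fst I)) a a \<and>
    (\<forall>\<eta>\<in>local_vecs N a (fst J). \<forall>z\<in>carrier a. X (Y_op J \<eta> z) = Y_op J \<eta> (X z) \<and>
       X (adj a a (Y_op J \<eta>) z) = adj a a (Y_op J \<eta>) (X z))" (is "_ \<longleftrightarrow> ?r")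
    and "X \<in> BQ I \<Longrightarrow> X \<omega> \<in> local_vecs N a (fst I) \<and> X = X_op I (X \<omega>)"
proof -
  show form: "X \<omega> \<in> local_vecs N a (fst I) \<and> X = X_op I (X \<omega>)" if "X \<in> BQ I"
    using that X_op_vac[OF I] by (auto simp: BQ_eq)
  show "X \<in> BQ I \<longleftrightarrow> ?r"
  proof
    assume "X \<in> BQ I"
    then show ?r using X_op_hom[OF I] XY_commute[OF I J] XY_adj_commute[OF I J] by (auto simp: BQ_eq)
  next
    assume r: ?r
    let ?\<xi> = "X \<omega>"
    have \<xi>: "?\<xi> \<in> local_vecs N a (fst I)"
    proof -
      have c: "arc_compl (fst I) \<in> arcs" by (rule arc_compl_in[OF arg_arc_fst[OF I]])
      have "compose (carrier vac) X \<iota> Om \<in> local_vecs N a (fst I)"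
        by (rule local_vecsI[OF lhom_compose[OF vac_module a_mod nhom_lhom[OF \<iota>_hom c] conjunct1[OF r] c]])
      then show ?thesis by simp
    qed
    have "X = X_op I ?\<xi>"
    proof (rule bop_eqI_total[OF hs[OF a_mod] hs[OF a_mod] lhom_bop[OF conjunct1[OF r]] lhom_bop[OF X_op_hom[OF I \<xi>]]
          local_total[OF a_mod arg_arc_fst[OF J(1)]]])
      fix \<eta> assume \<eta>: "\<eta> \<in> local_vecs N a (fst J)"
      have "X (Y_op J \<eta> \<omega>) = Y_op J \<eta> ?\<xi>" using r \<eta> by simp
      also have "\<dots> = Y_op J \<eta> (X_op I ?\<xi> \<omega>)" using X_op_vac[OF I \<xi>] by simp
      also have "\<dots> = X_op I ?\<xi> (Y_op J \<eta> \<omega>)" by (rule XY_commute[OF I J \<xi> \<eta> \<omega>_in, symmetric])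
      finally show "X \<eta> = X_op I ?\<xi> \<eta>" using Y_op_vac[OF J(1) \<eta>] by simp
    qed
    then show "X \<in> BQ I" using \<xi> by (auto simp: BQ_eq)
  qed
qed

lemma BQ_form:
  assumes I: "I \<in> arg_arcs" and X: "X \<in> BQ I"
  shows "X \<omega> \<in> local_vecs N a (fst I)" "X = X_op I (X \<omega>)" "X \<in> local_hom N (arc_compl (fst I)) a a" "X \<in> bounded_ops a a"
proof -
  show "X \<omega> \<in> local_vecs N a (fst I)" "X = X_op I (X \<omega>)" using X X_op_vac[OF I] by (auto simp: BQ_eq)
  show "X \<in> local_hom N (arc_compl (fst I)) a a" using X X_op_hom[OF I] by (auto simp: BQ_eq)
  then show "X \<in> bounded_ops a a" by (rule lhom_bop)
qed

lemma X_op_BQ: "\<xi> \<in> local_vecs N a (fst I) \<Longrightarrow> X_op I \<xi> \<in> BQ I"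
  by (auto simp: BQ_eq)

text \<open>Everything is read off from the commutation conditions of \<open>BQ_iff\<close>, where
  products, adjoints and inverses are transparent. Closure under inverses is what lets an
  isomorphism of extensions transport invertibility.\<close>

lemma BQ_closed:
  assumes I: "I \<in> arg_arcs"
  shows "ident a \<in> BQ I"
    and "X \<in> BQ I \<Longrightarrow> adj a a X \<in> BQ I"
    and "\<lbrakk>X \<in> BQ I; Z \<in> BQ I\<rbrakk> \<Longrightarrow> op_add a a X Z \<in> BQ I"
    and "X \<in> BQ I \<Longrightarrow> op_smult a a c X \<in> BQ I"
    and "\<lbrakk>X \<in> BQ I; Z \<in> BQ I\<rbrakk> \<Longrightarrow> compose (carrier a) X Z \<in> BQ I"
    and "\<lbrakk>X \<in> BQ I; S \<in> bounded_ops a a; \<And>x. x \<in> carrier a \<Longrightarrow> S (X x) = x; \<And>x. x \<in> carrier a \<Longrightarrow> X (S x) = x\<rbrakk>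
      \<Longrightarrow> S \<in> BQ I"
    and "x \<in> local_alg N (fst I) \<Longrightarrow> act a (fst I) x \<in> BQ I"
proof -
  obtain J where J: "J \<in> arg_arcs" "clockwise_to J I" "fst J = arc_compl (fst I)" "arc_compl (fst J) = fst I"
    by (rule arg_compl_exists[OF I]) (rule that)
  note iff = BQ_iff(1)[OF I J(1,2)]
  have c: "arc_compl (fst I) \<in> arcs" "fst I \<in> arcs" using arc_compl_in arg_arc_fst[OF I] by auto
  note h = hs[OF a_mod]
  have Y: "Y_op J \<eta> \<in> bounded_ops a a" if "\<eta> \<in> local_vecs N a (fst J)" for \<eta>
    by (rule lhom_bop[OF Y_op_hom[OF J(1) that]])
  note Yin = bop_in[OF Y] bop_in[OF adj_bop[OF h h Y]]
  have Xb: "X \<in> bounded_ops a a" if "X \<in> BQ I" for X using BQ_form[OF I that] by blast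
  note Xin = bop_in[OF Xb]
  have Xc: "X (Y_op J \<eta> z) = Y_op J \<eta> (X z)" "X (adj a a (Y_op J \<eta>) z) = adj a a (Y_op J \<eta>) (X z)"
    if "X \<in> BQ I" "\<eta> \<in> local_vecs N a (fst J)" "z \<in> carrier a" for X \<eta> z
    using that iff by auto
  show "ident a \<in> BQ I"
    unfolding iff using nhom_lhom[OF nhom_ident[OF a_mod] c(1)] Yin by simp
  show "adj a a X \<in> BQ I" if X: "X \<in> BQ I"
    unfolding iff
  proof (intro conjI ballI)
    show "adj a a X \<in> local_hom N (arc_compl (fst I)) a a"
      by (rule lhom_adj[OF a_mod a_mod BQ_form(3)[OF I X] c(1)])
    fix \<eta> z assume \<eta>: "\<eta> \<in> local_vecs N a (fst J)" and z: "z \<in> carrier a"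
    show "adj a a X (Y_op J \<eta> z) = Y_op J \<eta> (adj a a X z)"
      by (rule commute_adj_mixed[OF h Xb[OF X] Y[OF \<eta>] Xc(2)[OF X \<eta>] z])
    show "adj a a X (adj a a (Y_op J \<eta>) z) = adj a a (Y_op J \<eta>) (adj a a X z)"
      by (rule commute_adj_left[OF h Xb[OF X] Y[OF \<eta>] Xc(1)[OF X \<eta>] z])
  qed
  show "op_add a a X Z \<in> BQ I" if X: "X \<in> BQ I" and Z: "Z \<in> BQ I"
    unfolding iff
  proof (intro conjI ballI)
    show "op_add a a X Z \<in> local_hom N (arc_compl (fst I)) a a"
      by (rule lhom_op_add[OF a_mod a_mod c(1) BQ_form(3)[OF I X] BQ_form(3)[OF I Z]])
    fix \<eta> z assume \<eta>: "\<eta> \<in> local_vecs N a (fst J)" and z: "z \<in> carrier a"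
    show "op_add a a X Z (Y_op J \<eta> z) = Y_op J \<eta> (op_add a a X Z z)"
      using z Yin(1)[OF \<eta> z] Xc(1)[OF X \<eta> z] Xc(1)[OF Z \<eta> z] bop_add[OF Y[OF \<eta>] Xin[OF X z] Xin[OF Z z]] by simp
    show "op_add a a X Z (adj a a (Y_op J \<eta>) z) = adj a a (Y_op J \<eta>) (op_add a a X Z z)"
      using z Yin(2)[OF \<eta> z] Xc(2)[OF X \<eta> z] Xc(2)[OF Z \<eta> z]
        bop_add[OF adj_bop[OF h h Y[OF \<eta>]] Xin[OF X z] Xin[OF Z z]] by simp
  qed
  show "op_smult a a c X \<in> BQ I" if X: "X \<in> BQ I" for c
    unfolding iff
  proof (intro conjI ballI)
    show "op_smult a a c X \<in> local_hom N (arc_compl (fst I)) a a"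
      by (rule lhom_op_smult[OF a_mod a_mod _ BQ_form(3)[OF I X]]) (rule arc_compl_in[OF arg_arc_fst[OF I]])
    fix \<eta> z assume \<eta>: "\<eta> \<in> local_vecs N a (fst J)" and z: "z \<in> carrier a"
    show "op_smult a a c X (Y_op J \<eta> z) = Y_op J \<eta> (op_smult a a c X z)"
      using z Yin(1)[OF \<eta> z] Xc(1)[OF X \<eta> z] bop_smult[OF Y[OF \<eta>] Xin[OF X z]] by simp
    show "op_smult a a c X (adj a a (Y_op J \<eta>) z) = adj a a (Y_op J \<eta>) (op_smult a a c X z)"
      using z Yin(2)[OF \<eta> z] Xc(2)[OF X \<eta> z] bop_smult[OF adj_bop[OF h h Y[OF \<eta>]] Xin[OF X z]] by simp
  qed
  show "compose (carrier a) X Z \<in> BQ I" if X: "X \<in> BQ I" and Z: "Z \<in> BQ I"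
    unfolding iff
  proof (intro conjI ballI)
    show "compose (carrier a) X Z \<in> local_hom N (arc_compl (fst I)) a a"
      by (rule lhom_compose[OF a_mod a_mod BQ_form(3)[OF I Z] BQ_form(3)[OF I X] c(1)])
    fix \<eta> z assume \<eta>: "\<eta> \<in> local_vecs N a (fst J)" and z: "z \<in> carrier a"
    show "compose (carrier a) X Z (Y_op J \<eta> z) = Y_op J \<eta> (compose (carrier a) X Z z)"
      using z Yin(1)[OF \<eta> z] Xc(1)[OF X \<eta> Xin[OF Z z]] Xc(1)[OF Z \<eta> z] by simp
    show "compose (carrier a) X Z (adj a a (Y_op J \<eta>) z) = adj a a (Y_op J \<eta>) (compose (carrier a) X Z z)"
      using z Yin(2)[OF \<eta> z] Xc(2)[OF X \<eta> Xin[OF Z z]] Xc(2)[OF Z \<eta> z] by simp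
  qed
  show "S \<in> BQ I" if X: "X \<in> BQ I" and S: "S \<in> bounded_ops a a" and SX: "\<And>x. x \<in> carrier a \<Longrightarrow> S (X x) = x"
    and XS: "\<And>x. x \<in> carrier a \<Longrightarrow> X (S x) = x"
    unfolding iff
  proof (intro conjI ballI)
    show "S \<in> local_hom N (arc_compl (fst I)) a a"
      by (rule lhom_inverse[OF a_mod a_mod c(1) BQ_form(3)[OF I X] S SX XS])
    fix \<eta> z assume \<eta>: "\<eta> \<in> local_vecs N a (fst J)" and z: "z \<in> carrier a"
    have Sz: "S z \<in> carrier a" by (rule bop_in[OF S z])
    show "S (Y_op J \<eta> z) = Y_op J \<eta> (S z)"
      using Xc(1)[OF X \<eta> Sz] SX[OF Yin(1)[OF \<eta> Sz]] XS[OF z] by simp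
    show "S (adj a a (Y_op J \<eta>) z) = adj a a (Y_op J \<eta>) (S z)"
      using Xc(2)[OF X \<eta> Sz] SX[OF Yin(2)[OF \<eta> Sz]] XS[OF z] by simp
  qed
  show "act a (fst I) x \<in> BQ I" if x: "x \<in> local_alg N (fst I)"
    unfolding iff
  proof (intro conjI ballI)
    let ?x = "adj (vac_space N) (vac_space N) x"
    have ax: "?x \<in> local_alg N (fst I)" by (rule vN_adj[OF local_vN[OF c(2)] x])
    note xb = act_bop[OF a_mod c(2) x]
    fix \<eta> z assume \<eta>: "\<eta> \<in> local_vecs N a (fst J)" and z: "z \<in> carrier a"
    have Yh: "Y_op J \<eta> \<in> local_hom N (fst I) a a" using Y_op_hom[OF J(1) \<eta>] J(4) by simp
    show "act a (fst I) x (Y_op J \<eta> z) = Y_op J \<eta> (act a (fst I) x z)"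
      by (rule lhom_act[OF Yh x z, symmetric])
    show "act a (fst I) x (adj a a (Y_op J \<eta>) z) = adj a a (Y_op J \<eta>) (act a (fst I) x z)"
      by (rule lhom_act[OF lhom_adj[OF a_mod a_mod Yh c(2)] x z, symmetric])
  qed (rule act_lhom_compl[OF a_mod I x])
qed

end

section \<open>Left isomorphisms\<close>

context frobenius_alg
begin

lemma BQ_mono:
  assumes I: "I \<in> arg_arcs" and J: "J \<in> arg_arcs" and IJ: "arg_sub I J"
  shows "BQ I \<subseteq> BQ J"
proof
  fix X assume "X \<in> BQ I"
  then obtain \<xi> where \<xi>: "\<xi> \<in> local_vecs N a (fst I)" "X = X_op I \<xi>" by (auto simp: BQ_eq)
  have "local_vecs N a (fst I) \<subseteq> local_vecs N a (fst J)"
    by (rule local_vecs_mono[OF a_mod arg_arc_fst[OF I] arg_arc_fst[OF J]]) (use IJ in \<open>simp add: arg_sub_def\<close>)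
  moreover have "X = X_op J \<xi>" using L_isotony[OF a_mod a_mod I J IJ \<xi>(1)] \<xi>(2) by (simp add: X_op_def)
  ultimately show "X \<in> BQ J" using \<xi>(1) by (auto simp: BQ_eq)
qed

lemma BQ_bop: "\<lbrakk>I \<in> arg_arcs; X \<in> BQ I\<rbrakk> \<Longrightarrow> X \<in> bounded_ops a a"
  by (rule BQ_form(4))

lemma BQ_cyclic:
  assumes I: "I \<in> arg_arcs" shows "total_in a {X \<omega> | X. X \<in> BQ I}"
proof -
  have "{X \<omega> | X. X \<in> BQ I} = local_vecs N a (fst I)"
  proof
    show "{X \<omega> | X. X \<in> BQ I} \<subseteq> local_vecs N a (fst I)" using BQ_form(1)[OF I] by blast
    show "local_vecs N a (fst I) \<subseteq> {X \<omega> | X. X \<in> BQ I}"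
    proof
      fix \<xi> assume "\<xi> \<in> local_vecs N a (fst I)"
      then show "\<xi> \<in> {X \<omega> | X. X \<in> BQ I}"
        by (intro CollectI exI[of _ "X_op I \<xi>"] conjI X_op_BQ) (simp add: X_op_vac[OF I])
    qed
  qed
  then show ?thesis using local_total[OF a_mod arg_arc_fst[OF I]] by simp
qed

lemma frob_extn_simps [simp]: "emod (frob_extn N F Q) = a" "eincl (frob_extn N F Q) = \<iota>"
  by (simp_all add: frob_extn_def)

end

lemma (in fusion_net) local_vecs_inverse_hom:
  assumes "net_module N i" "net_module N j" "V \<in> net_hom N i j" "I \<in> arcs" "\<xi> \<in> local_vecs N i I"
  shows "V \<xi> \<in> local_vecs N j I"
  by (rule hom_local_vecs[OF assms(1,2,4) nhom_lhom[OF assms(3) arc_compl_in[OF assms(4)]] assms(5)])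

text \<open>The inverse is a parameter because \<open>left_iso\<close> only asserts its existence,
  while the conjugation \<open>X -> V X S\<close> refers to it throughout.\<close>

locale left_iso_pair = A: frobenius_alg N F Qa + B: frobenius_alg N F Qb
  for N :: "'h net" and F :: "'h fusion" (structure) and Qa Qb :: "'h frob" +
  fixes V S
  assumes left: "left_iso N F Qa Qb V"
    and S_bop: "S \<in> bounded_ops (fobj Qb) (fobj Qa)"
    and S_V: "x \<in> carrier (fobj Qa) \<Longrightarrow> S (V x) = x"
    and V_S: "y \<in> carrier (fobj Qb) \<Longrightarrow> V (S y) = y"
begin

lemma V_hom: "V \<in> net_hom N A.a B.a"
  using left by (simp add: left_iso_def Let_def)

lemma S_hom: "S \<in> net_hom N B.a A.a"
  by (rule nhomI, rule A.lhom_inverse[OF A.a_mod B.a_mod _ nhom_lhom[OF V_hom] S_bop S_V V_S])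

lemma V_unit: "x \<in> carrier (vac_space N) \<Longrightarrow> V (A.\<iota> x) = B.\<iota> x"
proof -
  have "compose (carrier (vac_module N)) V (funit Qa) = funit Qb"
    using left by (simp add: left_iso_def Let_def)
  from fun_cong[OF this, of x] show "x \<in> carrier (vac_space N) \<Longrightarrow> V (A.\<iota> x) = B.\<iota> x" by simp
qed

lemma V_mult: "x \<in> carrier (A.a \<boxtimes> A.a) \<Longrightarrow> V (A.\<mu> x) = B.\<mu> (tensm F A.a B.a A.a B.a V V x)"
proof -
  have "compose (carrier (A.a \<boxtimes> A.a)) V (fmult Qa)
       = compose (carrier (A.a \<boxtimes> A.a)) (fmult Qb) (tensm F A.a B.a A.a B.a V V)"
    using left by (simp add: left_iso_def Let_def)
  from fun_cong[OF this, of x] show "x \<in> carrier (A.a \<boxtimes> A.a) \<Longrightarrow> V (A.\<mu> x) = B.\<mu> (tensm F A.a B.a A.a B.a V V x)"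
    by simp
qed

lemma V_star: "x \<in> carrier (A.a \<boxtimes> B.a) \<Longrightarrow> adj A.a B.a V (B.\<mu> (tensm F A.a B.a B.a B.a V (ident B.a) x))
    = A.\<mu> (tensm F A.a A.a B.a A.a (ident A.a) (adj A.a B.a V) x)"
proof -
  have "compose (carrier (A.a \<boxtimes> B.a)) (adj A.a B.a V)
         (compose (carrier (A.a \<boxtimes> B.a)) (fmult Qb) (tensm F A.a B.a B.a B.a V (ident B.a)))
       = compose (carrier (A.a \<boxtimes> B.a)) (fmult Qa) (tensm F A.a A.a B.a A.a (ident A.a) (adj A.a B.a V))"
    using left by (simp add: left_iso_def Let_def)
  from fun_cong[OF this, of x] show "x \<in> carrier (A.a \<boxtimes> B.a) \<Longrightarrow>
    adj A.a B.a V (B.\<mu> (tensm F A.a B.a B.a B.a V (ident B.a) x))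
    = A.\<mu> (tensm F A.a A.a B.a A.a (ident A.a) (adj A.a B.a V) x)" by simp
qed

text \<open>With the factors separated, \<open>L_functorial\<close> handles
  \<open>1 \<boxtimes> V\<close> and \<open>L_left_functorial\<close> handles
  \<open>V \<boxtimes> 1\<close>.\<close>

lemma V_V_split:
  assumes "x \<in> carrier (A.a \<boxtimes> A.a)"
  shows "tensm F A.a B.a A.a B.a V V x = tensm F A.a B.a B.a B.a V (ident B.a) (tensm F A.a A.a A.a B.a (ident A.a) V x)"
proof -
  have "compose (carrier A.a) V (ident A.a) = V"
    by (rule bop_eqI[OF bop_compose[OF A.hs A.hs ident_bop nhom_bop[OF V_hom]] nhom_bop[OF V_hom]]) simp_all
  moreover have "compose (carrier A.a) (ident B.a) V = V"
    by (rule bop_eqI[OF bop_compose[OF A.hs A.hs nhom_bop[OF V_hom] ident_bop] nhom_bop[OF V_hom]])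
      (simp_all add: nhom_in[OF V_hom])
  ultimately have "tensm F A.a B.a A.a B.a V V = compose (carrier (A.a \<boxtimes> A.a))
      (tensm F A.a B.a B.a B.a V (ident B.a)) (tensm F A.a A.a A.a B.a (ident A.a) V)"
    using A.tensm_compose[OF A.a_mod A.a_mod B.a_mod A.a_mod B.a_mod B.a_mod
        nhom_ident[OF A.a_mod] V_hom V_hom nhom_ident[OF B.a_mod]] by simp
  from fun_cong[OF this, of x] show ?thesis using assms by simp
qed

lemma V_L:
  assumes I: "I \<in> arg_arcs" and \<xi>: "\<xi> \<in> local_vecs N A.a (fst I)" and z: "z \<in> carrier A.a"
  shows "tensm F A.a A.a A.a B.a (ident A.a) V (Lop F A.a A.a I \<xi> z) = Lop F A.a B.a I \<xi> (V z)"
  by (rule A.L_functorial[OF A.a_mod A.a_mod B.a_mod V_hom I \<xi> z])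

lemma V_X:
  assumes I: "I \<in> arg_arcs" and \<xi>: "\<xi> \<in> local_vecs N A.a (fst I)" and z: "z \<in> carrier A.a"
  shows "V (A.X_op I \<xi> z) = B.X_op I (V \<xi>) (V z)"
proof -
  have Lz: "Lop F A.a A.a I \<xi> z \<in> carrier (A.a \<boxtimes> A.a)" by (rule A.L_in[OF A.a_mod A.a_mod I \<xi> z])
  have Vz: "V z \<in> carrier B.a" by (rule nhom_in[OF V_hom z])
  show ?thesis
    using V_mult[OF Lz] V_V_split[OF Lz] V_L[OF I \<xi> z] A.L_left_functorial[OF A.a_mod B.a_mod B.a_mod V_hom I \<xi> Vz] z Vz
    by (simp add: A.X_op_apply B.X_op_apply)
qed

text \<open>This is where the relation \<open>V_star\<close> enters: after multiplicativity of
  \<open>V\<close> it brings the adjoint of \<open>V\<close> through the product, onto the right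
  factor only, so left multiplication by \<xi> is unaffected.\<close>

lemma VV_commute:
  assumes I: "I \<in> arg_arcs" and X: "X \<in> A.BQ I" and z: "z \<in> carrier A.a"
  shows "adj A.a B.a V (V (X z)) = X (adj A.a B.a V (V z))"
proof -
  obtain \<xi> where \<xi>: "\<xi> \<in> local_vecs N A.a (fst I)" "X = A.X_op I \<xi>" using X by (auto simp: A.BQ_eq)
  have Va: "adj A.a B.a V \<in> net_hom N B.a A.a" by (rule A.nhom_adj[OF A.a_mod B.a_mod V_hom])
  have Lz: "Lop F A.a A.a I \<xi> z \<in> carrier (A.a \<boxtimes> A.a)" by (rule A.L_in[OF A.a_mod A.a_mod I \<xi>(1) z])
  have Vz: "V z \<in> carrier B.a" by (rule nhom_in[OF V_hom z])
  have LVz: "Lop F A.a B.a I \<xi> (V z) \<in> carrier (A.a \<boxtimes> B.a)" by (rule A.L_in[OF A.a_mod B.a_mod I \<xi>(1) Vz])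
  have "adj A.a B.a V (V (X z)) = adj A.a B.a V (B.\<mu> (tensm F A.a B.a B.a B.a V (ident B.a) (Lop F A.a B.a I \<xi> (V z))))"
    using V_mult[OF Lz] V_V_split[OF Lz] V_L[OF I \<xi>(1) z] z by (simp add: \<xi>(2) A.X_op_apply)
  also have "\<dots> = A.\<mu> (tensm F A.a A.a B.a A.a (ident A.a) (adj A.a B.a V) (Lop F A.a B.a I \<xi> (V z)))"
    by (rule V_star[OF LVz])
  also have "tensm F A.a A.a B.a A.a (ident A.a) (adj A.a B.a V) (Lop F A.a B.a I \<xi> (V z))
      = Lop F A.a A.a I \<xi> (adj A.a B.a V (V z))"
    by (rule A.L_functorial[OF A.a_mod B.a_mod A.a_mod Va I \<xi>(1) Vz])
  also have "A.\<mu> \<dots> = X (adj A.a B.a V (V z))"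
    using nhom_in[OF Va Vz] by (simp add: \<xi>(2) A.X_op_apply)
  finally show ?thesis .
qed

definition phi :: "arg_arc \<Rightarrow> ('h \<Rightarrow> 'h) \<Rightarrow> ('h \<Rightarrow> 'h)" where
  "phi = (\<lambda>I\<in>arg_arcs. \<lambda>X\<in>A.BQ I. compose (carrier B.a) V (compose (carrier B.a) X S))"

lemma phi_apply:
  assumes "I \<in> arg_arcs" "X \<in> A.BQ I"
  shows "phi I X = compose (carrier B.a) V (compose (carrier B.a) X S)"
  using assms by (simp add: phi_def)

lemma phi_bop: "\<lbrakk>I \<in> arg_arcs; X \<in> A.BQ I\<rbrakk> \<Longrightarrow> phi I X \<in> bounded_ops B.a B.a"
  using bop_compose[OF A.hs A.hs bop_compose[OF A.hs A.hs S_bop A.BQ_bop] nhom_bop[OF V_hom]]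
  by (simp add: phi_apply)

lemma phi_X:
  assumes I: "I \<in> arg_arcs" and \<xi>: "\<xi> \<in> local_vecs N A.a (fst I)"
  shows "phi I (A.X_op I \<xi>) = B.X_op I (V \<xi>)"
proof (rule bop_eqI[OF phi_bop[OF I A.X_op_BQ[OF \<xi>]]])
  have V\<xi>: "V \<xi> \<in> local_vecs N B.a (fst I)"
    by (rule A.local_vecs_inverse_hom[OF A.a_mod B.a_mod V_hom arg_arc_fst[OF I] \<xi>])
  show "B.X_op I (V \<xi>) \<in> bounded_ops B.a B.a" by (rule lhom_bop[OF B.X_op_hom[OF I V\<xi>]])
  fix z assume z: "z \<in> carrier B.a"
  show "phi I (A.X_op I \<xi>) z = B.X_op I (V \<xi>) z"
    using V_X[OF I \<xi> nhom_in[OF S_hom z]] V_S[OF z] z A.X_op_BQ[OF \<xi>] I by (simp add: phi_apply)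
qed

lemma phi_in: "\<lbrakk>I \<in> arg_arcs; X \<in> A.BQ I\<rbrakk> \<Longrightarrow> phi I X \<in> B.BQ I"
proof -
  assume I: "I \<in> arg_arcs" and "X \<in> A.BQ I"
  then obtain \<xi> where \<xi>: "\<xi> \<in> local_vecs N A.a (fst I)" "X = A.X_op I \<xi>" by (auto simp: A.BQ_eq)
  have "V \<xi> \<in> local_vecs N B.a (fst I)"
    by (rule A.local_vecs_inverse_hom[OF A.a_mod B.a_mod V_hom arg_arc_fst[OF I] \<xi>(1)])
  then show "phi I X \<in> B.BQ I" unfolding \<xi>(2) phi_X[OF I \<xi>(1)] by (rule B.X_op_BQ)
qed

lemma phi_bij:
  assumes I: "I \<in> arg_arcs" shows "bij_betw (phi I) (A.BQ I) (B.BQ I)"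
proof (rule bij_betwI')
  fix X Y assume X: "X \<in> A.BQ I" and Y: "Y \<in> A.BQ I"
  show "(phi I X = phi I Y) = (X = Y)"
  proof
    assume eq: "phi I X = phi I Y"
    show "X = Y"
    proof (rule bop_eqI[OF A.BQ_bop[OF I X] A.BQ_bop[OF I Y]])
      fix z assume z: "z \<in> carrier A.a"
      have Vz: "V z \<in> carrier B.a" by (rule nhom_in[OF V_hom z])
      have "V (X z) = V (Y z)"
        using fun_cong[OF eq, of "V z"] Vz S_V[OF z] by (simp add: phi_apply I X Y)
      then have "S (V (X z)) = S (V (Y z))" by (rule arg_cong)
      then show "X z = Y z"
        by (simp only: S_V[OF bop_in[OF A.BQ_bop[OF I X] z]] S_V[OF bop_in[OF A.BQ_bop[OF I Y] z]])
    qed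
  qed simp
next
  fix Y assume "Y \<in> B.BQ I"
  then obtain \<eta> where \<eta>: "\<eta> \<in> local_vecs N B.a (fst I)" "Y = B.X_op I \<eta>" by (auto simp: B.BQ_eq)
  have S\<eta>: "S \<eta> \<in> local_vecs N A.a (fst I)"
    by (rule A.local_vecs_inverse_hom[OF B.a_mod A.a_mod S_hom arg_arc_fst[OF I] \<eta>(1)])
  have "phi I (A.X_op I (S \<eta>)) = Y"
    using phi_X[OF I S\<eta>] V_S[OF A.local_vecs_in[OF B.a_mod \<eta>(1)]] \<eta>(2) by simp
  then show "\<exists>X\<in>A.BQ I. Y = phi I X" using A.X_op_BQ[OF S\<eta>] by blast
qed (rule phi_in[OF I])

lemma phi_iso: "extn_iso N (frob_extn N F Qa) (frob_extn N F Qb) phi"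
  unfolding extn_iso_def A.frob_extn_simps B.frob_extn_simps
proof (intro conjI ballI impI)
  show "phi \<in> (\<Pi>\<^sub>E I\<in>arg_arcs. A.BQ I \<rightarrow>\<^sub>E B.BQ I)"
    using phi_in by (auto simp: PiE_iff extensional_def phi_def)
next
  fix I assume I: "I \<in> arg_arcs"
  have eq: "phi I = (\<lambda>X\<in>A.BQ I. compose (carrier B.a) V (compose (carrier B.a) X S))"
    using I by (simp add: phi_def)
  have "normal_rep A.a (A.BQ I) B.a (phi I)"
    unfolding eq
    by (rule conj_normal_rep[OF A.hs[OF A.a_mod] A.hs[OF B.a_mod] nhom_bop[OF V_hom] S_bop S_V V_S subsetI
        A.BQ_closed(1)[OF I] A.BQ_closed(2)[OF I] A.BQ_closed(3)[OF I] A.BQ_closed(4)[OF I] A.BQ_closed(5)[OF I]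
        VV_commute[OF I]])
      (rule A.BQ_bop[OF I] | assumption)+
  then show "normal_iso A.a (A.BQ I) B.a (B.BQ I) (phi I)"
    using phi_bij[OF I] by (simp add: normal_iso_def)
next
  fix I J X assume I: "I \<in> arg_arcs" and J: "J \<in> arg_arcs" "arg_sub I J" and X: "X \<in> A.BQ I"
  have "X \<in> A.BQ J" using A.BQ_mono[OF I J] X by blast
  then show "phi J X = phi I X" using I J X by (simp add: phi_apply)
next
  fix I x assume I: "I \<in> arg_arcs" and x: "x \<in> local_alg N (fst I)"
  note X = A.BQ_closed(7)[OF I x]
  show "phi I (act A.a (fst I) x) = act B.a (fst I) x"
  proof (rule bop_eqI[OF phi_bop[OF I X] act_bop[OF B.a_mod arg_arc_fst[OF I] x]])
    fix z assume z: "z \<in> carrier B.a"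
    show "phi I (act A.a (fst I) x) z = act B.a (fst I) x z"
      using lhom_act[OF nhom_lhom[OF V_hom arg_arc_fst[OF I]] x nhom_in[OF S_hom z]] z V_S[OF z]
      by (simp add: phi_apply I X)
  qed
qed

lemma phi_implements: "implements (frob_extn N F Qa) (frob_extn N F Qb) V phi"
  unfolding implements_def A.frob_extn_simps
proof (intro ballI)
  fix I X assume I: "I \<in> arg_arcs" and X: "X \<in> A.BQ I"
  show "compose (carrier A.a) V X = compose (carrier A.a) (phi I X) V"
    by (rule bop_eqI[OF bop_compose[OF A.hs A.hs A.BQ_bop[OF I X] nhom_bop[OF V_hom]]
          bop_compose[OF A.hs A.hs nhom_bop[OF V_hom] phi_bop[OF I X]]])
      (simp_all add: phi_apply I X S_V nhom_in[OF V_hom])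
qed

text \<open>\<open>V\<close> is onto, so the intertwining relation fixes \<open>\<psi> I X\<close>
  on all of \<open>H_b\<close>; off the algebras and the intervals both families take the default
  value.\<close>

lemma phi_unique:
  assumes iso: "extn_iso N (frob_extn N F Qa) (frob_extn N F Qb) \<psi>"
    and imp: "implements (frob_extn N F Qa) (frob_extn N F Qb) V \<psi>"
  shows "\<psi> = phi"
proof -
  have \<psi>: "\<psi> \<in> (\<Pi>\<^sub>E I\<in>arg_arcs. A.BQ I \<rightarrow>\<^sub>E B.BQ I)" using iso by (simp add: extn_iso_def)
  have "\<psi> I X = phi I X" if I: "I \<in> arg_arcs" and X: "X \<in> A.BQ I" for I X
  proof (rule bop_eqI[OF B.BQ_bop[OF I] phi_bop[OF I X]])
    show "\<psi> I X \<in> B.BQ I" using \<psi> I X by (auto simp: PiE_iff)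
    fix z assume z: "z \<in> carrier B.a"
    have Sz: "S z \<in> carrier A.a" by (rule nhom_in[OF S_hom z])
    have "compose (carrier A.a) V X = compose (carrier A.a) (\<psi> I X) V"
      using imp I X by (simp add: implements_def)
    from fun_cong[OF this, of "S z"] show "\<psi> I X z = phi I X z"
      using Sz z V_S[OF z] by (simp add: phi_apply I X)
  qed
  moreover have "\<psi> I X = phi I X" if I: "I \<in> arg_arcs" and X: "X \<notin> A.BQ I" for I X
  proof -
    have "\<psi> I \<in> A.BQ I \<rightarrow>\<^sub>E B.BQ I" by (rule PiE_mem[OF \<psi> I])
    from PiE_arb[OF this X] show ?thesis using I X by (simp add: phi_def)
  qed
  moreover have "\<psi> I = phi I" if "I \<notin> arg_arcs" for I
    using PiE_arb[OF \<psi> that] that by (simp add: phi_def)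
  ultimately show ?thesis by (intro ext) metis
qed

lemma iso_of_eq: "iso_of N F Qa Qb V = phi"
  unfolding iso_of_def
proof (rule the_equality)
  show "extn_iso N (frob_extn N F Qa) (frob_extn N F Qb) phi \<and> implements (frob_extn N F Qa) (frob_extn N F Qb) V phi"
    by (intro conjI phi_iso phi_implements)
next
  fix \<psi> assume "extn_iso N (frob_extn N F Qa) (frob_extn N F Qb) \<psi> \<and> implements (frob_extn N F Qa) (frob_extn N F Qb) V \<psi>"
  then show "\<psi> = phi" by (elim conjE) (rule phi_unique)
qed

text \<open>An implementing unitary \<open>W\<close> that matches the units sends
  \<open>X \<omega>\<close> to \<open>phi I X\<close> applied to the unit vector of
  \<open>Qb\<close>, as \<open>V\<close> does. These vectors are total, so
  \<open>W = V\<close>.\<close>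

lemma unitary_iff:
  "V \<in> unitary_ops A.a B.a \<longleftrightarrow> unitary_extn_iso N (frob_extn N F Qa) (frob_extn N F Qb) phi"
proof
  assume "V \<in> unitary_ops A.a B.a"
  moreover have "compose (carrier (vac_module N)) V (funit Qa) = funit Qb"
    using left by (simp add: left_iso_def Let_def)
  ultimately show "unitary_extn_iso N (frob_extn N F Qa) (frob_extn N F Qb) phi"
    using phi_iso phi_implements by (auto simp: unitary_extn_iso_def)
next
  assume "unitary_extn_iso N (frob_extn N F Qa) (frob_extn N F Qb) phi"
  then obtain W where W: "W \<in> unitary_ops A.a B.a" "compose (carrier (vac_module N)) W (funit Qa) = funit Qb"
    and imp: "implements (frob_extn N F Qa) (frob_extn N F Qb) W phi"
    by (auto simp: unitary_extn_iso_def)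
  have Wb: "W \<in> bounded_ops A.a B.a" using W by (simp add: unitary_ops_def)
  have W\<omega>: "W A.\<omega> = B.\<omega>" using fun_cong[OF W(2), of "vacuum N"] by simp
  have "arc_of 0 1 \<in> arcs" using pi_gt3 by (intro arc_of_in) auto
  then obtain I where I: "I \<in> arg_arcs" using arg_arc_exists by blast
  have "W = V"
  proof (rule bop_eqI_total[OF A.hs[OF A.a_mod] A.hs[OF B.a_mod] Wb nhom_bop[OF V_hom] A.BQ_cyclic[OF I]])
    fix z assume "z \<in> {X A.\<omega> |X. X \<in> A.BQ I}"
    then obtain X where X: "X \<in> A.BQ I" "z = X A.\<omega>" by blast
    have "compose (carrier A.a) W X A.\<omega> = compose (carrier A.a) (phi I X) W A.\<omega>"
      using imp I X(1) by (simp add: implements_def)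
    moreover have "compose (carrier A.a) V X A.\<omega> = compose (carrier A.a) (phi I X) V A.\<omega>"
      using phi_implements I X(1) by (simp add: implements_def)
    ultimately show "W z = V z" using X W\<omega> V_unit[of "vacuum N"] by simp
  qed
  then show "V \<in> unitary_ops A.a B.a" using W by simp
qed

end

section \<open>Existence of the inverse, and composition of left isomorphisms\<close>

lemma left_iso_pairI:
  assumes "irreducible_moebius_net N" "categorical_extension N F" "cstar_frobenius N F Qa" "cstar_frobenius N F Qb"
    "left_iso N F Qa Qb V"
  obtains S where "left_iso_pair N F Qa Qb V S"
proof -
  interpret irreducible_moebius_net N by fact
  interpret categorical_extension N F by fact
  interpret A: frobenius_alg N F Qa by unfold_locales fact
  interpret B: frobenius_alg N F Qb by unfold_locales fact
  obtain S where S: "S \<in> bounded_ops (fobj Qb) (fobj Qa)" "compose (carrier (fobj Qa)) S V = ident (fobj Qa)"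
    "compose (carrier (fobj Qb)) V S = ident (fobj Qb)"
    using assms(5) by (auto simp: left_iso_def Let_def)
  have "left_iso_pair N F Qa Qb V S"
  proof
    show "left_iso N F Qa Qb V" "S \<in> bounded_ops (fobj Qb) (fobj Qa)" by fact+
    show "S (V x) = x" if "x \<in> carrier (fobj Qa)" for x
      using fun_cong[OF S(2), of x] that by simp
    show "V (S x) = x" if "x \<in> carrier (fobj Qb)" for x
      using fun_cong[OF S(3), of x] that by simp
  qed
  then show ?thesis by (rule that)
qed

lemma left_iso_compose:
  assumes net: "irreducible_moebius_net N" "categorical_extension N F"
    and Q: "cstar_frobenius N F Qa" "cstar_frobenius N F Qb" "cstar_frobenius N F Qc"
    and V: "left_iso N F Qa Qb V" and W: "left_iso N F Qb Qc W"
  defines "WV \<equiv> compose (carrier (fobj Qa)) W V"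
  shows "left_iso N F Qa Qc WV"
    and "iso_of N F Qa Qc WV = extn_iso_compose (frob_extn N F Qa) (iso_of N F Qb Qc W) (iso_of N F Qa Qb V)"
proof -
  obtain S where "left_iso_pair N F Qa Qb V S" by (rule left_iso_pairI[OF net Q(1,2) V])
  then interpret P: left_iso_pair N F Qa Qb V S .
  obtain T where "left_iso_pair N F Qb Qc W T" by (rule left_iso_pairI[OF net Q(2,3) W])
  then interpret R: left_iso_pair N F Qb Qc W T .
  let ?a = "fobj Qa" and ?b = "fobj Qb" and ?c = "fobj Qc"
  note am = P.A.a_mod and bm = P.B.a_mod and cm = R.B.a_mod
  note [simp] = nhom_in[OF P.V_hom] nhom_in[OF P.S_hom] nhom_in[OF R.V_hom] nhom_in[OF R.S_hom] P.S_V P.V_S R.S_V R.V_S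
  have h: "hilbert_space ?a" "hilbert_space ?b" "hilbert_space ?c" using am bm cm by (simp_all add: P.A.hs)
  have WV: "WV \<in> net_hom N ?a ?c" unfolding WV_def by (rule nhom_compose[OF am bm P.V_hom R.V_hom])
  let ?ST = "compose (carrier ?c) S T"
  have ST: "?ST \<in> bounded_ops ?c ?a" by (rule bop_compose[OF h(3,2) R.S_bop P.S_bop])
  have inv: "?ST (WV x) = x" if "x \<in> carrier ?a" for x using that by (simp add: WV_def)
  have inv': "WV (?ST y) = y" if "y \<in> carrier ?c" for y using that by (simp add: WV_def)
  have adjWV: "adj ?a ?c WV = compose (carrier ?c) (adj ?a ?b V) (adj ?b ?c W)"
    unfolding WV_def by (rule adj_compose[OF h nhom_bop[OF P.V_hom] nhom_bop[OF R.V_hom]])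
  have Va: "adj ?a ?b V \<in> net_hom N ?b ?a" by (rule P.A.nhom_adj[OF am bm P.V_hom])
  have Wa: "adj ?b ?c W \<in> net_hom N ?c ?b" by (rule P.A.nhom_adj[OF bm cm R.V_hom])
  have idc: "compose (carrier ?b) (ident ?b) V' = V'" if "V' \<in> bounded_ops ?b ?b" for V'
    by (rule bop_eqI[OF bop_compose[OF h(2,2) that ident_bop[OF h(2)]] that]) (use bop_in[OF that] in simp)
  have ii: "compose (carrier i) (ident i) (ident i) = ident i" if "hilbert_space i" for i :: "'a rep_space"
    by (rule bop_eqI[OF bop_compose[OF that that ident_bop[OF that] ident_bop[OF that]] ident_bop[OF that]]) simp
  have idl: "compose (carrier i) (ident j) X = X" if "hilbert_space i" "hilbert_space j" "X \<in> bounded_ops i j"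
    for i j :: "'a rep_space" and X
    by (rule bop_eqI[OF bop_compose[OF that(1,2,3) ident_bop[OF that(2)]] that(3)]) (use bop_in[OF that(3)] in simp)
  have idr: "compose (carrier i) X (ident i) = X" if "hilbert_space i" "hilbert_space j" "X \<in> bounded_ops i j"
    for i j :: "'a rep_space" and X
    by (rule bop_eqI[OF bop_compose[OF that(1,1) ident_bop[OF that(1)] that(3)] that(3)]) simp
  note tc = P.A.tensm_compose
  note id = nhom_ident[OF am] nhom_ident[OF bm] nhom_ident[OF cm]
  have md: "net_module N (?a \<boxtimes>\<^bsub>F\<^esub> ?a)" "net_module N (?b \<boxtimes>\<^bsub>F\<^esub> ?b)" "net_module N (?a \<boxtimes>\<^bsub>F\<^esub> ?c)" "net_module N (?b \<boxtimes>\<^bsub>F\<^esub> ?c)" "net_module N (?a \<boxtimes>\<^bsub>F\<^esub> ?b)"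
    using am bm cm P.A.tens_module by auto
  have VV: "tensm F ?a ?b ?a ?b V V \<in> net_hom N (?a \<boxtimes>\<^bsub>F\<^esub> ?a) (?b \<boxtimes>\<^bsub>F\<^esub> ?b)" by (rule P.A.tensm_hom[OF am bm am bm P.V_hom P.V_hom])
  have V1: "tensm F ?a ?b ?c ?c V (ident ?c) \<in> net_hom N (?a \<boxtimes>\<^bsub>F\<^esub> ?c) (?b \<boxtimes>\<^bsub>F\<^esub> ?c)" by (rule P.A.tensm_hom[OF am bm cm cm P.V_hom id(3)])
  have mult: "WV (fmult Qa x) = fmult Qc (tensm F ?a ?c ?a ?c WV WV x)" if x: "x \<in> carrier (?a \<boxtimes>\<^bsub>F\<^esub> ?a)" for x
  proof -
    have "tensm F ?a ?c ?a ?c WV WV = compose (carrier (?a \<boxtimes>\<^bsub>F\<^esub> ?a)) (tensm F ?b ?c ?b ?c W W) (tensm F ?a ?b ?a ?b V V)"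
      unfolding WV_def by (rule tc[OF am bm cm am bm cm P.V_hom R.V_hom P.V_hom R.V_hom])
    then show ?thesis
      using x nhom_in[OF P.A.\<mu>_hom x] nhom_in[OF VV x] P.V_mult[OF x] R.V_mult[OF nhom_in[OF VV x]] by (simp add: WV_def)
  qed
  \<comment> \<open>The adjoint of \<open>WV\<close> is applied from the outside inwards: the
    relation for \<open>W\<close> moves its adjoint to the right factor, \<open>V\<close> on the
    left factor commutes with it, and the relation for \<open>V\<close> finishes.\<close>
  have star: "adj ?a ?c WV (fmult Qc (tensm F ?a ?c ?c ?c WV (ident ?c) x))
      = fmult Qa (tensm F ?a ?a ?c ?a (ident ?a) (adj ?a ?c WV) x)" if x: "x \<in> carrier (?a \<boxtimes>\<^bsub>F\<^esub> ?c)" for x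
  proof -
    let ?y = "tensm F ?a ?b ?c ?c V (ident ?c) x"
    have y: "?y \<in> carrier (?b \<boxtimes>\<^bsub>F\<^esub> ?c)" by (rule nhom_in[OF V1 x])
    have W1: "tensm F ?b ?c ?c ?c W (ident ?c) \<in> net_hom N (?b \<boxtimes>\<^bsub>F\<^esub> ?c) (?c \<boxtimes>\<^bsub>F\<^esub> ?c)" by (rule P.A.tensm_hom[OF bm cm cm cm R.V_hom id(3)])
    have aW1: "tensm F ?a ?a ?c ?b (ident ?a) (adj ?b ?c W) \<in> net_hom N (?a \<boxtimes>\<^bsub>F\<^esub> ?c) (?a \<boxtimes>\<^bsub>F\<^esub> ?b)"
      by (rule P.A.tensm_hom[OF am am cm bm id(1) Wa])
    let ?z = "tensm F ?a ?a ?c ?b (ident ?a) (adj ?b ?c W) x"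
    have z: "?z \<in> carrier (?a \<boxtimes>\<^bsub>F\<^esub> ?b)" by (rule nhom_in[OF aW1 x])
    have e1: "tensm F ?a ?c ?c ?c WV (ident ?c) x = tensm F ?b ?c ?c ?c W (ident ?c) ?y"
      using tc[OF am bm cm cm cm cm P.V_hom R.V_hom id(3) id(3)] ii[OF h(3)] x by (simp add: WV_def)
    have e2: "tensm F ?b ?b ?c ?b (ident ?b) (adj ?b ?c W) ?y = tensm F ?a ?b ?c ?b V (adj ?b ?c W) x"
    proof -
      have "tensm F ?a ?b ?c ?b (compose (carrier ?a) (ident ?b) V) (compose (carrier ?c) (adj ?b ?c W) (ident ?c))
        = compose (carrier (?a \<boxtimes>\<^bsub>F\<^esub> ?c)) (tensm F ?b ?b ?c ?b (ident ?b) (adj ?b ?c W)) (tensm F ?a ?b ?c ?c V (ident ?c))"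
        by (rule tc[OF am bm bm cm cm bm P.V_hom id(2) id(3) Wa])
      from fun_cong[OF this, of x] show ?thesis
        using x idl[OF h(1,2) nhom_bop[OF P.V_hom]] idr[OF h(3,2) nhom_bop[OF Wa]] by simp
    qed
    have e3: "tensm F ?a ?b ?c ?b V (adj ?b ?c W) x = tensm F ?a ?b ?b ?b V (ident ?b) ?z"
    proof -
      have "tensm F ?a ?b ?c ?b (compose (carrier ?a) V (ident ?a)) (compose (carrier ?c) (ident ?b) (adj ?b ?c W))
        = compose (carrier (?a \<boxtimes>\<^bsub>F\<^esub> ?c)) (tensm F ?a ?b ?b ?b V (ident ?b)) (tensm F ?a ?a ?c ?b (ident ?a) (adj ?b ?c W))"
        by (rule tc[OF am am bm cm bm bm id(1) P.V_hom Wa id(2)])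
      from fun_cong[OF this, of x] show ?thesis
        using x idr[OF h(1,2) nhom_bop[OF P.V_hom]] idl[OF h(3,2) nhom_bop[OF Wa]] by simp
    qed
    have e4: "tensm F ?a ?a ?b ?a (ident ?a) (adj ?a ?b V) ?z = tensm F ?a ?a ?c ?a (ident ?a) (adj ?a ?c WV) x"
    proof -
      have "tensm F ?a ?a ?c ?a (compose (carrier ?a) (ident ?a) (ident ?a)) (compose (carrier ?c) (adj ?a ?b V) (adj ?b ?c W))
        = compose (carrier (?a \<boxtimes>\<^bsub>F\<^esub> ?c)) (tensm F ?a ?a ?b ?a (ident ?a) (adj ?a ?b V)) (tensm F ?a ?a ?c ?b (ident ?a) (adj ?b ?c W))"
        by (rule tc[OF am am am cm bm am id(1) id(1) Wa Va])
      from fun_cong[OF this, of x] show ?thesis using x by (simp add: ii[OF h(1)] adjWV)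
    qed
    have mc: "fmult Qc (tensm F ?b ?c ?c ?c W (ident ?c) ?y) \<in> carrier ?c" by (rule nhom_in[OF R.B.\<mu>_hom nhom_in[OF W1 y]])
    have "adj ?a ?c WV (fmult Qc (tensm F ?a ?c ?c ?c WV (ident ?c) x))
        = adj ?a ?b V (adj ?b ?c W (fmult Qc (tensm F ?b ?c ?c ?c W (ident ?c) ?y)))"
      using mc by (simp add: e1 adjWV)
    also have "\<dots> = adj ?a ?b V (fmult Qb (tensm F ?a ?b ?b ?b V (ident ?b) ?z))"
      by (simp only: R.V_star[OF y] e2 e3)
    also have "\<dots> = fmult Qa (tensm F ?a ?a ?c ?a (ident ?a) (adj ?a ?c WV) x)"
      by (simp only: P.V_star[OF z] e4)
    finally show ?thesis .
  qed
  have WV\<iota>: "compose (carrier (vac_module N)) WV (funit Qa) = funit Qc"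
    by (rule bop_eqI[OF bop_compose[OF P.A.vac_hilb h(1) nhom_bop[OF P.A.\<iota>_hom] nhom_bop[OF WV]] nhom_bop[OF R.B.\<iota>_hom]])
      (use nhom_in[OF P.A.\<iota>_hom] P.V_unit R.V_unit in \<open>simp add: WV_def\<close>)
  show L: "left_iso N F Qa Qc WV"
    unfolding left_iso_def Let_def
  proof (intro conjI WV WV\<iota>)
    show "\<exists>S\<in>bounded_ops ?c ?a. compose (carrier ?a) S WV = ident ?a \<and> compose (carrier ?c) WV S = ident ?c"
    proof (intro bexI[OF _ ST] conjI)
      show "compose (carrier ?a) ?ST WV = ident ?a"
        by (rule bop_eqI[OF bop_compose[OF h(1,3) nhom_bop[OF WV] ST] ident_bop[OF h(1)]])
          (simp only: compose_apply inv ident_apply)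
      show "compose (carrier ?c) WV ?ST = ident ?c"
        by (rule bop_eqI[OF bop_compose[OF h(3,1) ST nhom_bop[OF WV]] ident_bop[OF h(3)]])
          (simp only: compose_apply[of _ _ WV ?ST] inv' ident_apply)
    qed
    show "compose (carrier (?a \<boxtimes>\<^bsub>F\<^esub> ?a)) WV (fmult Qa) = compose (carrier (?a \<boxtimes>\<^bsub>F\<^esub> ?a)) (fmult Qc) (tensm F ?a ?c ?a ?c WV WV)"
      by (rule extensionalityI[of _ "carrier (?a \<boxtimes>\<^bsub>F\<^esub> ?a)"]) (auto simp: mult compose_def)
    show "compose (carrier (?a \<boxtimes>\<^bsub>F\<^esub> ?c)) (adj ?a ?c WV) (compose (carrier (?a \<boxtimes>\<^bsub>F\<^esub> ?c)) (fmult Qc) (tensm F ?a ?c ?c ?c WV (ident ?c)))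
      = compose (carrier (?a \<boxtimes>\<^bsub>F\<^esub> ?c)) (fmult Qa) (tensm F ?a ?a ?c ?a (ident ?a) (adj ?a ?c WV))"
      by (rule extensionalityI[of _ "carrier (?a \<boxtimes>\<^bsub>F\<^esub> ?c)"]) (auto simp: star compose_def)
  qed
  interpret PR: left_iso_pair N F Qa Qc WV ?ST
    by unfold_locales (fact L ST inv inv')+
  have "PR.phi = extn_iso_compose (frob_extn N F Qa) R.phi P.phi"
  proof -
    have eq: "PR.phi I X = R.phi I (P.phi I X)" if I: "I \<in> arg_arcs" and X: "X \<in> P.A.BQ I" for I X
    proof (rule bop_eqI[OF PR.phi_bop[OF I X] R.phi_bop[OF I P.phi_in[OF I X]]])
      fix z assume z: "z \<in> carrier ?c"
      show "PR.phi I X z = R.phi I (P.phi I X) z"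
      proof -
        have "PR.phi I X z = WV (X (?ST z))" using z unfolding PR.phi_apply[OF I X] by simp
        moreover have "R.phi I (P.phi I X) z = W (V (X (S (T z))))"
        proof -
          have "R.phi I (P.phi I X) z = W (P.phi I X (T z))"
            using z by (simp add: R.phi_apply[OF I P.phi_in[OF I X]])
          also have "P.phi I X (T z) = V (X (S (T z)))" using z by (simp add: P.phi_apply[OF I X])
          finally show ?thesis .
        qed
        moreover have "WV (X (?ST z)) = W (V (X (S (T z))))"
          using z bop_in[OF P.A.BQ_bop[OF I X]] by (simp add: WV_def)
        ultimately show ?thesis by (simp only:)
      qed
    qed
    have "PR.phi I X = extn_iso_compose (frob_extn N F Qa) R.phi P.phi I X" for I X
    proof (cases "I \<in> arg_arcs \<and> X \<in> P.A.BQ I")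
      case True
      then show ?thesis using eq by (simp add: extn_iso_compose_def)
    next
      case False
      \<comment> \<open>Two different default values: \<open>undefined\<close> for an operator
        outside the algebra, and the value of an undefined map at \<open>X\<close> for an
        \<open>I\<close> outside \<open>arg_arcs\<close>.\<close>
      then have "PR.phi I X = (if I \<in> arg_arcs then undefined else undefined X)" by (auto simp: PR.phi_def)
      also have "\<dots> = extn_iso_compose (frob_extn N F Qa) R.phi P.phi I X"
        using False by (auto simp: extn_iso_compose_def compose_def)
      finally show ?thesis .
    qed
    then show ?thesis by (intro ext) (simp only:)
  qed
  then show "iso_of N F Qa Qc WV = extn_iso_compose (frob_extn N F Qa) (iso_of N F Qb Qc W) (iso_of N F Qa Qb V)"
    by (simp add: PR.iso_of_eq P.iso_of_eq R.iso_of_eq)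
qed

section \<open>Positivity and powers of self-adjoint operators\<close>

lemma second_difference_less:
  fixes a b c :: real
  assumes "\<bar>a - l\<bar> < q" "\<bar>b - l\<bar> < q" "\<bar>c - l\<bar> < q"
  shows "a - 2 * b + c < 4 * q"
  using assms by linarith

context hilbert_space
begin

text \<open>Positivity of the form at \<open>x - P x / C\<close>, together with
  \<open><P (P x), P x> \<le> C |P x|^2\<close>.\<close>

lemma positive_cauchy_schwarz:
  assumes P: "P \<in> bounded_ops H H" "adj H H P = P" "\<And>x. x \<in> carrier H \<Longrightarrow> 0 \<le> Re (hinner H (P x) x)"
    and C: "C > 0" "\<And>x. x \<in> carrier H \<Longrightarrow> hnorm H (P x) \<le> C * hnorm H x" and x: "x \<in> carrier H"
  shows "(hnorm H (P x))\<^sup>2 \<le> C * Re (hinner H (P x) x)"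
proof -
  note hs = hilbert_space_axioms
  have sa: "hinner H (P u) w = hinner H u (P w)" if "u \<in> carrier H" "w \<in> carrier H" for u w
    using adj_ip[OF hs hs P(1) that] P(2) by simp
  have Px: "P x \<in> carrier H" "P (P x) \<in> carrier H" using bop_in[OF P(1)] x by auto
  let ?t = "complex_of_real (1 / C)"
  let ?y = "x \<oplus> (- ?t) \<odot> P x"
  have yc: "?y \<in> carrier H" using x Px by simp
  have Py: "P ?y = P x \<oplus> (- ?t) \<odot> P (P x)" using x Px by (simp add: bop_add[OF P(1)] bop_smult[OF P(1)])
  have e: "hinner H (P (P x)) x = hinner H (P x) (P x)" using sa[OF Px(1) x] .
  have "hinner H (P ?y) ?y = hinner H (P x) x - 2 * ?t * hinner H (P x) (P x) + ?t * ?t * hinner H (P (P x)) (P x)"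
    unfolding Py using x Px e by (simp add: inner_simps algebra_simps)
  moreover have "Re (hinner H (P (P x)) (P x)) \<le> C * (hnorm H (P x))\<^sup>2"
  proof -
    have "Re (hinner H (P (P x)) (P x)) \<le> hnorm H (P (P x)) * hnorm H (P x)"
      using cauchy_schwarz[OF Px(2,1)] complex_Re_le_cmod order_trans by blast
    also have "\<dots> \<le> C * hnorm H (P x) * hnorm H (P x)" using C(2)[OF Px(1)] Px by (intro mult_right_mono) auto
    finally show ?thesis by (simp add: power2_eq_square)
  qed
  moreover have "0 \<le> Re (hinner H (P ?y) ?y)" by (rule P(3)[OF yc])
  moreover have "Re (hinner H (P x) x - 2 * ?t * hinner H (P x) (P x) + ?t * ?t * hinner H (P (P x)) (P x))
    = Re (hinner H (P x) x) - 2 / C * (hnorm H (P x))\<^sup>2 + 1 / C * (1 / C) * Re (hinner H (P (P x)) (P x))"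
    by (simp add: inner_self[OF Px(1)])
  ultimately have "0 \<le> Re (hinner H (P x) x) - 2 / C * (hnorm H (P x))\<^sup>2 + 1 / C * (1 / C) * (C * (hnorm H (P x))\<^sup>2)"
    using C(1) mult_left_mono[of "Re (hinner H (P (P x)) (P x))" "C * (hnorm H (P x))\<^sup>2" "1 / C * (1 / C)"] by simp
  then show ?thesis using C(1) by (simp add: field_simps)
qed

text \<open>The infimum of the numerical range of a self-adjoint operator lies in its spectrum.\<close>

lemma positive_if_shifts_invertible:
  assumes B: "B \<in> bounded_ops H H" "adj H H B = B"
    and inv: "\<And>e::real. e > 0 \<Longrightarrow> \<exists>S\<in>bounded_ops H H. \<forall>x\<in>carrier H. S (B x \<oplus> of_real e \<odot> x) = x"
    and x: "x \<in> carrier H"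
  shows "0 \<le> Re (hinner H (B x) x)"
proof (rule ccontr)
  assume neg: "\<not> ?thesis"
  note hs = hilbert_space_axioms
  note [simp] = bop_in[OF B(1)]
  let ?q = "\<lambda>x. Re (hinner H (B x) x)"
  let ?U = "{u \<in> carrier H. hnorm H u = 1}"
  obtain C where C: "C > 0" "\<And>x. x \<in> carrier H \<Longrightarrow> hnorm H (B x) \<le> C * hnorm H x" using bop_bound[OF hs B(1)] by blast
  have low: "- C \<le> ?q u" if "u \<in> ?U" for u
  proof -
    have "cmod (hinner H (B u) u) \<le> hnorm H (B u) * hnorm H u" using that by (intro cauchy_schwarz) auto
    also have "\<dots> \<le> C" using C(2)[of u] that by simp
    finally show ?thesis using abs_Re_le_cmod[of "hinner H (B u) u"] by linarith
  qed
  have bdd: "bdd_below (?q ` ?U)" by (rule bdd_belowI2[of _ "- C"]) (rule low)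
  define m where "m = Inf (?q ` ?U)"
  have n0: "hnorm H x \<noteq> 0" using neg x by (auto simp: hnorm_eq_0)
  let ?u = "of_real (1 / hnorm H x) \<odot> x"
  have uU: "?u \<in> ?U" using x n0 by (simp add: hnorm_smult norm_divide)
  have qs: "?q (of_real r \<odot> y) = r\<^sup>2 * ?q y" if "y \<in> carrier H" for y r
    using that by (simp add: bop_smult[OF B(1)] inner_simps power2_eq_square)
  have "m \<le> ?q ?u" unfolding m_def using uU bdd by (intro cInf_lower) auto
  also have "?q ?u < 0" unfolding qs[OF x] using neg n0 by (simp add: mult_pos_neg)
  finally have m: "m < 0" .
  have mq: "m * (hnorm H y)\<^sup>2 \<le> ?q y" if y: "y \<in> carrier H" for y
  proof (cases "hnorm H y = 0")
    case True
    then show ?thesis using y hnorm_eq_0 by simp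
  next
    case False
    have "of_real (1 / hnorm H y) \<odot> y \<in> ?U" using y False by (simp add: hnorm_smult norm_divide)
    then have "m \<le> ?q (of_real (1 / hnorm H y) \<odot> y)" unfolding m_def using bdd by (intro cInf_lower) auto
    then have "m \<le> (1 / hnorm H y)\<^sup>2 * ?q y" by (simp only: qs[OF y])
    then show ?thesis using False by (simp add: field_simps)
  qed
  \<comment> \<open>\<open>P = B - m\<close> is positive with infimum zero on unit vectors. If
    \<open>m < 0\<close>, the hypothesis at \<open>e = - m\<close> makes \<open>P\<close> bounded
    below, which contradicts the infimum.\<close>
  define P where "P = op_add H H B (op_smult H H (of_real (- m)) (ident H))"
  have sb: "op_smult H H (of_real (- m)) (ident H) \<in> bounded_ops H H" by (rule op_smult_bop[OF hs hs ident_bop[OF hs]])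
  have Pb: "P \<in> bounded_ops H H" unfolding P_def by (rule op_add_bop[OF hs hs sb B(1)])
  have Pa: "P y = B y \<oplus> of_real (- m) \<odot> y" if "y \<in> carrier H" for y using that by (simp add: P_def)
  have Padj: "adj H H P = P"
    by (rule adj_eqI[OF hs hs Pb Pb])
      (use adj_ip[OF hs hs B(1)] B(2) in \<open>simp add: Pa inner_simps\<close>)
  have Ppos: "0 \<le> Re (hinner H (P y) y)" if y: "y \<in> carrier H" for y
    using mq[OF y] y by (simp add: Pa inner_simps inner_self)
  obtain D where D: "D > 0" "\<And>x. x \<in> carrier H \<Longrightarrow> hnorm H (P x) \<le> D * hnorm H x" using bop_bound[OF hs Pb] by blast
  obtain S where S: "S \<in> bounded_ops H H" "\<And>x. x \<in> carrier H \<Longrightarrow> S (P x) = x"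
    using inv[of "- m"] m by (auto simp: Pa)
  obtain K where K: "K > 0" "\<And>x. x \<in> carrier H \<Longrightarrow> hnorm H (S x) \<le> K * hnorm H x" using bop_bound[OF hs S(1)] by blast
  \<comment> \<open>For a unit vector, \<open>1 \<le> K^2 |P y|^2 \<le> K^2 D <P y, y>\<close>; so
    the infimum \<open>m\<close> could be raised by this amount.\<close>
  let ?d = "1 / (K\<^sup>2 * D)"
  have d: "?d > 0" using K D by simp
  have "m + ?d \<le> ?q y" if y: "y \<in> ?U" for y
  proof -
    have yc: "y \<in> carrier H" "hnorm H y = 1" using y by auto
    have "1 \<le> K * hnorm H (P y)" using K(2)[OF bop_in[OF Pb yc(1)]] S(2)[OF yc(1)] yc(2) by simp
    then have "1 \<le> (K * hnorm H (P y))\<^sup>2" by (simp add: one_le_power)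
    also have "\<dots> \<le> K\<^sup>2 * (D * Re (hinner H (P y) y))"
      using positive_cauchy_schwarz[OF Pb Padj Ppos D yc(1)] by (simp add: power_mult_distrib mult_left_mono)
    finally have "?d \<le> Re (hinner H (P y) y)" using K D by (simp add: field_simps)
    then show ?thesis using yc by (simp add: Pa inner_simps inner_self)
  qed
  then have "m + ?d \<le> m" unfolding m_def[of] using uU by (intro cInf_greatest) (auto simp: m_def)
  then show False using d by simp
qed

text \<open>For self-adjoint \<open>A\<close> the products \<open>\<langle>A\<^sup>2\<^sup>n x, A\<^sup>2\<^sup>m x\<rangle>\<close> depend on \<open>n + m\<close> only, so \<open>A\<^sup>2\<^sup>n x\<close> is Cauchy.\<close>

lemma contraction_powers_vanish:
  assumes A: "A \<in> bounded_ops H H" "adj H H A = A" "\<And>x. x \<in> carrier H \<Longrightarrow> hnorm H (A x) \<le> hnorm H x"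
    and strict: "\<And>x. \<lbrakk>x \<in> carrier H; hnorm H (A x) = hnorm H x\<rbrakk> \<Longrightarrow> x = \<zero>" and x: "x \<in> carrier H" and e: "e > 0"
  shows "\<exists>n. hnorm H ((A ^^ n) x) < e"
proof -
  note hs = hilbert_space_axioms
  note Ain = bop_in[OF A(1)]
  have pc: "(A ^^ n) y \<in> carrier H" if "y \<in> carrier H" for n y using that by (induction n) (auto simp: Ain)
  have sa: "hinner H (A u) w = hinner H u (A w)" if "u \<in> carrier H" "w \<in> carrier H" for u w
    using adj_ip[OF hs hs A(1) that] A(2) by simp
  have san: "hinner H ((A ^^ n) u) w = hinner H u ((A ^^ n) w)" if "u \<in> carrier H" "w \<in> carrier H" for n u w
    using that
  proof (induction n arbitrary: u w)
    case (Suc n)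
    have "hinner H ((A ^^ Suc n) u) w = hinner H ((A ^^ n) u) (A w)" using Suc.prems sa pc by simp
    also have "\<dots> = hinner H u ((A ^^ n) (A w))" by (rule Suc.IH[OF Suc.prems(1) Ain[OF Suc.prems(2)]])
    also have "(A ^^ n) (A w) = (A ^^ Suc n) w" by (simp add: funpow_swap1)
    finally show ?case .
  qed simp
  define s where "s n = (hnorm H ((A ^^ n) x))\<^sup>2" for n
  have dec: "decseq s"
    unfolding decseq_Suc_iff s_def using A(3) pc x by (auto intro!: power_mono simp: Ain)
  have "\<And>n. 0 \<le> s n" by (simp add: s_def)
  then obtain L where L: "s \<longlonglongrightarrow> L" using decseq_convergent[OF dec, of 0] by blast
  have prod: "hinner H ((A ^^ (2 * n)) x) ((A ^^ (2 * m)) x) = of_real (s (n + m))" for n m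
  proof -
    have "2 * m = m + m" "2 * n = n + n" by auto
    have "hinner H ((A ^^ (2 * n)) x) ((A ^^ (2 * m)) x) = hinner H x ((A ^^ (2 * n + 2 * m)) x)"
      using san[OF x pc[OF x], of "2 * n" "2 * m"] by (simp add: funpow_add)
    also have "2 * n + 2 * m = (n + m) + (n + m)" by simp
    also have "hinner H x ((A ^^ ((n + m) + (n + m))) x) = hinner H ((A ^^ (n + m)) x) ((A ^^ (n + m)) x)"
      using san[OF x pc[OF x], of "n + m" "n + m"] by (simp add: funpow_add)
    also have "\<dots> = of_real (s (n + m))" using pc[OF x] by (simp add: inner_self s_def)
    finally show ?thesis .
  qed
  define y where "y n = (A ^^ (2 * n)) x" for n
  have yc: "y n \<in> carrier H" for n using pc[OF x] by (simp add: y_def)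
  have yn: "(hnorm H (y n))\<^sup>2 = s (2 * n)" for n by (simp add: y_def s_def)
  have cau: "\<exists>M. \<forall>m\<ge>M. \<forall>n\<ge>M. hnorm H (y m \<ominus> y n) < d" if d: "d > 0" for d
  proof -
    have "d\<^sup>2 / 4 > 0" using d by simp
    then obtain M where M: "\<And>n. n \<ge> M \<Longrightarrow> \<bar>s n - L\<bar> < d\<^sup>2 / 4"
      using L unfolding LIMSEQ_iff real_norm_def by meson
    have "hnorm H (y m \<ominus> y n) < d" if "m \<ge> M" "n \<ge> M" for m n
    proof -
      \<comment> \<open>A second difference of the convergent sequence \<open>s\<close>; its
        coefficients \<open>1, 2, 1\<close> add up to \<open>4\<close>, which accounts for the
        choice of \<open>M\<close>.\<close>
      have "(hnorm H (y m \<ominus> y n))\<^sup>2 = s (2 * m) - 2 * s (m + n) + s (2 * n)"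
        using prod[of m n] by (simp add: hnorm_diff_sq yc yn) (simp add: y_def)
      also have "\<dots> < d\<^sup>2"
      proof -
        have "\<bar>s (2 * m) - L\<bar> < d\<^sup>2 / 4" "\<bar>s (m + n) - L\<bar> < d\<^sup>2 / 4" "\<bar>s (2 * n) - L\<bar> < d\<^sup>2 / 4"
          by (rule M, use that in simp)+
        from second_difference_less[OF this] show ?thesis by simp
      qed
      finally show ?thesis by (rule power2_less_imp_less) (use d in simp)
    qed
    then show ?thesis by blast
  qed
  obtain z where z: "z \<in> carrier H" "(\<lambda>n. hnorm H (y n \<ominus> z)) \<longlonglongrightarrow> 0"
    by (rule cauchy_limit[OF yc cau]) (assumption, rule that)
  have nlim: "(\<lambda>n. hnorm H (B (y n))) \<longlonglongrightarrow> hnorm H (B z)"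
    if B: "B \<in> bounded_ops H H" "\<And>x. x \<in> carrier H \<Longrightarrow> hnorm H (B x) \<le> hnorm H x" for B
  proof (rule LIM_zero_cancel, rule Lim_null_comparison[OF _ z(2)], rule eventuallyI)
    fix n
    note Bin = bop_in[OF B(1)]
    have "B (y n) \<ominus> B z = B (y n \<ominus> z)"
    proof -
      have "y n \<ominus> z = y n \<oplus> (-1) \<odot> z"
        by (rule hilbert_eqI) (use yc z in \<open>simp_all add: inner_simps\<close>)
      moreover have "B (y n \<oplus> (-1) \<odot> z) = B (y n) \<oplus> (-1) \<odot> B z"
        using yc z by (simp add: bop_add[OF B(1)] bop_smult[OF B(1)])
      moreover have "B (y n) \<ominus> B z = B (y n) \<oplus> (-1) \<odot> B z"
        by (rule hilbert_eqI) (use yc z Bin in \<open>simp_all add: inner_simps\<close>)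
      ultimately show ?thesis by simp
    qed
    then have d: "hnorm H (B (y n) \<ominus> B z) \<le> hnorm H (y n \<ominus> z)" using B(2)[of "y n \<ominus> z"] yc z by simp
    have "hnorm H (B (y n)) \<le> hnorm H (B z) + hnorm H (B (y n) \<ominus> B z)"
      using hnorm_diff_triangle[of "B (y n)" "B z" \<zero>] Bin yc z by simp
    moreover have "hnorm H (B z) \<le> hnorm H (B (y n)) + hnorm H (B (y n) \<ominus> B z)"
      using hnorm_diff_triangle[of "B z" "B (y n)" \<zero>] hnorm_minus_commute[of "B z" "B (y n)"] Bin yc z by simp
    ultimately show "norm (hnorm H (B (y n)) - hnorm H (B z)) \<le> hnorm H (y n \<ominus> z)" using d by simp
  qed
  have sq: "(\<lambda>n. sqrt (s (k n))) \<longlonglongrightarrow> sqrt L" if "strict_mono k" for k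
    using LIMSEQ_subseq_LIMSEQ[OF L that] by (intro tendsto_real_sqrt) (simp add: o_def)
  have 1: "hnorm H z = sqrt L"
  proof (rule LIMSEQ_unique)
    show "(\<lambda>n. hnorm H (y n)) \<longlonglongrightarrow> hnorm H z" using nlim[OF ident_bop[OF hs]] yc z by simp
    show "(\<lambda>n. hnorm H (y n)) \<longlonglongrightarrow> sqrt L"
      using sq[of "\<lambda>n. 2 * n"] pc[OF x] by (simp add: s_def y_def strict_mono_def)
  qed
  \<comment> \<open>The odd powers have the same limiting norm as the even ones, so \<open>A\<close>
    preserves the norm of the limit \<open>z\<close>, and strictness gives
    \<open>z = \<zero>\<close>.\<close>
  have 2: "hnorm H (A z) = sqrt L"
  proof (rule LIMSEQ_unique)
    show "(\<lambda>n. hnorm H (A (y n))) \<longlonglongrightarrow> hnorm H (A z)" by (rule nlim[OF A(1,3)])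
    show "(\<lambda>n. hnorm H (A (y n))) \<longlonglongrightarrow> sqrt L"
      using sq[of "\<lambda>n. Suc (2 * n)"] pc[OF x] Ain[OF pc[OF x]] by (simp add: s_def y_def strict_mono_def)
  qed
  have "z = \<zero>" using strict[OF z(1)] 1 2 by simp
  then have "L = 0" using 1 by simp
  then have "\<forall>\<^sub>F n in sequentially. s n < e\<^sup>2" using L e by (intro order_tendstoD(2)) auto
  then obtain n where "s n < e\<^sup>2" by (auto dest: eventually_happens)
  then have "hnorm H ((A ^^ n) x) < e" using e unfolding s_def by (auto intro: power2_less_imp_less)
  then show ?thesis by blast
qed

end

section \<open>Isomorphisms of extensions\<close>

lemma (in fusion_net) some_arg_arc: "\<exists>I. I \<in> arg_arcs"
proof -
  have "arc_of 0 1 \<in> arcs" using pi_gt3 by (intro arc_of_in) auto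
  then show ?thesis using arg_arc_exists by blast
qed

text \<open>Interchange law in a form that asks for the factorisations only pointwise on the
  carriers; all manipulations of tensor products in the transport of \<mu> go through it.\<close>

lemma (in fusion_net) tensm_split:
  assumes "net_module N i" "net_module N i'" "net_module N i''" "net_module N j" "net_module N j'" "net_module N j''"
    "P1 \<in> net_hom N i i'" "P2 \<in> net_hom N i' i''" "Q1 \<in> net_hom N j j'" "Q2 \<in> net_hom N j' j''"
    "P \<in> net_hom N i i''" "Q \<in> net_hom N j j''"
    "\<And>x. x \<in> carrier i \<Longrightarrow> P x = P2 (P1 x)" "\<And>x. x \<in> carrier j \<Longrightarrow> Q x = Q2 (Q1 x)" "z \<in> carrier (i \<boxtimes> j)"
  shows "tensm F i i'' j j'' P Q z = tensm F i' i'' j' j'' P2 Q2 (tensm F i i' j j' P1 Q1 z)"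
proof -
  have "P = compose (carrier i) P2 P1"
    by (rule bop_eqI[OF nhom_bop[OF assms(11)] nhom_bop[OF nhom_compose[OF assms(1,2,7,8)]]]) (simp add: assms(13))
  moreover have "Q = compose (carrier j) Q2 Q1"
    by (rule bop_eqI[OF nhom_bop[OF assms(12)] nhom_bop[OF nhom_compose[OF assms(4,5,9,10)]]]) (simp add: assms(14))
  ultimately have "tensm F i i'' j j'' P Q = compose (carrier (i \<boxtimes> j)) (tensm F i' i'' j' j'' P2 Q2) (tensm F i i' j j' P1 Q1)"
    using tensm_compose[OF assms(1-7,8,9,10)] by simp
  from fun_cong[OF this, of z] show ?thesis using assms(15) by simp
qed

text \<open>The adjoint of \<open>G\<close> times \<open>G\<close> is an endomorphism of the vacuum,
  by irreducibility the scalar \<open>|G Om|^2\<close>. So \<open>1 \<boxtimes> G\<close> is a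
  multiple of an isometry.\<close>

lemma (in fusion_net) one_tensor_norm:
  assumes i: "net_module N i" and j: "net_module N j" and G: "G \<in> net_hom N vac j" and u: "u \<in> carrier (i \<boxtimes> vac)"
  shows "hnorm (i \<boxtimes> j) (tensm F i i vac j (ident i) G u) = hnorm j (G Om) * hnorm (i \<boxtimes> vac) u"
proof -
  let ?G = "tensm F i i vac j (ident i) G"
  have m: "net_module N (i \<boxtimes> vac)" "net_module N (i \<boxtimes> j)" using tens_module i j vac_module by auto
  interpret IV: hilbert_space "i \<boxtimes> vac" by (rule hs[OF m(1)])
  interpret IJ: hilbert_space "i \<boxtimes> j" by (rule hs[OF m(2)])
  interpret J: hilbert_space j by (rule hs[OF j])
  have Gs: "adj vac j G \<in> net_hom N j vac" by (rule nhom_adj[OF vac_module j G])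
  have GG: "compose (carrier vac) (adj vac j G) G \<in> net_hom N vac vac" by (rule nhom_compose[OF vac_module j G Gs])
  obtain c where c: "\<And>x. x \<in> carrier (vac_space N) \<Longrightarrow> compose (carrier vac) (adj vac j G) G x = c \<odot>\<^bsub>vac_space N\<^esub> x"
    using scalar_hom[OF GG] by blast
  have GOm: "G Om \<in> carrier j" using nhom_in[OF G, of Om] by simp
  have "hinner j (G Om) (G Om) = hinner vac Om (adj vac j G (G Om))"
    by (rule adj_ip[OF vac_hilb J.hilbert_space_axioms nhom_bop[OF G] _ GOm]) simp
  also have "\<dots> = cnj c"
    using c[of Om] V.inner_smult_right[of Om Om c] V.inner_self[of Om] vacuum_unit by simp
  finally have "cnj c = of_real ((hnorm j (G Om))\<^sup>2)" using J.inner_self[OF GOm] by simp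
  then have cc: "c = of_real ((hnorm j (G Om))\<^sup>2)" by (metis complex_cnj_cnj complex_cnj_complex_of_real)
  have Gh: "?G \<in> net_hom N (i \<boxtimes> vac) (i \<boxtimes> j)" by (rule tensm_hom[OF i i vac_module j nhom_ident[OF i] G])
  have "adj (i \<boxtimes> vac) (i \<boxtimes> j) ?G (?G u) = c \<odot>\<^bsub>i \<boxtimes> vac\<^esub> u"
  proof -
    have "adj (i \<boxtimes> vac) (i \<boxtimes> j) ?G = tensm F i i j vac (ident i) (adj vac j G)"
      using tensm_adj[OF i i vac_module j nhom_ident[OF i] G] i by simp
    then have "adj (i \<boxtimes> vac) (i \<boxtimes> j) ?G (?G u) = tensm F i i j vac (ident i) (adj vac j G) (?G u)" by simp
    also have "\<dots> = tensm F i i vac vac (ident i) (op_smult vac vac c (ident vac)) u"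
    proof (rule tensm_split[OF i i i vac_module j vac_module nhom_ident[OF i] nhom_ident[OF i] G Gs nhom_ident[OF i] _ _ _ u, symmetric])
      have eq: "compose (carrier vac) (adj vac j G) G = op_smult vac vac c (ident vac)"
        by (rule bop_eqI[OF nhom_bop[OF GG] op_smult_bop[OF vac_hilb vac_hilb ident_bop[OF vac_hilb]]])
          (use c in simp)
      then show "op_smult vac vac c (ident vac) \<in> net_hom N vac vac" using GG by simp
      show "op_smult vac vac c (ident vac) x = adj vac j G (G x)" if "x \<in> carrier vac" for x
        using fun_cong[OF eq, of x] that by simp
    qed simp
    also have "\<dots> = op_smult (i \<boxtimes> vac) (i \<boxtimes> vac) c (ident (i \<boxtimes> vac)) u"
      using tensm_smult_right[OF i i vac_module vac_module nhom_ident[OF i] nhom_ident[OF vac_module], of c]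
        tensm_ident[OF i vac_module] by simp
    finally show ?thesis using u by simp
  qed
  then have "hinner (i \<boxtimes> j) (?G u) (?G u) = hinner (i \<boxtimes> vac) u (c \<odot>\<^bsub>i \<boxtimes> vac\<^esub> u)"
    using adj_ip[OF IV.hilbert_space_axioms IJ.hilbert_space_axioms nhom_bop[OF Gh] u nhom_in[OF Gh u]] by simp
  also have "\<dots> = of_real ((hnorm j (G Om))\<^sup>2 * (hnorm (i \<boxtimes> vac) u)\<^sup>2)"
    using u by (simp add: IV.inner_smult_right IV.inner_self cc)
  finally have "(hnorm (i \<boxtimes> j) (?G u))\<^sup>2 = (hnorm j (G Om) * hnorm (i \<boxtimes> vac) u)\<^sup>2"
    using IJ.hnorm_sq[OF nhom_in[OF Gh u]] by (simp add: power_mult_distrib)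
  then show ?thesis using nhom_in[OF Gh u] GOm u by (simp add: power2_eq_iff_nonneg)
qed

section \<open>The operator implementing an isomorphism of extensions\<close>

locale extension_iso = A: frobenius_alg N F Qa
  for N :: "'h net" and F :: "'h fusion" (structure) and Qa :: "'h frob" +
  fixes Eb :: "'h extn" and \<phi>
  assumes ext: "net_extension N Eb" and iso: "extn_iso N (frob_extn N F Qa) Eb \<phi>"
begin

abbreviation "b \<equiv> emod Eb"
abbreviation "\<iota>b \<equiv> eincl Eb"
abbreviation "Bb \<equiv> ealg Eb"
abbreviation "\<omega>b \<equiv> \<iota>b (vacuum N)"

lemma b_mod [simp]: "net_module N b" and \<iota>b_hom: "\<iota>b \<in> net_hom N (vac_module N) b"
  using ext by (simp_all add: net_extension_def)

lemma \<omega>b_in [simp]: "\<omega>b \<in> carrier b"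
  using nhom_in[OF \<iota>b_hom, of "vacuum N"] by simp

sublocale HA: hilbert_space A.a by (rule A.hs[OF A.a_mod])
sublocale HB: hilbert_space b by (rule A.hs[OF b_mod])

context
  fixes I assumes I: "I \<in> arg_arcs"
begin

lemma \<phi>_normal: "normal_rep A.a (A.BQ I) b (\<phi> I)" and \<phi>_bij: "bij_betw (\<phi> I) (A.BQ I) (Bb I)"
  using iso I by (auto simp: extn_iso_def normal_iso_def)

lemma \<phi>_in: "X \<in> A.BQ I \<Longrightarrow> \<phi> I X \<in> Bb I"
  using \<phi>_bij by (auto simp: bij_betw_def)

lemma \<phi>_bop: "X \<in> A.BQ I \<Longrightarrow> \<phi> I X \<in> bounded_ops b b"
  using \<phi>_normal unfolding normal_rep_def by blast

lemma \<phi>_ident: "\<phi> I (ident A.a) = ident b"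
  using \<phi>_normal unfolding normal_rep_def by blast

lemma \<phi>_add: "\<lbrakk>X \<in> A.BQ I; Y \<in> A.BQ I\<rbrakk> \<Longrightarrow> \<phi> I (op_add A.a A.a X Y) = op_add b b (\<phi> I X) (\<phi> I Y)"
  using \<phi>_normal unfolding normal_rep_def by blast

lemma \<phi>_smult: "X \<in> A.BQ I \<Longrightarrow> \<phi> I (op_smult A.a A.a c X) = op_smult b b c (\<phi> I X)"
  using \<phi>_normal unfolding normal_rep_def by blast

lemma \<phi>_compose: "\<lbrakk>X \<in> A.BQ I; Y \<in> A.BQ I\<rbrakk>
    \<Longrightarrow> \<phi> I (compose (carrier A.a) X Y) = compose (carrier b) (\<phi> I X) (\<phi> I Y)"
  using \<phi>_normal unfolding normal_rep_def by blast

lemma \<phi>_adj: "X \<in> A.BQ I \<Longrightarrow> \<phi> I (adj A.a A.a X) = adj b b (\<phi> I X)"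
  using \<phi>_normal unfolding normal_rep_def by blast

lemma \<phi>_inj: "\<lbrakk>X \<in> A.BQ I; Y \<in> A.BQ I; \<phi> I X = \<phi> I Y\<rbrakk> \<Longrightarrow> X = Y"
  using \<phi>_bij by (auto simp: bij_betw_def inj_on_def)

lemma \<phi>_act: "x \<in> local_alg N (fst I) \<Longrightarrow> \<phi> I (act A.a (fst I) x) = act b (fst I) x"
  using iso I by (auto simp: extn_iso_def)

lemma Bb_cyclic: "total_in b {Y \<omega>b | Y. Y \<in> Bb I}"
  using ext I HB.dense_in_total by (simp add: net_extension_def cyclic_vec_def)

lemma Bb_separating: "\<lbrakk>Y \<in> Bb I; Y \<omega>b = \<zero>\<^bsub>b\<^esub>\<rbrakk> \<Longrightarrow> Y = (\<lambda>x\<in>carrier b. \<zero>\<^bsub>b\<^esub>)"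
  using ext I unfolding net_extension_def separating_vec_def by blast

text \<open>Positivity is read off from the invertibility of \<open>X + e\<close> for \<open>e > 0\<close>, which \<open>\<phi>\<close> transports.\<close>

lemma \<phi>_positive:
  assumes X: "X \<in> A.BQ I" "adj A.a A.a X = X" "\<And>z. z \<in> carrier A.a \<Longrightarrow> 0 \<le> Re (hinner A.a (X z) z)"
    and y: "y \<in> carrier b"
  shows "0 \<le> Re (hinner b (\<phi> I X y) y)"
proof (rule HB.positive_if_shifts_invertible[OF \<phi>_bop[OF X(1)] _ _ y])
  show "adj b b (\<phi> I X) = \<phi> I X" using \<phi>_adj[OF X(1)] X(2) by simp
  fix e :: real assume e: "e > 0"
  let ?e = "op_smult A.a A.a (of_real e) (ident A.a)"
  have eB: "?e \<in> A.BQ I" by (rule A.BQ_closed(4)[OF I A.BQ_closed(1)[OF I]])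
  let ?Z = "op_add A.a A.a X ?e"
  have Z: "?Z \<in> A.BQ I" by (rule A.BQ_closed(3)[OF I X(1) eB])
  note Xin = bop_in[OF A.BQ_bop[OF I X(1)]]
  \<comment> \<open>\<open>X + e\<close> is coercive with constant \<open>e\<close>; its inverse
    belongs to \<open>B_Q(I)\<close>, so \<phi> can be applied to it.\<close>
  obtain S where S: "S \<in> bounded_ops A.a A.a" "\<And>x. x \<in> carrier A.a \<Longrightarrow> ?Z (S x) = x" "\<And>x. x \<in> carrier A.a \<Longrightarrow> S (?Z x) = x"
  proof (rule lax_milgram[OF HA.hilbert_space_axioms A.BQ_bop[OF I Z] e])
    fix x assume x: "x \<in> carrier A.a"
    show "e * (hnorm A.a x)\<^sup>2 \<le> Re (hinner A.a (?Z x) x)"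
      using x X(3)[OF x] Xin[OF x] by (simp add: HA.inner_simps HA.inner_self)
  qed (rule that)
  have SB: "S \<in> A.BQ I" by (rule A.BQ_closed(6)[OF I Z S(1) S(3) S(2)])
  have "compose (carrier A.a) S ?Z = ident A.a"
    by (rule bop_eqI[OF bop_compose[OF HA.hilbert_space_axioms HA.hilbert_space_axioms A.BQ_bop[OF I Z] S(1)]
          ident_bop[OF HA.hilbert_space_axioms]]) (simp only: compose_apply S(3) ident_apply)
  then have "compose (carrier b) (\<phi> I S) (\<phi> I ?Z) = ident b" using \<phi>_compose[OF SB Z] \<phi>_ident by simp
  moreover have "\<phi> I ?Z = op_add b b (\<phi> I X) (op_smult b b (of_real e) (ident b))"
    using \<phi>_add[OF X(1) eB] \<phi>_smult[OF A.BQ_closed(1)[OF I]] \<phi>_ident by simp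
  ultimately have c: "compose (carrier b) (\<phi> I S) (op_add b b (\<phi> I X) (op_smult b b (of_real e) (ident b))) = ident b"
    by simp
  have "\<phi> I S (\<phi> I X w \<oplus>\<^bsub>b\<^esub> of_real e \<odot>\<^bsub>b\<^esub> w) = w" if "w \<in> carrier b" for w
    using fun_cong[OF c, of w] that by simp
  then show "\<exists>S\<in>bounded_ops b b. \<forall>x\<in>carrier b. S (\<phi> I X x \<oplus>\<^bsub>b\<^esub> of_real e \<odot>\<^bsub>b\<^esub> x) = x"
    using \<phi>_bop[OF SB] by blast
qed

end

lemma \<phi>_mono: "\<lbrakk>I \<in> arg_arcs; J \<in> arg_arcs; arg_sub I J; X \<in> A.BQ I\<rbrakk> \<Longrightarrow> \<phi> J X = \<phi> I X"
  using iso unfolding extn_iso_def by simp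

text \<open>A Pimsner-Popa type bound: \<open>X\<^sup>*X \<le> \<parallel>\<mu>\<parallel>\<^sup>2 x\<close> with \<open>x = L(\<xi>)\<^sup>*L(\<xi>)\<close>, which lies in \<open>A(I)\<close> by Haag duality
  and on which \<open>\<phi>\<close> is therefore prescribed.\<close>

lemma \<phi>_bounded:
  obtains C where "C \<ge> 0" "\<And>I X. \<lbrakk>I \<in> arg_arcs; X \<in> A.BQ I\<rbrakk> \<Longrightarrow> hnorm b (\<phi> I X \<omega>b) \<le> C * hnorm A.a (X A.\<omega>)"
proof -
  obtain m where m: "m > 0" "\<And>x. x \<in> carrier (A.a \<boxtimes> A.a) \<Longrightarrow> hnorm A.a (A.\<mu> x) \<le> m * hnorm (A.a \<boxtimes> A.a) x"
    using bop_bound[OF A.hs[OF A.aa_mod(1)] nhom_bop[OF A.\<mu>_hom]] by blast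
  note av = A.tens_module[OF A.a_mod A.vac_module]
  interpret AA: hilbert_space "A.a \<boxtimes> A.a" by (rule A.hs[OF A.aa_mod(1)])
  interpret AV: hilbert_space "A.a \<boxtimes> A.vac" by (rule A.hs[OF av])
  have \<iota>s: "adj A.vac b \<iota>b \<in> net_hom N b A.vac" by (rule A.nhom_adj[OF A.vac_module b_mod \<iota>b_hom])
  obtain c where c: "\<And>x. x \<in> carrier (vac_space N) \<Longrightarrow> compose (carrier A.vac) (adj A.vac b \<iota>b) \<iota>b x = c \<odot>\<^bsub>vac_space N\<^esub> x"
    using A.scalar_hom[OF nhom_compose[OF A.vac_module b_mod \<iota>b_hom \<iota>s]] by blast
  \<comment> \<open>\<open>m\<close> bounds the norm of \<mu>, and \<open>c\<close> is the scalar
    given by the adjoint of \<open>\<iota>b\<close> times \<open>\<iota>b\<close>. Neither depends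
    on \<open>I\<close> or \<open>X\<close>.\<close>
  let ?C = "m * sqrt (cmod c)"
  have "hnorm b (\<phi> I X \<omega>b) \<le> ?C * hnorm A.a (X A.\<omega>)" if I: "I \<in> arg_arcs" and X: "X \<in> A.BQ I" for I X
  proof -
    let ?\<xi> = "X A.\<omega>"
    have \<xi>: "?\<xi> \<in> local_vecs N A.a (fst I)" and Xf: "X = A.X_op I ?\<xi>" using A.BQ_form(1,2)[OF I X] by auto
    have \<xi>c: "?\<xi> \<in> carrier A.a" by (rule A.local_vecs_in[OF A.a_mod \<xi>])
    let ?L = "Lop F A.a A.a I ?\<xi>" and ?Lv = "Lop F A.a A.vac I ?\<xi>"
    define x where "x = compose (carrier A.vac) (adj A.vac (A.a \<boxtimes> A.vac) ?Lv) ?Lv"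
    note x = A.LstarL_act[OF A.a_mod A.a_mod I \<xi>, folded x_def]
    note Lb = lhom_bop[OF A.L_hom[OF A.a_mod A.a_mod I \<xi>]] and Lvb = lhom_bop[OF A.L_hom[OF A.a_mod A.vac_module I \<xi>]]
    have Lin: "?L z \<in> carrier (A.a \<boxtimes> A.a)" if "z \<in> carrier A.a" for z by (rule bop_in[OF Lb that])
    note arc = arg_arc_fst[OF I]
    let ?x = "act A.a (fst I) x"
    have xB: "?x \<in> A.BQ I" by (rule A.BQ_closed(7)[OF I x(1)])
    let ?XX = "compose (carrier A.a) (adj A.a A.a X) X"
    have XaB: "adj A.a A.a X \<in> A.BQ I" by (rule A.BQ_closed(2)[OF I X])
    have XXB: "?XX \<in> A.BQ I" by (rule A.BQ_closed(5)[OF I XaB X])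
    \<comment> \<open>\<open>m^2 x - adj X X\<close>, positive because
      \<open>|X z| = |\<mu> (L z)| \<le> m |L z|\<close>.\<close>
    let ?Z = "op_add A.a A.a (op_smult A.a A.a (of_real (m\<^sup>2)) ?x) (op_smult A.a A.a (-1) ?XX)"
    have Z1: "op_smult A.a A.a (of_real (m\<^sup>2)) ?x \<in> A.BQ I" and Z2: "op_smult A.a A.a (-1) ?XX \<in> A.BQ I"
      by (rule A.BQ_closed(4)[OF I xB], rule A.BQ_closed(4)[OF I XXB])
    have ZB: "?Z \<in> A.BQ I" by (rule A.BQ_closed(3)[OF I Z1 Z2])
    note ha = HA.hilbert_space_axioms
    note xin = bop_in[OF A.BQ_bop[OF I xB]] and Xin = bop_in[OF A.BQ_bop[OF I X]] and Xain = bop_in[OF A.BQ_bop[OF I XaB]]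
    have ipx: "hinner A.a (?x y) z = hinner (A.a \<boxtimes> A.a) (?L y) (?L z)" "hinner A.a y (?x z) = hinner (A.a \<boxtimes> A.a) (?L y) (?L z)"
      if "y \<in> carrier A.a" "z \<in> carrier A.a" for y z
      using adj_ip2[OF ha AA.hilbert_space_axioms Lb that(2) Lin[OF that(1)]]
        adj_ip[OF ha AA.hilbert_space_axioms Lb that(1) Lin[OF that(2)]] x(2) that by simp_all
    have ipX: "hinner A.a (adj A.a A.a X (X y)) z = hinner A.a (X y) (X z)" "hinner A.a y (adj A.a A.a X (X z)) = hinner A.a (X y) (X z)"
      if "y \<in> carrier A.a" "z \<in> carrier A.a" for y z
      using adj_ip2[OF ha ha A.BQ_bop[OF I X] that(2) Xin[OF that(1)]]
        adj_ip[OF ha ha A.BQ_bop[OF I X] that(1) Xin[OF that(2)]] by simp_all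
    have Zadj: "adj A.a A.a ?Z = ?Z"
      by (rule adj_eqI[OF ha ha A.BQ_bop[OF I ZB] A.BQ_bop[OF I ZB]])
        (simp add: HA.inner_simps xin Xin Xain ipx ipX)
    have Zpos: "0 \<le> Re (hinner A.a (?Z z) z)" if z: "z \<in> carrier A.a" for z
    proof -
      have "hnorm A.a (X z) \<le> m * hnorm (A.a \<boxtimes> A.a) (?L z)"
        using m(2)[OF Lin[OF z]] A.X_op_apply[OF z, of I ?\<xi>] Xf by simp
      then have "(hnorm A.a (X z))\<^sup>2 \<le> m\<^sup>2 * (hnorm (A.a \<boxtimes> A.a) (?L z))\<^sup>2"
        using power_mono[of "hnorm A.a (X z)" "m * hnorm (A.a \<boxtimes> A.a) (?L z)" 2] Xin[OF z] by (simp add: power_mult_distrib)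
      then show ?thesis
        using z by (simp add: HA.inner_simps xin Xin Xain ipx ipX HA.inner_self AA.inner_self Lin)
    qed
    have pos: "0 \<le> Re (hinner b (\<phi> I ?Z \<omega>b) \<omega>b)" by (rule \<phi>_positive[OF I ZB Zadj Zpos \<omega>b_in])
    have \<phi>Z: "\<phi> I ?Z = op_add b b (op_smult b b (of_real (m\<^sup>2)) (act b (fst I) x))
        (op_smult b b (-1) (compose (carrier b) (adj b b (\<phi> I X)) (\<phi> I X)))"
      using \<phi>_add[OF I Z1 Z2] \<phi>_smult[OF I xB] \<phi>_smult[OF I XXB] \<phi>_act[OF I x(1)] \<phi>_compose[OF I XaB X] \<phi>_adj[OF I X] by simp
    note fb = \<phi>_bop[OF I X]
    have fin: "\<phi> I X \<omega>b \<in> carrier b" "adj b b (\<phi> I X) (\<phi> I X \<omega>b) \<in> carrier b"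
      using bop_in[OF fb] bop_in[OF adj_bop[OF HB.hilbert_space_axioms HB.hilbert_space_axioms fb]] by auto
    have ab: "act b (fst I) x \<omega>b \<in> carrier b" by (rule act_in[OF b_mod arc x(1) \<omega>b_in])
    have xO: "x (vacuum N) \<in> carrier (vac_space N)" using bop_in[OF A.local_bop[OF arc x(1)], of "vacuum N"] by simp
    have LvO: "?Lv (vacuum N) \<in> carrier (A.a \<boxtimes> A.vac)" using bop_in[OF Lvb, of "vacuum N"] by simp
    have nLv: "hnorm (A.a \<boxtimes> A.vac) (?Lv (vacuum N)) = hnorm A.a ?\<xi>"
      using unitary_opsD(5)[OF AV.hilbert_space_axioms ha A.unitors(4)[OF A.a_mod] LvO] A.L_state_field[OF A.a_mod I \<xi>] by simp
    \<comment> \<open>\<open>\<phi>\<close> maps the action of \<open>x\<close> on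
      \<open>H_a\<close> to that on \<open>H_b\<close>; moving it through \<open>\<iota>b\<close>
      into the vacuum gives \<open>c\<close> times \<open><x Om, Om> = |L Om|^2 = |\<xi>|^2\<close>,
      the last step by the state-field property.\<close>
    have "hinner b (act b (fst I) x \<omega>b) \<omega>b = hinner b (\<iota>b (x (vacuum N))) \<omega>b"
      using lhom_act[OF nhom_lhom[OF \<iota>b_hom arc] x(1), of "vacuum N"] by simp
    also have "\<dots> = hinner A.vac (x (vacuum N)) (adj A.vac b \<iota>b \<omega>b)"
      by (rule adj_ip[OF A.vac_hilb HB.hilbert_space_axioms nhom_bop[OF \<iota>b_hom] _ \<omega>b_in]) (simp add: xO)
    also have "\<dots> = cnj c * hinner A.vac (x (vacuum N)) (vacuum N)"
      using c[of "vacuum N"] A.V.inner_smult_right[of "vacuum N" "x (vacuum N)" c] xO by simp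
    also have "hinner A.vac (x (vacuum N)) (vacuum N) = hinner (A.a \<boxtimes> A.vac) (?Lv (vacuum N)) (?Lv (vacuum N))"
      using adj_ip2[OF A.vac_hilb AV.hilbert_space_axioms Lvb _ LvO, of "vacuum N"] by (simp add: x_def)
    also have "\<dots> = of_real ((hnorm A.a ?\<xi>)\<^sup>2)" using AV.inner_self[OF LvO] nLv by simp
    finally have e: "hinner b (act b (fst I) x \<omega>b) \<omega>b = cnj c * of_real ((hnorm A.a ?\<xi>)\<^sup>2)" .
    have "hinner b (adj b b (\<phi> I X) (\<phi> I X \<omega>b)) \<omega>b = of_real ((hnorm b (\<phi> I X \<omega>b))\<^sup>2)"
      using adj_ip2[OF HB.hilbert_space_axioms HB.hilbert_space_axioms fb \<omega>b_in fin(1)] HB.inner_self[OF fin(1)] by simp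
    then have "hinner b (\<phi> I ?Z \<omega>b) \<omega>b = of_real (m\<^sup>2) * (cnj c * of_real ((hnorm A.a ?\<xi>)\<^sup>2)) - of_real ((hnorm b (\<phi> I X \<omega>b))\<^sup>2)"
      unfolding \<phi>Z using fin ab e by (simp add: HB.inner_simps)
    moreover have "Re (of_real (m\<^sup>2) * (cnj c * of_real ((hnorm A.a ?\<xi>)\<^sup>2)) - of_real ((hnorm b (\<phi> I X \<omega>b))\<^sup>2))
        = m\<^sup>2 * (Re c * (hnorm A.a ?\<xi>)\<^sup>2) - (hnorm b (\<phi> I X \<omega>b))\<^sup>2"
      by (simp del: of_real_power)
    ultimately have "Re (hinner b (\<phi> I ?Z \<omega>b) \<omega>b) = m\<^sup>2 * (Re c * (hnorm A.a ?\<xi>)\<^sup>2) - (hnorm b (\<phi> I X \<omega>b))\<^sup>2"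
      by (simp only:)
    with pos have "0 \<le> m\<^sup>2 * (Re c * (hnorm A.a ?\<xi>)\<^sup>2) - (hnorm b (\<phi> I X \<omega>b))\<^sup>2" by (simp only:)
    then have "(hnorm b (\<phi> I X \<omega>b))\<^sup>2 \<le> m\<^sup>2 * (Re c * (hnorm A.a ?\<xi>)\<^sup>2)"
      by (simp only: diff_ge_0_iff_ge)
    also have "\<dots> \<le> m\<^sup>2 * (cmod c * (hnorm A.a ?\<xi>)\<^sup>2)"
      by (intro mult_left_mono mult_right_mono complex_Re_le_cmod) auto
    also have "\<dots> = (?C * hnorm A.a ?\<xi>)\<^sup>2" by (simp add: power_mult_distrib)
    finally show ?thesis by (rule power2_le_imp_le) (use m \<xi>c in simp)
  qed
  then show ?thesis using that[of ?C] m(1) by simp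
qed

end

text \<open>\<open>D X \<omega> = X D \<omega>\<close> says that \<open>D\<close> is right
  multiplication by \<open>D \<omega>\<close>, that is, \<mu> after
  \<open>1 \<boxtimes> D \<iota>\<close> after the inverse unitor. The middle factor has norm
  exactly \<open>|D \<omega>|\<close> by \<open>one_tensor_norm\<close>.\<close>

lemma (in frobenius_alg) module_endo_norm:
  obtains m where "m > 0" "\<And>I D z. \<lbrakk>I \<in> arg_arcs; D \<in> net_hom N a a;
      \<And>X z. \<lbrakk>X \<in> BQ I; z \<in> carrier a\<rbrakk> \<Longrightarrow> D (X z) = X (D z); z \<in> carrier a\<rbrakk>
    \<Longrightarrow> hnorm a (D z) \<le> m * hnorm a (D \<omega>) * hnorm a z"
proof -
  obtain m where m: "m > 0" "\<And>x. x \<in> carrier (a \<boxtimes> a) \<Longrightarrow> hnorm a (\<mu> x) \<le> m * hnorm (a \<boxtimes> a) x"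
    using bop_bound[OF hs[OF aa_mod(1)] nhom_bop[OF \<mu>_hom]] by blast
  note av = tens_module[OF a_mod vac_module]
  note h = hs[OF a_mod] hs[OF aa_mod(1)] hs[OF av]
  interpret AV: hilbert_space "a \<boxtimes> vac" by (rule h)
  note ru = unitary_opsD[OF h(3,1) unitors(4)[OF a_mod]]
  let ?r = "adj (a \<boxtimes> vac) a (runit F a)"
  have r: "?r \<in> net_hom N a (a \<boxtimes> vac)" by (rule nhom_adj[OF av a_mod unitors(3)[OF a_mod]])
  have rn: "hnorm (a \<boxtimes> vac) (?r z) = hnorm a z" if z: "z \<in> carrier a" for z
    using ru(5)[OF nhom_in[OF r z]] ru(3)[OF z] by simp
  have "hnorm a (D z) \<le> m * hnorm a (D \<omega>) * hnorm a z"
    if I: "I \<in> arg_arcs" and D: "D \<in> net_hom N a a"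
      and c: "\<And>X z. \<lbrakk>X \<in> BQ I; z \<in> carrier a\<rbrakk> \<Longrightarrow> D (X z) = X (D z)" and z: "z \<in> carrier a" for I D z
  proof -
    let ?G = "compose (carrier vac) D \<iota>"
    have G: "?G \<in> net_hom N vac a" by (rule nhom_compose[OF vac_module a_mod \<iota>_hom D])
    have GO: "?G Om = D \<omega>" by simp
    let ?t = "tensm F a a vac a (ident a) ?G"
    have t: "?t \<in> net_hom N (a \<boxtimes> vac) (a \<boxtimes> a)" by (rule tensm_hom[OF a_mod a_mod vac_module a_mod nhom_ident[OF a_mod] G])
    let ?E = "compose (carrier a) \<mu> (compose (carrier a) ?t ?r)"
    have E: "?E \<in> net_hom N a a"
      by (rule nhom_compose[OF a_mod aa_mod(1) nhom_compose[OF a_mod av r t] \<mu>_hom])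
    have "D = ?E"
    proof (rule bop_eqI_total[OF h(1,1) nhom_bop[OF D] nhom_bop[OF E] BQ_cyclic[OF I]])
      fix y assume "y \<in> {X \<omega> | X. X \<in> BQ I}"
      then obtain X where X: "X \<in> BQ I" "y = X \<omega>" by blast
      have y: "y \<in> local_vecs N a (fst I)" "X = X_op I y" using BQ_form(1,2)[OF I X(1)] X(2) by auto
      have yc: "y \<in> carrier a" by (rule local_vecs_in[OF a_mod y(1)])
      have O: "Om \<in> carrier vac" by simp
      have LO: "Lop F a vac I y Om \<in> carrier (a \<boxtimes> vac)" by (rule L_in[OF a_mod vac_module I y(1) O])
      have "?r y = Lop F a vac I y Om" using ru(2)[OF LO] L_state_field[OF a_mod I y(1)] by simp
      then have "?E y = \<mu> (?t (Lop F a vac I y Om))" using yc by simp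
      also have "?t (Lop F a vac I y Om) = Lop F a a I y (?G Om)"
        by (rule L_functorial[OF a_mod vac_module a_mod G I y(1) O])
      also have "\<mu> \<dots> = X (D \<omega>)" unfolding GO
        by (subst y(2)) (rule X_op_apply[OF nhom_in[OF D \<omega>_in], symmetric])
      also have "\<dots> = D y" using c[OF X(1) \<omega>_in] X(2) by simp
      finally show "D y = ?E y" by simp
    qed
    from fun_cong[OF this, of z] have "D z = \<mu> (?t (?r z))" using z by simp
    then have "hnorm a (D z) \<le> m * hnorm (a \<boxtimes> a) (?t (?r z))"
      using m(2)[OF nhom_in[OF t nhom_in[OF r z]]] by simp
    also have "hnorm (a \<boxtimes> a) (?t (?r z)) = hnorm a (D \<omega>) * hnorm a z"
      using one_tensor_norm[OF a_mod a_mod G nhom_in[OF r z]] rn[OF z] GO by simp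
    finally show ?thesis by (simp add: mult.assoc)
  qed
  then show ?thesis by (rule that[OF m(1)])
qed

context extension_iso
begin

lemma BQ_vec_subspace:
  assumes I: "I \<in> arg_arcs" shows "lin_subspace A.a {X A.\<omega> | X. X \<in> A.BQ I}"
  unfolding lin_subspace_def
proof (intro conjI ballI allI)
  show "{X A.\<omega> | X. X \<in> A.BQ I} \<subseteq> carrier A.a" using bop_in[OF A.BQ_bop[OF I] A.\<omega>_in] by blast
  have "op_smult A.a A.a 0 (ident A.a) A.\<omega> = \<zero>\<^bsub>A.a\<^esub>" by simp
  then show "\<zero>\<^bsub>A.a\<^esub> \<in> {X A.\<omega> | X. X \<in> A.BQ I}"
    using A.BQ_closed(4)[OF I A.BQ_closed(1)[OF I], of 0] unfolding mem_Collect_eq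
    by (intro exI[of _ "op_smult A.a A.a 0 (ident A.a)"]) simp
next
  fix x y assume "x \<in> {X A.\<omega> | X. X \<in> A.BQ I}" "y \<in> {X A.\<omega> | X. X \<in> A.BQ I}"
  then obtain X Y where XY: "X \<in> A.BQ I" "Y \<in> A.BQ I" "x = X A.\<omega>" "y = Y A.\<omega>" by blast
  then have "x \<oplus>\<^bsub>A.a\<^esub> y = op_add A.a A.a X Y A.\<omega>" by simp
  then show "x \<oplus>\<^bsub>A.a\<^esub> y \<in> {X A.\<omega> | X. X \<in> A.BQ I}" using A.BQ_closed(3)[OF I XY(1,2)] by blast
next
  fix c x assume "x \<in> {X A.\<omega> | X. X \<in> A.BQ I}"
  then obtain X where X: "X \<in> A.BQ I" "x = X A.\<omega>" by blast
  then have "c \<odot>\<^bsub>A.a\<^esub> x = op_smult A.a A.a c X A.\<omega>" by simp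
  then show "c \<odot>\<^bsub>A.a\<^esub> x \<in> {X A.\<omega> | X. X \<in> A.BQ I}" using A.BQ_closed(4)[OF I X(1)] by blast
qed

text \<open>One operator for each arg-valued interval, since its domain
  \<open>B_Q(I) \<omega>\<close> depends on the interval; \<open>VV_const\<close> shows that they
  coincide.\<close>

definition VV :: "arg_arc \<Rightarrow> 'h \<Rightarrow> 'h" where
  "VV I = (SOME T. T \<in> bounded_ops A.a b \<and> (\<forall>X\<in>A.BQ I. T (X A.\<omega>) = \<phi> I X \<omega>b))"

lemma VV:
  assumes I: "I \<in> arg_arcs"
  shows "VV I \<in> bounded_ops A.a b" "X \<in> A.BQ I \<Longrightarrow> VV I (X A.\<omega>) = \<phi> I X \<omega>b"
proof -
  let ?D = "{X A.\<omega> | X. X \<in> A.BQ I}"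
  let ?f = "\<lambda>z. \<phi> I (A.X_op I z) \<omega>b"
  obtain C where C: "\<And>I X. \<lbrakk>I \<in> arg_arcs; X \<in> A.BQ I\<rbrakk> \<Longrightarrow> hnorm b (\<phi> I X \<omega>b) \<le> C * hnorm A.a (X A.\<omega>)"
    by (rule \<phi>_bounded) (rule that)
  have f: "?f (X A.\<omega>) = \<phi> I X \<omega>b" if "X \<in> A.BQ I" for X
    using A.BQ_form(2)[OF I that] by simp
  obtain T where T: "T \<in> bounded_ops A.a b" "\<And>x. x \<in> ?D \<Longrightarrow> T x = ?f x"
  proof (rule extend_bounded[OF HA.hilbert_space_axioms HB.hilbert_space_axioms BQ_vec_subspace[OF I] A.BQ_cyclic[OF I], of ?f C])
    fix x assume "x \<in> ?D"
    then obtain X where X: "X \<in> A.BQ I" "x = X A.\<omega>" by blast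
    show "?f x \<in> carrier b" using f[OF X(1)] X(2) bop_in[OF \<phi>_bop[OF I X(1)] \<omega>b_in] by simp
    show "hnorm b (?f x) \<le> C * hnorm A.a x" using f[OF X(1)] X(2) C[OF I X(1)] by simp
    fix c
    have "c \<odot>\<^bsub>A.a\<^esub> x = op_smult A.a A.a c X A.\<omega>" using X by simp
    then show "?f (c \<odot>\<^bsub>A.a\<^esub> x) = c \<odot>\<^bsub>b\<^esub> ?f x"
      using f[OF A.BQ_closed(4)[OF I X(1)], of c] f[OF X(1)] X(2) \<phi>_smult[OF I X(1), of c] by simp
  next
    fix x y assume "x \<in> ?D" "y \<in> ?D"
    then obtain X Y where XY: "X \<in> A.BQ I" "Y \<in> A.BQ I" "x = X A.\<omega>" "y = Y A.\<omega>" by blast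
    have "x \<oplus>\<^bsub>A.a\<^esub> y = op_add A.a A.a X Y A.\<omega>" using XY by simp
    then show "?f (x \<oplus>\<^bsub>A.a\<^esub> y) = ?f x \<oplus>\<^bsub>b\<^esub> ?f y"
      using f[OF A.BQ_closed(3)[OF I XY(1,2)]] f[OF XY(1)] f[OF XY(2)] XY(3,4) \<phi>_add[OF I XY(1,2)] by simp
  qed (rule that)
  have "\<exists>T. T \<in> bounded_ops A.a b \<and> (\<forall>X\<in>A.BQ I. T (X A.\<omega>) = \<phi> I X \<omega>b)"
  proof (intro exI[of _ T] conjI ballI T(1))
    fix X assume X: "X \<in> A.BQ I"
    then have "X A.\<omega> \<in> ?D" by blast
    from T(2)[OF this] f[OF X] show "T (X A.\<omega>) = \<phi> I X \<omega>b" by simp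
  qed
  note r = someI_ex[OF this, folded VV_def]
  show "VV I \<in> bounded_ops A.a b" by (rule conjunct1[OF r])
  show "X \<in> A.BQ I \<Longrightarrow> VV I (X A.\<omega>) = \<phi> I X \<omega>b" by (rule bspec[OF conjunct2[OF r]])
qed

lemma VV_mono:
  assumes I: "I \<in> arg_arcs" and J: "J \<in> arg_arcs" and IJ: "arg_sub I J"
  shows "VV J = VV I"
proof (rule bop_eqI_total[OF HA.hilbert_space_axioms HB.hilbert_space_axioms VV(1)[OF J] VV(1)[OF I] A.BQ_cyclic[OF I]])
  fix x assume "x \<in> {X A.\<omega> | X. X \<in> A.BQ I}"
  then obtain X where X: "X \<in> A.BQ I" "x = X A.\<omega>" by blast
  have "X \<in> A.BQ J" using A.BQ_mono[OF I J IJ] X(1) by blast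
  then show "VV J x = VV I x" using VV(2)[OF J] VV(2)[OF I X(1)] X(2) \<phi>_mono[OF I J IJ X(1)] by simp
qed

lemma VV_AI:
  assumes "a \<le> c" "c < d" "d \<le> b'" "b' < a + 2 * pi"
  shows "VV (AI a b') = VV (AI c d)"
  by (rule VV_mono[OF AI_in AI_in AI_sub]) (use assms in linarith)+

text \<open>Shrinking the interval does not change the operator. Sliding an interval along the real
  line of angles in overlapping steps therefore connects any two, also those over the same arc with
  different windings.\<close>

lemma VV_const:
  assumes I: "I \<in> arg_arcs" and J: "J \<in> arg_arcs" shows "VV I = VV J"
proof -
  \<comment> \<open>Reference intervals of length \<open>2\<close>, less than a full turn. Those at
    centres at most \<open>1\<close> apart share a common subinterval, and every interval contains a
    shorter concentric one of this family.\<close>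
  define W where "W s = VV (AI (s - 1) (s + 1))" for s :: real
  have pi: "2 < 2 * pi" using pi_gt3 by simp
  have 1: "W s = W t" if "s \<le> t" "t \<le> s + 1" for s t
  proof -
    have "W s = VV (AI (t - 1) (s + 1))" unfolding W_def by (rule VV_AI) (use that pi in linarith)+
    also have "\<dots> = W t" unfolding W_def by (rule VV_AI[symmetric]) (use that pi in linarith)+
    finally show ?thesis .
  qed
  have up: "W s = W (s + real n * r)" if "0 \<le> r" "r \<le> 1" for s r n
  proof (induction n)
    case (Suc n)
    have "W (s + real n * r) = W (s + real (Suc n) * r)" by (rule 1) (use that in \<open>auto simp: algebra_simps\<close>)
    with Suc show ?case by simp
  qed simp
  have le: "W s = W t" if "s \<le> t" for s t
  proof -
    obtain n :: nat where n: "t - s < real n" using reals_Archimedean2 by blast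
    then have npos: "real n > 0" using that by linarith
    then have "W s = W (s + real n * ((t - s) / real n))" using n that by (intro up) auto
    then show ?thesis using npos by simp
  qed
  have W: "W s = W t" for s t 
  proof (cases "s \<le> t")
    case False
    then have "W t = W s" by (intro le) simp
    then show ?thesis by (rule sym)
  qed (rule le)
  have form: "\<exists>s. VV K = W s" if K: "K \<in> arg_arcs" for K
  proof -
    obtain a b' where ab: "a < b'" "b' < a + 2 * pi" "K = AI a b'" by (rule arg_arc_form[OF K])
    define c where "c = (a + b') / 2"
    define h where "h = min ((b' - a) / 2) 1"
    have h: "0 < h" "h \<le> (b' - a) / 2" "h \<le> 1" using ab unfolding h_def by (simp, linarith, linarith)
    have cc: "a \<le> c - h" "c + h \<le> b'" using h by (auto simp: c_def field_simps)
    have "VV K = VV (AI (c - h) (c + h))" unfolding ab(3) by (rule VV_AI) (use h cc ab in linarith)+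
    also have "\<dots> = W c" unfolding W_def by (rule VV_AI[symmetric]) (use h pi in linarith)+
    finally show ?thesis by blast
  qed
  show ?thesis
  proof -
    obtain s t where "VV I = W s" "VV J = W t" using form[OF I] form[OF J] by blast
    then show ?thesis using W[of s t] by simp
  qed
qed

definition V :: "'h \<Rightarrow> 'h" where "V = VV (SOME I. I \<in> arg_arcs)"

lemma V_eq: "I \<in> arg_arcs \<Longrightarrow> V = VV I"
  unfolding V_def using someI_ex[OF A.some_arg_arc] by (rule VV_const)

lemma V_bop: "V \<in> bounded_ops A.a b"
proof -
  obtain I where I: "I \<in> arg_arcs" using A.some_arg_arc by blast
  show ?thesis unfolding V_eq[OF I] by (rule VV(1)[OF I])
qed

lemma V_BQ: "\<lbrakk>I \<in> arg_arcs; X \<in> A.BQ I\<rbrakk> \<Longrightarrow> V (X A.\<omega>) = \<phi> I X \<omega>b"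
  by (simp only: V_eq VV(2))

text \<open>On the total set \<open>Y \<omega>\<close>, multiplicativity of \<phi> gives
  \<open>V X Y \<omega> = \<phi>(X) \<phi>(Y) \<omega>b\<close>, which is
  \<open>\<phi>(X) V Y \<omega>\<close>.\<close>

lemma V_X:
  assumes I: "I \<in> arg_arcs" and X: "X \<in> A.BQ I" and z: "z \<in> carrier A.a"
  shows "V (X z) = \<phi> I X (V z)"
proof -
  note h = HA.hilbert_space_axioms HB.hilbert_space_axioms
  have "compose (carrier A.a) V X = compose (carrier A.a) (\<phi> I X) V"
  proof (rule bop_eqI_total[OF h bop_compose[OF h(1,1) A.BQ_bop[OF I X] V_bop] bop_compose[OF h V_bop \<phi>_bop[OF I X]] A.BQ_cyclic[OF I]])
    fix y assume "y \<in> {X A.\<omega> | X. X \<in> A.BQ I}"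
    then obtain Y where Y: "Y \<in> A.BQ I" "y = Y A.\<omega>" by blast
    have yc: "y \<in> carrier A.a" using bop_in[OF A.BQ_bop[OF I Y(1)] A.\<omega>_in] Y(2) by simp
    have "V (X y) = V (compose (carrier A.a) X Y A.\<omega>)" using Y(2) by simp
    also have "\<dots> = \<phi> I (compose (carrier A.a) X Y) \<omega>b" by (rule V_BQ[OF I A.BQ_closed(5)[OF I X Y(1)]])
    also have "\<dots> = \<phi> I X (V y)" using \<phi>_compose[OF I X Y(1)] V_BQ[OF I Y(1)] Y(2) by simp
    finally show "compose (carrier A.a) V X y = compose (carrier A.a) (\<phi> I X) V y" using yc by simp
  qed
  from fun_cong[OF this, of z] show ?thesis using z by simp
qed

text \<open>The action of \<open>A(J)\<close> lies in the algebra of an interval over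
  \<open>J\<close>, and \<phi> is prescribed there, so the implementing relation becomes the
  intertwining relation.\<close>

lemma V_hom: "V \<in> net_hom N A.a b"
proof (rule nhomI, rule lhomI[OF V_bop])
  fix J x z assume J: "J \<in> arcs" and x: "x \<in> local_alg N J" and z: "z \<in> carrier A.a"
  obtain I where I: "I \<in> arg_arcs" "fst I = J" using arg_arc_exists[OF J] by blast
  have x': "x \<in> local_alg N (fst I)" using x I by simp
  show "V (act A.a J x z) = act b J x (V z)"
    using V_X[OF I(1) A.BQ_closed(7)[OF I(1) x'] z] \<phi>_act[OF I(1) x'] I(2) by simp
qed

lemma V_\<omega>: "V A.\<omega> = \<omega>b"
proof -
  obtain I where I: "I \<in> arg_arcs" using A.some_arg_arc by blast
  show ?thesis using V_BQ[OF I A.BQ_closed(1)[OF I]] \<phi>_ident[OF I] by simp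
qed

lemma V_\<iota>: "x \<in> carrier (vac_space N) \<Longrightarrow> V (A.\<iota> x) = \<iota>b x"
proof -
  obtain I where I: "I \<in> arg_arcs" using A.some_arg_arc by blast
  note arc = arg_arc_fst[OF I]
  have "compose (carrier A.vac) V A.\<iota> = \<iota>b"
    by (rule A.lhom_vac_eqI[OF b_mod arc nhom_lhom[OF nhom_compose[OF A.vac_module A.a_mod A.\<iota>_hom V_hom] arc] nhom_lhom[OF \<iota>b_hom arc]])
      (simp add: V_\<omega>)
  from fun_cong[OF this, of x] show "x \<in> carrier (vac_space N) \<Longrightarrow> V (A.\<iota> x) = \<iota>b x" by simp
qed

lemma V_range_total: "total_in b (V ` carrier A.a)"
proof -
  obtain I where I: "I \<in> arg_arcs" using A.some_arg_arc by blast
  show ?thesis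
  proof (rule HB.total_mono[OF Bb_cyclic[OF I]])
    show "{Y \<omega>b | Y. Y \<in> Bb I} \<subseteq> V ` carrier A.a"
    proof
      fix y assume "y \<in> {Y \<omega>b | Y. Y \<in> Bb I}"
      then obtain Y where Y: "Y \<in> Bb I" "y = Y \<omega>b" by blast
      have "Y \<in> \<phi> I ` A.BQ I" using Y(1) bij_betw_imp_surj_on[OF \<phi>_bij[OF I]] by simp
      then obtain X where X: "X \<in> A.BQ I" "\<phi> I X = Y" by (elim imageE) (rule that, simp_all)
      show "y \<in> V ` carrier A.a"
        using V_BQ[OF I X(1)] X(2) Y(2) bop_in[OF A.BQ_bop[OF I X(1)] A.\<omega>_in] by force
    qed
    show "V ` carrier A.a \<subseteq> carrier b" using bop_in[OF V_bop] by blast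
  qed
qed

text \<open>The kernel \<open>K\<close> of \<open>V\<close> is a submodule meeting every \<open>H\<^sub>a(I)\<close> trivially, as \<open>\<omega>b\<close> is separating;
  but the projection onto \<open>K\<close> maps \<open>H\<^sub>a(I)\<close> into \<open>K \<inter> H\<^sub>a(I)\<close>.\<close>

lemma V_inj:
  assumes z: "z \<in> carrier A.a" and Vz: "V z = \<zero>\<^bsub>b\<^esub>"
  shows "z = \<zero>\<^bsub>A.a\<^esub>"
proof -
  note h = HA.hilbert_space_axioms HB.hilbert_space_axioms
  have Va: "adj A.a b V \<in> bounded_ops b A.a" by (rule adj_bop[OF h V_bop])
  \<comment> \<open>The kernel of \<open>V\<close> is written as the complement of the range of its
    adjoint, so that \<open>perp_projection\<close> provides the projection onto it.\<close>
  let ?S = "adj A.a b V ` carrier b"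
  have Sc: "?S \<subseteq> carrier A.a" using bop_in[OF Va] by blast
  have ker: "y \<in> perp A.a ?S \<longleftrightarrow> y \<in> carrier A.a \<and> V y = \<zero>\<^bsub>b\<^esub>" for y
  proof
    assume y: "y \<in> perp A.a ?S"
    then have yc: "y \<in> carrier A.a" by (simp add: perp_def)
    have "hinner b (V y) (V y) = hinner A.a (adj A.a b V (V y)) y"
      using adj_ip2[OF h V_bop yc bop_in[OF V_bop yc]] by simp
    also have "\<dots> = 0" using y bop_in[OF V_bop yc] by (simp add: perp_def)
    finally show "y \<in> carrier A.a \<and> V y = \<zero>\<^bsub>b\<^esub>" using yc HB.inner_definite[OF bop_in[OF V_bop yc]] by simp
  next
    assume y: "y \<in> carrier A.a \<and> V y = \<zero>\<^bsub>b\<^esub>"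
    then show "y \<in> perp A.a ?S" using adj_ip2[OF h V_bop] by (auto simp: perp_def)
  qed
  obtain P where P: "P \<in> bounded_ops A.a A.a" "\<And>x. x \<in> carrier A.a \<Longrightarrow> P x \<in> perp A.a ?S" "\<And>x. x \<in> perp A.a ?S \<Longrightarrow> P x = x"
    "\<And>x y. \<lbrakk>x \<in> carrier A.a; y \<in> carrier A.a\<rbrakk> \<Longrightarrow> hinner A.a (P x) y = hinner A.a x (P y)"
    by (rule HA.perp_projection[OF Sc]) (rule that)
  have inv: "act A.a J x y \<in> perp A.a ?S" if J: "J \<in> arcs" and x: "x \<in> local_alg N J" and y: "y \<in> perp A.a ?S" for J x y
  proof -
    have yc: "y \<in> carrier A.a" "V y = \<zero>\<^bsub>b\<^esub>" using y ker by auto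
    show ?thesis unfolding ker
      using act_in[OF A.a_mod J x yc(1)] lhom_act[OF nhom_lhom[OF V_hom J] x yc(1)] yc(2)
        bop_zero[OF h(2,2) act_bop[OF b_mod J x]] by simp
  qed
  have Ph: "P \<in> net_hom N A.a A.a"
  proof (rule nhomI, rule lhomI[OF P(1)])
    fix J x y assume J: "J \<in> arcs" and x: "x \<in> local_alg N J" and y: "y \<in> carrier A.a"
    have ax: "adj (vac_space N) (vac_space N) x \<in> local_alg N J" by (rule vN_adj[OF A.local_vN[OF J] x])
    show "P (act A.a J x y) = act A.a J x (P y)"
    proof (rule HA.projection_commute[OF P act_bop[OF A.a_mod J x] inv[OF J x] _ y])
      show "\<And>z. z \<in> perp A.a ?S \<Longrightarrow> adj A.a A.a (act A.a J x) z \<in> perp A.a ?S"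
        using inv[OF J ax] act_adj[OF A.a_mod J x] by simp
    qed
  qed
  obtain I where I: "I \<in> arg_arcs" using A.some_arg_arc by blast
  note arc = arg_arc_fst[OF I]
  have "P = (\<lambda>x\<in>carrier A.a. \<zero>\<^bsub>A.a\<^esub>)"
  proof (rule bop_eqI_total[OF h(1,1) P(1) _ A.local_total[OF A.a_mod arc]])
    show "(\<lambda>x\<in>carrier A.a. \<zero>\<^bsub>A.a\<^esub>) \<in> bounded_ops A.a A.a" by (rule bopI[where C = 0]) auto
    fix y assume y: "y \<in> local_vecs N A.a (fst I)"
    have yc: "y \<in> carrier A.a" by (rule A.local_vecs_in[OF A.a_mod y])
    let ?p = "P y"
    have p: "?p \<in> local_vecs N A.a (fst I)" by (rule A.local_vecs_inverse_hom[OF A.a_mod A.a_mod Ph arc y])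
    let ?X = "A.X_op I ?p"
    have X: "?X \<in> A.BQ I" by (rule A.X_op_BQ[OF p])
    have X\<omega>: "?X A.\<omega> = ?p" by (rule A.X_op_vac[OF I p])
    have "\<phi> I ?X \<omega>b = \<zero>\<^bsub>b\<^esub>" using V_BQ[OF I X] X\<omega> P(2)[OF yc] ker by simp
    then have f0: "\<phi> I ?X = (\<lambda>x\<in>carrier b. \<zero>\<^bsub>b\<^esub>)" by (rule Bb_separating[OF I \<phi>_in[OF I X]])
    \<comment> \<open>The zero element of \<open>B_Q(I)\<close>; its image is also zero, so
      injectivity of \<phi> gives \<open>?X = ?Z\<close>.\<close>
    let ?Z = "op_smult A.a A.a 0 ?X"
    have Z: "?Z \<in> A.BQ I" by (rule A.BQ_closed(4)[OF I X])
    have "\<phi> I ?Z = \<phi> I ?X"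
      unfolding \<phi>_smult[OF I X] f0 by (rule HOL.ext) (simp add: op_smult_def)
    then have "?Z = ?X" by (rule \<phi>_inj[OF I Z X])
    then have "?Z A.\<omega> = ?X A.\<omega>" by simp
    then have "?p = \<zero>\<^bsub>A.a\<^esub>" using X\<omega> A.local_vecs_in[OF A.a_mod p] by simp
    then show "P y = (\<lambda>x\<in>carrier A.a. \<zero>\<^bsub>A.a\<^esub>) y" using yc by simp
  qed
  moreover have "P z = z" using P(3) ker z Vz by blast
  ultimately show ?thesis using z by simp
qed

abbreviation "Vs \<equiv> adj A.a b V"

lemma Vs_hom: "Vs \<in> net_hom N b A.a"
  by (rule A.nhom_adj[OF A.a_mod b_mod V_hom])

text \<open>\<phi> respects adjoints, so \<open>\<phi> I X\<close> can be moved to the other side of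
  the inner product and back through \<open>V\<close> as the adjoint of \<open>X\<close>.\<close>

lemma VV_commute:
  assumes I: "I \<in> arg_arcs" and X: "X \<in> A.BQ I" and z: "z \<in> carrier A.a"
  shows "Vs (V (X z)) = X (Vs (V z))"
proof -
  note h = HA.hilbert_space_axioms HB.hilbert_space_axioms
  note Xa = A.BQ_closed(2)[OF I X]
  note Vin = bop_in[OF V_bop] and Vsin = nhom_in[OF Vs_hom] and Xin = bop_in[OF A.BQ_bop[OF I X]]
    and Xain = bop_in[OF A.BQ_bop[OF I Xa]]
  have tot: "total_in A.a (carrier A.a)" unfolding total_in_def using HA.inner_definite by blast
  show ?thesis
  proof (rule HA.hilbert_eqI_total[OF Vsin[OF Vin[OF Xin[OF z]]] Xin[OF Vsin[OF Vin[OF z]]] tot])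
    fix y assume y: "y \<in> carrier A.a"
    have "hinner A.a y (Vs (V (X z))) = hinner b (V y) (V (X z))"
      by (rule adj_ip[OF h V_bop y Vin[OF Xin[OF z]], symmetric])
    also have "\<dots> = hinner b (V y) (\<phi> I X (V z))" by (simp only: V_X[OF I X z])
    also have "\<dots> = hinner b (adj b b (\<phi> I X) (V y)) (V z)"
      by (rule adj_ip2[OF h(2,2) \<phi>_bop[OF I X] Vin[OF z] Vin[OF y], symmetric])
    also have "adj b b (\<phi> I X) (V y) = V (adj A.a A.a X y)"
      using \<phi>_adj[OF I X] V_X[OF I Xa y] by simp
    also have "hinner b \<dots> (V z) = hinner A.a (adj A.a A.a X y) (Vs (V z))"
      by (rule adj_ip[OF h V_bop Xain[OF y] Vin[OF z]])
    also have "\<dots> = hinner A.a y (X (Vs (V z)))"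
      by (rule adj_ip2[OF h(1,1) A.BQ_bop[OF I X] Vsin[OF Vin[OF z]] y])
    finally show "hinner A.a y (Vs (V (X z))) = hinner A.a y (X (Vs (V z)))" .
  qed
qed

text \<open>With \<open>T = V\<^sup>*V\<close> and \<open>A = 1 - c T\<close>, the powers \<open>A\<^sup>n\<close> commute with \<open>B\<^sub>Q(I)\<close>, so their norms are controlled by
  \<open>A\<^sup>n \<omega> \<rightarrow> 0\<close>. This replaces the finite-dimensionality of the endomorphism algebra of \<open>a\<close>.\<close>

lemma V_bounded_below:
  obtains \<delta> where "\<delta> > 0" "\<And>z. z \<in> carrier A.a \<Longrightarrow> \<delta> * (hnorm A.a z)\<^sup>2 \<le> Re (hinner A.a (Vs (V z)) z)"
proof -
  note h = HA.hilbert_space_axioms HB.hilbert_space_axioms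
  note [simp] = bop_in[OF V_bop] nhom_in[OF Vs_hom]
  obtain C where C: "C > 0" "\<And>x. x \<in> carrier A.a \<Longrightarrow> hnorm b (V x) \<le> C * hnorm A.a x" using bop_bound[OF h(1) V_bop] by blast
  \<comment> \<open>With \<open>C\<close> a bound for \<open>V\<close>, this makes
    \<open>A = 1 - c T\<close> satisfy \<open>|A z|^2 \<le> |z|^2 - c |V z|^2\<close>: a
    contraction, and a strict one off the kernel of \<open>V\<close>, which is trivial.\<close>
  define c where "c = 1 / C\<^sup>2"
  have c: "c > 0" "c * C\<^sup>2 = 1" using C(1) by (simp_all add: c_def)
  let ?T = "\<lambda>z. Vs (V z)"
  have ipT: "hinner A.a (?T y) z = hinner b (V y) (V z)" "hinner A.a y (?T z) = hinner b (V y) (V z)"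
    if "y \<in> carrier A.a" "z \<in> carrier A.a" for y z
    using that adj_ip2[OF h V_bop, of z "V y"] adj_ip[OF h V_bop, of y "V z"] by simp_all
  have nT: "(hnorm A.a (?T z))\<^sup>2 \<le> C\<^sup>2 * (hnorm b (V z))\<^sup>2" if z: "z \<in> carrier A.a" for z
  proof -
    have "(hnorm A.a (?T z))\<^sup>2 = Re (hinner b (V z) (V (?T z)))"
      using ipT(1)[OF z, of "?T z"] z by (simp add: HA.hnorm_sq)
    also have "\<dots> \<le> hnorm b (V z) * hnorm b (V (?T z))"
      by (rule order_trans[OF complex_Re_le_cmod HB.cauchy_schwarz]) (use z in simp_all)
    also have "\<dots> \<le> hnorm b (V z) * (C * hnorm A.a (?T z))" using C(2)[of "?T z"] z by (intro mult_left_mono) auto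
    finally have "1 * (hnorm A.a (?T z))\<^sup>2 \<le> (hnorm b (V z) * C) * hnorm A.a (?T z)" by (simp add: mult.assoc)
    then have "hnorm A.a (?T z) \<le> hnorm b (V z) * C / 1" by (rule bounded_below_cancel) (use z C(1) in auto)
    then have "(hnorm A.a (?T z))\<^sup>2 \<le> (hnorm b (V z) * C)\<^sup>2" using z by (intro power_mono) auto
    then show ?thesis by (simp add: power_mult_distrib mult.commute)
  qed
  let ?To = "compose (carrier A.a) Vs V"
  have To: "?To \<in> net_hom N A.a A.a" by (rule nhom_compose[OF A.a_mod b_mod V_hom Vs_hom])
  define A where "A = op_add A.a A.a (ident A.a) (op_smult A.a A.a (of_real (- c)) ?To)"
  have A: "A \<in> net_hom N A.a A.a"
  proof (rule nhomI)
    fix J assume J: "J \<in> arcs"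
    show "A \<in> local_hom N J A.a A.a" unfolding A_def
      by (rule A.lhom_op_add[OF A.a_mod A.a_mod J nhom_lhom[OF nhom_ident[OF A.a_mod] J]
            A.lhom_op_smult[OF A.a_mod A.a_mod J nhom_lhom[OF To J]]])
  qed
  note Ab = nhom_bop[OF A] and Ain = nhom_in[OF A]
  have Az: "A z = z \<oplus>\<^bsub>A.a\<^esub> of_real (- c) \<odot>\<^bsub>A.a\<^esub> ?T z" if "z \<in> carrier A.a" for z
    using that by (simp add: A_def)
  have Aadj: "adj A.a A.a A = A"
    by (rule adj_eqI[OF h(1,1) Ab Ab]) (simp add: Az HA.inner_simps ipT)
  have An: "(hnorm A.a (A z))\<^sup>2 \<le> (hnorm A.a z)\<^sup>2 - c * (hnorm b (V z))\<^sup>2" if z: "z \<in> carrier A.a" for z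
  proof -
    have "hinner A.a (A z) (A z) = hinner A.a z z - 2 * of_real c * hinner b (V z) (V z) + of_real (c * c) * hinner A.a (?T z) (?T z)"
      using z by (simp add: Az HA.inner_simps ipT bop_add[OF V_bop] bop_smult[OF V_bop] HB.inner_simps algebra_simps)
    then have "(hnorm A.a (A z))\<^sup>2 = (hnorm A.a z)\<^sup>2 - 2 * c * (hnorm b (V z))\<^sup>2 + c * c * (hnorm A.a (?T z))\<^sup>2"
      using z Ain[OF z] by (simp add: HA.hnorm_sq HB.hnorm_sq)
    also have "c * c * (hnorm A.a (?T z))\<^sup>2 \<le> c * c * (C\<^sup>2 * (hnorm b (V z))\<^sup>2)"
      using nT[OF z] c by (intro mult_left_mono) auto
    also have "c * c * (C\<^sup>2 * (hnorm b (V z))\<^sup>2) = c * (hnorm b (V z))\<^sup>2"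
    proof -
      have "c * c * (C\<^sup>2 * (hnorm b (V z))\<^sup>2) = c * (c * C\<^sup>2) * (hnorm b (V z))\<^sup>2" by (simp add: mult.assoc)
      then show ?thesis by (simp add: c(2))
    qed
    finally show ?thesis by simp
  qed
  have Acon: "hnorm A.a (A z) \<le> hnorm A.a z" if z: "z \<in> carrier A.a" for z
  proof (rule power2_le_imp_le)
    show "(hnorm A.a (A z))\<^sup>2 \<le> (hnorm A.a z)\<^sup>2"
      using An[OF z] mult_nonneg_nonneg[OF less_imp_le[OF c(1)] zero_le_power2[of "hnorm b (V z)"]] by linarith
  qed (use z in simp)
  have Astrict: "z = \<zero>\<^bsub>A.a\<^esub>" if z: "z \<in> carrier A.a" and e: "hnorm A.a (A z) = hnorm A.a z" for z
  proof -
    have "c * (hnorm b (V z))\<^sup>2 \<le> 0" using An[OF z] e by simp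
    then have "hnorm b (V z) = 0" using c(1) by (simp add: mult_le_0_iff)
    then show ?thesis using V_inj[OF z] HB.hnorm_eq_0[of "V z"] z by simp
  qed
  have pc: "(A ^^ n) z \<in> carrier A.a" if "z \<in> carrier A.a" for n z using that by (induction n) (auto simp: Ain)
  obtain I where I: "I \<in> arg_arcs" using A.some_arg_arc by blast
  have AX: "A (X z) = X (A z)" if X: "X \<in> A.BQ I" and z: "z \<in> carrier A.a" for X z
    using z bop_in[OF A.BQ_bop[OF I X]] VV_commute[OF I X z]
    by (simp add: Az bop_add[OF A.BQ_bop[OF I X]] bop_smult[OF A.BQ_bop[OF I X]])
  have AnX: "(A ^^ n) (X z) = X ((A ^^ n) z)" if X: "X \<in> A.BQ I" and z: "z \<in> carrier A.a" for X z n
    by (induction n) (simp_all add: AX[OF X pc[OF z]])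
  have Dn: "restrict (A ^^ n) (carrier A.a) \<in> net_hom N A.a A.a" for n
  proof (induction n)
    case 0
    have "restrict (A ^^ 0) (carrier A.a) = ident A.a" by (simp add: ident_def id_def)
    then show ?case using nhom_ident[OF A.a_mod] by (simp only:)
  next
    case (Suc n)
    have "restrict (A ^^ Suc n) (carrier A.a) = compose (carrier A.a) A (restrict (A ^^ n) (carrier A.a))"
      by (rule HOL.ext) (simp add: compose_def)
    then show ?case using nhom_compose[OF A.a_mod A.a_mod Suc A] by (simp only:)
  qed
  obtain m where m: "m > 0" "\<And>I D z. \<lbrakk>I \<in> arg_arcs; D \<in> net_hom N A.a A.a;
      \<And>X z. \<lbrakk>X \<in> A.BQ I; z \<in> carrier A.a\<rbrakk> \<Longrightarrow> D (X z) = X (D z); z \<in> carrier A.a\<rbrakk>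
    \<Longrightarrow> hnorm A.a (D z) \<le> m * hnorm A.a (D A.\<omega>) * hnorm A.a z"
    by (rule A.module_endo_norm) (rule that, assumption, blast)
  \<comment> \<open>The threshold at \<omega> for which the bound of \<open>module_endo_norm\<close>
    makes the \<open>n\<close>-th power of \<open>A\<close> have norm at most
    \<open>1/2\<close>.\<close>
  have "1 / (2 * m) > 0" using m(1) by simp
  then obtain n where n: "hnorm A.a ((A ^^ n) A.\<omega>) < 1 / (2 * m)"
    using HA.contraction_powers_vanish[OF Ab Aadj Acon Astrict A.\<omega>_in] by blast
  have half: "hnorm A.a ((A ^^ n) z) \<le> 1/2 * hnorm A.a z" if z: "z \<in> carrier A.a" for z
  proof -
    have "hnorm A.a (restrict (A ^^ n) (carrier A.a) z) \<le> m * hnorm A.a (restrict (A ^^ n) (carrier A.a) A.\<omega>) * hnorm A.a z"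
      by (rule m(2)[OF I Dn _ z]) (simp add: AnX pc bop_in[OF A.BQ_bop[OF I]])
    also have "\<dots> \<le> m * (1 / (2 * m)) * hnorm A.a z"
      using n m(1) z by (intro mult_right_mono mult_left_mono) auto
    finally show ?thesis using z m(1) by simp
  qed
  have dc: "hnorm A.a (A u \<ominus>\<^bsub>A.a\<^esub> A w) \<le> hnorm A.a (u \<ominus>\<^bsub>A.a\<^esub> w)" if u: "u \<in> carrier A.a" and w: "w \<in> carrier A.a" for u w
  proof -
    have 1: "u \<ominus>\<^bsub>A.a\<^esub> w = u \<oplus>\<^bsub>A.a\<^esub> (-1) \<odot>\<^bsub>A.a\<^esub> w"
      by (rule HA.hilbert_eqI) (use u w in \<open>simp_all add: HA.inner_simps\<close>)
    have 2: "A u \<ominus>\<^bsub>A.a\<^esub> A w = A u \<oplus>\<^bsub>A.a\<^esub> (-1) \<odot>\<^bsub>A.a\<^esub> A w"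
      by (rule HA.hilbert_eqI) (use u w Ain in \<open>simp_all add: HA.inner_simps\<close>)
    have "A (u \<ominus>\<^bsub>A.a\<^esub> w) = A u \<ominus>\<^bsub>A.a\<^esub> A w"
      unfolding 1 2 using u w by (simp add: bop_add[OF Ab] bop_smult[OF Ab])
    then show ?thesis using Acon[of "u \<ominus>\<^bsub>A.a\<^esub> w"] u w by simp
  qed
  have step: "hnorm A.a ((A ^^ k) z \<ominus>\<^bsub>A.a\<^esub> (A ^^ Suc k) z) \<le> c * hnorm A.a (?T z)" if z: "z \<in> carrier A.a" for k z
  proof (induction k)
    case 0
    have "z \<ominus>\<^bsub>A.a\<^esub> A z = of_real c \<odot>\<^bsub>A.a\<^esub> ?T z"
      by (rule HA.hilbert_eqI) (use z Ain in \<open>simp_all add: Az HA.inner_simps\<close>)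
    then show ?case using z c(1) by (simp add: HA.hnorm_smult)
  next
    case (Suc k)
    have "hnorm A.a ((A ^^ Suc k) z \<ominus>\<^bsub>A.a\<^esub> (A ^^ Suc (Suc k)) z) \<le> hnorm A.a ((A ^^ k) z \<ominus>\<^bsub>A.a\<^esub> (A ^^ Suc k) z)"
      using dc[OF pc[OF z] pc[OF z], of k "Suc k"] by simp
    with Suc show ?case by linarith
  qed
  \<comment> \<open>Telescoping: each step from \<open>(A ^^ k) z\<close> to the next costs at most
    \<open>|z - A z| = c |T z|\<close>, since \<open>A\<close> is a contraction.\<close>
  have tel: "hnorm A.a (z \<ominus>\<^bsub>A.a\<^esub> (A ^^ k) z) \<le> real k * (c * hnorm A.a (?T z))" if z: "z \<in> carrier A.a" for k z
  proof (induction k)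
    case 0
    have "z \<ominus>\<^bsub>A.a\<^esub> z = \<zero>\<^bsub>A.a\<^esub>" by (rule HA.hilbert_eqI) (use z in \<open>simp_all add: HA.inner_simps\<close>)
    then show ?case by simp
  next
    case (Suc k)
    have "hnorm A.a (z \<ominus>\<^bsub>A.a\<^esub> (A ^^ Suc k) z) \<le> hnorm A.a (z \<ominus>\<^bsub>A.a\<^esub> (A ^^ k) z) + hnorm A.a ((A ^^ k) z \<ominus>\<^bsub>A.a\<^esub> (A ^^ Suc k) z)"
      by (rule HA.hnorm_diff_triangle[OF z pc[OF z] pc[OF z]])
    then show ?case using Suc step[OF z, of k] by (simp add: distrib_right)
  qed
  \<comment> \<open>Since \<open>|(A ^^ n) z| \<le> |z| / 2\<close>, telescoping gives
    \<open>|z| \<le> 2 n c |T z|\<close>; the added \<open>1\<close> keeps \<open>K\<close> positive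
    also for \<open>n = 0\<close>.\<close>
  define K where "K = 2 * real n * c + 1"
  have K: "K > 0" using c(1) by (simp add: K_def add_nonneg_pos)
  have low: "hnorm A.a z \<le> K * hnorm A.a (?T z)" if z: "z \<in> carrier A.a" for z
  proof -
    have "hnorm A.a z \<le> hnorm A.a (z \<ominus>\<^bsub>A.a\<^esub> (A ^^ n) z) + hnorm A.a ((A ^^ n) z)"
      using HA.hnorm_diff_triangle[OF z pc[OF z] HA.zero_closed, of n] z pc[OF z] by simp
    then have "hnorm A.a z \<le> 2 * (real n * (c * hnorm A.a (?T z)))" using tel[OF z, of n] half[OF z] by linarith
    moreover have "0 \<le> hnorm A.a (?T z)" using z by simp
    ultimately show ?thesis unfolding K_def by (simp add: algebra_simps)
  qed
  have "1 / (K\<^sup>2 * C\<^sup>2) * (hnorm A.a z)\<^sup>2 \<le> Re (hinner A.a (?T z) z)" if z: "z \<in> carrier A.a" for z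
  proof -
    have "(hnorm A.a z)\<^sup>2 \<le> (K * hnorm A.a (?T z))\<^sup>2" using low[OF z] z by (intro power_mono) auto
    also have "\<dots> \<le> K\<^sup>2 * (C\<^sup>2 * (hnorm b (V z))\<^sup>2)"
      using nT[OF z] by (simp add: power_mult_distrib mult_left_mono)
    also have "(hnorm b (V z))\<^sup>2 = Re (hinner A.a (?T z) z)" using ipT(1)[OF z z] z by (simp add: HB.hnorm_sq)
    finally show ?thesis using K C(1) by (simp add: field_simps)
  qed
  then show ?thesis using that[of "1 / (K\<^sup>2 * C\<^sup>2)"] K C(1) by simp
qed

text \<open>The lower bound makes the adjoint of \<open>V\<close> times \<open>V\<close> coercive,
  hence invertible; its inverse composed with that adjoint is a left inverse of \<open>V\<close>. It
  is a right inverse on the range of \<open>V\<close>, which is total because \<phi> is onto and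
  \<open>\<omega>b\<close> is cyclic.\<close>

lemma V_inverse:
  obtains S where "S \<in> net_hom N b A.a" "\<And>x. x \<in> carrier A.a \<Longrightarrow> S (V x) = x" "\<And>y. y \<in> carrier b \<Longrightarrow> V (S y) = y"
proof -
  note h = HA.hilbert_space_axioms HB.hilbert_space_axioms
  have To: "compose (carrier A.a) Vs V \<in> bounded_ops A.a A.a" by (rule bop_compose[OF h V_bop nhom_bop[OF Vs_hom]])
  obtain d where d: "d > 0" "\<And>z. z \<in> carrier A.a \<Longrightarrow> d * (hnorm A.a z)\<^sup>2 \<le> Re (hinner A.a (Vs (V z)) z)"
    by (rule V_bounded_below) (rule that)
  obtain R where R: "R \<in> bounded_ops A.a A.a" "\<And>x. x \<in> carrier A.a \<Longrightarrow> compose (carrier A.a) Vs V (R x) = x"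
    "\<And>x. x \<in> carrier A.a \<Longrightarrow> R (compose (carrier A.a) Vs V x) = x"
  proof (rule lax_milgram[OF h(1) To d(1)])
    fix x assume "x \<in> carrier A.a"
    then show "d * (hnorm A.a x)\<^sup>2 \<le> Re (hinner A.a (compose (carrier A.a) Vs V x) x)" using d(2) by simp
  qed (rule that)
  let ?S = "compose (carrier b) R Vs"
  have Sb: "?S \<in> bounded_ops b A.a" by (rule bop_compose[OF h(2,1) nhom_bop[OF Vs_hom] R(1)])
  have SV: "?S (V x) = x" if x: "x \<in> carrier A.a" for x using R(3)[OF x] x bop_in[OF V_bop x] by simp
  have eq: "compose (carrier b) V ?S = ident b"
  proof (rule bop_eqI_total[OF h(2,2) bop_compose[OF h(2,1) Sb V_bop] ident_bop[OF h(2)] V_range_total])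
    fix y assume "y \<in> V ` carrier A.a"
    then obtain z where z: "z \<in> carrier A.a" "y = V z" by blast
    have yc: "y \<in> carrier b" using z bop_in[OF V_bop] by simp
    have "compose (carrier b) V ?S y = V (?S (V z))" using z(2) yc by simp
    also have "\<dots> = V z" by (simp only: SV[OF z(1)])
    finally show "compose (carrier b) V ?S y = ident b y" using yc z(2) by simp
  qed
  have VS: "V (?S y) = y" if "y \<in> carrier b" for y
    using fun_cong[OF eq, of y] that by (simp only: compose_apply ident_apply)
  have "?S \<in> net_hom N b A.a"
    by (rule nhomI, rule A.lhom_inverse[OF A.a_mod b_mod _ nhom_lhom[OF V_hom] Sb SV VS])
  then show ?thesis using that SV VS by blast
qed

end

section \<open>The transported Frobenius algebra\<close>

locale extension_iso_inv = extension_iso N F Qa Eb \<phi>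
  for N :: "'h net" and F :: "'h fusion" (structure) and Qa :: "'h frob" and Eb :: "'h extn" and \<phi> +
  fixes S
  assumes S_hom: "S \<in> net_hom N b (fobj Qa)"
    and S_V: "x \<in> carrier (fobj Qa) \<Longrightarrow> S (V x) = x"
    and V_S: "y \<in> carrier (emod Eb) \<Longrightarrow> V (S y) = y"
begin

lemma mods: "net_module N (A.a \<boxtimes> A.a)" "net_module N (A.a \<boxtimes> b)" "net_module N (b \<boxtimes> b)"
  "net_module N (A.vac \<boxtimes> b)" "net_module N (b \<boxtimes> A.vac)" "net_module N (b \<boxtimes> b \<boxtimes> b)" "net_module N (b \<boxtimes> (b \<boxtimes> b))"
  "net_module N (A.a \<boxtimes> A.a \<boxtimes> b)" "net_module N (A.a \<boxtimes> (A.a \<boxtimes> b))" "net_module N (A.a \<boxtimes> A.a \<boxtimes> A.a)"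
  by (simp_all add: A.tens_module A.vac_module)

lemmas ida = nhom_ident[OF A.a_mod] and idb = nhom_ident[OF b_mod]

abbreviation "SS \<equiv> tensm F b A.a b A.a S S"

definition \<mu>b :: "'h \<Rightarrow> 'h" where
  "\<mu>b = compose (carrier (b \<boxtimes> b)) V (compose (carrier (b \<boxtimes> b)) A.\<mu> SS)"

definition Qb :: "'h frob" where "Qb = \<lparr>fobj = b, fmult = \<mu>b, funit = \<iota>b\<rparr>"

lemma Qb_simps [simp]: "fobj Qb = b" "fmult Qb = \<mu>b" "funit Qb = \<iota>b"
  by (simp_all add: Qb_def)

lemma SS_hom: "SS \<in> net_hom N (b \<boxtimes> b) (A.a \<boxtimes> A.a)"
  by (rule A.tensm_hom[OF b_mod A.a_mod b_mod A.a_mod S_hom S_hom])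

lemma \<mu>b_hom: "\<mu>b \<in> net_hom N (b \<boxtimes> b) b"
  unfolding \<mu>b_def
  by (rule nhom_compose[OF mods(3) A.a_mod nhom_compose[OF mods(3,1) SS_hom A.\<mu>_hom] V_hom])

lemma \<mu>b_apply: "x \<in> carrier (b \<boxtimes> b) \<Longrightarrow> \<mu>b x = V (A.\<mu> (SS x))"
  by (simp add: \<mu>b_def)

lemma S_\<mu>b: "x \<in> carrier (b \<boxtimes> b) \<Longrightarrow> S (\<mu>b x) = A.\<mu> (SS x)"
  by (simp add: \<mu>b_apply S_V[OF nhom_in[OF A.\<mu>_hom nhom_in[OF SS_hom]]])

lemma S_\<iota>: "x \<in> carrier (vac_space N) \<Longrightarrow> S (\<iota>b x) = A.\<iota> x"
proof -
  assume x: "x \<in> carrier (vac_space N)"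
  then have "A.\<iota> x \<in> carrier A.a" by (intro nhom_in[OF A.\<iota>_hom]) simp
  then show ?thesis unfolding V_\<iota>[OF x, symmetric] by (rule S_V)
qed

lemma unit_left_b: assumes x: "x \<in> carrier (A.vac \<boxtimes> b)"
  shows "\<mu>b (tensm F A.vac b b b \<iota>b (ident b) x) = lunit F b x"
proof -
  note v = A.vac_module and idv = nhom_ident[OF A.vac_module]
  let ?u = "tensm F A.vac b b b \<iota>b (ident b) x"
  have u: "?u \<in> carrier (b \<boxtimes> b)" by (rule nhom_in[OF A.tensm_hom[OF v b_mod b_mod b_mod \<iota>b_hom idb] x])
  let ?w = "tensm F A.vac A.vac b A.a (ident A.vac) S x"
  have w: "?w \<in> carrier (A.vac \<boxtimes> A.a)" by (rule nhom_in[OF A.tensm_hom[OF v v b_mod A.a_mod idv S_hom] x])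
  have "SS ?u = tensm F A.vac A.a b A.a A.\<iota> S x"
    by (rule A.tensm_split[OF v b_mod A.a_mod b_mod b_mod A.a_mod \<iota>b_hom S_hom idb S_hom A.\<iota>_hom S_hom _ _ x, symmetric])
      (simp_all add: S_\<iota>)
  also have "\<dots> = tensm F A.vac A.a A.a A.a A.\<iota> (ident A.a) ?w"
    by (rule A.tensm_split[OF v v A.a_mod b_mod A.a_mod A.a_mod idv A.\<iota>_hom S_hom ida A.\<iota>_hom S_hom _ _ x])
      (simp_all add: nhom_in[OF S_hom])
  finally have "\<mu>b ?u = V (lunit F A.a ?w)" by (simp only: \<mu>b_apply[OF u] A.unit_left[OF w])
  also have "\<dots> = V (S (lunit F b x))" by (simp only: A.lunit_natural[OF b_mod A.a_mod S_hom x])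
  also have "\<dots> = lunit F b x" by (rule V_S[OF nhom_in[OF A.unitors(1)[OF b_mod] x]])
  finally show ?thesis .
qed

lemma unit_right_b: assumes x: "x \<in> carrier (b \<boxtimes> A.vac)"
  shows "\<mu>b (tensm F b b A.vac b (ident b) \<iota>b x) = runit F b x"
proof -
  note v = A.vac_module and idv = nhom_ident[OF A.vac_module]
  let ?u = "tensm F b b A.vac b (ident b) \<iota>b x"
  have u: "?u \<in> carrier (b \<boxtimes> b)" by (rule nhom_in[OF A.tensm_hom[OF b_mod b_mod v b_mod idb \<iota>b_hom] x])
  let ?w = "tensm F b A.a A.vac A.vac S (ident A.vac) x"
  have w: "?w \<in> carrier (A.a \<boxtimes> A.vac)" by (rule nhom_in[OF A.tensm_hom[OF b_mod A.a_mod v v S_hom idv] x])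
  have "SS ?u = tensm F b A.a A.vac A.a S A.\<iota> x"
    by (rule A.tensm_split[OF b_mod b_mod A.a_mod v b_mod A.a_mod idb S_hom \<iota>b_hom S_hom S_hom A.\<iota>_hom _ _ x, symmetric])
      (simp_all add: S_\<iota>)
  also have "\<dots> = tensm F A.a A.a A.vac A.a (ident A.a) A.\<iota> ?w"
    by (rule A.tensm_split[OF b_mod A.a_mod A.a_mod v v A.a_mod S_hom ida idv A.\<iota>_hom S_hom A.\<iota>_hom _ _ x])
      (simp_all add: nhom_in[OF S_hom])
  finally have "\<mu>b ?u = V (runit F A.a ?w)" by (simp only: \<mu>b_apply[OF u] A.unit_right[OF w])
  also have "\<dots> = V (S (runit F b x))" by (simp only: A.runit_natural[OF b_mod A.a_mod S_hom x])
  also have "\<dots> = runit F b x" by (rule V_S[OF nhom_in[OF A.unitors(3)[OF b_mod] x]])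
  finally show ?thesis .
qed

abbreviation "\<mu>bl \<equiv> tensm F (b \<boxtimes> b) b b b \<mu>b (ident b)"
abbreviation "\<mu>br \<equiv> tensm F b b (b \<boxtimes> b) b (ident b) \<mu>b"
abbreviation "\<alpha>b \<equiv> assoc F b b b"

lemma \<mu>bl_hom: "\<mu>bl \<in> net_hom N (b \<boxtimes> b \<boxtimes> b) (b \<boxtimes> b)" and \<mu>br_hom: "\<mu>br \<in> net_hom N (b \<boxtimes> (b \<boxtimes> b)) (b \<boxtimes> b)"
  and \<alpha>b_hom: "\<alpha>b \<in> net_hom N (b \<boxtimes> b \<boxtimes> b) (b \<boxtimes> (b \<boxtimes> b))"
  using A.tensm_hom[OF mods(3) b_mod b_mod b_mod \<mu>b_hom idb] A.tensm_hom[OF b_mod b_mod mods(3) b_mod idb \<mu>b_hom]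
    A.assoc_iso[of b b b] by auto

lemma assoc_b: assumes x: "x \<in> carrier (b \<boxtimes> b \<boxtimes> b)" shows "\<mu>b (\<mu>bl x) = \<mu>b (\<mu>br (\<alpha>b x))"
proof -
  let ?SSS = "tensm F (b \<boxtimes> b) (A.a \<boxtimes> A.a) b A.a SS S x"
  have SSS: "?SSS \<in> carrier (A.a \<boxtimes> A.a \<boxtimes> A.a)"
    by (rule nhom_in[OF A.tensm_hom[OF mods(3,1) b_mod A.a_mod SS_hom S_hom] x])
  note \<alpha>x = nhom_in[OF \<alpha>b_hom x]
  let ?c = "compose (carrier (b \<boxtimes> b)) A.\<mu> SS"
  have c: "?c \<in> net_hom N (b \<boxtimes> b) A.a" by (rule nhom_compose[OF mods(3,1) SS_hom A.\<mu>_hom])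
  have "SS (\<mu>bl x) = tensm F (b \<boxtimes> b) A.a b A.a ?c S x"
    by (rule A.tensm_split[OF mods(3) b_mod A.a_mod b_mod b_mod A.a_mod \<mu>b_hom S_hom idb S_hom c S_hom _ _ x, symmetric])
      (simp_all add: S_\<mu>b)
  also have "\<dots> = A.\<mu>l ?SSS"
    by (rule A.tensm_split[OF mods(3,1) A.a_mod b_mod A.a_mod A.a_mod SS_hom A.\<mu>_hom S_hom ida c S_hom _ _ x])
      (simp_all add: nhom_in[OF S_hom])
  finally have "A.\<mu> (SS (\<mu>bl x)) = A.\<mu> (A.\<mu>r (A.\<alpha> ?SSS))" by (simp only: A.\<mu>_assoc[OF SSS])
  also have "A.\<alpha> ?SSS = tensm F b A.a (b \<boxtimes> b) (A.a \<boxtimes> A.a) S SS (\<alpha>b x)"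
    by (rule A.assoc_natural[OF b_mod A.a_mod b_mod A.a_mod b_mod A.a_mod S_hom S_hom S_hom x])
  also have "A.\<mu>r \<dots> = tensm F b A.a (b \<boxtimes> b) A.a S ?c (\<alpha>b x)"
    by (rule A.tensm_split[OF b_mod A.a_mod A.a_mod mods(3,1) A.a_mod S_hom ida SS_hom A.\<mu>_hom S_hom c _ _ \<alpha>x, symmetric])
      (simp_all add: nhom_in[OF S_hom])
  also have "\<dots> = SS (\<mu>br (\<alpha>b x))"
    by (rule A.tensm_split[OF b_mod b_mod A.a_mod mods(3) b_mod A.a_mod idb S_hom \<mu>b_hom S_hom S_hom c _ _ \<alpha>x])
      (simp_all add: S_\<mu>b)
  finally show ?thesis by (simp only: \<mu>b_apply[OF nhom_in[OF \<mu>bl_hom x]] \<mu>b_apply[OF nhom_in[OF \<mu>br_hom \<alpha>x]])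
qed

abbreviation "TT \<equiv> compose (carrier A.a) Vs V"

lemma TT_hom: "TT \<in> net_hom N A.a A.a"
  by (rule nhom_compose[OF A.a_mod b_mod V_hom Vs_hom])

text \<open>\<open>TT\<close> commutes with all left multiplications by local vectors. Since the
  vectors \<open>L(\<xi>) \<eta>\<close> are total in the fusion product, this becomes an identity
  about \<mu> itself.\<close>

lemma TT_\<mu>: assumes x: "x \<in> carrier (A.a \<boxtimes> A.a)"
  shows "Vs (V (A.\<mu> x)) = A.\<mu> (tensm F A.a A.a A.a A.a (ident A.a) TT x)"
proof -
  obtain I where I: "I \<in> arg_arcs" using A.some_arg_arc by blast
  let ?t = "tensm F A.a A.a A.a A.a (ident A.a) TT"
  have t: "?t \<in> net_hom N (A.a \<boxtimes> A.a) (A.a \<boxtimes> A.a)" by (rule A.tensm_hom[OF A.a_mod A.a_mod A.a_mod A.a_mod ida TT_hom])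
  have "compose (carrier (A.a \<boxtimes> A.a)) TT A.\<mu> = compose (carrier (A.a \<boxtimes> A.a)) A.\<mu> ?t"
  proof (rule bop_eqI_total[OF A.hs[OF mods(1)] HA.hilbert_space_axioms nhom_bop[OF nhom_compose[OF mods(1) A.a_mod A.\<mu>_hom TT_hom]]
        nhom_bop[OF nhom_compose[OF mods(1,1) t A.\<mu>_hom]] A.L_total[OF A.a_mod A.a_mod I]])
    fix y assume "y \<in> {Lop F A.a A.a I \<xi> \<eta> |\<xi> \<eta>. \<xi> \<in> local_vecs N A.a (fst I) \<and> \<eta> \<in> carrier A.a}"
    then obtain \<xi> \<eta> where y: "y = Lop F A.a A.a I \<xi> \<eta>" "\<xi> \<in> local_vecs N A.a (fst I)" "\<eta> \<in> carrier A.a" by blast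
    have yc: "y \<in> carrier (A.a \<boxtimes> A.a)" unfolding y(1) by (rule A.L_in[OF A.a_mod A.a_mod I y(2,3)])
    have "Vs (V (A.\<mu> y)) = Vs (V (A.X_op I \<xi> \<eta>))" by (simp only: y(1) A.X_op_apply[OF y(3)])
    also have "\<dots> = A.X_op I \<xi> (TT \<eta>)" using VV_commute[OF I A.X_op_BQ[OF y(2)] y(3)] y(3) by simp
    also have "\<dots> = A.\<mu> (Lop F A.a A.a I \<xi> (TT \<eta>))" by (rule A.X_op_apply[OF nhom_in[OF TT_hom y(3)]])
    also have "Lop F A.a A.a I \<xi> (TT \<eta>) = ?t y"
      unfolding y(1) by (rule A.L_functorial[OF A.a_mod A.a_mod A.a_mod TT_hom I y(2,3), symmetric])
    finally show "compose (carrier (A.a \<boxtimes> A.a)) TT A.\<mu> y = compose (carrier (A.a \<boxtimes> A.a)) A.\<mu> ?t y"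
      using yc nhom_in[OF A.\<mu>_hom yc] by simp
  qed
  from fun_cong[OF this, of x] show ?thesis using x nhom_in[OF A.\<mu>_hom x] by simp
qed

abbreviation "V1 \<equiv> tensm F A.a b b b V (ident b)"

lemma V1_hom: "V1 \<in> net_hom N (A.a \<boxtimes> b) (b \<boxtimes> b)"
  by (rule A.tensm_hom[OF A.a_mod b_mod b_mod b_mod V_hom idb])

lemma SS_V1: assumes x: "x \<in> carrier (A.a \<boxtimes> b)"
  shows "SS (V1 x) = tensm F A.a A.a b A.a (ident A.a) S x"
  by (rule A.tensm_split[OF A.a_mod b_mod A.a_mod b_mod b_mod A.a_mod V_hom S_hom idb S_hom ida S_hom _ _ x, symmetric])
    (simp_all add: S_V)

text \<open>Inserting the definition of \<open>\<mu>b\<close> leaves \<open>TT\<close> applied to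
  \<mu>, which \<open>TT_\<mu>\<close> moves to the right factor; there it meets \<open>S\<close>
  and becomes the adjoint of \<open>V\<close>.\<close>

lemma V_star_b: assumes x: "x \<in> carrier (A.a \<boxtimes> b)"
  shows "Vs (\<mu>b (V1 x)) = A.\<mu> (tensm F A.a A.a b A.a (ident A.a) Vs x)"
proof -
  let ?y = "tensm F A.a A.a b A.a (ident A.a) S x"
  have y: "?y \<in> carrier (A.a \<boxtimes> A.a)" by (rule nhom_in[OF A.tensm_hom[OF A.a_mod A.a_mod b_mod A.a_mod ida S_hom] x])
  have "Vs (\<mu>b (V1 x)) = A.\<mu> (tensm F A.a A.a A.a A.a (ident A.a) TT ?y)"
    by (simp only: \<mu>b_apply[OF nhom_in[OF V1_hom x]] SS_V1[OF x] TT_\<mu>[OF y])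
  also have "tensm F A.a A.a A.a A.a (ident A.a) TT ?y = tensm F A.a A.a b A.a (ident A.a) Vs x"
    by (rule A.tensm_split[OF A.a_mod A.a_mod A.a_mod b_mod A.a_mod A.a_mod ida ida S_hom TT_hom ida Vs_hom _ _ x, symmetric])
      (simp_all add: V_S nhom_in[OF S_hom])
  finally show ?thesis .
qed

abbreviation "Sa \<equiv> adj b A.a S"

lemma Sa_hom: "Sa \<in> net_hom N A.a b"
  by (rule A.nhom_adj[OF b_mod A.a_mod S_hom])

lemma Sa_Vs: assumes y: "y \<in> carrier b" shows "Sa (Vs y) = y"
proof -
  note h = HA.hilbert_space_axioms HB.hilbert_space_axioms
  have "compose (carrier b) V S = ident b"
    by (rule bop_eqI[OF bop_compose[OF h(2,1) nhom_bop[OF S_hom] V_bop] ident_bop[OF h(2)]])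
      (simp only: compose_apply V_S ident_apply)
  then have "compose (carrier b) Sa Vs = ident b"
    using adj_compose[OF h(2,1,2) nhom_bop[OF S_hom] V_bop] h(2) by simp
  from fun_cong[OF this, of y] show ?thesis using y by (simp only: compose_apply ident_apply)
qed

abbreviation "SVs \<equiv> tensm F b A.a b A.a S Vs"
abbreviation "SaV \<equiv> tensm F A.a b A.a b Sa V"

lemma SVs_hom: "SVs \<in> net_hom N (b \<boxtimes> b) (A.a \<boxtimes> A.a)"
  by (rule A.tensm_hom[OF b_mod A.a_mod b_mod A.a_mod S_hom Vs_hom])

lemma SaV_hom: "SaV \<in> net_hom N (A.a \<boxtimes> A.a) (b \<boxtimes> b)"
  by (rule A.tensm_hom[OF A.a_mod b_mod A.a_mod b_mod Sa_hom V_hom])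

text \<open>The relation \<open>V\<^sup>* \<mu>\<^sub>b (V \<otimes> 1) = \<mu>\<^sub>a (1 \<otimes> V\<^sup>*)\<close> turns \<open>V \<mu>\<^sub>a (V\<^sup>-\<^sup>1 \<otimes> V\<^sup>-\<^sup>1)\<close> into an expression whose
  adjoint can be composed with the Frobenius relation of \<open>\<mu>\<^sub>a\<close>.\<close>

lemma \<mu>b_alt: assumes x: "x \<in> carrier (b \<boxtimes> b)" shows "\<mu>b x = Sa (A.\<mu> (SVs x))"
proof -
  let ?y = "tensm F b A.a b b S (ident b) x"
  have y: "?y \<in> carrier (A.a \<boxtimes> b)" by (rule nhom_in[OF A.tensm_hom[OF b_mod A.a_mod b_mod b_mod S_hom idb] x])
  have "V1 ?y = tensm F b b b b (ident b) (ident b) x"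
    by (rule A.tensm_split[OF b_mod A.a_mod b_mod b_mod b_mod b_mod S_hom V_hom idb idb idb idb _ _ x, symmetric])
      (simp_all add: V_S)
  also have "\<dots> = x" using A.tensm_ident[OF b_mod b_mod] x by simp
  finally have "Vs (\<mu>b x) = A.\<mu> (tensm F A.a A.a b A.a (ident A.a) Vs ?y)" using V_star_b[OF y] by simp
  also have "tensm F A.a A.a b A.a (ident A.a) Vs ?y = SVs x"
    by (rule A.tensm_split[OF b_mod A.a_mod A.a_mod b_mod b_mod A.a_mod S_hom ida idb Vs_hom S_hom Vs_hom _ _ x, symmetric])
      (simp_all add: nhom_in[OF S_hom])
  finally have "Sa (Vs (\<mu>b x)) = Sa (A.\<mu> (SVs x))" by (rule arg_cong)
  then show ?thesis by (simp only: Sa_Vs[OF nhom_in[OF \<mu>b_hom x]])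
qed

abbreviation "D \<equiv> adj (A.a \<boxtimes> A.a) A.a A.\<mu>"

lemma D_hom: "D \<in> net_hom N A.a (A.a \<boxtimes> A.a)"
  by (rule A.nhom_adj[OF mods(1) A.a_mod A.\<mu>_hom])

abbreviation "Db \<equiv> adj (b \<boxtimes> b) b \<mu>b"

lemma Db_hom: "Db \<in> net_hom N b (b \<boxtimes> b)"
  by (rule A.nhom_adj[OF mods(3) b_mod \<mu>b_hom])

text \<open>The adjoint of \<open>\<mu>b_alt\<close>. In this form the second factor of the
  comultiplication carries \<open>V\<close>, which a following \<open>S\<close> can cancel; the
  adjoint of the defining formula of \<open>\<mu>b\<close> would put the adjoint of \<open>S\<close>
  there.\<close>

lemma Db_apply: assumes z: "z \<in> carrier b" shows "Db z = SaV (D (S z))"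
proof -
  note h = HA.hilbert_space_axioms HB.hilbert_space_axioms and h2 = A.hs[OF mods(1)] A.hs[OF mods(3)]
  let ?c = "compose (carrier (b \<boxtimes> b)) A.\<mu> SVs"
  have c: "?c \<in> bounded_ops (b \<boxtimes> b) A.a" by (rule bop_compose[OF h2(2,1) nhom_bop[OF SVs_hom] nhom_bop[OF A.\<mu>_hom]])
  have e: "\<mu>b = compose (carrier (b \<boxtimes> b)) Sa ?c"
    by (rule bop_eqI[OF nhom_bop[OF \<mu>b_hom] bop_compose[OF h2(2) h(1) c nhom_bop[OF Sa_hom]]])
      (simp add: \<mu>b_alt)
  have "adj (b \<boxtimes> b) (A.a \<boxtimes> A.a) SVs = tensm F A.a b A.a b Sa (adj b A.a Vs)"
    by (rule A.tensm_adj[OF b_mod A.a_mod b_mod A.a_mod S_hom Vs_hom, symmetric])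
  then have SVsa: "adj (b \<boxtimes> b) (A.a \<boxtimes> A.a) SVs = SaV" using adj_adj[OF h V_bop] by simp
  have "Db = compose (carrier b) (adj (b \<boxtimes> b) A.a ?c) (adj A.a b Sa)"
    by (subst e) (rule adj_compose[OF h2(2) h c nhom_bop[OF Sa_hom]])
  also have "adj A.a b Sa = S" by (rule adj_adj[OF h(2,1) nhom_bop[OF S_hom]])
  also have "adj (b \<boxtimes> b) A.a ?c = compose (carrier A.a) SaV D"
    using adj_compose[OF h2(2,1) h(1) nhom_bop[OF SVs_hom] nhom_bop[OF A.\<mu>_hom]] SVsa by simp
  finally have "Db = compose (carrier b) (compose (carrier A.a) SaV D) S" .
  from fun_cong[OF this, of z] show ?thesis using z nhom_in[OF S_hom z] by simp
qed

text \<open>In the second tensor factor the \<open>V\<close> coming from \<open>Db\<close> cancels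
  against an \<open>S\<close> from \<open>\<mu>b\<close>. What remains is the Frobenius relation of
  \<mu>, with \<open>SS\<close> before it and \<open>SaV\<close> after it, and
  \<open>Db_apply\<close> recognises the result.\<close>

lemma frob_b: assumes x: "x \<in> carrier (b \<boxtimes> b)"
  shows "\<mu>br (\<alpha>b (adj (b \<boxtimes> b \<boxtimes> b) (b \<boxtimes> b) \<mu>bl x)) = Db (\<mu>b x)"
proof -
  let ?a = "A.a" and ?aa = "A.a \<boxtimes> A.a"
  let ?DS = "compose (carrier b) D S"
  have DS: "?DS \<in> net_hom N b ?aa" by (rule nhom_compose[OF b_mod A.a_mod S_hom D_hom])
  let ?w = "tensm F b ?aa b b ?DS (ident b) x"
  have w: "?w \<in> carrier (?aa \<boxtimes> b)" by (rule nhom_in[OF A.tensm_hom[OF b_mod mods(1) b_mod b_mod DS idb] x])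
  let ?u = "assoc F ?a ?a b ?w"
  have \<alpha>aab: "assoc F ?a ?a b \<in> net_hom N (?aa \<boxtimes> b) (?a \<boxtimes> (?a \<boxtimes> b))" using A.assoc_iso[of ?a ?a b] by auto
  have u: "?u \<in> carrier (?a \<boxtimes> (?a \<boxtimes> b))" by (rule nhom_in[OF \<alpha>aab w])
  have "adj (b \<boxtimes> b \<boxtimes> b) (b \<boxtimes> b) \<mu>bl = tensm F b (b \<boxtimes> b) b b Db (ident b)"
    using A.tensm_adj[OF mods(3) b_mod b_mod b_mod \<mu>b_hom idb] HB.hilbert_space_axioms by simp
  then have "adj (b \<boxtimes> b \<boxtimes> b) (b \<boxtimes> b) \<mu>bl x = tensm F b (b \<boxtimes> b) b b Db (ident b) x" by simp
  also have "\<dots> = tensm F ?aa (b \<boxtimes> b) b b SaV (ident b) ?w"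
    by (rule A.tensm_split[OF b_mod mods(1,3) b_mod b_mod b_mod DS SaV_hom idb idb Db_hom idb _ _ x])
      (simp_all add: Db_apply)
  finally have "\<alpha>b (adj (b \<boxtimes> b \<boxtimes> b) (b \<boxtimes> b) \<mu>bl x) = \<alpha>b (tensm F ?aa (b \<boxtimes> b) b b SaV (ident b) ?w)"
    by (rule arg_cong)
  also have "\<dots> = tensm F ?a b (?a \<boxtimes> b) (b \<boxtimes> b) Sa V1 ?u"
    by (rule A.assoc_natural[OF A.a_mod b_mod A.a_mod b_mod b_mod b_mod Sa_hom V_hom idb w])
  finally have 1: "\<mu>br (\<alpha>b (adj (b \<boxtimes> b \<boxtimes> b) (b \<boxtimes> b) \<mu>bl x)) = \<mu>br (tensm F ?a b (?a \<boxtimes> b) (b \<boxtimes> b) Sa V1 ?u)"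
    by (rule arg_cong)
  let ?oS = "tensm F ?a ?a b ?a (ident ?a) S"
  have oS: "?oS \<in> net_hom N (?a \<boxtimes> b) ?aa" by (rule A.tensm_hom[OF A.a_mod A.a_mod b_mod A.a_mod ida S_hom])
  let ?c = "compose (carrier (?a \<boxtimes> b)) A.\<mu> ?oS"
  have c: "?c \<in> net_hom N (?a \<boxtimes> b) ?a" by (rule nhom_compose[OF mods(2,1) oS A.\<mu>_hom])
  let ?d = "compose (carrier (?a \<boxtimes> b)) V ?c"
  have d: "?d \<in> net_hom N (?a \<boxtimes> b) b" by (rule nhom_compose[OF mods(2) A.a_mod c V_hom])
  have "\<mu>br (tensm F ?a b (?a \<boxtimes> b) (b \<boxtimes> b) Sa V1 ?u) = tensm F ?a b (?a \<boxtimes> b) b Sa ?d ?u"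
    by (rule A.tensm_split[OF A.a_mod b_mod b_mod mods(2,3) b_mod Sa_hom idb V1_hom \<mu>b_hom Sa_hom d _ _ u, symmetric])
      (simp_all add: \<mu>b_apply SS_V1 nhom_in[OF V1_hom] nhom_in[OF Sa_hom])
  also have "\<dots> = SaV (tensm F ?a ?a (?a \<boxtimes> b) ?a (ident ?a) ?c ?u)"
    by (rule A.tensm_split[OF A.a_mod A.a_mod b_mod mods(2) A.a_mod b_mod ida Sa_hom c V_hom Sa_hom d _ _ u]) simp_all
  also have "tensm F ?a ?a (?a \<boxtimes> b) ?a (ident ?a) ?c ?u
      = A.\<mu>r (tensm F ?a ?a (?a \<boxtimes> b) ?aa (ident ?a) ?oS ?u)"
    by (rule A.tensm_split[OF A.a_mod A.a_mod A.a_mod mods(2,1) A.a_mod ida ida oS A.\<mu>_hom ida c _ _ u]) simp_all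
  also have "tensm F ?a ?a (?a \<boxtimes> b) ?aa (ident ?a) ?oS ?u
      = A.\<alpha> (tensm F ?aa ?aa b ?a (tensm F ?a ?a ?a ?a (ident ?a) (ident ?a)) S ?w)"
    by (rule A.assoc_natural[OF A.a_mod A.a_mod A.a_mod A.a_mod b_mod A.a_mod ida ida S_hom w, symmetric])
  also have "tensm F ?a ?a ?a ?a (ident ?a) (ident ?a) = ident ?aa" by (rule A.tensm_ident[OF A.a_mod A.a_mod])
  also have "tensm F ?aa ?aa b ?a (ident ?aa) S ?w = tensm F b ?aa b ?a ?DS S x"
    by (rule A.tensm_split[OF b_mod mods(1,1) b_mod b_mod A.a_mod DS nhom_ident[OF mods(1)] idb S_hom DS S_hom _ _ x, symmetric])
      (simp_all add: nhom_in[OF D_hom nhom_in[OF S_hom]])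
  also have "\<dots> = tensm F ?a ?aa ?a ?a D (ident ?a) (SS x)"
    by (rule A.tensm_split[OF b_mod A.a_mod mods(1) b_mod A.a_mod A.a_mod S_hom D_hom S_hom ida DS S_hom _ _ x])
      (simp_all add: nhom_in[OF S_hom])
  also have "tensm F ?a ?aa ?a ?a D (ident ?a) = adj (?aa \<boxtimes> ?a) ?aa A.\<mu>l"
    using A.tensm_adj[OF mods(1) A.a_mod A.a_mod A.a_mod A.\<mu>_hom ida] HA.hilbert_space_axioms by simp
  also have "A.\<mu>r (A.\<alpha> (adj (?aa \<boxtimes> ?a) ?aa A.\<mu>l (SS x))) = D (A.\<mu> (SS x))"
    by (rule A.\<mu>_frob[OF nhom_in[OF SS_hom x]])
  also have "SaV (D (A.\<mu> (SS x))) = Db (\<mu>b x)"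
    by (simp only: Db_apply[OF nhom_in[OF \<mu>b_hom x]] S_\<mu>b[OF x])
  finally show ?thesis unfolding 1 .
qed

lemma Qb_frob: "cstar_frobenius N F Qb"
  unfolding cstar_frobenius_def Let_def Qb_simps commutes_adjointly_def
proof (intro conjI ballI b_mod \<mu>b_hom \<iota>b_hom)
  show "compose (carrier (b \<boxtimes> b \<boxtimes> b)) \<mu>b \<mu>bl = compose (carrier (b \<boxtimes> b \<boxtimes> b)) \<mu>b (compose (carrier (b \<boxtimes> b \<boxtimes> b)) \<mu>br \<alpha>b)"
    by (rule extensionalityI[of _ "carrier (b \<boxtimes> b \<boxtimes> b)"]) (auto simp: assoc_b compose_def)
  have "adj (b \<boxtimes> b \<boxtimes> b) (b \<boxtimes> b) \<mu>bl x \<in> carrier (b \<boxtimes> b \<boxtimes> b)" if "x \<in> carrier (b \<boxtimes> b)" for x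
    by (rule nhom_in[OF A.nhom_adj[OF mods(6,3) \<mu>bl_hom] that])
  then show "compose (carrier (b \<boxtimes> b)) (compose (carrier (b \<boxtimes> b \<boxtimes> b)) \<mu>br \<alpha>b) (adj (b \<boxtimes> b \<boxtimes> b) (b \<boxtimes> b) \<mu>bl)
      = compose (carrier (b \<boxtimes> b)) Db \<mu>b"
    by (intro extensionalityI[of _ "carrier (b \<boxtimes> b)"]) (auto simp: frob_b compose_def)
qed (rule unit_left_b unit_right_b, assumption)+

lemma left_V: "left_iso N F Qa Qb V"
  unfolding left_iso_def Let_def Qb_simps
proof (intro conjI V_hom bexI[OF _ nhom_bop[OF S_hom]])
  note h = HA.hilbert_space_axioms HB.hilbert_space_axioms
  show "compose (carrier A.a) S V = ident A.a"
    by (rule bop_eqI[OF bop_compose[OF h(1,2) V_bop nhom_bop[OF S_hom]] ident_bop[OF h(1)]])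
      (simp only: compose_apply S_V ident_apply)
  show "compose (carrier b) V S = ident b"
    by (rule bop_eqI[OF bop_compose[OF h(2,1) nhom_bop[OF S_hom] V_bop] ident_bop[OF h(2)]])
      (simp only: compose_apply V_S ident_apply)
  show "compose (carrier A.vac) V A.\<iota> = \<iota>b"
    by (rule bop_eqI[OF nhom_bop[OF nhom_compose[OF A.vac_module A.a_mod A.\<iota>_hom V_hom]] nhom_bop[OF \<iota>b_hom]])
      (simp add: V_\<iota>)
  show "compose (carrier (A.a \<boxtimes> A.a)) V A.\<mu> = compose (carrier (A.a \<boxtimes> A.a)) \<mu>b (tensm F A.a b A.a b V V)"
  proof (rule extensionalityI[of _ "carrier (A.a \<boxtimes> A.a)"])
    fix x assume x: "x \<in> carrier (A.a \<boxtimes> A.a)"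
    let ?y = "tensm F A.a b A.a b V V x"
    have y: "?y \<in> carrier (b \<boxtimes> b)" by (rule nhom_in[OF A.tensm_hom[OF A.a_mod b_mod A.a_mod b_mod V_hom V_hom] x])
    have "SS ?y = tensm F A.a A.a A.a A.a (ident A.a) (ident A.a) x"
      by (rule A.tensm_split[OF A.a_mod b_mod A.a_mod A.a_mod b_mod A.a_mod V_hom S_hom V_hom S_hom ida ida _ _ x, symmetric])
        (simp_all add: S_V)
    then have "SS ?y = x" using A.tensm_ident[OF A.a_mod A.a_mod] x by simp
    then show "compose (carrier (A.a \<boxtimes> A.a)) V A.\<mu> x = compose (carrier (A.a \<boxtimes> A.a)) \<mu>b (tensm F A.a b A.a b V V) x"
      using x \<mu>b_apply[OF y] by simp
  qed simp_all
  show "compose (carrier (A.a \<boxtimes> b)) Vs (compose (carrier (A.a \<boxtimes> b)) \<mu>b V1)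
      = compose (carrier (A.a \<boxtimes> b)) A.\<mu> (tensm F A.a A.a b A.a (ident A.a) Vs)"
    by (rule extensionalityI[of _ "carrier (A.a \<boxtimes> b)"]) (auto simp: V_star_b compose_def)
qed

sublocale P: left_iso_pair N F Qa Qb V S
proof (unfold_locales)
  show "cstar_frobenius N F Qb" by (rule Qb_frob)
  show "left_iso N F Qa Qb V" by (rule left_V)
  show "S \<in> bounded_ops (fobj Qb) (fobj Qa)" using nhom_bop[OF S_hom] by simp
  show "\<And>x. x \<in> carrier (fobj Qa) \<Longrightarrow> S (V x) = x" by (rule S_V)
  show "\<And>y. y \<in> carrier (fobj Qb) \<Longrightarrow> V (S y) = y" by (simp add: V_S)
qed

text \<open>\<phi> is conjugation by \<open>V\<close>, as is the isomorphism belonging to the left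
  isomorphism \<open>V\<close>; so both target algebras are the same image.\<close>

lemma ealg_eq: assumes I: "I \<in> arg_arcs" shows "Bb I = ealg (frob_extn N F Qb) I"
proof -
  have "\<phi> I X = P.phi I X" if X: "X \<in> A.BQ I" for X
  proof (rule bop_eqI[OF \<phi>_bop[OF I X]])
    show "P.phi I X \<in> bounded_ops b b" using P.phi_bop[OF I X] by simp
    fix z assume z: "z \<in> carrier b"
    have "P.phi I X z = V (X (S z))" using z unfolding P.phi_apply[OF I X] by simp
    also have "\<dots> = \<phi> I X z" unfolding V_X[OF I X nhom_in[OF S_hom z]] V_S[OF z] ..
    finally show "\<phi> I X z = P.phi I X z" by simp
  qed
  then have "\<phi> I ` A.BQ I = P.phi I ` A.BQ I" by (intro image_cong refl)
  then show ?thesis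
    by (simp only: bij_betw_imp_surj_on[OF \<phi>_bij[OF I]] bij_betw_imp_surj_on[OF P.phi_bij[OF I]])
qed

end

text \<open>\<open>\<mu>\<close> is recovered from \<open>B\<^sub>Q\<close> since \<open>\<mu> L(\<xi>, I)\<close> is the element of \<open>B\<^sub>Q(I)\<close> mapping \<open>\<omega>\<close> to \<open>\<xi>\<close>.\<close>

lemma frob_unique:
  assumes net: "irreducible_moebius_net N" "categorical_extension N F"
    and Q: "cstar_frobenius N F Q" "cstar_frobenius N F Q'"
    and eq: "fobj Q = fobj Q'" "funit Q = funit Q'"
      "\<And>I. I \<in> arg_arcs \<Longrightarrow> ealg (frob_extn N F Q) I = ealg (frob_extn N F Q') I"
  shows "Q = (Q' :: 'h frob)"
proof -
  interpret irreducible_moebius_net N by fact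
  interpret categorical_extension N F by fact
  interpret A: frobenius_alg N F Q by unfold_locales fact
  interpret B: frobenius_alg N F Q' by unfold_locales fact
  obtain I where I: "I \<in> arg_arcs" using A.some_arg_arc by blast
  have \<mu>': "B.\<mu> \<in> net_hom N (A.a \<boxtimes>\<^bsub>F\<^esub> A.a) A.a" using B.\<mu>_hom eq(1) by simp
  have "A.\<mu> = B.\<mu>"
  proof (rule bop_eqI_total[OF hs[OF A.aa_mod(1)] hs[OF A.a_mod] nhom_bop[OF A.\<mu>_hom] nhom_bop[OF \<mu>'] A.L_total[OF A.a_mod A.a_mod I]])
    fix y assume "y \<in> {Lop F A.a A.a I \<xi> \<eta> |\<xi> \<eta>. \<xi> \<in> local_vecs N A.a (fst I) \<and> \<eta> \<in> carrier A.a}"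
    then obtain \<xi> \<eta> where y: "y = Lop F A.a A.a I \<xi> \<eta>" "\<xi> \<in> local_vecs N A.a (fst I)" "\<eta> \<in> carrier A.a" by blast
    have X: "A.X_op I \<xi> \<in> B.BQ I" unfolding eq(3)[OF I, symmetric] by (rule A.X_op_BQ[OF y(2)])
    have "A.X_op I \<xi> = B.X_op I (A.X_op I \<xi> B.\<omega>)" by (rule B.BQ_form(2)[OF I X])
    also have "A.X_op I \<xi> B.\<omega> = \<xi>" using A.X_op_vac[OF I y(2)] eq(2) by simp
    finally have "A.X_op I \<xi> \<eta> = B.X_op I \<xi> \<eta>" by (rule fun_cong)
    then show "A.\<mu> y = B.\<mu> y" using y(3) eq(1) unfolding y(1) by (simp add: A.X_op_apply B.X_op_apply)
  qed
  with eq(1,2) show ?thesis by (simp add: frob.equality)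
qed

text \<open>Both left isomorphisms preserve the unit and implement the same family, so they agree on
  the total set \<open>B_Q(I) \<omega>\<close>.\<close>

lemma left_iso_unique:
  assumes net: "irreducible_moebius_net N" "categorical_extension N F"
    and Q: "cstar_frobenius N F Qa" "cstar_frobenius N F Qb"
    and V: "left_iso N F Qa Qb V" "left_iso N F Qa Qb V'" and eq: "iso_of N F Qa Qb V = iso_of N F Qa Qb V'"
  shows "V = V'"
proof -
  obtain S where "left_iso_pair N F Qa Qb V S" by (rule left_iso_pairI[OF net Q V(1)])
  then interpret P: left_iso_pair N F Qa Qb V S .
  obtain S' where "left_iso_pair N F Qa Qb V' S'" by (rule left_iso_pairI[OF net Q V(2)])
  then interpret P': left_iso_pair N F Qa Qb V' S' .
  obtain I where I: "I \<in> arg_arcs" using P.A.some_arg_arc by blast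
  have phi: "P.phi = P'.phi" using eq by (simp only: P.iso_of_eq P'.iso_of_eq)
  show ?thesis
  proof (rule bop_eqI_total[OF P.A.hs[OF P.A.a_mod] P.A.hs[OF P.B.a_mod] nhom_bop[OF P.V_hom] nhom_bop[OF P'.V_hom] P.A.BQ_cyclic[OF I]])
    fix z assume "z \<in> {X P.A.\<omega> |X. X \<in> P.A.BQ I}"
    then obtain X where X: "X \<in> P.A.BQ I" "z = X P.A.\<omega>" by blast
    have "compose (carrier P.A.a) V X P.A.\<omega> = compose (carrier P.A.a) (P.phi I X) V P.A.\<omega>"
      using P.phi_implements I X(1) by (simp add: implements_def)
    moreover have "compose (carrier P.A.a) V' X P.A.\<omega> = compose (carrier P.A.a) (P.phi I X) V' P.A.\<omega>"
      using P'.phi_implements I X(1) unfolding phi by (simp add: implements_def)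
    ultimately show "V z = V' z" using X P.V_unit[of "vacuum N"] P'.V_unit[of "vacuum N"] by simp
  qed
qed

lemma extension_from_frobenius:
  assumes net: "irreducible_moebius_net N" "categorical_extension N F"
    and Qa: "cstar_frobenius N F Qa" and E: "net_extension N Eb" and iso: "extn_iso N (frob_extn N F Qa) Eb \<phi>"
  shows "\<exists>Qb V. cstar_frobenius N F Qb \<and> fobj Qb = emod Eb \<and> funit Qb = eincl Eb \<and>
    (\<forall>I\<in>arg_arcs. ealg Eb I = ealg (frob_extn N F Qb) I) \<and> left_iso N F Qa Qb V \<and> \<phi> = iso_of N F Qa Qb V"
proof -
  interpret irreducible_moebius_net N by fact
  interpret categorical_extension N F by fact
  interpret E: extension_iso N F Qa Eb \<phi> by unfold_locales fact+
  obtain S where S: "S \<in> net_hom N E.b E.A.a" "\<And>x. x \<in> carrier E.A.a \<Longrightarrow> S (E.V x) = x"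
    "\<And>y. y \<in> carrier E.b \<Longrightarrow> E.V (S y) = y"
    by (rule E.V_inverse) (rule that)
  interpret I: extension_iso_inv N F Qa Eb \<phi> S by unfold_locales (fact S)+
  have ealg: "ealg Eb I = ealg (frob_extn N F I.Qb) I" if "I \<in> arg_arcs" for I by (rule I.ealg_eq[OF that])
  have "\<phi> = I.P.phi"
  proof (rule I.P.phi_unique)
    have m: "emod (frob_extn N F I.Qb) = emod Eb" by (simp add: frob_extn_def)
    show "extn_iso N (frob_extn N F Qa) (frob_extn N F I.Qb) \<phi>"
      using iso PiE_cong[of arg_arcs "\<lambda>I. E.A.BQ I \<rightarrow>\<^sub>E ealg Eb I" "\<lambda>I. E.A.BQ I \<rightarrow>\<^sub>E ealg (frob_extn N F I.Qb) I"] ealg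
      unfolding extn_iso_def m by simp
    show "implements (frob_extn N F Qa) (frob_extn N F I.Qb) E.V \<phi>"
      unfolding implements_def
    proof (intro ballI)
      fix I X assume I: "I \<in> arg_arcs" and X: "X \<in> E.A.BQ I"
      show "compose (carrier (emod (frob_extn N F Qa))) E.V X = compose (carrier (emod (frob_extn N F Qa))) (\<phi> I X) E.V"
        by (rule extensionalityI[of _ "carrier E.A.a"])
          (simp_all add: frob_extn_def E.V_X[OF I X] )
    qed
  qed
  then have "\<phi> = iso_of N F Qa I.Qb E.V" by (simp only: I.P.iso_of_eq)
  then show ?thesis using I.Qb_frob ealg I.left_V by (intro exI[of _ I.Qb] exI[of _ E.V]) simp
qed

theorem theorem3p7:
  fixes N :: "'h net" and F :: "'h fusion"
  assumes "irreducible_moebius_net N" and "categorical_extension N F"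
  shows
    "(\<forall>Qa Qb V. cstar_frobenius N F Qa \<and> cstar_frobenius N F Qb \<and> left_iso N F Qa Qb V \<longrightarrow>
        (\<exists>!\<phi>. extn_iso N (frob_extn N F Qa) (frob_extn N F Qb) \<phi> \<and>
               implements (frob_extn N F Qa) (frob_extn N F Qb) V \<phi>) \<and>
        (V \<in> unitary_ops (fobj Qa) (fobj Qb) \<longleftrightarrow>
           unitary_extn_iso N (frob_extn N F Qa) (frob_extn N F Qb) (iso_of N F Qa Qb V))) \<and>
     (\<forall>Qa Qb Qc V W. cstar_frobenius N F Qa \<and> cstar_frobenius N F Qb \<and> cstar_frobenius N F Qc \<and>
        left_iso N F Qa Qb V \<and> left_iso N F Qb Qc W \<longrightarrow>
        left_iso N F Qa Qc (compose (carrier (fobj Qa)) W V) \<and>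
        iso_of N F Qa Qc (compose (carrier (fobj Qa)) W V)
          = extn_iso_compose (frob_extn N F Qa) (iso_of N F Qb Qc W) (iso_of N F Qa Qb V)) \<and>
     (\<forall>Qa Eb \<phi>. cstar_frobenius N F Qa \<and> net_extension N Eb \<and>
        extn_iso N (frob_extn N F Qa) Eb \<phi> \<longrightarrow>
        (\<exists>!Qb. cstar_frobenius N F Qb \<and> fobj Qb = emod Eb \<and> funit Qb = eincl Eb \<and>
                (\<forall>I\<in>arg_arcs. ealg Eb I = ealg (frob_extn N F Qb) I)) \<and>
        (\<forall>Qb. cstar_frobenius N F Qb \<and> fobj Qb = emod Eb \<and> funit Qb = eincl Eb \<and>
              (\<forall>I\<in>arg_arcs. ealg Eb I = ealg (frob_extn N F Qb) I) \<longrightarrow>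
              (\<exists>!V. left_iso N F Qa Qb V \<and> \<phi> = iso_of N F Qa Qb V)))"
proof (intro conjI allI impI)
  fix Qa Qb :: "'h frob" and V
  assume h: "cstar_frobenius N F Qa \<and> cstar_frobenius N F Qb \<and> left_iso N F Qa Qb V"
  then obtain S where "left_iso_pair N F Qa Qb V S" using left_iso_pairI[OF assms] by blast
  then interpret left_iso_pair N F Qa Qb V S .
  show "\<exists>!\<phi>. extn_iso N (frob_extn N F Qa) (frob_extn N F Qb) \<phi> \<and>
      implements (frob_extn N F Qa) (frob_extn N F Qb) V \<phi>"
    by (rule ex1I[of _ phi]) (simp add: phi_iso phi_implements, elim conjE, rule phi_unique)
  show "V \<in> unitary_ops (fobj Qa) (fobj Qb) \<longleftrightarrow>
      unitary_extn_iso N (frob_extn N F Qa) (frob_extn N F Qb) (iso_of N F Qa Qb V)"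
    unfolding iso_of_eq by (rule unitary_iff)
next
  fix Qa Qb Qc :: "'h frob" and V W
  assume h: "cstar_frobenius N F Qa \<and> cstar_frobenius N F Qb \<and> cstar_frobenius N F Qc \<and>
    left_iso N F Qa Qb V \<and> left_iso N F Qb Qc W"
  show "left_iso N F Qa Qc (compose (carrier (fobj Qa)) W V)"
    and "iso_of N F Qa Qc (compose (carrier (fobj Qa)) W V)
      = extn_iso_compose (frob_extn N F Qa) (iso_of N F Qb Qc W) (iso_of N F Qa Qb V)"
    using left_iso_compose[OF assms] h by blast+
next
  fix Qa :: "'h frob" and Eb \<phi>
  assume h: "cstar_frobenius N F Qa \<and> net_extension N Eb \<and> extn_iso N (frob_extn N F Qa) Eb \<phi>"
  let ?P = "\<lambda>Qb. cstar_frobenius N F Qb \<and> fobj Qb = emod Eb \<and> funit Qb = eincl Eb \<and>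
    (\<forall>I\<in>arg_arcs. ealg Eb I = ealg (frob_extn N F Qb) I)"
  obtain Q V where Q: "?P Q" and V: "left_iso N F Qa Q V" "\<phi> = iso_of N F Qa Q V"
    using extension_from_frobenius[OF assms] h by blast
  have unique: "Q' = Q" if "?P Q'" for Q'
    by (rule frob_unique[OF assms]) (use that Q in simp_all)
  show "\<exists>!Qb. ?P Qb" using Q unique by (rule ex1I)
  fix Q' assume "?P Q'"
  \<comment> \<open>The algebra is unique, so the claim for an arbitrary \<open>Q'\<close> reduces
    to the transported algebra, for which \<open>V\<close> has been constructed.\<close>
  then have "Q' = Q" by (rule unique)
  moreover have "\<exists>!V. left_iso N F Qa Q V \<and> \<phi> = iso_of N F Qa Q V"
  proof (rule ex1I[of _ V])
    show "left_iso N F Qa Q V \<and> \<phi> = iso_of N F Qa Q V" using V by simp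
    fix V' assume V': "left_iso N F Qa Q V' \<and> \<phi> = iso_of N F Qa Q V'"
    show "V' = V"
      by (rule left_iso_unique[OF assms]) (use h Q V V' in simp_all)
  qed
  ultimately show "\<exists>!V. left_iso N F Qa Q' V \<and> \<phi> = iso_of N F Qa Q' V" by simp
qed

end
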